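(* Let $N=1$, $\alpha>0$ and $\mu\in\mathbb{R}$, $\mu\ne0$. (i) There exists $m_0\ge0$ such that for all integers $m\ge m_0$ there exist at least two different, even, regular self-similar solutions $u$ of $u_t=u_{xx}+|u|^\alpha u$ on $(0,\infty)\times\mathbb{R}$ with initial value $u_0(x)=\mu|x|^{-2/\alpha}$ in the sense (A) below, and also in the sense (B) below if $\alpha>2$, and whose profiles have exactly $2m$ zeros. (ii) There exists $m_0\ge0$ such that for all integers $m\ge m_0$ there exist at least two different, odd, regular self-similar solutions $u$ of $u_t=u_{xx}+|u|^\alpha u$ on $(0,\infty)\times\mathbb{R}$ with initial value $u_0(x)=\mu|x|^{-\frac2\alpha-1}x$ in the sense (A), and also in the sense (B) if $\alpha>2$, and whose profiles have exactly $2m+1$ zeros. Here (A) and (B) are: (A) $u(t)\to u_0$ as $t\downarrow0$ in $L^q(\{|x|>\varepsilon\})$ for all $\varepsilon>0$ and all $q\ge1$, $q>\frac\alpha2$; (B) $u(t)\to u_0$ as $t\downarrow0$ in $L^p(\mathbb{R})+L^q(\mathbb{R})$ for all $1\le p<\frac\alpha2<q$. These solutions satisfy $u\in C^1((0,\infty),L^r(\mathbb{R}))$ and $u_{xx},\ |u|^\alpha u\in C((0,\infty),L^r(\mathbb{R}))$ for all $r\ge1$, $r>\frac\alpha2$. Furthermore, if $\alpha>2$, they are solutions of the integral equation $$u(t)=e^{t\Delta}u_0+\int_0^te^{(t-s)\Delta}|u(s)|^\alpha u(s)\,ds,$$ where each term is in $C((0,\infty),L^r(\mathbb{R}))$ for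 all $r>\frac\alpha2>1$. Moreover, the map $t\mapsto u(t)-e^{t\Delta}u_0$ is in $C([0,\infty),L^r(\mathbb{R}))$ for all $r\ge1$ such that $\frac{\alpha}{2(\alpha+1)}<r<\frac\alpha2$.
   Context: A self-similar solution of $u_t=u_{xx}+|u|^\alpha u$ is a solution of the form $u(t,x)=t^{-1/\alpha}f(x/\sqrt t)$; $f:\mathbb{R}\to\mathbb{R}$ is its profile. It is regular if $f\in C^2(\mathbb{R})$, in which case $f''+\frac x2f'+\frac1\alpha f+|f|^\alpha f=0$ on $\mathbb{R}$ and $u$ is a classical solution for $t>0$. It is even (resp. odd) if its profile is an even (resp. odd) function; zeros of the profile are counted on $\mathbb{R}$. $e^{t\Delta}$ denotes the heat semigroup on $\mathbb{R}$. The value at $t=0$ of $u(t)-e^{t\Delta}u_0$ is understood to be $0$. *)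

theory Defs
  imports "HOL-Analysis.Analysis"
begin

section \<open>Lebesgue spaces\<close>

text \<open>Elements of a Lebesgue space are represented by functions, not by classes; the exponent \<open>p\<close>
  is a real number with \<open>1 \<le> p\<close>.\<close>

definition Lp :: "'a measure \<Rightarrow> real \<Rightarrow> ('a \<Rightarrow> real) set" where
  "Lp M p = {f \<in> borel_measurable M. integrable M (\<lambda>x. \<bar>f x\<bar> powr p)}"

definition Lp_norm :: "'a measure \<Rightarrow> real \<Rightarrow> ('a \<Rightarrow> real) \<Rightarrow> real" where
  "Lp_norm M p f = (\<integral>x. \<bar>f x\<bar> powr p \<partial>M) powr (1 / p)"

definition tendsto_Lp ::
    "'a measure \<Rightarrow> real \<Rightarrow> ('t \<Rightarrow> 'a \<Rightarrow> real) \<Rightarrow> ('a \<Rightarrow> real) \<Rightarrow> 't filter \<Rightarrow> bool" where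
  "tendsto_Lp M p u v F \<longleftrightarrow>
     v \<in> Lp M p \<and> (\<forall>\<^sub>F t in F. u t \<in> Lp M p) \<and>
     ((\<lambda>t. Lp_norm M p (\<lambda>x. u t x - v x)) \<longlongrightarrow> 0) F"

definition Lp_sum :: "'a measure \<Rightarrow> real \<Rightarrow> real \<Rightarrow> ('a \<Rightarrow> real) set" where
  "Lp_sum M p q = {f. \<exists>g\<in>Lp M p. \<exists>h\<in>Lp M q. f = (\<lambda>x. g x + h x)}"

definition Lp_sum_norm :: "'a measure \<Rightarrow> real \<Rightarrow> real \<Rightarrow> ('a \<Rightarrow> real) \<Rightarrow> real" where
  "Lp_sum_norm M p q f =
     Inf {Lp_norm M p g + Lp_norm M q h | g h.
            g \<in> Lp M p \<and> h \<in> Lp M q \<and> f = (\<lambda>x. g x + h x)}"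

definition tendsto_Lp_sum ::
    "'a measure \<Rightarrow> real \<Rightarrow> real \<Rightarrow> ('t \<Rightarrow> 'a \<Rightarrow> real) \<Rightarrow> ('a \<Rightarrow> real) \<Rightarrow> 't filter \<Rightarrow> bool" where
  "tendsto_Lp_sum M p q u v F \<longleftrightarrow>
     v \<in> Lp_sum M p q \<and> (\<forall>\<^sub>F t in F. u t \<in> Lp_sum M p q) \<and>
     ((\<lambda>t. Lp_sum_norm M p q (\<lambda>x. u t x - v x)) \<longlongrightarrow> 0) F"

definition Lp_continuous_on ::
    "'a measure \<Rightarrow> real \<Rightarrow> real set \<Rightarrow> (real \<Rightarrow> 'a \<Rightarrow> real) \<Rightarrow> bool" where
  "Lp_continuous_on M p I u \<longleftrightarrow>
     (\<forall>t\<in>I. u t \<in> Lp M p) \<and> (\<forall>t\<in>I. tendsto_Lp M p u (u t) (at t within I))"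

definition Lp_C1_on ::
    "'a measure \<Rightarrow> real \<Rightarrow> real set \<Rightarrow> (real \<Rightarrow> 'a \<Rightarrow> real) \<Rightarrow> bool" where
  "Lp_C1_on M p I u \<longleftrightarrow>
     (\<forall>t\<in>I. u t \<in> Lp M p) \<and>
     (\<exists>v. Lp_continuous_on M p I v \<and>
          (\<forall>t\<in>I. tendsto_Lp M p (\<lambda>s x. (u s x - u t x) / (s - t)) (v t) (at t within I)))"

text \<open>Absolute convergence of the \<open>L\<^sup>p\<close>-valued integral of \<open>v\<close> over \<open>I\<close>. For jointly measurable \<open>v\<close>
  it makes \<open>v\<close> Bochner integrable, and by Minkowski's inequality the Bochner integral is then
  represented, for almost every \<open>x\<close>, by the absolutely convergent integral of \<open>v s x\<close> over \<open>s \<in> I\<close>.\<close>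

definition Lp_abs_integrable_on ::
    "'a measure \<Rightarrow> real \<Rightarrow> real set \<Rightarrow> (real \<Rightarrow> 'a \<Rightarrow> real) \<Rightarrow> bool" where
  "Lp_abs_integrable_on M p I v \<longleftrightarrow>
     (\<lambda>(s, x). v s x) \<in> borel_measurable (restrict_space lborel I \<Otimes>\<^sub>M M) \<and>
     (\<forall>s\<in>I. v s \<in> Lp M p) \<and>
     set_integrable lborel I (\<lambda>s. Lp_norm M p (v s))"


section \<open>The heat equation with nonlinearity \<open>|u|\<^sup>\<alpha>u\<close>\<close>

definition nonlin :: "real \<Rightarrow> real \<Rightarrow> real" where
  "nonlin \<alpha> y = \<bar>y\<bar> powr \<alpha> * y"

text \<open>The first argument of a solution \<open>u\<close> is the time. The definition below asks for
  \<open>u_t = u_xx + |u|\<^sup>\<alpha>u\<close> pointwise on \<open>(0,\<infinity>) \<times> \<real>\<close>, with continuous \<open>u_t\<close> and \<open>u_xx\<close>.\<close>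

definition classical_solution :: "real \<Rightarrow> (real \<Rightarrow> real \<Rightarrow> real) \<Rightarrow> bool" where
  "classical_solution \<alpha> u \<longleftrightarrow>
     (\<exists>ut ux uxx.
        continuous_on ({0<..} \<times> UNIV) (\<lambda>(t, x). ut t x) \<and>
        continuous_on ({0<..} \<times> UNIV) (\<lambda>(t, x). uxx t x) \<and>
        (\<forall>t>0. \<forall>x.
           ((\<lambda>s. u s x) has_real_derivative ut t x) (at t) \<and>
           (u t has_real_derivative ux t x) (at x) \<and>
           (ux t has_real_derivative uxx t x) (at x) \<and>
           ut t x = uxx t x + nonlin \<alpha> (u t x)))"

definition C2 :: "(real \<Rightarrow> real) \<Rightarrow> bool" where
  "C2 f \<longleftrightarrow>
     (\<exists>f' f''. (\<forall>x. (f has_real_derivative f' x) (at x)) \<and>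
               (\<forall>x. (f' has_real_derivative f'' x) (at x)) \<and>
               continuous_on UNIV f'')"

definition self_similar :: "real \<Rightarrow> (real \<Rightarrow> real) \<Rightarrow> real \<Rightarrow> real \<Rightarrow> real" where
  "self_similar \<alpha> f t x = t powr (- 1 / \<alpha>) * f (x / sqrt t)"

definition regular_self_similar_solution :: "real \<Rightarrow> (real \<Rightarrow> real) \<Rightarrow> bool" where
  "regular_self_similar_solution \<alpha> f \<longleftrightarrow> C2 f \<and> classical_solution \<alpha> (self_similar \<alpha> f)"

text \<open>Heat semigroup on the real line; used for \<open>t > 0\<close> only.\<close>

definition heat :: "real \<Rightarrow> (real \<Rightarrow> real) \<Rightarrow> real \<Rightarrow> real" where
  "heat t g x = (\<integral>y. exp (- (x - y)\<^sup>2 / (4 * t)) / sqrt (4 * pi * t) * g y \<partial>lborel)"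

definition initial_value_A ::
    "real \<Rightarrow> (real \<Rightarrow> real \<Rightarrow> real) \<Rightarrow> (real \<Rightarrow> real) \<Rightarrow> bool" where
  "initial_value_A \<alpha> u u0 \<longleftrightarrow>
     (\<forall>\<epsilon>>0. \<forall>q. 1 \<le> q \<and> \<alpha> / 2 < q \<longrightarrow>
        tendsto_Lp (restrict_space lborel {x. \<epsilon> < \<bar>x\<bar>}) q u u0 (at_right 0))"

definition initial_value_B ::
    "real \<Rightarrow> (real \<Rightarrow> real \<Rightarrow> real) \<Rightarrow> (real \<Rightarrow> real) \<Rightarrow> bool" where
  "initial_value_B \<alpha> u u0 \<longleftrightarrow>
     (\<forall>p q. 1 \<le> p \<and> p < \<alpha> / 2 \<and> \<alpha> / 2 < q \<longrightarrow>
        tendsto_Lp_sum lborel p q u u0 (at_right 0))"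

definition Lr_regularity :: "real \<Rightarrow> (real \<Rightarrow> real \<Rightarrow> real) \<Rightarrow> bool" where
  "Lr_regularity \<alpha> u \<longleftrightarrow>
     (\<forall>r. 1 \<le> r \<and> \<alpha> / 2 < r \<longrightarrow>
        Lp_C1_on lborel r {0<..} u \<and>
        Lp_continuous_on lborel r {0<..} (\<lambda>t. deriv (deriv (u t))) \<and>
        Lp_continuous_on lborel r {0<..} (\<lambda>t x. nonlin \<alpha> (u t x)))"

definition duhamel :: "real \<Rightarrow> (real \<Rightarrow> real \<Rightarrow> real) \<Rightarrow> real \<Rightarrow> real \<Rightarrow> real" where
  "duhamel \<alpha> u t x = (LINT s:{0<..<t}|lborel. heat (t - s) (\<lambda>y. nonlin \<alpha> (u s y)) x)"

definition integral_equation ::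
    "real \<Rightarrow> (real \<Rightarrow> real \<Rightarrow> real) \<Rightarrow> (real \<Rightarrow> real) \<Rightarrow> bool" where
  "integral_equation \<alpha> u u0 \<longleftrightarrow>
     (\<forall>t>0. AE x in lborel. u t x = heat t u0 x + duhamel \<alpha> u t x) \<and>
     (\<forall>r. \<alpha> / 2 < r \<longrightarrow>
        (\<forall>t>0. Lp_abs_integrable_on lborel r {0<..<t}
                  (\<lambda>s. heat (t - s) (\<lambda>y. nonlin \<alpha> (u s y)))) \<and>
        Lp_continuous_on lborel r {0<..} u \<and>
        Lp_continuous_on lborel r {0<..} (\<lambda>t. heat t u0) \<and>
        Lp_continuous_on lborel r {0<..} (duhamel \<alpha> u))"

definition difference_continuity ::
    "real \<Rightarrow> (real \<Rightarrow> real \<Rightarrow> real) \<Rightarrow> (real \<Rightarrow> real) \<Rightarrow> bool" where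
  "difference_continuity \<alpha> u u0 \<longleftrightarrow>
     (\<forall>r. 1 \<le> r \<and> \<alpha> / (2 * (\<alpha> + 1)) < r \<and> r < \<alpha> / 2 \<longrightarrow>
        Lp_continuous_on lborel r {0..}
          (\<lambda>t x. if t = 0 then 0 else u t x - heat t u0 x))"

definition has_exactly_zeros :: "(real \<Rightarrow> real) \<Rightarrow> nat \<Rightarrow> bool" where
  "has_exactly_zeros f n \<longleftrightarrow> finite {x. f x = 0} \<and> card {x. f x = 0} = n"

text \<open>The function \<open>f\<close> is the profile of a regular self-similar solution with initial value \<open>u0\<close>
  which has all the properties asserted in the theorem, except for parity and number of zeros.\<close>

definition solution_profile :: "real \<Rightarrow> (real \<Rightarrow> real) \<Rightarrow> (real \<Rightarrow> real) \<Rightarrow> bool" where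
  "solution_profile \<alpha> u0 f \<longleftrightarrow>
     regular_self_similar_solution \<alpha> f \<and>
     initial_value_A \<alpha> (self_similar \<alpha> f) u0 \<and>
     Lr_regularity \<alpha> (self_similar \<alpha> f) \<and>
     (\<alpha> > 2 \<longrightarrow>
        initial_value_B \<alpha> (self_similar \<alpha> f) u0 \<and>
        integral_equation \<alpha> (self_similar \<alpha> f) u0 \<and>
        difference_continuity \<alpha> (self_similar \<alpha> f) u0)"

text \<open>Different solutions have different profiles and conversely, since
  \<open>self_similar \<alpha> f 1 = f\<close>; the theorem therefore quantifies over profiles.\<close>

lemma self_similar_1: "self_similar \<alpha> f 1 = f"
  by (simp add: self_similar_def fun_eq_iff)

end

theory Submission
  imports Defs "HOL-Probability.Probability"
begin

text \<open>
  Let \<open>k = 2 / \<alpha>\<close>. The profiles are found by shooting from infinity. For \<open>w x = x powr k * f x\<close> the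
  profile equation is strongly damped for large \<open>x\<close>, and its solutions with \<open>w \<longlonglongrightarrow> \<mu>\<close> form a
  one-parameter family: for every large \<open>X\<close> there is one with \<open>w' X = - \<mu> / 32 * X\<close>, and one with the
  opposite velocity, that stays within \<open>\<mu> / 2\<close> of \<open>\<mu>\<close> on \<open>{X..}\<close>. For fixed \<open>X\<close> the limit of \<open>w\<close> is an
  increasing function of \<open>w X\<close>, so the solution with limit \<open>\<mu>\<close> is unique and depends continuously on \<open>X\<close>.
  The Lyapunov function \<open>x\<^sup>2 * w'\<^sup>2 / 2 + H w\<close>, where \<open>H\<close> is the potential of the restoring force,
  is nonincreasing; hence the energy of \<open>f\<close> on a fixed interval \<open>[0, x0]\<close> tends to infinity with \<open>X\<close>,
  and so does the angle of \<open>(f, f')\<close> at \<open>0\<close>. As a continuous function of \<open>X\<close> the angle takes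
  every large multiple of \<open>\<pi> / 2\<close>: the even multiples are even profiles, the odd ones odd profiles, and
  the multiple is the number of zeros. The two signs of \<open>w' X\<close> give two different profiles each time.

  Convergence to the initial value and regularity follow from the decay \<open>f x = O(\<bar>x\<bar> powr - k)\<close> by
  dominated convergence. For Duhamel's formula one differentiates \<open>s \<mapsto> (e\<^bsup>(t - s)\<Delta>\<^esup> u s) x\<close>. All terms of
  the integral equation are self-similar, so their continuity in time is continuity of dilations
  in \<open>L\<^sup>r\<close>.
\<close>

section \<open>Ordinary differential equations with linear growth\<close>

text \<open>The two conditions on a profile sit at opposite ends: the limit of \<open>w\<close> at
  infinity, and \<open>f' 0 = 0\<close> or \<open>f 0 = 0\<close> at the origin. Starting at
  infinity meets the first exactly and leaves \<open>X\<close> to meet the second. A velocity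
  proportional to \<open>X\<close> is of the largest order that friction of size about
  \<open>x / 2\<close> absorbs: it moves \<open>w\<close> by a distance independent of
  \<open>X\<close>, while \<open>x\<^sup>2 * w'\<^sup>2\<close> at \<open>X\<close> grows like
  \<open>X ^ 4\<close>. With the factor \<open>\<mu> / 32\<close> this distance is at most
  \<open>\<mu> / 8\<close>, the force adds at most \<open>\<mu> / 16\<close>, and so
  \<open>w\<close> keeps the sign of \<mu>; all positive zeros of \<open>f\<close> are then below
  \<open>X\<close>. The sign is also why the two velocities give different profiles: for
  \<open>\<mu> > 0\<close> the force points downwards, so a negative velocity stays negative, while
  a positive one can become negative only by far less than \<open>\<mu> / 32 * x\<close>. The angle
  need not be monotone. It suffices that at every zero of \<open>f\<close> it turns in the same
  direction, at speed \<omega>. The number of zeros does not depend on \<omega>, which can therefore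
  be adapted to the number wanted.\<close>

lemma antiderivative_exists:
  fixes h :: "real \<Rightarrow> 'a::euclidean_space"
  assumes "continuous_on UNIV h"
  obtains H where "\<And>x. (H has_vector_derivative h x) (at x)" "H x0 = 0"
proof
  fix x :: real
  define a where "a = min x x0 - 1"
  define b where "b = max x x0 + 1"
  have "((\<lambda>u. LBINT y=x0..u. h y) has_vector_derivative h x) (at x within {a..b})"
    by (rule interval_integral_FTC2) (auto simp: a_def b_def intro: continuous_on_subset[OF assms])
  moreover have "at x within {a..b} = at x"
    by (rule at_within_interior) (auto simp: a_def b_def)
  ultimately show "((\<lambda>u. LBINT y=x0..u. h y) has_vector_derivative h x) (at x)" by simp
qed (simp add: zero_ereal_def)

text \<open>Replaces the estimate of an integral by an explicit primitive \<open>g\<close> of the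
  bound on the speed; \<open>global_ode_exists\<close> and \<open>damped_bounds\<close> exhibit such
  primitives.\<close>

lemma vector_derivative_bound:
  fixes f :: "real \<Rightarrow> 'a::real_normed_vector"
  assumes "a \<le> b"
    and f: "\<And>x. a \<le> x \<Longrightarrow> x \<le> b \<Longrightarrow> (f has_vector_derivative f' x) (at x)"
    and g: "\<And>x. a \<le> x \<Longrightarrow> x \<le> b \<Longrightarrow> (g has_real_derivative g' x) (at x)"
    and le: "\<And>x. a \<le> x \<Longrightarrow> x \<le> b \<Longrightarrow> norm (f' x) \<le> g' x"
  shows "norm (f b - f a) \<le> g b - g a"
proof (cases "a = b")
  case False
  show ?thesis
  proof (rule differentiable_bound_general[where f' = f' and \<phi>' = g'])
    show "continuous_on {a..b} f" "continuous_on {a..b} g"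
      by (meson f atLeastAtMost_iff continuous_at_imp_continuous_on has_vector_derivative_continuous,
          meson g atLeastAtMost_iff continuous_at_imp_continuous_on DERIV_isCont)
  qed (use False \<open>a \<le> b\<close> f g[unfolded has_real_derivative_iff_has_vector_derivative] le in auto)
qed simp

text \<open>The squared distance \<open>e\<close> is differentiable with
  \<open>\<bar>e' x\<bar> \<le> 2 * \<Lambda> x * e x\<close>, so \<open>e * exp (- 2 * m)\<close>
  decreases and \<open>e * exp (2 * m)\<close> increases. The first bounds later values by earlier
  ones, the second the converse. The primitive \<open>m\<close> stands in for the integral of the
  Lipschitz constant.\<close>

lemma gronwall_solutions:
  fixes u v :: "real \<Rightarrow> 'a::euclidean_space"
  assumes Lip: "\<And>x p q. norm (F x p - F x q) \<le> \<Lambda> x * norm (p - q)"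
    and m: "\<And>x. (m has_real_derivative \<Lambda> x) (at x)"
    and u: "\<And>x. (u has_vector_derivative F x (u x)) (at x)"
    and v: "\<And>x. (v has_vector_derivative F x (v x)) (at x)"
  shows "norm (u x - v x) \<le> norm (u y - v y) * exp \<bar>m x - m y\<bar>"
proof -
  define e where "e x = (u x - v x) \<bullet> (u x - v x)" for x
  define e' where "e' x = 2 * ((u x - v x) \<bullet> (F x (u x) - F x (v x)))" for x
  have e: "(e has_real_derivative e' x) (at x)" for x
    unfolding e_def e'_def has_field_derivative_def
    by (rule derivative_eq_intros u[unfolded has_vector_derivative_def] v[unfolded has_vector_derivative_def] refl)+
      (auto simp: algebra_simps inner_simps inner_commute fun_eq_iff)
  have e_sq: "e x = (norm (u x - v x))\<^sup>2" for x by (simp add: e_def power2_norm_eq_inner)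
  have bnd: "\<bar>e' x\<bar> \<le> 2 * \<Lambda> x * e x" for x
  proof -
    have "\<bar>(u x - v x) \<bullet> (F x (u x) - F x (v x))\<bar> \<le> norm (u x - v x) * norm (F x (u x) - F x (v x))"
      by (rule Cauchy_Schwarz_ineq2)
    also have "\<dots> \<le> norm (u x - v x) * (\<Lambda> x * norm (u x - v x))"
      by (intro mult_left_mono Lip) auto
    finally show ?thesis by (simp add: e'_def e_sq power2_eq_square abs_mult algebra_simps)
  qed
  have dec: "e b * exp (- 2 * m b) \<le> e a * exp (- 2 * m a)" if "a \<le> b" for a b
  proof (rule DERIV_nonpos_imp_nonincreasing[OF that])
    fix x
    have "((\<lambda>x. e x * exp (- 2 * m x)) has_real_derivative (e' x - 2 * \<Lambda> x * e x) * exp (- 2 * m x)) (at x)"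
      by (rule derivative_eq_intros e m refl)+ (auto simp: algebra_simps)
    moreover have "(e' x - 2 * \<Lambda> x * e x) * exp (- 2 * m x) \<le> 0"
      using bnd[of x] by (intro mult_nonpos_nonneg) auto
    ultimately show "\<exists>y. ((\<lambda>x. e x * exp (- 2 * m x)) has_real_derivative y) (at x) \<and> y \<le> 0" by blast
  qed
  have inc: "e a * exp (2 * m a) \<le> e b * exp (2 * m b)" if "a \<le> b" for a b
  proof (rule DERIV_nonneg_imp_nondecreasing[OF that])
    fix x
    have "((\<lambda>x. e x * exp (2 * m x)) has_real_derivative (e' x + 2 * \<Lambda> x * e x) * exp (2 * m x)) (at x)"
      by (rule derivative_eq_intros e m refl)+ (auto simp: algebra_simps)
    moreover have "(e' x + 2 * \<Lambda> x * e x) * exp (2 * m x) \<ge> 0"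
      using bnd[of x] by (intro mult_nonneg_nonneg) auto
    ultimately show "\<exists>y. ((\<lambda>x. e x * exp (2 * m x)) has_real_derivative y) (at x) \<and> 0 \<le> y" by blast
  qed
  have "e x \<le> e y * exp (2 * (m x - m y)) \<or> e x \<le> e y * exp (2 * (m y - m x))"
  proof (cases "y \<le> x")
    case True
    from dec[OF this] have "e x * exp (- 2 * m x) * exp (2 * m x) \<le> e y * exp (- 2 * m y) * exp (2 * m x)"
      by (rule mult_right_mono) auto
    then show ?thesis by (auto simp: mult.assoc algebra_simps simp flip: exp_add)
  next
    case False
    then have "x \<le> y" by simp
    from inc[OF this] have "e x * exp (2 * m x) * exp (- 2 * m x) \<le> e y * exp (2 * m y) * exp (- 2 * m x)"
      by (rule mult_right_mono) auto
    then show ?thesis by (auto simp: mult.assoc algebra_simps simp flip: exp_add)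
  qed
  moreover have "exp (2 * (m x - m y)) \<le> exp (2 * \<bar>m x - m y\<bar>)" "exp (2 * (m y - m x)) \<le> exp (2 * \<bar>m x - m y\<bar>)"
    by (auto simp: abs_if)
  ultimately have "e x \<le> e y * exp (2 * \<bar>m x - m y\<bar>)"
    by (metis e_sq mult_left_mono order_trans zero_le_power2)
  then have "(norm (u x - v x))\<^sup>2 \<le> (norm (u y - v y) * exp \<bar>m x - m y\<bar>)\<^sup>2"
    by (simp add: e_sq power_mult_distrib exp_double)
  then show ?thesis by (rule power2_le_imp_le) simp
qed

text \<open>Banach's fixed point theorem for bounded continuous functions, with the solution divided by
  \<open>W x = exp (2 * \<bar>m x - m x0\<bar>)\<close>; the weight makes the Picard operator a contraction on the whole line.\<close>

lemma global_ode_exists: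
  fixes F :: "real \<Rightarrow> 'a::euclidean_space \<Rightarrow> 'a"
  assumes cont: "continuous_on UNIV (\<lambda>(x, p). F x p)"
    and zero: "\<And>x. F x 0 = 0"
    and Lip: "\<And>x p q. norm (F x p - F x q) \<le> \<Lambda> x * norm (p - q)"
    and m: "\<And>x. (m has_real_derivative \<Lambda> x) (at x)"
    and pos: "\<And>x. 0 \<le> \<Lambda> x"
  shows "\<exists>u. u x0 = p \<and> (\<forall>x. (u has_vector_derivative F x (u x)) (at x))"
proof -
  define W where "W x = exp (2 * \<bar>m x - m x0\<bar>)" for x
  have W: "W x > 0" "W x \<noteq> 0" for x by (auto simp: W_def)
  have mmono: "m a \<le> m b" if "a \<le> b" for a b
    by (rule DERIV_nonneg_imp_nondecreasing[OF that]) (use m pos in blast)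
  have mcont: "continuous_on S m" for S
    by (meson DERIV_isCont continuous_at_imp_continuous_on m)
  have Wcont: "continuous_on S W" for S
    unfolding W_def by (intro continuous_intros mcont)
  define B where "B u x = F x (W x *\<^sub>R apply_bcontfun u x)" for u :: "real \<Rightarrow>\<^sub>C 'a" and x
  have Bcont: "continuous_on UNIV (B u)" for u
  proof -
    have "continuous_on UNIV ((\<lambda>(x, p). F x p) \<circ> (\<lambda>x. (x, W x *\<^sub>R apply_bcontfun u x)))"
      by (rule continuous_on_compose) (auto intro!: continuous_intros Wcont continuous_on_subset[OF cont])
    then show ?thesis by (simp add: B_def o_def)
  qed
  have "\<exists>H. (\<forall>x. (H has_vector_derivative B u x) (at x)) \<and> H x0 = 0" for u
    using antiderivative_exists[OF Bcont] by metis
  then obtain I where I: "\<And>u x. (I u has_vector_derivative B u x) (at x)" "\<And>u. I u x0 = 0"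
    by metis
  have Icont: "continuous_on UNIV (I u)" for u
    by (meson I(1) continuous_at_imp_continuous_on has_vector_derivative_continuous)
  \<comment> \<open>\<open>exp (2 * (m x - m x0)) / 2\<close> is a primitive of
    \<open>\<Lambda> x * exp (2 * (m x - m x0))\<close>: the factor 2 in the exponent of
    \<open>W\<close> becomes the contraction constant 1/2. Left of \<open>x0\<close> the mirrored
    primitive is used.\<close>
  have diff: "norm (I u x - I v x) \<le> W x / 2 * dist u v" for u v x
  proof -
    have Bd: "norm (B u y - B v y) \<le> \<Lambda> y * W y * dist u v" for y
    proof -
      have "norm (B u y - B v y) \<le> \<Lambda> y * norm (W y *\<^sub>R (apply_bcontfun u y - apply_bcontfun v y))"
        using Lip[of y] by (simp add: B_def scaleR_diff_right)
      also have "\<dots> = \<Lambda> y * (W y * dist (apply_bcontfun u y) (apply_bcontfun v y))"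
        using W(1)[of y] by (simp add: dist_norm)
      also have "\<dots> \<le> \<Lambda> y * (W y * dist u v)"
        using W(1)[of y] pos[of y] by (intro mult_left_mono dist_bounded) auto
      finally show ?thesis by simp
    qed
    have der: "((\<lambda>x. I u x - I v x) has_vector_derivative (B u y - B v y)) (at y)" for y
      by (intro has_vector_derivative_diff I)
    show ?thesis
    proof (cases "x0 \<le> x")
      case True
      have "norm ((I u x - I v x) - (I u x0 - I v x0)) \<le>
          exp (2 * (m x - m x0)) / 2 * dist u v - exp (2 * (m x0 - m x0)) / 2 * dist u v"
      proof (rule vector_derivative_bound[OF True, where g = "\<lambda>x. exp (2 * (m x - m x0)) / 2 * dist u v"])
        show "((\<lambda>x. exp (2 * (m x - m x0)) / 2 * dist u v) has_real_derivative
            \<Lambda> y * exp (2 * (m y - m x0)) * dist u v) (at y)" for y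
          by (auto intro!: derivative_eq_intros m)
        show "norm (B u y - B v y) \<le> \<Lambda> y * exp (2 * (m y - m x0)) * dist u v" if "x0 \<le> y" "y \<le> x" for y
          using Bd[of y] mmono[OF that(1)] by (simp add: W_def)
      qed (rule der)
      also have "\<dots> \<le> W x / 2 * dist u v"
        using mmono[OF True] by (simp add: W_def)
      finally show ?thesis by (simp add: I)
    next
      case False
      then have le: "x \<le> x0" by simp
      have "norm ((I u x0 - I v x0) - (I u x - I v x)) \<le>
          - exp (2 * (m x0 - m x0)) / 2 * dist u v - (- exp (2 * (m x0 - m x)) / 2 * dist u v)"
      proof (rule vector_derivative_bound[OF le, where g = "\<lambda>x. - exp (2 * (m x0 - m x)) / 2 * dist u v"])
        show "((\<lambda>x. - exp (2 * (m x0 - m x)) / 2 * dist u v) has_real_derivative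
            \<Lambda> y * exp (2 * (m x0 - m y)) * dist u v) (at y)" for y
          by (auto intro!: derivative_eq_intros m)
        show "norm (B u y - B v y) \<le> \<Lambda> y * exp (2 * (m x0 - m y)) * dist u v" if "x \<le> y" "y \<le> x0" for y
          using Bd[of y] mmono[OF that(2)] by (simp add: W_def)
      qed (rule der)
      also have "\<dots> \<le> W x / 2 * dist u v"
        using mmono[OF le] by (simp add: W_def)
      finally show ?thesis by (simp add: I norm_minus_commute)
    qed
  qed
  \<comment> \<open>As \<open>F x 0 = 0\<close>, the zero function is mapped to zero. Comparing with
    it in \<open>diff\<close> bounds \<open>I u\<close> by a multiple of \<open>W\<close>, so
    \<open>T u\<close> is a bounded function.\<close>
  have I0: "I 0 x = 0" for x
  proof -
    have d: "(I 0 has_vector_derivative 0) (at y)" for y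
      using I(1)[of 0 y] zero by (simp add: B_def)
    have "norm (I 0 b - I 0 a) \<le> 0 - 0" if "a \<le> b" for a b
      by (rule vector_derivative_bound[OF that d]) (auto intro: derivative_eq_intros)
    then show ?thesis
      by (metis I(2) diff_self eq_iff_diff_eq_0 linear norm_le_zero_iff)
  qed
  define T where "T u x = (p + I u x) /\<^sub>R W x" for u x
  have Tin: "T u \<in> bcontfun" for u
  proof (rule bcontfun_normI)
    show "continuous_on UNIV (T u)"
      unfolding T_def using W(2) by (intro continuous_intros Icont Wcont) auto
    show "norm (T u x) \<le> norm p + dist u 0 / 2" for x
    proof -
      have W1: "W x \<ge> 1" by (simp add: W_def)
      have "norm (p + I u x) \<le> norm p + W x / 2 * dist u 0"
        using diff[of u x 0] norm_triangle_ineq[of p "I u x"] by (simp add: I0)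
      also have "\<dots> \<le> (norm p + dist u 0 / 2) * W x"
        using mult_left_mono[OF W1, of "norm p"] by (simp add: algebra_simps)
      finally show ?thesis using W(1)[of x] by (simp add: T_def divide_simps)
    qed
  qed
  have "\<exists>!u. Bcontfun (T u) = u"
  proof (rule banach_fix_type)
    show "\<forall>u v. dist (Bcontfun (T u)) (Bcontfun (T v)) \<le> 1/2 * dist u v"
    proof (intro allI dist_bound)
      fix u v x
      have "dist (T u x) (T v x) = norm (I u x - I v x) / W x"
        using W(1)[of x] by (simp add: T_def dist_norm flip: scaleR_diff_right) (simp add: divide_inverse_commute)
      also have "\<dots> \<le> 1/2 * dist u v"
        using diff[of u x v] W(1)[of x] by (simp add: field_simps)
      finally show "dist (apply_bcontfun (Bcontfun (T u)) x) (apply_bcontfun (Bcontfun (T v)) x) \<le> 1/2 * dist u v"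
        by (simp add: Bcontfun_inverse[OF Tin])
    qed
  qed auto
  then obtain u where u: "Bcontfun (T u) = u" by blast
  have ux: "W x *\<^sub>R apply_bcontfun u x = p + I u x" for x
  proof -
    have "apply_bcontfun u x = T u x" by (metis u Bcontfun_inverse[OF Tin])
    then show ?thesis using W(2)[of x] by (simp add: T_def)
  qed
  show ?thesis
  proof (intro exI[of _ "\<lambda>x. p + I u x"] conjI allI)
    show "((\<lambda>x. p + I u x) has_vector_derivative F x (p + I u x)) (at x)" for x
      using I(1)[of u x] ux[of x] by (auto simp: B_def intro!: derivative_eq_intros)
  qed (simp add: I)
qed

text \<open>A solution with nearby data is compared with the fixed solution \<open>u\<close>, with
  Gronwall started at the initial point of the nearby one. The initial error is the distance of its
  datum from \<open>u\<close> at that point, so joint continuity in all arguments follows from that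
  of \<open>u\<close> and \<open>m\<close>.\<close>

lemma global_ode_continuous:
  fixes F :: "real \<Rightarrow> 'a::euclidean_space \<Rightarrow> 'a"
  assumes Lip: "\<And>x p q. norm (F x p - F x q) \<le> \<Lambda> x * norm (p - q)"
    and m: "\<And>x. (m has_real_derivative \<Lambda> x) (at x)"
    and U0: "\<And>x0 p. U x0 p x0 = p"
    and U: "\<And>x0 p x. (U x0 p has_vector_derivative F x (U x0 p x)) (at x)"
  shows "continuous_on UNIV (\<lambda>(x0, p, x). U x0 p x)"
proof -
  have "isCont (\<lambda>(x0, p, x). U x0 p x) z" for z
  proof -
    obtain x0 p x where z: "z = (x0, p, x)" by (metis prod_cases3)
    define u where "u = U x0 p"
    have ucont: "isCont u y" for y unfolding u_def
      by (meson U has_vector_derivative_continuous)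
    have mcont: "isCont m y" for y using m DERIV_isCont by blast
    define b where "b q = norm (u (fst q) - fst (snd q)) * exp \<bar>m (snd (snd q)) - m (fst q)\<bar> + norm (u (snd (snd q)) - u x)"
      for q :: "real \<times> 'a \<times> real"
    have le: "norm (U (fst q) (fst (snd q)) (snd (snd q)) - u x) \<le> b q" for q
    proof -
      have "norm (u (snd (snd q)) - U (fst q) (fst (snd q)) (snd (snd q))) \<le>
        norm (u (fst q) - U (fst q) (fst (snd q)) (fst q)) * exp \<bar>m (snd (snd q)) - m (fst q)\<bar>"
        unfolding u_def by (rule gronwall_solutions[OF Lip m U U])
      moreover have "norm (U (fst q) (fst (snd q)) (snd (snd q)) - u x) \<le>
          norm (u (snd (snd q)) - U (fst q) (fst (snd q)) (snd (snd q))) + norm (u (snd (snd q)) - u x)"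
        using norm_triangle_ineq4[of "u (snd (snd q)) - u x" "u (snd (snd q)) - U (fst q) (fst (snd q)) (snd (snd q))"]
        by simp
      ultimately show ?thesis by (simp add: b_def U0)
    qed
    have "isCont b z"
      unfolding b_def z
      by (intro continuous_intros isCont_o2[OF _ ucont] isCont_o2[OF _ mcont])
    moreover have "b z = 0" by (simp add: b_def z u_def U0)
    ultimately have "(b \<longlongrightarrow> 0) (at z)" by (simp add: isCont_def)
    then have "((\<lambda>q. U (fst q) (fst (snd q)) (snd (snd q)) - u x) \<longlongrightarrow> 0) (at z)"
      by (rule Lim_null_comparison[rotated]) (simp add: le)
    then have "((\<lambda>q. U (fst q) (fst (snd q)) (snd (snd q))) \<longlongrightarrow> u x) (at z)"
      by (simp add: LIM_zero_iff)
    then show ?thesis by (simp add: isCont_def z u_def case_prod_unfold)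
  qed
  then show ?thesis by (simp add: continuous_at_imp_continuous_on)
qed

section \<open>The profile equation\<close>

lemma DERIV_abs_powr:
  fixes p y :: real
  assumes "p > 1"
  shows "((\<lambda>y. \<bar>y\<bar> powr p) has_real_derivative p * \<bar>y\<bar> powr (p - 2) * y) (at y)"
proof -
  consider "y > 0" | "y < 0" | "y = 0" by linarith
  then show ?thesis
  proof cases
    case 1
    have "((\<lambda>y. y powr p) has_real_derivative p * y powr (p - 1)) (at y)"
      using 1 by (rule has_real_derivative_powr)
    moreover have "\<forall>\<^sub>F z in nhds y. z powr p = \<bar>z\<bar> powr p"
      using eventually_nhds_in_open[of "{0<..}" y] 1 by (auto elim!: eventually_mono)
    moreover have "p * y powr (p - 1) = p * \<bar>y\<bar> powr (p - 2) * y"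
      using 1 powr_add[of y "p - 2" 1] by simp
    ultimately show ?thesis using DERIV_cong_ev[OF refl] by metis
  next
    case 2
    have "((\<lambda>y. (- y) powr p) has_real_derivative p * (- y) powr (p - 1) * (- 1)) (at y)"
      using 2 by (auto intro!: derivative_eq_intros)
    moreover have "\<forall>\<^sub>F z in nhds y. (- z) powr p = \<bar>z\<bar> powr p"
      using eventually_nhds_in_open[of "{..<0}" y] 2 by (auto elim!: eventually_mono)
    moreover have "p * (- y) powr (p - 1) * (- 1) = p * \<bar>y\<bar> powr (p - 2) * y"
      using 2 powr_add[of "- y" "p - 2" 1] by simp
    ultimately show ?thesis using DERIV_cong_ev[OF refl] by metis
  next
    \<comment> \<open>The difference quotient at 0 is at most
      \<open>\<bar>h\<bar> powr (p - 1)\<close>, which tends to 0 because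
      \<open>p > 1\<close>.\<close>
    case 3
    have "((\<lambda>h::real. \<bar>h\<bar> powr (p - 1)) \<longlongrightarrow> \<bar>0\<bar> powr (p - 1)) (at 0)"
      by (intro tendsto_powr' tendsto_intros) (use assms in auto)
    then have lim: "((\<lambda>h::real. \<bar>h\<bar> powr (p - 1)) \<longlongrightarrow> 0) (at 0)" using assms by simp
    have le: "norm (\<bar>0 + h\<bar> powr p / h) \<le> \<bar>h\<bar> powr (p - 1)" if "h \<noteq> 0" for h :: real
      using that powr_add[of "\<bar>h\<bar>" "p - 1" 1] by (simp add: abs_mult)
    have "((\<lambda>h::real. (\<bar>0 + h\<bar> powr p - \<bar>0\<bar> powr p) / h) \<longlongrightarrow> 0) (at 0)"
      by (rule Lim_null_comparison[OF _ lim]) (use le in \<open>auto simp: eventually_at_filter\<close>)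
    then show ?thesis using 3 by (simp add: DERIV_def)
  qed
qed

text \<open>Away from 0 the function is \<open>\<bar>y\<bar> powr (\<alpha> + 2) / y\<close>, to
  which the quotient rule applies; at 0 its difference quotient is
  \<open>\<bar>h\<bar> powr \<alpha>\<close> itself.\<close>

lemma DERIV_nonlin:
  assumes "\<alpha> > 0"
  shows "(nonlin \<alpha> has_real_derivative (\<alpha> + 1) * \<bar>y\<bar> powr \<alpha>) (at y)"
proof (cases "y = 0")
  case True
  have "((\<lambda>h::real. \<bar>h\<bar> powr \<alpha>) \<longlongrightarrow> \<bar>0\<bar> powr \<alpha>) (at 0)"
    by (intro tendsto_powr' tendsto_intros) (use assms in auto)
  then have "((\<lambda>h::real. \<bar>h\<bar> powr \<alpha>) \<longlongrightarrow> 0) (at 0)" using assms by simp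
  then have "((\<lambda>h::real. (nonlin \<alpha> (0 + h) - nonlin \<alpha> 0) / h) \<longlongrightarrow> 0) (at 0)"
    by (rule Lim_transform_eventually)
      (use assms in \<open>auto simp: eventually_at_filter nonlin_def\<close>)
  then show ?thesis using True assms by (simp add: DERIV_def)
next
  case False
  have pe: "\<bar>y\<bar> powr (\<alpha> + 2) = \<bar>y\<bar> powr \<alpha> * y\<^sup>2"
    using False powr_add[of "\<bar>y\<bar>" \<alpha> 2] by simp
  have "((\<lambda>y. \<bar>y\<bar> powr (\<alpha> + 2) / y) has_real_derivative
      ((\<alpha> + 2) * \<bar>y\<bar> powr (\<alpha> + 2 - 2) * y * y - \<bar>y\<bar> powr (\<alpha> + 2)) / (y * y)) (at y)"
    using False assms DERIV_divide[OF DERIV_abs_powr[of "\<alpha> + 2" y] DERIV_ident[of "at y"]] by simp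
  moreover have "((\<alpha> + 2) * \<bar>y\<bar> powr (\<alpha> + 2 - 2) * y * y - \<bar>y\<bar> powr (\<alpha> + 2)) / (y * y) = (\<alpha> + 1) * \<bar>y\<bar> powr \<alpha>"
    using False by (simp add: pe power2_eq_square field_simps)
  moreover have "\<forall>\<^sub>F z in nhds y. \<bar>z\<bar> powr (\<alpha> + 2) / z = nonlin \<alpha> z"
    using eventually_nhds_in_open[of "- {0}" y] False powr_add[of "\<bar>_\<bar>" \<alpha> 2]
    by (auto elim!: eventually_mono simp: nonlin_def power2_eq_square)
  ultimately show ?thesis using DERIV_cong_ev[OF refl] by metis
qed

lemma isCont_nonlin: "\<alpha> > 0 \<Longrightarrow> isCont (nonlin \<alpha>) y"
  using DERIV_nonlin DERIV_isCont by blast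

lemma continuous_on_nonlin: "\<alpha> > 0 \<Longrightarrow> continuous_on S (nonlin \<alpha>)"
  by (simp add: continuous_at_imp_continuous_on isCont_nonlin)

lemma nonlin_minus: "nonlin \<alpha> (- y) = - nonlin \<alpha> y"
  by (simp add: nonlin_def)

lemma abs_nonlin: "\<bar>nonlin \<alpha> y\<bar> = \<bar>y\<bar> powr (\<alpha> + 1)"
  by (cases "y = 0") (auto simp: nonlin_def abs_mult powr_add)

lemma nonlin_Lipschitz:
  assumes "\<alpha> > 0" "\<bar>a\<bar> \<le> R" "\<bar>b\<bar> \<le> R"
  shows "\<bar>nonlin \<alpha> a - nonlin \<alpha> b\<bar> \<le> (\<alpha> + 1) * R powr \<alpha> * \<bar>a - b\<bar>"
proof -
  have "norm (nonlin \<alpha> a - nonlin \<alpha> b) \<le> (\<alpha> + 1) * R powr \<alpha> * norm (a - b)"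
  proof (rule field_differentiable_bound[where S = "{-R..R}"])
    show "(nonlin \<alpha> has_real_derivative (\<alpha> + 1) * \<bar>y\<bar> powr \<alpha>) (at y within {-R..R})" for y
      using DERIV_nonlin[OF assms(1)] by (rule has_field_derivative_at_within)
    show "norm ((\<alpha> + 1) * \<bar>y\<bar> powr \<alpha>) \<le> (\<alpha> + 1) * R powr \<alpha>" if "y \<in> {-R..R}" for y
      using that assms by (auto simp: abs_mult intro!: powr_mono2)
  qed (use assms in auto)
  then show ?thesis by simp
qed

text \<open>Friction gives \<open>e' = - (x / 2) * g\<^sup>2\<close>, so the energy is largest at 0.
  As \<open>g\<^sup>2 / 2 \<le> e\<close>, it cannot decay faster than
  \<open>exp (- x\<^sup>2 / 2)\<close>; data at some \<open>x \<ge> 0\<close> thus bound the energy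
  at 0 and hence everywhere. The potential is left general because the truncated equation has its
  own.\<close>

lemma energy_decay:
  fixes f g V V' :: "real \<Rightarrow> real"
  assumes f: "\<And>x. (f has_real_derivative g x) (at x)"
    and g: "\<And>x. (g has_real_derivative - (x / 2) * g x - V' (f x)) (at x)"
    and V: "\<And>y. (V has_real_derivative V' y) (at y)" "\<And>y. V y \<ge> 0"
  defines "e \<equiv> \<lambda>x. (g x)\<^sup>2 / 2 + V (f x)"
  shows "0 \<le> a \<Longrightarrow> a \<le> b \<Longrightarrow> e b \<le> e a"
    and "e x \<le> e 0"
    and "0 \<le> x \<Longrightarrow> e 0 \<le> e x * exp (x\<^sup>2 / 2)"
proof -
  have e: "(e has_real_derivative - (x / 2) * (g x)\<^sup>2) (at x)" for x
  proof -
    have "((\<lambda>x. (g x)\<^sup>2 / 2) has_real_derivative g x * (- (x / 2) * g x - V' (f x))) (at x)"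
      by (auto intro!: derivative_eq_intros g)
    moreover have "((\<lambda>x. V (f x)) has_real_derivative V' (f x) * g x) (at x)"
      by (rule DERIV_chain2[OF V(1) f])
    ultimately have "(e has_real_derivative g x * (- (x / 2) * g x - V' (f x)) + V' (f x) * g x) (at x)"
      unfolding e_def by (rule DERIV_add)
    then show ?thesis by (simp add: power2_eq_square algebra_simps)
  qed
  show 1: "e b \<le> e a" if "0 \<le> a" "a \<le> b" for a b
    by (rule DERIV_nonpos_imp_nonincreasing[OF that(2)]) (use that e in force)
  show "e x \<le> e 0"
  proof (cases "0 \<le> x")
    case False
    show ?thesis
      by (rule DERIV_nonneg_imp_nondecreasing[of x 0 e])
        (use False e mult_nonpos_nonneg[OF _ zero_le_power2] in \<open>auto intro!: exI\<close>)
  qed (use 1 in auto)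
  show "e 0 \<le> e x * exp (x\<^sup>2 / 2)" if "0 \<le> x"
  proof -
    have "e 0 * exp (0\<^sup>2 / 2) \<le> e x * exp (x\<^sup>2 / 2)"
    proof (rule DERIV_nonneg_imp_nondecreasing[OF that])
      fix y :: real assume y: "0 \<le> y" "y \<le> x"
      have "((\<lambda>x. e x * exp (x\<^sup>2 / 2)) has_real_derivative
          (- (y / 2) * (g y)\<^sup>2 + e y * y) * exp (y\<^sup>2 / 2)) (at y)"
        by (auto intro!: derivative_eq_intros e simp: algebra_simps)
      moreover have "- (y / 2) * (g y)\<^sup>2 + e y * y = V (f y) * y"
        by (simp add: e_def algebra_simps)
      ultimately show "\<exists>d. ((\<lambda>x. e x * exp (x\<^sup>2 / 2)) has_real_derivative d) (at y) \<and> 0 \<le> d"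
        using y V(2)[of "f y"] by (metis mult_nonneg_nonneg exp_ge_zero)
    qed
    then show ?thesis by simp
  qed
qed

definition profile_eq :: "real \<Rightarrow> (real \<Rightarrow> real) \<Rightarrow> (real \<Rightarrow> real) \<Rightarrow> bool" where
  "profile_eq \<alpha> f g \<longleftrightarrow>
     (\<forall>x. (f has_real_derivative g x) (at x) \<and>
          (g has_real_derivative - (x / 2) * g x - (f x / \<alpha> + nonlin \<alpha> (f x))) (at x))"

definition energy :: "real \<Rightarrow> real \<Rightarrow> real \<Rightarrow> real" where
  "energy \<alpha> y z = z\<^sup>2 / 2 + (y\<^sup>2 / (2 * \<alpha>) + \<bar>y\<bar> powr (\<alpha> + 2) / (\<alpha> + 2))"

lemma DERIV_potential:
  assumes "\<alpha> > 0"
  shows "((\<lambda>y. y\<^sup>2 / (2 * \<alpha>) + \<bar>y\<bar> powr (\<alpha> + 2) / (\<alpha> + 2)) has_real_derivative y / \<alpha> + nonlin \<alpha> y) (at y)"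
proof -
  have "((\<lambda>y. y\<^sup>2 / (2 * \<alpha>)) has_real_derivative y / \<alpha>) (at y)"
    using assms by (auto intro!: derivative_eq_intros)
  moreover have "((\<lambda>y. \<bar>y\<bar> powr (\<alpha> + 2) / (\<alpha> + 2)) has_real_derivative
      (\<alpha> + 2) * \<bar>y\<bar> powr (\<alpha> + 2 - 2) * y / (\<alpha> + 2)) (at y)"
    using assms by (intro DERIV_cdivide DERIV_abs_powr) simp
  ultimately show ?thesis using assms DERIV_add by (fastforce simp: nonlin_def)
qed

lemma profile_energy:
  assumes "\<alpha> > 0" "profile_eq \<alpha> f g"
  shows "0 \<le> a \<Longrightarrow> a \<le> b \<Longrightarrow> energy \<alpha> (f b) (g b) \<le> energy \<alpha> (f a) (g a)"
    and "energy \<alpha> (f x) (g x) \<le> energy \<alpha> (f 0) (g 0)"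
proof -
  have f: "(f has_real_derivative g x) (at x)"
    and g: "(g has_real_derivative - (x / 2) * g x - (f x / \<alpha> + nonlin \<alpha> (f x))) (at x)" for x
    using assms by (auto simp: profile_eq_def)
  note * = energy_decay[OF f g DERIV_potential[OF assms(1)]]
  show "0 \<le> a \<Longrightarrow> a \<le> b \<Longrightarrow> energy \<alpha> (f b) (g b) \<le> energy \<alpha> (f a) (g a)"
    unfolding energy_def using *(1)[of a b] assms(1) by simp
  show "energy \<alpha> (f x) (g x) \<le> energy \<alpha> (f 0) (g 0)"
    unfolding energy_def using *(2)[of x] assms(1) by simp
qed

lemma energy_bounds:
  assumes "\<alpha> > 0" "energy \<alpha> y z \<le> M"
  shows "\<bar>y\<bar> \<le> sqrt (2 * \<alpha> * M)" "\<bar>z\<bar> \<le> sqrt (2 * M)"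
proof -
  have "y\<^sup>2 / (2 * \<alpha>) \<le> energy \<alpha> y z" "z\<^sup>2 / 2 \<le> energy \<alpha> y z" using assms(1) by (simp_all add: energy_def)
  with assms(2) have "y\<^sup>2 / (2 * \<alpha>) \<le> M" "z\<^sup>2 / 2 \<le> M" by linarith+
  then have "y\<^sup>2 \<le> 2 * \<alpha> * M" "z\<^sup>2 \<le> 2 * M" using assms(1) by (simp_all add: field_simps)
  then show "\<bar>y\<bar> \<le> sqrt (2 * \<alpha> * M)" "\<bar>z\<bar> \<le> sqrt (2 * M)"
    by (metis real_sqrt_abs real_sqrt_le_iff)+
qed

lemma profile_bounded:
  assumes "\<alpha> > 0" "profile_eq \<alpha> f g"
  shows "\<exists>R>0. \<forall>x. \<bar>f x\<bar> \<le> R \<and> \<bar>g x\<bar> \<le> R"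
proof (intro exI conjI allI)
  define E where "E = energy \<alpha> (f 0) (g 0)"
  have "E \<ge> 0" using assms(1) by (simp add: E_def energy_def)
  then have nonneg: "0 \<le> sqrt (2 * \<alpha> * E)" "0 \<le> sqrt (2 * E)" using assms(1) by auto
  then show "0 < 1 + sqrt (2 * \<alpha> * E) + sqrt (2 * E)" by linarith
  fix x
  have "energy \<alpha> (f x) (g x) \<le> E" using profile_energy(2)[OF assms] by (simp add: E_def)
  note bounds = energy_bounds[OF assms(1) this]
  show "\<bar>f x\<bar> \<le> 1 + sqrt (2 * \<alpha> * E) + sqrt (2 * E)" "\<bar>g x\<bar> \<le> 1 + sqrt (2 * \<alpha> * E) + sqrt (2 * E)"
    using bounds nonneg by linarith+
qed

section \<open>Truncation of the nonlinearity and the global flow\<close>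

definition clamp_sym :: "real \<Rightarrow> real \<Rightarrow> real" where
  "clamp_sym R y = max (- R) (min R y)"

text \<open>Cutting off the argument of the nonlinearity makes the first-order system globally
  Lipschitz, as \<open>global_ode_exists\<close> demands. The energy bound shows afterwards that the
  cut-off is never active.\<close>

definition truncated_field :: "real \<Rightarrow> real \<Rightarrow> real \<Rightarrow> real \<times> real \<Rightarrow> real \<times> real" where
  "truncated_field \<alpha> R x p =
     (snd p, - (x / 2) * snd p - (fst p / \<alpha> + nonlin \<alpha> (clamp_sym R (fst p))))"

text \<open>The friction contributes \<open>\<bar>x\<bar> / 2\<close>; estimating it by
  \<open>1 + x\<^sup>2\<close> makes the constant a polynomial, with primitive
  \<open>field_Lip_int\<close>.\<close>

definition field_Lip :: "real \<Rightarrow> real \<Rightarrow> real \<Rightarrow> real" where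
  "field_Lip \<alpha> R x = 2 + 1 / \<alpha> + (\<alpha> + 1) * R powr \<alpha> + x\<^sup>2"

definition field_Lip_int :: "real \<Rightarrow> real \<Rightarrow> real \<Rightarrow> real" where
  "field_Lip_int \<alpha> R x = (2 + 1 / \<alpha> + (\<alpha> + 1) * R powr \<alpha>) * x + x ^ 3 / 3"

lemma DERIV_field_Lip_int: "(field_Lip_int \<alpha> R has_real_derivative field_Lip \<alpha> R x) (at x)"
  unfolding field_Lip_int_def field_Lip_def by (auto intro!: derivative_eq_intros)

lemma truncated_field_Lipschitz:
  assumes "\<alpha> > 0" "R > 0"
  shows "norm (truncated_field \<alpha> R x p - truncated_field \<alpha> R x q) \<le> field_Lip \<alpha> R x * norm (p - q)"
proof -
  define u v where "u = fst p - fst q" and "v = snd p - snd q"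
  define K where "K = (\<alpha> + 1) * R powr \<alpha>"
  have uv: "\<bar>u\<bar> \<le> norm (p - q)" "\<bar>v\<bar> \<le> norm (p - q)"
    using norm_fst_le[of u v] norm_snd_le[of v u] by (simp_all add: u_def v_def flip: fst_diff snd_diff)
  have K0: "K \<ge> 0" using assms by (simp add: K_def)
  have "\<bar>nonlin \<alpha> (clamp_sym R (fst p)) - nonlin \<alpha> (clamp_sym R (fst q))\<bar>
      \<le> K * \<bar>clamp_sym R (fst p) - clamp_sym R (fst q)\<bar>"
    unfolding K_def by (rule nonlin_Lipschitz) (use assms in \<open>auto simp: clamp_sym_def\<close>)
  also have "\<dots> \<le> K * \<bar>u\<bar>"
    using K0 by (intro mult_left_mono) (auto simp: clamp_sym_def u_def)
  finally have n: "\<bar>nonlin \<alpha> (clamp_sym R (fst p)) - nonlin \<alpha> (clamp_sym R (fst q))\<bar> \<le> K * \<bar>u\<bar>" .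
  have eq: "truncated_field \<alpha> R x p - truncated_field \<alpha> R x q =
     (v, - (x / 2) * v - u / \<alpha> - (nonlin \<alpha> (clamp_sym R (fst p)) - nonlin \<alpha> (clamp_sym R (fst q))))"
    by (simp add: truncated_field_def u_def v_def algebra_simps diff_divide_distrib)
  have "norm (truncated_field \<alpha> R x p - truncated_field \<alpha> R x q) \<le>
      \<bar>v\<bar> + \<bar>- (x / 2) * v - u / \<alpha> - (nonlin \<alpha> (clamp_sym R (fst p)) - nonlin \<alpha> (clamp_sym R (fst q)))\<bar>"
    unfolding eq using norm_Pair_le[of v "- (x / 2) * v - u / \<alpha> - (nonlin \<alpha> (clamp_sym R (fst p)) - nonlin \<alpha> (clamp_sym R (fst q)))"]
    by simp
  also have "\<dots> \<le> \<bar>v\<bar> + (\<bar>x\<bar> / 2 * \<bar>v\<bar> + \<bar>u\<bar> / \<alpha> + K * \<bar>u\<bar>)"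
  proof -
    have "\<bar>- (x / 2) * v\<bar> = \<bar>x\<bar> / 2 * \<bar>v\<bar>" "\<bar>u / \<alpha>\<bar> = \<bar>u\<bar> / \<alpha>"
      using assms by (simp_all add: abs_mult)
    with n show ?thesis by linarith
  qed
  also have "\<dots> \<le> \<bar>v\<bar> + ((1 + x\<^sup>2) * \<bar>v\<bar> + \<bar>u\<bar> / \<alpha> + K * \<bar>u\<bar>)"
  proof -
    have "\<bar>x\<bar> / 2 \<le> 1 + x\<^sup>2"
      using zero_le_power2[of "\<bar>x\<bar> - 1"] zero_le_power2[of x] unfolding power2_diff power2_abs by simp
    from mult_right_mono[OF this abs_ge_zero[of v]] show ?thesis by linarith
  qed
  also have "\<dots> \<le> field_Lip \<alpha> R x * norm (p - q)"
  proof -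
    have "\<bar>v\<bar> + ((1 + x\<^sup>2) * \<bar>v\<bar> + \<bar>u\<bar> / \<alpha> + K * \<bar>u\<bar>) = (2 + x\<^sup>2) * \<bar>v\<bar> + (1 / \<alpha> + K) * \<bar>u\<bar>"
      by (simp add: algebra_simps)
    also have "\<dots> \<le> (2 + x\<^sup>2) * norm (p - q) + (1 / \<alpha> + K) * norm (p - q)"
      using uv K0 assms by (intro add_mono mult_left_mono) auto
    finally show ?thesis by (simp add: field_Lip_def K_def algebra_simps)
  qed
  finally show ?thesis .
qed

lemma profile_eq_truncated:
  assumes "\<alpha> > 0" "profile_eq \<alpha> f g" "\<And>x. \<bar>f x\<bar> \<le> R"
  shows "((\<lambda>x. (f x, g x)) has_vector_derivative truncated_field \<alpha> R x (f x, g x)) (at x)"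
proof -
  have "clamp_sym R (f x) = f x" using assms(3)[of x] by (auto simp: clamp_sym_def)
  then show ?thesis
    using assms(2)
    by (auto simp: profile_eq_def truncated_field_def has_real_derivative_iff_has_vector_derivative
        intro!: has_vector_derivative_Pair)
qed

text \<open>Both profiles are bounded on the whole line, hence solve one and the same truncated
  system for a common \<open>R\<close>, to which Gronwall applies.\<close>

lemma profile_unique:
  assumes "\<alpha> > 0" "profile_eq \<alpha> f g" "profile_eq \<alpha> f2 g2" "f x0 = f2 x0" "g x0 = g2 x0"
  shows "f x = f2 x" "g x = g2 x"
proof -
  obtain R1 R2 where R: "R1 > 0" "\<And>x. \<bar>f x\<bar> \<le> R1" "\<And>x. \<bar>f2 x\<bar> \<le> R2"
    using profile_bounded[OF assms(1,2)] profile_bounded[OF assms(1,3)] by metis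
  define R where "R = max R1 R2"
  have R': "R > 0" "\<And>x. \<bar>f x\<bar> \<le> R" "\<And>x. \<bar>f2 x\<bar> \<le> R"
    using R unfolding R_def by (meson less_max_iff_disj max.coboundedI1 max.coboundedI2)+
  have "norm ((f x, g x) - (f2 x, g2 x)) \<le> norm ((f x0, g x0) - (f2 x0, g2 x0)) *
      exp \<bar>field_Lip_int \<alpha> R x - field_Lip_int \<alpha> R x0\<bar>"
    by (rule gronwall_solutions[OF truncated_field_Lipschitz[OF assms(1) R'(1)] DERIV_field_Lip_int
          profile_eq_truncated[OF assms(1,2) R'(2)] profile_eq_truncated[OF assms(1,3) R'(3)]])
  then show "f x = f2 x" "g x = g2 x" using assms(4,5) by (auto simp: zero_prod_def)
qed

lemma truncated_flow:
  assumes "\<alpha> > 0" "R > 0"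
  shows "\<exists>U. (\<forall>x0 p. U x0 p x0 = p) \<and>
     (\<forall>x0 p x. (U x0 p has_vector_derivative truncated_field \<alpha> R x (U x0 p x)) (at x)) \<and>
     continuous_on UNIV (\<lambda>(x0, p, x). U x0 p x)"
proof -
  have cont: "continuous_on UNIV (\<lambda>(x, p). truncated_field \<alpha> R x p)"
    unfolding truncated_field_def clamp_sym_def case_prod_unfold
    by (intro continuous_intros continuous_on_compose2[OF continuous_on_nonlin[OF assms(1), of UNIV]])
      (use assms in auto)
  have "\<exists>u. u x0 = p \<and> (\<forall>x. (u has_vector_derivative truncated_field \<alpha> R x (u x)) (at x))" for x0 p
    by (rule global_ode_exists[OF cont _ truncated_field_Lipschitz[OF assms] DERIV_field_Lip_int])
      (use assms in \<open>auto simp: truncated_field_def field_Lip_def clamp_sym_def nonlin_def zero_prod_def\<close>)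
  then obtain U where U: "\<And>x0 p. U x0 p x0 = p"
    "\<And>x0 p x. (U x0 p has_vector_derivative truncated_field \<alpha> R x (U x0 p x)) (at x)"
    by metis
  moreover have "continuous_on UNIV (\<lambda>(x0, p, x). U x0 p x)"
    by (rule global_ode_continuous[OF truncated_field_Lipschitz[OF assms] DERIV_field_Lip_int U])
  ultimately show ?thesis by blast
qed

text \<open>There is a circle to break: \<open>R\<close> must exceed the size of the solution, which
  is estimated through the truncated potential \<open>P\<close> and so through \<open>R\<close>. But
  the cut-off only weakens the force, so \<open>P\<close> is at most
  \<open>B powr (\<alpha> + 1) * B\<close> on \<open>{-B..B}\<close> whatever \<open>R\<close> is,
  and the energy bound \<open>Q\<close> can be fixed before \<open>R\<close>.\<close>

lemma truncated_solution_is_profile: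
  assumes "\<alpha> > 0" "B > 0"
  shows "\<exists>R>0. \<forall>x0 u. 0 \<le> x0 \<and> x0 \<le> B \<and> norm (u x0) \<le> B \<and>
     (\<forall>x. (u has_vector_derivative truncated_field \<alpha> R x (u x)) (at x)) \<longrightarrow>
     profile_eq \<alpha> (fst \<circ> u) (snd \<circ> u)"
proof -
  \<comment> \<open>Bounds the energy of data of norm at most \<open>B\<close> at a point
    \<open>x0 \<le> B\<close>; the factor \<open>exp (B\<^sup>2 / 2)\<close> carries the bound back
    to 0.\<close>
  define Q where "Q = (B\<^sup>2 / 2 + (B\<^sup>2 / (2 * \<alpha>) + B powr (\<alpha> + 1) * B)) * exp (B\<^sup>2 / 2)"
  have Q: "Q \<ge> 0" using assms by (simp add: Q_def)
  define R where "R = B + sqrt (2 * \<alpha> * Q)"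
  have R: "R > 0" "R \<ge> B" using assms Q by (auto simp: R_def add_pos_nonneg)
  define N where "N y = nonlin \<alpha> (clamp_sym R y)" for y
  have "continuous_on UNIV N"
    unfolding N_def clamp_sym_def
    by (intro continuous_on_compose2[OF continuous_on_nonlin[OF assms(1), of UNIV]] continuous_intros) auto
  then obtain P where P: "\<And>y. (P has_vector_derivative N y) (at y)" "P 0 = 0"
    using antiderivative_exists[of N 0] by metis
  then have P': "(P has_real_derivative N y) (at y)" for y
    by (simp add: has_real_derivative_iff_has_vector_derivative)
  have Nsgn: "y \<ge> 0 \<Longrightarrow> N y \<ge> 0" "y \<le> 0 \<Longrightarrow> N y \<le> 0" for y
    using R(1) by (auto simp: N_def nonlin_def clamp_sym_def intro!: mult_nonneg_nonneg mult_nonneg_nonpos)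
  have Ppos: "P y \<ge> 0" for y
  proof (cases "y \<ge> 0")
    case True
    have "P 0 \<le> P y" by (rule DERIV_nonneg_imp_nondecreasing[OF True]) (use P' Nsgn in blast)
    then show ?thesis using P by simp
  next
    case False
    then have "y \<le> 0" by simp
    then have "P 0 \<le> P y" by (rule DERIV_nonpos_imp_nonincreasing) (use P' Nsgn in blast)
    then show ?thesis using P by simp
  qed
  have Ple: "P y \<le> B powr (\<alpha> + 1) * B" if "\<bar>y\<bar> \<le> B" for y
  proof -
    have "norm (P y - P 0) \<le> B powr (\<alpha> + 1) * norm (y - 0)"
    proof (rule field_differentiable_bound[where S = "{-B..B}"])
      show "(P has_real_derivative N z) (at z within {-B..B})" for z
        using P' by (rule has_field_derivative_at_within)
      show "norm (N z) \<le> B powr (\<alpha> + 1)" if "z \<in> {-B..B}" for z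
        unfolding N_def real_norm_def abs_nonlin
        using that assms R by (intro powr_mono2) (auto simp: clamp_sym_def)
    qed (use that in auto)
    also have "\<dots> \<le> B powr (\<alpha> + 1) * B" using that by (intro mult_left_mono) auto
    finally show ?thesis using P by auto
  qed
  define V where "V y = y\<^sup>2 / (2 * \<alpha>) + P y" for y
  have V: "(V has_real_derivative y / \<alpha> + N y) (at y)" "V y \<ge> 0" for y
    unfolding V_def using assms Ppos[of y] by (auto intro!: derivative_eq_intros P')
  show ?thesis
  proof (intro exI[of _ R] conjI allI impI R(1), elim conjE)
    fix x0 :: real and u
    assume x0: "0 \<le> x0" "x0 \<le> B" and ux0: "norm (u x0) \<le> B"
      and u: "\<forall>x. (u has_vector_derivative truncated_field \<alpha> R x (u x)) (at x)"
    define f g where "f x = fst (u x)" and "g x = snd (u x)" for x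
    have f: "(f has_real_derivative g x) (at x)" for x
    proof -
      have "((\<lambda>x. fst (u x)) has_vector_derivative fst (truncated_field \<alpha> R x (u x))) (at x)"
        using bounded_linear.has_vector_derivative[OF bounded_linear_fst u[rule_format]] .
      then show ?thesis
        by (simp add: f_def[abs_def] g_def truncated_field_def has_real_derivative_iff_has_vector_derivative)
    qed
    have g: "(g has_real_derivative - (x / 2) * g x - (f x / \<alpha> + N (f x))) (at x)" for x
    proof -
      have "((\<lambda>x. snd (u x)) has_vector_derivative snd (truncated_field \<alpha> R x (u x))) (at x)"
        using bounded_linear.has_vector_derivative[OF bounded_linear_snd u[rule_format]] .
      then show ?thesis
        by (simp add: f_def g_def[abs_def] truncated_field_def N_def has_real_derivative_iff_has_vector_derivative)
    qed
    note decay = energy_decay[OF f g V]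
    have fx0: "\<bar>f x0\<bar> \<le> B" "\<bar>g x0\<bar> \<le> B"
      using ux0 norm_fst_le[of "fst (u x0)" "snd (u x0)"] norm_snd_le[of "snd (u x0)" "fst (u x0)"]
      by (auto simp: f_def g_def)
    have fg2: "(f x0)\<^sup>2 \<le> B\<^sup>2" "(g x0)\<^sup>2 \<le> B\<^sup>2"
      using fx0 abs_le_square_iff assms(2) by (metis abs_of_pos)+
    have "(g 0)\<^sup>2 / 2 + V (f 0) \<le> ((g x0)\<^sup>2 / 2 + V (f x0)) * exp (x0\<^sup>2 / 2)"
      by (rule decay(3)[OF x0(1)])
    also have "\<dots> \<le> Q"
      unfolding Q_def
    proof (rule mult_mono)
      have "(f x0)\<^sup>2 / (2 * \<alpha>) \<le> B\<^sup>2 / (2 * \<alpha>)" using fg2 assms by (intro divide_right_mono) auto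
      then show "(g x0)\<^sup>2 / 2 + V (f x0) \<le> B\<^sup>2 / 2 + (B\<^sup>2 / (2 * \<alpha>) + B powr (\<alpha> + 1) * B)"
        unfolding V_def using Ple[OF fx0(1)] fg2 by linarith
      show "exp (x0\<^sup>2 / 2) \<le> exp (B\<^sup>2 / 2)" using x0 by (simp add: power_mono)
    qed (use assms in auto)
    finally have Q0: "(g 0)\<^sup>2 / 2 + V (f 0) \<le> Q" .
    have fR: "\<bar>f x\<bar> \<le> R" for x
    proof -
      have "(f x)\<^sup>2 / (2 * \<alpha>) \<le> (g x)\<^sup>2 / 2 + V (f x)"
        unfolding V_def using Ppos[of "f x"] by simp
      also have "\<dots> \<le> Q" using decay(2)[of x] Q0 by simp
      finally have "(f x)\<^sup>2 \<le> 2 * \<alpha> * Q" using assms by (simp add: field_simps)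
      then have "\<bar>f x\<bar> \<le> sqrt (2 * \<alpha> * Q)" by (metis real_sqrt_abs real_sqrt_le_iff)
      then show ?thesis using assms by (simp add: R_def)
    qed
    have "N (f x) = nonlin \<alpha> (f x)" for x
      using fR[of x] by (auto simp: N_def clamp_sym_def max_def min_def)
    then show "profile_eq \<alpha> (fst \<circ> u) (snd \<circ> u)"
      using f g by (auto simp: profile_eq_def o_def f_def[abs_def] g_def[abs_def])
  qed
qed

text \<open>The data are prescribed at \<open>max 0 x0\<close>: backwards in \<open>x < 0\<close> the a priori bound
  is only available from \<open>0\<close>.\<close>

lemma profile_flow:
  assumes "\<alpha> > 0"
  shows "\<exists>\<Phi>. (\<forall>x0 p. \<Phi> x0 p (max 0 x0) = p \<and> profile_eq \<alpha> (fst \<circ> \<Phi> x0 p) (snd \<circ> \<Phi> x0 p)) \<and>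
     continuous_on UNIV (\<lambda>(x0, p, x). \<Phi> x0 p x)"
proof -
  have loc: "\<exists>U. (\<forall>x0 p. 0 \<le> x0 \<and> x0 \<le> B \<and> norm p \<le> B \<longrightarrow>
      U x0 p x0 = p \<and> profile_eq \<alpha> (fst \<circ> U x0 p) (snd \<circ> U x0 p)) \<and>
      continuous_on UNIV (\<lambda>(x0, p, x). U x0 p x)" if B: "B > 0" for B
  proof -
    obtain R where R: "R > 0" "\<And>x0 u. 0 \<le> x0 \<Longrightarrow> x0 \<le> B \<Longrightarrow> norm (u x0) \<le> B \<Longrightarrow>
       (\<And>x. (u has_vector_derivative truncated_field \<alpha> R x (u x)) (at x)) \<Longrightarrow>
       profile_eq \<alpha> (fst \<circ> u) (snd \<circ> u)"
      using truncated_solution_is_profile[OF assms B] by metis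
    obtain U where U: "\<And>x0 p. U x0 p x0 = p"
      "\<And>x0 p x. (U x0 p has_vector_derivative truncated_field \<alpha> R x (U x0 p x)) (at x)"
      "continuous_on UNIV (\<lambda>(x0, p, x). U x0 p x)"
      using truncated_flow[OF assms R(1)] by metis
    show ?thesis
      by (intro exI[of _ U] conjI allI impI) (use U R(2)[where u = "U _ _"] in auto)
  qed
  have "\<exists>u. u (max 0 x0) = p \<and> profile_eq \<alpha> (fst \<circ> u) (snd \<circ> u)" for x0 p
  proof -
    have "1 + max 0 x0 + norm p > 0" by (smt (verit) norm_ge_zero)
    from loc[OF this] obtain U where "\<forall>y q. 0 \<le> y \<and> y \<le> 1 + max 0 x0 + norm p \<and> norm q \<le> 1 + max 0 x0 + norm p \<longrightarrow>
      U y q y = q \<and> profile_eq \<alpha> (fst \<circ> U y q) (snd \<circ> U y q)" by blast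
    note * = this[rule_format, of "max 0 x0" p]
    have "U (max 0 x0) p (max 0 x0) = p \<and> profile_eq \<alpha> (fst \<circ> U (max 0 x0) p) (snd \<circ> U (max 0 x0) p)"
      by (rule *) (simp add: add_increasing2)
    then show ?thesis by blast
  qed
  then obtain \<Phi> where \<Phi>: "\<And>x0 p. \<Phi> x0 p (max 0 x0) = p"
    "\<And>x0 p. profile_eq \<alpha> (fst \<circ> \<Phi> x0 p) (snd \<circ> \<Phi> x0 p)" by metis
  \<comment> \<open>Continuity is local: on the open set \<open>A n\<close> uniqueness identifies
    \<Phi> with one of the flows from \<open>loc\<close>, and these sets exhaust the space.\<close>
  define A where "A n = {..<real (Suc n)} \<times> ball (0::real \<times> real) (real (Suc n)) \<times> (UNIV :: real set)" for n :: nat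
  have "continuous_on (\<Union>n. A n) (\<lambda>(x0, p, x). \<Phi> x0 p x)"
  proof (rule continuous_on_open_UN)
    show "open (A n)" for n unfolding A_def by (intro open_Times) auto
    show "continuous_on (A n) (\<lambda>(x0, p, x). \<Phi> x0 p x)" for n
    proof -
      obtain U where U: "\<And>x0 p. 0 \<le> x0 \<Longrightarrow> x0 \<le> real (Suc n) \<Longrightarrow> norm p \<le> real (Suc n) \<Longrightarrow>
          U x0 p x0 = p \<and> profile_eq \<alpha> (fst \<circ> U x0 p) (snd \<circ> U x0 p)"
        "continuous_on UNIV (\<lambda>(x0, p, x). U x0 p x)"
        using loc[of "real (Suc n)"] by (metis of_nat_0_less_iff zero_less_Suc)
      have eq: "\<Phi> x0 p x = U (max 0 x0) p x" if "(x0, p, x) \<in> A n" for x0 p x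
      proof -
        have *: "U (max 0 x0) p (max 0 x0) = p" "profile_eq \<alpha> (fst \<circ> U (max 0 x0) p) (snd \<circ> U (max 0 x0) p)"
          using U(1)[of "max 0 x0" p] that by (auto simp: A_def)
        show ?thesis
          using profile_unique[OF assms \<Phi>(2)[of x0 p] *(2), of "max 0 x0" x] *(1) \<Phi>(1)[of x0 p]
          by (auto simp: prod_eq_iff)
      qed
      have "continuous_on (A n) ((\<lambda>(x0, p, x). U x0 p x) \<circ> (\<lambda>z. (max 0 (fst z), fst (snd z), snd (snd z))))"
        by (rule continuous_on_compose) (auto intro!: continuous_intros continuous_on_subset[OF U(2)])
      then show ?thesis
        by (rule continuous_on_cong[OF refl, THEN iffD1, rotated]) (auto simp: eq)
    qed
  qed
  moreover have "(\<Union>n. A n) = UNIV"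
  proof (intro equalityI subsetI UNIV_I)
    fix z :: "real \<times> (real \<times> real) \<times> real"
    obtain n where n: "max (fst z) (norm (fst (snd z))) < real n" using reals_Archimedean2 by blast
    then have "z \<in> A n" by (cases z) (auto simp: A_def)
    then show "z \<in> (\<Union>n. A n)" by blast
  qed
  ultimately show ?thesis using \<Phi> by metis
qed

section \<open>Solutions near infinity\<close>

definition rho :: "real \<Rightarrow> real \<Rightarrow> real" where
  "rho k x = exp (x\<^sup>2 / 4) * x powr (- 2 * k)"

lemma rho_pos: "x > 0 \<Longrightarrow> rho k x > 0"
  by (simp add: rho_def)

lemma DERIV_rho:
  assumes "x > 0"
  shows "(rho k has_real_derivative (x / 2 - 2 * k / x) * rho k x) (at x)"
proof -
  have "((\<lambda>x. exp (x\<^sup>2 / 4) * x powr (- 2 * k)) has_real_derivative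
      exp (x\<^sup>2 / 4) * (x / 2) * x powr (- 2 * k) + exp (x\<^sup>2 / 4) * (- 2 * k * x powr (- 2 * k - 1))) (at x)"
    using assms by (auto intro!: derivative_eq_intros)
  moreover have "x powr (- 2 * k - 1) = x powr (- 2 * k) / x"
    using assms by (simp add: powr_diff)
  ultimately show ?thesis
    unfolding rho_def[abs_def] by (simp add: algebra_simps)
qed

lemma rho_mono:
  assumes "X > 0" "X\<^sup>2 \<ge> 8 * k" "k \<ge> 0" "X \<le> x"
  shows "rho k X \<le> rho k x"
proof (rule DERIV_nonneg_imp_nondecreasing[OF assms(4)])
  fix y assume y: "X \<le> y" "y \<le> x"
  then have y0: "y > 0" using assms by simp
  have "8 * k \<le> y\<^sup>2" using assms y by (meson order_trans power_mono less_imp_le)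
  then have "y / 2 - 2 * k / y \<ge> 0" using y0 assms(3) by (simp add: field_simps power2_eq_square)
  then show "\<exists>d. (rho k has_real_derivative d) (at y) \<and> 0 \<le> d"
    using DERIV_rho[OF y0] rho_pos[OF y0, of k] by (metis mult_nonneg_nonneg less_imp_le)
qed

text \<open>\<open>rho k * v\<close> has derivative \<open>- rho k * r / x\<^sup>2\<close>, which is
  integrated against explicit majorants. That of \<open>4 * H * rho k x / x ^ 3\<close> grows at
  least at the speed \<open>H * rho k x / x\<^sup>2\<close> once
  \<open>x\<^sup>2 \<ge> 8 * k + 12\<close>, the origin of this bound. An abstract \<open>r\<close>
  serves both a single solution and the difference of two.\<close>

lemma damped_bounds:
  fixes w v r :: "real \<Rightarrow> real"
  assumes X: "X > 0" "X\<^sup>2 \<ge> 8 * k + 12" "k \<ge> 0" and b: "X \<le> b"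
    and w: "\<And>x. X \<le> x \<Longrightarrow> x \<le> b \<Longrightarrow> (w has_real_derivative v x) (at x)"
    and v: "\<And>x. X \<le> x \<Longrightarrow> x \<le> b \<Longrightarrow>
      (v has_real_derivative - (x / 2 - 2 * k / x) * v x - r x / x\<^sup>2) (at x)"
    and r: "\<And>x. X \<le> x \<Longrightarrow> x \<le> b \<Longrightarrow> \<bar>r x\<bar> \<le> H"
  shows "X \<le> x \<Longrightarrow> x \<le> b \<Longrightarrow> \<bar>rho k x * v x - rho k X * v X\<bar> \<le> 4 * H * rho k x / x ^ 3"
    and "X \<le> a \<Longrightarrow> a \<le> b \<Longrightarrow>
      \<bar>w b - w a\<bar> \<le> 4 / a * (rho k X / rho k a) * \<bar>v X\<bar> + 2 * H / a\<^sup>2"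
proof -
  have H: "H \<ge> 0" using r[of X] b by fastforce
  have pos: "x > 0" "8 * k + 12 \<le> x\<^sup>2" if "X \<le> x" for x
    using that X by (simp, meson order_trans power_mono less_imp_le)
  have rv: "((\<lambda>x. rho k x * v x) has_real_derivative - rho k x * r x / x\<^sup>2) (at x)" if "X \<le> x" "x \<le> b" for x
  proof -
    have "((\<lambda>x. rho k x * v x) has_real_derivative
      (x / 2 - 2 * k / x) * rho k x * v x + (- (x / 2 - 2 * k / x) * v x - r x / x\<^sup>2) * rho k x) (at x)"
      using DERIV_mult[OF DERIV_rho[OF pos(1)] v] that by blast
    then show ?thesis by (simp add: algebra_simps)
  qed
  have 1: "\<bar>rho k x * v x - rho k X * v X\<bar> \<le> 4 * H * rho k x / x ^ 3" if x: "X \<le> x" "x \<le> b" for x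
  proof -
    define G where "G x = 4 * H * (rho k x / x ^ 3)" for x
    have G: "(G has_real_derivative 4 * H * (rho k y * (y / 2 - 2 * k / y - 3 / y) / y ^ 3)) (at y)" if "X \<le> y" for y
    proof -
      have y: "y > 0" using pos that by blast
      have "((\<lambda>y. rho k y / y ^ 3) has_real_derivative
        ((y / 2 - 2 * k / y) * rho k y * y ^ 3 - rho k y * (3 * y\<^sup>2)) / (y ^ 3 * y ^ 3)) (at y)"
      proof (rule DERIV_divide)
        show "(rho k has_real_derivative (y / 2 - 2 * k / y) * rho k y) (at y)" by (rule DERIV_rho[OF y])
        show "((\<lambda>y. y ^ 3) has_real_derivative 3 * y\<^sup>2) (at y)" by (auto intro!: derivative_eq_intros)
      qed (use y in simp)
      moreover have "(A * R * y ^ 3 - R * (3 * y\<^sup>2)) / (y ^ 3 * y ^ 3) = R * (A - 3 / y) / y ^ 3" for A R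
      proof -
        have "A * R * y ^ 3 - R * (3 * y\<^sup>2) = R * (A - 3 / y) * y ^ 3"
          using y by (simp add: algebra_simps power2_eq_square power3_eq_cube)
        then have "(A * R * y ^ 3 - R * (3 * y\<^sup>2)) / (y ^ 3 * y ^ 3) = R * (A - 3 / y) * y ^ 3 / (y ^ 3 * y ^ 3)"
          by (simp only:)
        also have "\<dots> = R * (A - 3 / y) / y ^ 3"
          using y by (intro nonzero_mult_divide_mult_cancel_right) simp
        finally show ?thesis .
      qed
      ultimately have "((\<lambda>y. rho k y / y ^ 3) has_real_derivative rho k y * (y / 2 - 2 * k / y - 3 / y) / y ^ 3) (at y)"
        by (simp only:)
      from DERIV_cmult[OF this, of "4 * H"] show ?thesis unfolding G_def by simp
    qed
    have "norm ((rho k x * v x) - (rho k X * v X)) \<le> G x - G X"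
    proof (rule vector_derivative_bound[OF x(1)])
      fix y assume y: "X \<le> y" "y \<le> x"
      then show "((\<lambda>x. rho k x * v x) has_vector_derivative - rho k y * r y / y\<^sup>2) (at y)"
        using rv[of y] x by (simp add: has_real_derivative_iff_has_vector_derivative)
      show "(G has_real_derivative 4 * H * (rho k y * (y / 2 - 2 * k / y - 3 / y) / y ^ 3)) (at y)"
        using G y by blast
      have y0: "y > 0" "8 * k + 12 \<le> y\<^sup>2" using pos y by auto
      have q: "1 / y\<^sup>2 \<le> 4 * ((y / 2 - 2 * k / y - 3 / y) / y ^ 3)"
      proof -
        have "4 * ((y / 2 - 2 * k / y - 3 / y) / y ^ 3) = (2 - (8 * k + 12) / y\<^sup>2) / y\<^sup>2"
          using y0(1) by (simp add: divide_simps power2_eq_square power3_eq_cube)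
        moreover have "(8 * k + 12) / y\<^sup>2 \<le> 1" using y0 by (simp add: divide_le_eq_1)
        ultimately show ?thesis by (simp add: divide_right_mono)
      qed
      have "norm (- rho k y * r y / y\<^sup>2) = \<bar>r y\<bar> * (rho k y * (1 / y\<^sup>2))"
        using rho_pos[OF y0(1), of k] by (simp add: abs_mult)
      also have "\<dots> \<le> H * (rho k y * (4 * ((y / 2 - 2 * k / y - 3 / y) / y ^ 3)))"
        using r[of y] y x rho_pos[OF y0(1), of k] q H y0(1) by (intro mult_mono mult_left_mono) auto
      finally show "norm (- rho k y * r y / y\<^sup>2) \<le> 4 * H * (rho k y * (y / 2 - 2 * k / y - 3 / y) / y ^ 3)"
        by (simp add: mult.assoc mult.left_commute)
    qed
    moreover have "G X \<ge> 0" using H rho_pos[OF X(1), of k] X(1) by (simp add: G_def)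
    ultimately show ?thesis by (simp add: G_def)
  qed
  show "X \<le> x \<Longrightarrow> x \<le> b \<Longrightarrow> \<bar>rho k x * v x - rho k X * v X\<bar> \<le> 4 * H * rho k x / x ^ 3"
    by (rule 1)
  show "\<bar>w b - w a\<bar> \<le> 4 / a * (rho k X / rho k a) * \<bar>v X\<bar> + 2 * H / a\<^sup>2" if a: "X \<le> a" "a \<le> b"
  proof -
    define c where "c = rho k X * \<bar>v X\<bar>"
    have c: "c \<ge> 0" using rho_pos[OF X(1), of k] by (simp add: c_def)
    \<comment> \<open>Integrates \<open>\<bar>v z\<bar> \<le> c / rho k z + 4 * H / z ^ 3\<close>.
      The second term has the primitive \<open>- 2 * H / z\<^sup>2\<close>. For the first,
      \<open>- 4 * c / (z * rho k z)\<close> grows fast enough because the relative growth rate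
      \<open>z / 2 - 2 * k / z\<close> of \<open>rho k\<close> is of order \<open>z\<close>.\<close>
    define M where "M z = - 4 * c / (z * rho k z) - 2 * H / z\<^sup>2" for z
    define M' where "M' z = 4 * c * (rho k z + z * ((z / 2 - 2 * k / z) * rho k z)) / (z * rho k z)\<^sup>2 + 4 * H / z ^ 3" for z
    have M: "(M has_real_derivative M' z) (at z)" if "X \<le> z" for z
    proof -
      have z: "z > 0" "rho k z > 0" using pos(1)[OF that] rho_pos by auto
      have "((\<lambda>z. z * rho k z) has_real_derivative (rho k z + z * ((z / 2 - 2 * k / z) * rho k z))) (at z)"
        by (auto intro!: derivative_eq_intros DERIV_rho z)
      then have 1: "((\<lambda>z. - 4 * c / (z * rho k z)) has_real_derivative
        4 * c * (rho k z + z * ((z / 2 - 2 * k / z) * rho k z)) / (z * rho k z)\<^sup>2) (at z)"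
        using DERIV_divide[OF DERIV_const[of "- 4 * c"] \<open>((\<lambda>z. z * rho k z) has_real_derivative _) (at z)\<close>] z
        by (simp add: power2_eq_square)
      have 2: "((\<lambda>z. 2 * H / z\<^sup>2) has_real_derivative - 4 * H / z ^ 3) (at z)"
        using z by (auto intro!: derivative_eq_intros simp: field_simps power2_eq_square power3_eq_cube)
      show ?thesis unfolding M_def[abs_def] M'_def using DERIV_diff[OF 1 2] by simp
    qed
    have "norm (w b - w a) \<le> M b - M a"
    proof (rule vector_derivative_bound[OF a(2)])
      fix z assume "a \<le> z" "z \<le> b"
      then have z: "X \<le> z" "z \<le> b" using a by auto
      show "(w has_vector_derivative v z) (at z)"
        using w[OF z] by (simp add: has_real_derivative_iff_has_vector_derivative)
      show "(M has_real_derivative M' z) (at z)" by (rule M[OF z(1)])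
      have z0: "z > 0" "8 * k + 12 \<le> z\<^sup>2" using pos z by auto
      define R where "R = rho k z"
      have R: "R > 0" using rho_pos[OF z0(1)] by (simp add: R_def)
      have "\<bar>R * v z\<bar> \<le> c + 4 * H * R / z ^ 3"
      proof -
        have "\<bar>rho k X * v X\<bar> = c" using rho_pos[OF X(1), of k] by (simp add: c_def abs_mult)
        then show ?thesis using 1[OF z] unfolding R_def by linarith
      qed
      then have "\<bar>v z\<bar> \<le> c / R + 4 * H / z ^ 3"
        using R by (simp add: abs_mult field_simps)
      also have "\<dots> \<le> M' z"
      proof -
        have "c * R * z\<^sup>2 \<le> 4 * c * (R + z * ((z / 2 - 2 * k / z) * R))"
        proof -
          have "4 * c * (R + z * ((z / 2 - 2 * k / z) * R)) = c * R * (4 + 2 * z\<^sup>2 - 8 * k)"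
            using z0(1) by (simp add: field_simps power2_eq_square)
          moreover have "c * R * z\<^sup>2 \<le> c * R * (4 + 2 * z\<^sup>2 - 8 * k)"
            using c R z0(2) by (intro mult_left_mono) auto
          ultimately show ?thesis by (simp only:)
        qed
        then have "c * R * z\<^sup>2 / (z * R)\<^sup>2 \<le> 4 * c * (R + z * ((z / 2 - 2 * k / z) * R)) / (z * R)\<^sup>2"
          by (rule divide_right_mono) simp
        moreover have "c * R * z\<^sup>2 / (z * R)\<^sup>2 = c / R"
          using R z0(1) by (simp add: power2_eq_square)
        ultimately show ?thesis by (simp add: M'_def R_def)
      qed
      finally show "norm (v z) \<le> M' z" by simp
    qed
    also have "\<dots> \<le> - M a"
    proof -
      have "b > 0" "rho k b > 0" using pos(1)[OF b] rho_pos by auto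
      then have "0 \<le> 4 * c / (b * rho k b)" "0 \<le> 2 * H / b\<^sup>2" using c H by simp_all
      then show ?thesis by (simp add: M_def)
    qed
    also have "- M a = 4 / a * (rho k X / rho k a) * \<bar>v X\<bar> + 2 * H / a\<^sup>2"
      by (simp add: M_def c_def)
    finally show ?thesis by simp
  qed
qed

text \<open>In terms of \<open>w = inv_pos \<alpha> f\<close> and \<open>k = 2 / \<alpha>\<close> the profile equation reads
  \<open>w'' + (x / 2 - 2 * k / x) * w' + inv_force \<alpha> w / x\<^sup>2 = 0\<close>, and \<open>rho k\<close> is an integrating factor.\<close>

definition inv_force :: "real \<Rightarrow> real \<Rightarrow> real" where
  "inv_force \<alpha> y = (2 / \<alpha>) * (2 / \<alpha> + 1) * y + nonlin \<alpha> y"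

definition inv_pos :: "real \<Rightarrow> (real \<Rightarrow> real) \<Rightarrow> real \<Rightarrow> real" where
  "inv_pos \<alpha> f x = x powr (2 / \<alpha>) * f x"

definition inv_vel :: "real \<Rightarrow> (real \<Rightarrow> real) \<Rightarrow> (real \<Rightarrow> real) \<Rightarrow> real \<Rightarrow> real" where
  "inv_vel \<alpha> f g x = x powr (2 / \<alpha>) * (g x + 2 / \<alpha> * f x / x)"

lemma DERIV_inv_pos:
  assumes "profile_eq \<alpha> f g" "x > 0"
  shows "(inv_pos \<alpha> f has_real_derivative inv_vel \<alpha> f g x) (at x)"
proof -
  define k where "k = 2 / \<alpha>"
  have "((\<lambda>x. x powr k * f x) has_real_derivative k * x powr (k - 1) * f x + g x * x powr k) (at x)"
    using assms by (intro DERIV_mult has_real_derivative_powr) (auto simp: profile_eq_def)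
  moreover have "x powr (k - 1) = x powr k / x" using assms by (simp add: powr_diff)
  ultimately show ?thesis
    unfolding inv_pos_def[abs_def] inv_vel_def k_def[symmetric] by (simp add: algebra_simps)
qed

text \<open>The exponent \<open>2 / \<alpha>\<close> is the one for which
  \<open>x powr (2 / \<alpha>)\<close> raised to \<alpha> is \<open>x\<^sup>2\<close>, so the weight
  passes through the nonlinearity. The linear term \<open>f x / \<alpha>\<close> is cancelled by the
  friction acting on \<open>2 / \<alpha> * f x / x\<close>, and only a force in \<open>w\<close>,
  divided by \<open>x\<^sup>2\<close>, remains.\<close>

lemma DERIV_inv_vel:
  assumes "profile_eq \<alpha> f g" "x > 0" "\<alpha> > 0"
  shows "(inv_vel \<alpha> f g has_real_derivative
     - (x / 2 - 2 * (2 / \<alpha>) / x) * inv_vel \<alpha> f g x - inv_force \<alpha> (inv_pos \<alpha> f x) / x\<^sup>2) (at x)"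
proof -
  define k where "k = 2 / \<alpha>"
  define N where "N = nonlin \<alpha> (f x)"
  define P where "P = x powr k"
  have k: "k > 0" "k * \<alpha> = 2" "1 / \<alpha> = k / 2" using assms by (auto simp: k_def)
  have g: "(g has_real_derivative - (x / 2) * g x - (k / 2 * f x + N)) (at x)"
    using assms(1) k(3) unfolding profile_eq_def N_def k_def by simp
  have f: "(f has_real_derivative g x) (at x)" using assms by (simp add: profile_eq_def)
  have "((\<lambda>x. k * f x / x) has_real_derivative (k * g x * x - k * f x * 1) / (x * x)) (at x)"
    using assms f by (intro DERIV_divide DERIV_cmult DERIV_ident) auto
  then have 1: "((\<lambda>x. g x + k * f x / x) has_real_derivative
    (- (x / 2) * g x - (k / 2 * f x + N)) + (k * g x * x - k * f x * 1) / (x * x)) (at x)"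
    by (intro DERIV_add g)
  have 2: "((\<lambda>x. x powr k) has_real_derivative k * x powr (k - 1)) (at x)"
    using assms by (intro has_real_derivative_powr)
  have 3: "x powr (k - 1) = P / x" using assms by (simp add: powr_diff P_def)
  have 4: "nonlin \<alpha> (P * f x) = x\<^sup>2 * P * N"
  proof -
    have "P powr \<alpha> = x powr (k * \<alpha>)" unfolding P_def by (simp add: powr_powr)
    then have "P powr \<alpha> = x\<^sup>2" using k(2) assms by simp
    moreover have "P \<ge> 0" by (simp add: P_def)
    ultimately show ?thesis by (simp add: nonlin_def N_def abs_mult powr_mult)
  qed
  have "((\<lambda>x. x powr k * (g x + k * f x / x)) has_real_derivative
     k * (P / x) * (g x + k * f x / x) +
     ((- (x / 2) * g x - (k / 2 * f x + N)) + (k * g x * x - k * f x * 1) / (x * x)) * P) (at x)"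
    using DERIV_mult[OF 2 1] unfolding 3 P_def[symmetric] .
  moreover have "k * (P / x) * (g x + k * f x / x) +
     ((- (x / 2) * g x - (k / 2 * f x + N)) + (k * g x * x - k * f x * 1) / (x * x)) * P
     = - (x / 2 - 2 * k / x) * (P * (g x + k * f x / x)) - (k * (k + 1) * (P * f x) + x\<^sup>2 * P * N) / x\<^sup>2"
    using assms(2) by (simp add: field_simps power2_eq_square)
  ultimately show ?thesis
    unfolding inv_vel_def[abs_def] inv_force_def inv_pos_def k_def[symmetric] P_def[symmetric] 4 by simp
qed

text \<open>Multiplication of the equation for \<open>w\<close> by \<open>x\<^sup>2 * w'\<close>
  makes the force autonomous, so it has a potential. With \<open>k = 2 / \<alpha>\<close> what is
  left of the derivative is \<open>x * w'\<^sup>2 * (1 + 2 * k - x\<^sup>2 / 2)\<close>, nonpositive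
  from \<open>x\<^sup>2 = 2 + 4 * k\<close> on.\<close>

lemma inv_lyapunov:
  assumes "\<alpha> > 0" "profile_eq \<alpha> f g" "0 < a" "2 + 8 / \<alpha> \<le> a\<^sup>2" "a \<le> b"
  defines "F \<equiv> \<lambda>x. x\<^sup>2 * (inv_vel \<alpha> f g x)\<^sup>2 / 2 + ((2 / \<alpha>) * (2 / \<alpha> + 1) * (inv_pos \<alpha> f x)\<^sup>2 / 2
       + \<bar>inv_pos \<alpha> f x\<bar> powr (\<alpha> + 2) / (\<alpha> + 2))"
  shows "F b \<le> F a"
proof (rule DERIV_nonpos_imp_nonincreasing[OF assms(5)])
  fix x assume x: "a \<le> x" "x \<le> b"
  define k where "k = 2 / \<alpha>"
  define w v where "w = inv_pos \<alpha> f" and "v = inv_vel \<alpha> f g"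
  have x0: "x > 0" using x assms by simp
  have x2: "2 + 4 * k \<le> x\<^sup>2"
  proof -
    have "a\<^sup>2 \<le> x\<^sup>2" using assms(3) x by (intro power_mono) auto
    then show ?thesis using assms(4) by (simp add: k_def)
  qed
  have w: "(w has_real_derivative v x) (at x)"
    unfolding w_def v_def by (rule DERIV_inv_pos[OF assms(2) x0])
  have v: "(v has_real_derivative - (x / 2 - 2 * k / x) * v x - inv_force \<alpha> (w x) / x\<^sup>2) (at x)"
    unfolding w_def v_def k_def by (rule DERIV_inv_vel[OF assms(2) x0 assms(1)])
  obtain D where D: "D = - (x / 2 - 2 * k / x) * v x - inv_force \<alpha> (w x) / x\<^sup>2" by blast
  have vD: "(v has_real_derivative D) (at x)" using v by (simp only: D)
  have "((\<lambda>y. \<bar>y\<bar> powr (\<alpha> + 2) / (\<alpha> + 2)) has_real_derivative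
      (\<alpha> + 2) * \<bar>w x\<bar> powr (\<alpha> + 2 - 2) * w x / (\<alpha> + 2)) (at (w x))"
    using assms(1) by (intro DERIV_cdivide DERIV_abs_powr) simp
  then have p: "((\<lambda>y. \<bar>y\<bar> powr (\<alpha> + 2) / (\<alpha> + 2)) has_real_derivative nonlin \<alpha> (w x)) (at (w x))"
    using assms(1) by (simp add: nonlin_def)
  have q: "((\<lambda>y. k * (k + 1) * y\<^sup>2 / 2) has_real_derivative k * (k + 1) * w x) (at (w x))"
    by (auto intro!: derivative_eq_intros)
  have "((\<lambda>x. k * (k + 1) * (w x)\<^sup>2 / 2 + \<bar>w x\<bar> powr (\<alpha> + 2) / (\<alpha> + 2)) has_real_derivative
     inv_force \<alpha> (w x) * v x) (at x)"
    using DERIV_chain2[OF DERIV_add[OF q p] w] by (simp add: inv_force_def k_def)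
  moreover have "((\<lambda>x. x\<^sup>2 * (v x)\<^sup>2 / 2) has_real_derivative
     x * (v x)\<^sup>2 + x\<^sup>2 * (v x * D)) (at x)"
  proof -
    have "((\<lambda>x. x\<^sup>2 * (v x)\<^sup>2 / 2) has_real_derivative
      (2 * x * (v x)\<^sup>2 + 2 * v x * D * x\<^sup>2) / 2) (at x)"
      by (intro DERIV_cdivide DERIV_mult) (auto intro!: derivative_eq_intros vD)
    moreover have "(2 * x * (v x)\<^sup>2 + 2 * v x * D * x\<^sup>2) / 2 = x * (v x)\<^sup>2 + x\<^sup>2 * (v x * D)"
      by (simp add: field_simps)
    ultimately show ?thesis by (simp only:)
  qed
  ultimately have "(F has_real_derivative
     x * (v x)\<^sup>2 + x\<^sup>2 * (v x * D) + inv_force \<alpha> (w x) * v x) (at x)"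
    unfolding F_def w_def[symmetric] v_def[symmetric] k_def[symmetric] by (intro DERIV_add)
  moreover have "x * (v x)\<^sup>2 + x\<^sup>2 * (v x * D) + inv_force \<alpha> (w x) * v x = x * (v x)\<^sup>2 * (1 + 2 * k - x\<^sup>2 / 2)"
  proof -
    have "x\<^sup>2 * D = - (x ^ 3 / 2 - 2 * k * x) * v x - inv_force \<alpha> (w x)"
      using x0 by (simp add: D field_simps power2_eq_square power3_eq_cube)
    then have "x\<^sup>2 * (v x * D) = v x * (- (x ^ 3 / 2 - 2 * k * x) * v x - inv_force \<alpha> (w x))"
      by (simp only: mult.left_commute)
    then show ?thesis by (simp add: algebra_simps power2_eq_square power3_eq_cube)
  qed
  moreover have "x * (v x)\<^sup>2 * (1 + 2 * k - x\<^sup>2 / 2) \<le> 0"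
    using x0 x2 by (intro mult_nonneg_nonpos mult_nonneg_nonneg) auto
  ultimately show "\<exists>d. (F has_real_derivative d) (at x) \<and> d \<le> 0" by metis
qed


section \<open>Shots from a large radius and their limits\<close>

lemma first_hitting:
  fixes g :: "real \<Rightarrow> real"
  assumes "a \<le> b" "continuous_on {a..b} g" "g a \<le> c" "c < g b"
  obtains z where "a \<le> z" "z \<le> b" "g z = c" "\<And>y. a \<le> y \<Longrightarrow> y \<le> z \<Longrightarrow> g y \<le> c"
proof -
  define S where "S = {a..b} \<inter> g -` {c..}"
  have "compact S"
    unfolding S_def compact_eq_bounded_closed
    using continuous_closed_preimage[OF assms(2)] bounded_Int bounded_closed_interval by blast
  moreover have "b \<in> S" using assms by (auto simp: S_def)
  ultimately obtain z where z: "z \<in> S" "\<And>y. y \<in> S \<Longrightarrow> z \<le> y"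
    using compact_attains_inf[of S] by blast
  have gz: "g z \<le> c"
  proof (rule ccontr)
    assume "\<not> g z \<le> c"
    then obtain y where "a \<le> y" "y \<le> z" "g y = c"
      using IVT'[of g a c z] assms z(1) continuous_on_subset[OF assms(2), of "{a..z}"] by (auto simp: S_def)
    then show False using z \<open>\<not> g z \<le> c\<close> by (force simp: S_def)
  qed
  have "g y \<le> c" if "a \<le> y" "y \<le> z" for y
    using z gz that by (cases "y = z") (force simp: S_def)+
  with gz z show ?thesis by (intro that[of z]) (auto simp: S_def)
qed

text \<open>The limit inherits the rate \<open>K / a\<close>. This rate, uniform for parameters in a
  bounded range, is what makes the limit of a shot continuous in \<open>X\<close>.\<close>

lemma tail_limit:
  fixes w :: "real \<Rightarrow> real"
  assumes X: "X > 0" and K: "\<And>a b. X \<le> a \<Longrightarrow> a \<le> b \<Longrightarrow> \<bar>w b - w a\<bar> \<le> K / a"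
  obtains L where "\<And>a. X \<le> a \<Longrightarrow> \<bar>w a - L\<bar> \<le> K / a"
proof -
  have K0: "K \<ge> 0" using K[of X X] X by (simp add: zero_le_divide_iff)
  have small: "\<exists>N. \<forall>n\<ge>N. K / (X + real n) < e" if "e > 0" for e
  proof -
    have "(\<lambda>n. K / (X + real n)) \<longlonglongrightarrow> 0" by real_asymp
    then show ?thesis using that order_tendstoD(2) by (metis eventually_sequentially)
  qed
  have "Cauchy (\<lambda>n. w (X + real n))"
  proof (rule metric_CauchyI)
    fix e :: real assume "e > 0"
    then obtain N where N: "\<And>n. n \<ge> N \<Longrightarrow> K / (X + real n) < e / 2" using small[of "e / 2"] by auto
    have *: "\<bar>w (X + real n) - w (X + real N)\<bar> < e / 2" if "n \<ge> N" for n
    proof -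
      have "\<bar>w (X + real n) - w (X + real N)\<bar> \<le> K / (X + real N)"
        by (rule K) (use that in auto)
      with N[of N] show ?thesis by linarith
    qed
    have "dist (w (X + real m)) (w (X + real n)) < e" if "m \<ge> N" "n \<ge> N" for m n
      using *[OF that(1)] *[OF that(2)] unfolding dist_real_def by linarith
    then show "\<exists>M. \<forall>m\<ge>M. \<forall>n\<ge>M. dist (w (X + real m)) (w (X + real n)) < e" by blast
  qed
  then obtain L where L: "(\<lambda>n. w (X + real n)) \<longlonglongrightarrow> L"
    using Cauchy_convergent convergent_def by blast
  have "\<bar>w a - L\<bar> \<le> K / a" if a: "X \<le> a" for a
  proof (rule LIMSEQ_le_const2)
    show "(\<lambda>n. \<bar>w a - w (X + real n)\<bar>) \<longlonglongrightarrow> \<bar>w a - L\<bar>" by (intro tendsto_intros L)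
    obtain N where "a < real N" using reals_Archimedean2 by blast
    then have "\<forall>n\<ge>N. \<bar>w a - w (X + real n)\<bar> \<le> K / a"
    proof (intro allI impI)
      fix n assume "N \<le> n"
      then have "a \<le> X + real n" using \<open>a < real N\<close> X by simp
      from K[OF a this] show "\<bar>w a - w (X + real n)\<bar> \<le> K / a" by (simp add: abs_minus_commute)
    qed
    then show "\<exists>N. \<forall>n\<ge>N. \<bar>w a - w (X + real n)\<bar> \<le> K / a" by blast
  qed
  then show ?thesis by (rule that)
qed

definition force_Lip :: "real \<Rightarrow> real \<Rightarrow> real" where
  "force_Lip \<alpha> \<mu> = (2 / \<alpha>) * (2 / \<alpha> + 1) + (\<alpha> + 1) * (2 * \<mu>) powr \<alpha>"

text \<open>Beyond \<open>start_pos \<alpha> \<mu>\<close> the damping term dominates, a solution with values in \<open>[- 2 * \<mu>, 2 * \<mu>]\<close>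
  and velocity at most \<open>\<mu> / 32 * X\<close> at \<open>X\<close> moves by at most \<open>3 / 16 * \<mu>\<close>, and \<open>shots_differ\<close> applies.\<close>

definition start_pos :: "real \<Rightarrow> real \<Rightarrow> real" where
  "start_pos \<alpha> \<mu> = sqrt (8 * (2 / \<alpha>) + 16 + 64 * force_Lip \<alpha> \<mu>)"

locale shooting =
  fixes \<alpha> \<mu> :: real
  assumes alpha: "\<alpha> > 0" and mu: "\<mu> > 0"
begin

abbreviation "\<kappa> \<equiv> 2 / \<alpha>"
abbreviation "\<Lambda> \<equiv> force_Lip \<alpha> \<mu>"

lemma Lam: "\<Lambda> > 0"
  using alpha mu by (simp add: force_Lip_def add_pos_nonneg)

text \<open>\<open>64 * \<Lambda>\<close> keeps the drift due to the force below
  \<open>\<mu> / 16\<close> in \<open>step_X\<close> and the perturbation in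
  \<open>shots_compare\<close> small; \<open>256 * \<Lambda>\<close> is the threshold in
  \<open>shots_differ\<close>; the last bound is that of \<open>inv_lyapunov\<close>.\<close>

lemma start:
  assumes "X \<ge> start_pos \<alpha> \<mu>"
  shows "X \<ge> 4" "X\<^sup>2 \<ge> 8 * \<kappa> + 12" "X\<^sup>2 \<ge> 8 * \<kappa>" "X\<^sup>2 \<ge> 64 * \<Lambda>" "X ^ 4 > 256 * \<Lambda>" "X\<^sup>2 \<ge> 2 + 8 / \<alpha>"
proof -
  have k: "\<kappa> > 0" using alpha by simp
  have "8 * \<kappa> + 16 + 64 * \<Lambda> \<ge> 0" using k Lam by simp
  then have s2: "(start_pos \<alpha> \<mu>)\<^sup>2 = 8 * \<kappa> + 16 + 64 * \<Lambda>" and "start_pos \<alpha> \<mu> \<ge> 0"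
    unfolding start_pos_def by auto
  then have X2: "X\<^sup>2 \<ge> 8 * \<kappa> + 16 + 64 * \<Lambda>" and X0: "X \<ge> 0"
    using power_mono[OF assms, of 2] assms by auto
  have "4\<^sup>2 \<le> X\<^sup>2" using X2 k Lam unfolding power2_eq_square by linarith
  then show "X \<ge> 4" using X0 by (rule power2_le_imp_le)
  show 1: "X\<^sup>2 \<ge> 8 * \<kappa> + 12" "X\<^sup>2 \<ge> 8 * \<kappa>" "X\<^sup>2 \<ge> 64 * \<Lambda>" using X2 k Lam by linarith+
  have "8 / \<alpha> = 4 * \<kappa>" by simp
  then show "X\<^sup>2 \<ge> 2 + 8 / \<alpha>" using X2 k Lam by linarith
  have "X\<^sup>2 \<ge> 16 + 64 * \<Lambda>" using X2 k by linarith
  then have "X\<^sup>2 * X\<^sup>2 \<ge> (16 + 64 * \<Lambda>) * 16" using Lam by (intro mult_mono) auto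
  then show "X ^ 4 > 256 * \<Lambda>" using Lam by (simp flip: power_add)
qed

lemma inv_force_Lip:
  assumes "\<bar>a\<bar> \<le> 2 * \<mu>" "\<bar>b\<bar> \<le> 2 * \<mu>"
  shows "\<bar>inv_force \<alpha> a - inv_force \<alpha> b\<bar> \<le> \<Lambda> * \<bar>a - b\<bar>"
proof -
  have "inv_force \<alpha> a - inv_force \<alpha> b = \<kappa> * (\<kappa> + 1) * (a - b) + (nonlin \<alpha> a - nonlin \<alpha> b)"
    unfolding inv_force_def right_diff_distrib[of "\<kappa> * (\<kappa> + 1)"] by simp
  also have "\<bar>\<dots>\<bar> \<le> \<bar>\<kappa> * (\<kappa> + 1) * (a - b)\<bar> + (\<alpha> + 1) * (2 * \<mu>) powr \<alpha> * \<bar>a - b\<bar>"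
    using nonlin_Lipschitz[OF alpha assms] abs_triangle_ineq by (meson add_left_mono order_trans)
  also have "\<bar>\<kappa> * (\<kappa> + 1) * (a - b)\<bar> = \<kappa> * (\<kappa> + 1) * \<bar>a - b\<bar>" using alpha by (simp add: abs_mult)
  finally show ?thesis by (simp add: force_Lip_def algebra_simps)
qed

lemma inv_force_bound: "\<bar>a\<bar> \<le> 2 * \<mu> \<Longrightarrow> \<bar>inv_force \<alpha> a\<bar> \<le> \<Lambda> * (2 * \<mu>)"
proof -
  assume a: "\<bar>a\<bar> \<le> 2 * \<mu>"
  have "\<bar>inv_force \<alpha> a - inv_force \<alpha> 0\<bar> \<le> \<Lambda> * \<bar>a - 0\<bar>"
    by (rule inv_force_Lip) (use a mu in auto)
  also have "\<dots> \<le> \<Lambda> * (2 * \<mu>)" using a Lam by (intro mult_left_mono) auto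
  finally show ?thesis by (simp add: inv_force_def nonlin_def)
qed

end

text \<open>The margins fit together: a start within \<open>\<mu> / 4\<close> and a drift of at most
  \<open>3 / 16 * \<mu>\<close> keep \<open>w\<close> within \<open>7 / 16 * \<mu>\<close> of \<mu>,
  less than \<open>\<mu> / 2\<close>. The velocity may grow with \<open>X\<close> because friction
  of order \<open>X\<close> stops it after a distance independent of \<open>X\<close>.\<close>

locale shot = shooting +
  fixes f g X
  assumes sol: "profile_eq \<alpha> f g" and X: "X \<ge> start_pos \<alpha> \<mu>"
    and pos: "\<bar>inv_pos \<alpha> f X - \<mu>\<bar> \<le> \<mu> / 4" and vel: "\<bar>inv_vel \<alpha> f g X\<bar> \<le> \<mu> / 32 * X"
begin

abbreviation "w \<equiv> inv_pos \<alpha> f"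
abbreviation "v \<equiv> inv_vel \<alpha> f g"

lemma X_ge: "X \<ge> 4" "X > 0" using start[OF X] by auto

lemma kappa_nonneg: "\<kappa> \<ge> 0" using alpha by simp

lemma w': "X \<le> x \<Longrightarrow> (w has_real_derivative v x) (at x)"
  using DERIV_inv_pos[OF sol] X_ge by simp

lemma v': "X \<le> x \<Longrightarrow> (v has_real_derivative - (x / 2 - 2 * \<kappa> / x) * v x - inv_force \<alpha> (w x) / x\<^sup>2) (at x)"
  using DERIV_inv_vel[OF sol _ alpha] X_ge by simp

lemma step:
  assumes "X \<le> a" "a \<le> b" "\<And>x. X \<le> x \<Longrightarrow> x \<le> b \<Longrightarrow> \<bar>w x\<bar> \<le> 2 * \<mu>"
  shows "\<bar>w b - w a\<bar> \<le> (\<mu> / 8 * X) / a + 4 * \<Lambda> * \<mu> / a\<^sup>2"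
proof -
  have a0: "a > 0" using assms X_ge by simp
  have "\<bar>w b - w a\<bar> \<le> 4 / a * (rho \<kappa> X / rho \<kappa> a) * \<bar>v X\<bar> + 2 * (\<Lambda> * (2 * \<mu>)) / a\<^sup>2"
    by (rule damped_bounds(2)[OF X_ge(2) start(2)[OF X] kappa_nonneg _ w' v'])
      (use assms inv_force_bound in auto)
  moreover have "4 / a * (rho \<kappa> X / rho \<kappa> a) * \<bar>v X\<bar> \<le> 4 / a * 1 * (\<mu> / 32 * X)"
    using vel a0 rho_pos[OF a0, of \<kappa>] rho_mono[OF X_ge(2) start(3)[OF X] kappa_nonneg assms(1)] rho_pos[OF X_ge(2), of \<kappa>]
    by (intro mult_mono) auto
  ultimately show ?thesis by (simp add: algebra_simps)
qed

lemma step_X: "X \<le> b \<Longrightarrow> (\<And>x. X \<le> x \<Longrightarrow> x \<le> b \<Longrightarrow> \<bar>w x\<bar> \<le> 2 * \<mu>) \<Longrightarrow> \<bar>w b - w X\<bar> \<le> 3 / 16 * \<mu>"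
proof -
  assume *: "X \<le> b" "\<And>x. X \<le> x \<Longrightarrow> x \<le> b \<Longrightarrow> \<bar>w x\<bar> \<le> 2 * \<mu>"
  have "64 * \<Lambda> * \<mu> \<le> X\<^sup>2 * \<mu>" using start(4)[OF X] mu by (intro mult_right_mono) auto
  then have "4 * \<Lambda> * \<mu> / X\<^sup>2 \<le> \<mu> / 16" using X_ge by (simp add: field_simps)
  then show "\<bar>w b - w X\<bar> \<le> 3 / 16 * \<mu>"
    using step[OF order_refl *] X_ge by simp
qed

text \<open>Continuity argument: up to the first point at distance \<open>\<mu> / 2\<close> from
  \<mu> the bound \<open>2 * \<mu>\<close> holds, so \<open>step_X\<close> limits the drift to
  \<open>3 / 16 * \<mu>\<close>, too little to arrive there from a start within
  \<open>\<mu> / 4\<close>.\<close>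

lemma near: "X \<le> x \<Longrightarrow> \<bar>w x - \<mu>\<bar> \<le> \<mu> / 2"
proof (rule ccontr)
  assume x: "X \<le> x" and far: "\<not> \<bar>w x - \<mu>\<bar> \<le> \<mu> / 2"
  have "continuous_on {X..x} (\<lambda>x. \<bar>w x - \<mu>\<bar>)"
    by (intro continuous_intros continuous_at_imp_continuous_on ballI DERIV_isCont[OF w']) auto
  moreover have "\<bar>w X - \<mu>\<bar> \<le> \<mu> / 2" "\<mu> / 2 < \<bar>w x - \<mu>\<bar>" using far pos mu by linarith+
  ultimately obtain z where z: "X \<le> z" "z \<le> x" "\<bar>w z - \<mu>\<bar> = \<mu> / 2" "\<And>y. X \<le> y \<Longrightarrow> y \<le> z \<Longrightarrow> \<bar>w y - \<mu>\<bar> \<le> \<mu> / 2"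
    using first_hitting[OF x, of "\<lambda>x. \<bar>w x - \<mu>\<bar>" "\<mu> / 2"] by blast
  have "\<bar>w z - w X\<bar> \<le> 3 / 16 * \<mu>"
  proof (rule step_X[OF z(1)])
    fix y assume "X \<le> y" "y \<le> z"
    from z(4)[OF this] show "\<bar>w y\<bar> \<le> 2 * \<mu>" using mu by linarith
  qed
  then show False using z(3) pos mu by linarith
qed

lemma w_bound: "X \<le> x \<Longrightarrow> \<bar>w x\<bar> \<le> 2 * \<mu>" "X \<le> x \<Longrightarrow> w x > 0"
proof -
  assume "X \<le> x"
  from near[OF this] have "w x - \<mu> \<le> \<mu> / 2" "\<mu> - w x \<le> \<mu> / 2" by linarith+
  then show "\<bar>w x\<bar> \<le> 2 * \<mu>" "w x > 0" using mu by linarith+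
qed

lemma tail: "X \<le> a \<Longrightarrow> a \<le> b \<Longrightarrow> \<bar>w b - w a\<bar> \<le> (\<mu> / 8 * X + 4 * \<Lambda> * \<mu>) / a"
proof -
  assume *: "X \<le> a" "a \<le> b"
  have a: "a \<ge> 1" using * X_ge by simp
  have "4 * \<Lambda> * \<mu> / a\<^sup>2 \<le> 4 * \<Lambda> * \<mu> / a"
    using a Lam mu by (intro divide_left_mono) (auto simp: power2_eq_square)
  moreover have "\<bar>w b - w a\<bar> \<le> (\<mu> / 8 * X) / a + 4 * \<Lambda> * \<mu> / a\<^sup>2"
    by (rule step[OF *]) (rule w_bound)
  ultimately show ?thesis unfolding add_divide_distrib by linarith
qed

text \<open>Chosen by its error bound, which some number satisfies by \<open>tail_limit\<close>;
  \<open>tendsto_L\<close> then identifies it as the limit of \<open>w\<close>.\<close>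

definition L where "L = (SOME L. \<forall>a\<ge>X. \<bar>w a - L\<bar> \<le> (\<mu> / 8 * X + 4 * \<Lambda> * \<mu>) / a)"

lemma L_bound: "X \<le> a \<Longrightarrow> \<bar>w a - L\<bar> \<le> (\<mu> / 8 * X + 4 * \<Lambda> * \<mu>) / a"
proof -
  obtain L0 where "\<And>a. X \<le> a \<Longrightarrow> \<bar>w a - L0\<bar> \<le> (\<mu> / 8 * X + 4 * \<Lambda> * \<mu>) / a"
    using tail_limit[OF X_ge(2), of w, OF tail] by blast
  then have "\<exists>L. \<forall>a\<ge>X. \<bar>w a - L\<bar> \<le> (\<mu> / 8 * X + 4 * \<Lambda> * \<mu>) / a" by blast
  then show "X \<le> a \<Longrightarrow> ?thesis" unfolding L_def by (rule someI2_ex) blast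
qed

lemma tendsto_L: "(w \<longlongrightarrow> L) at_top"
proof -
  have "((\<lambda>a. w a - L) \<longlongrightarrow> 0) at_top"
  proof (rule Lim_null_comparison)
    show "\<forall>\<^sub>F a in at_top. norm (w a - L) \<le> (\<mu> / 8 * X + 4 * \<Lambda> * \<mu>) / a"
      by (rule eventually_mono[OF eventually_ge_at_top[of X]]) (unfold real_norm_def, rule L_bound)
    show "((\<lambda>a. (\<mu> / 8 * X + 4 * \<Lambda> * \<mu>) / a) \<longlongrightarrow> 0) at_top" by real_asymp
  qed
  then show ?thesis by (simp add: LIM_zero_iff)
qed

lemma L_near: "\<bar>L - w X\<bar> \<le> 3 / 16 * \<mu>"
proof (rule tendsto_upperbound)
  show "((\<lambda>a. \<bar>w a - w X\<bar>) \<longlongrightarrow> \<bar>L - w X\<bar>) at_top" by (intro tendsto_intros tendsto_L)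
  show "\<forall>\<^sub>F a in at_top. \<bar>w a - w X\<bar> \<le> 3 / 16 * \<mu>"
    by (rule eventually_mono[OF eventually_ge_at_top[of X]]) (rule step_X, assumption, rule w_bound)
qed simp

text \<open>As \<open>w > 0\<close> the force is nonnegative, so \<open>rho \<kappa> * v\<close> is
  nonincreasing; by \<open>damped_bounds\<close> the loss in \<open>v\<close> is at most of order
  \<open>1 / x ^ 3\<close>. This pair of bounds tells the two signs of the initial velocity apart in
  \<open>shots_differ\<close>.\<close>

lemma v_lower:
  assumes "X \<le> x"
  shows "rho \<kappa> x * v x \<ge> rho \<kappa> X * v X - 8 * \<Lambda> * \<mu> * rho \<kappa> x / x ^ 3"
    and "rho \<kappa> x * v x \<le> rho \<kappa> X * v X"
proof -
  have "\<bar>rho \<kappa> x * v x - rho \<kappa> X * v X\<bar> \<le> 4 * (\<Lambda> * (2 * \<mu>)) * rho \<kappa> x / x ^ 3"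
    by (rule damped_bounds(1)[OF X_ge(2) start(2)[OF X] kappa_nonneg _ w' v', where b = x])
      (use assms inv_force_bound w_bound in auto)
  then show "rho \<kappa> x * v x \<ge> rho \<kappa> X * v X - 8 * \<Lambda> * \<mu> * rho \<kappa> x / x ^ 3" by simp
  show "rho \<kappa> x * v x \<le> rho \<kappa> X * v X"
  proof (rule DERIV_nonpos_imp_nonincreasing[OF assms])
    fix y assume y: "X \<le> y" "y \<le> x"
    have y0: "y > 0" using y X_ge by simp
    have "((\<lambda>x. rho \<kappa> x * v x) has_real_derivative
      (y / 2 - 2 * \<kappa> / y) * rho \<kappa> y * v y + (- (y / 2 - 2 * \<kappa> / y) * v y - inv_force \<alpha> (w y) / y\<^sup>2) * rho \<kappa> y) (at y)"
      using DERIV_mult[OF DERIV_rho[OF y0] v'] y by blast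
    moreover have "(y / 2 - 2 * \<kappa> / y) * rho \<kappa> y * v y + (- (y / 2 - 2 * \<kappa> / y) * v y - inv_force \<alpha> (w y) / y\<^sup>2) * rho \<kappa> y
      = - (inv_force \<alpha> (w y) * rho \<kappa> y / y\<^sup>2)" by (simp add: algebra_simps)
    moreover have "inv_force \<alpha> (w y) \<ge> 0"
      using w_bound(2)[OF y(1)] alpha by (simp add: inv_force_def nonlin_def)
    ultimately show "\<exists>d. ((\<lambda>x. rho \<kappa> x * v x) has_real_derivative d) (at y) \<and> d \<le> 0"
      using rho_pos[OF y0, of \<kappa>] by (metis divide_nonneg_nonneg mult_nonneg_nonneg neg_le_0_iff_le zero_le_power2 less_imp_le)
  qed
qed

end

text \<open>Suppose one profile were both shots. If \<open>X \<le> Y\<close>, its velocity is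
  negative at \<open>X\<close> and remains so, against its sign at \<open>Y\<close>. If
  \<open>Y \<le> X\<close>, it is positive at \<open>Y\<close> and by \<open>v_lower\<close> exceeds
  \<open>- 8 * \<Lambda> * \<mu> / X ^ 3\<close> at \<open>X\<close>, where \<Lambda> is
  \<open>force_Lip \<alpha> \<mu>\<close>; but \<open>- \<mu> / 32 * X\<close> is below that, as
  \<open>X ^ 4 > 256 * \<Lambda>\<close>.\<close>

lemma shots_differ:
  assumes s1: "shot \<alpha> \<mu> f g X" and s2: "shot \<alpha> \<mu> f2 g2 Y"
    and v1: "inv_vel \<alpha> f g X = - (\<mu> / 32) * X" and v2: "inv_vel \<alpha> f2 g2 Y = \<mu> / 32 * Y"
  shows "f \<noteq> f2"
proof
  assume eq: "f = f2"
  interpret a: shot \<alpha> \<mu> f g X by (rule s1)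
  interpret b: shot \<alpha> \<mu> f2 g2 Y by (rule s2)
  have "g x = g2 x" for x
    using a.sol b.sol eq DERIV_unique unfolding profile_eq_def by blast
  then have g: "g = g2" by blast
  have X: "X > 0" "Y > 0" using a.X_ge b.X_ge by auto
  show False
  proof (cases "X \<le> Y")
    case True
    have "rho (2 / \<alpha>) Y * (\<mu> / 32 * Y) \<le> rho (2 / \<alpha>) X * (- (\<mu> / 32) * X)"
      using a.v_lower(2)[OF True] v1 v2 eq g by simp
    moreover have "rho (2 / \<alpha>) Y * (\<mu> / 32 * Y) > 0" "rho (2 / \<alpha>) X * ((\<mu> / 32) * X) > 0"
      using X a.mu rho_pos by auto
    ultimately show False by simp
  next
    case False
    then have le: "Y \<le> X" by simp
    define R where "R = rho (2 / \<alpha>) X"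
    have R: "R > 0" using X by (simp add: R_def rho_pos)
    have "R * (- (\<mu> / 32) * X) \<ge> rho (2 / \<alpha>) Y * (\<mu> / 32 * Y) - 8 * force_Lip \<alpha> \<mu> * \<mu> * R / X ^ 3"
      using b.v_lower(1)[OF le] v1 v2 eq g by (simp add: R_def)
    moreover have "rho (2 / \<alpha>) Y * (\<mu> / 32 * Y) > 0" using X a.mu rho_pos by auto
    ultimately have "R * (\<mu> / 32 * X) < 8 * force_Lip \<alpha> \<mu> * \<mu> * R / X ^ 3" by simp
    then have "R * (\<mu> / 32 * X) * X ^ 3 < 8 * force_Lip \<alpha> \<mu> * \<mu> * R"
      using X by (simp add: pos_less_divide_eq)
    then have "(R * \<mu>) * X ^ 4 < (R * \<mu>) * (256 * force_Lip \<alpha> \<mu>)"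
      by (simp add: power_eq_if algebra_simps)
    then have "X ^ 4 < 256 * force_Lip \<alpha> \<mu>" using R a.mu by (simp add: mult_less_cancel_left_pos)
    then show False using a.start(5)[OF a.X] by simp
  qed
qed

text \<open>As a function of the starting position the limit differs from the identity by a map with
  Lipschitz constant 1/2. It is therefore Lipschitz with Lipschitz inverse, which replaces
  differentiability in the implicit function argument of \<open>shooting_family\<close>.\<close>

lemma shots_compare:
  assumes s1: "shot \<alpha> \<mu> f g X" and s2: "shot \<alpha> \<mu> f2 g2 X"
    and v: "inv_vel \<alpha> f g X = inv_vel \<alpha> f2 g2 X"
  shows "\<bar>(shot.L \<alpha> \<mu> f X - shot.L \<alpha> \<mu> f2 X) - (inv_pos \<alpha> f X - inv_pos \<alpha> f2 X)\<bar>
     \<le> \<bar>inv_pos \<alpha> f X - inv_pos \<alpha> f2 X\<bar> / 2"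
proof -
  interpret a: shot \<alpha> \<mu> f g X by (rule s1)
  interpret b: shot \<alpha> \<mu> f2 g2 X by (rule s2)
  define d where "d x = a.w x - b.w x" for x
  define S where "S = (SUP x\<in>{X..}. \<bar>d x\<bar>)"
  have bdd: "bdd_above ((\<lambda>x. \<bar>d x\<bar>) ` {X..})"
    by (intro bdd_aboveI2[of _ _ "4 * \<mu>"]) (use a.w_bound(1) b.w_bound(1) in \<open>fastforce simp: d_def\<close>)
  have S: "\<bar>d x\<bar> \<le> S" if "X \<le> x" for x
    unfolding S_def using that by (intro cSUP_upper bdd) auto
  have S0: "S \<ge> 0" using S[of X] by simp
  \<comment> \<open>The velocities at \<open>X\<close> agree, so the difference \<open>d\<close> is
    driven only by the difference of the forces, at most \<open>\<Lambda> * S\<close>. Its drift is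
    a small fraction of its own supremum \<open>S\<close> and can be absorbed.\<close>
  have small: "2 * (a.\<Lambda> * S) / X\<^sup>2 \<le> S / 32"
  proof -
    have "64 * a.\<Lambda> * S \<le> X\<^sup>2 * S" using a.start(4)[OF a.X] S0 by (intro mult_right_mono) auto
    then show ?thesis using a.X_ge by (simp add: field_simps)
  qed
  have step: "\<bar>d x - d X\<bar> \<le> S / 32" if x: "X \<le> x" for x
  proof -
    have "\<bar>d x - d X\<bar> \<le> 4 / X * (rho a.\<kappa> X / rho a.\<kappa> X) * \<bar>a.v X - b.v X\<bar> + 2 * (a.\<Lambda> * S) / X\<^sup>2"
    proof (rule damped_bounds(2)[OF a.X_ge(2) a.start(2)[OF a.X] a.kappa_nonneg x, where v = "\<lambda>x. a.v x - b.v x"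
          and r = "\<lambda>x. inv_force \<alpha> (a.w x) - inv_force \<alpha> (b.w x)"])
      fix y assume y: "X \<le> y"
      show "(d has_real_derivative a.v y - b.v y) (at y)"
        unfolding d_def[abs_def] by (intro DERIV_diff a.w' b.w' y)
      have "((\<lambda>x. a.v x - b.v x) has_real_derivative
        (- (y / 2 - 2 * a.\<kappa> / y) * a.v y - inv_force \<alpha> (a.w y) / y\<^sup>2) -
        (- (y / 2 - 2 * a.\<kappa> / y) * b.v y - inv_force \<alpha> (b.w y) / y\<^sup>2)) (at y)"
        by (intro DERIV_diff a.v' b.v' y)
      then show "((\<lambda>x. a.v x - b.v x) has_real_derivative
        - (y / 2 - 2 * a.\<kappa> / y) * (a.v y - b.v y) - (inv_force \<alpha> (a.w y) - inv_force \<alpha> (b.w y)) / y\<^sup>2) (at y)"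
        by (simp add: algebra_simps diff_divide_distrib)
      show "\<bar>inv_force \<alpha> (a.w y) - inv_force \<alpha> (b.w y)\<bar> \<le> a.\<Lambda> * S"
        using a.inv_force_Lip[OF a.w_bound(1)[OF y] b.w_bound(1)[OF y]] S[OF y] a.Lam
        by (auto simp: d_def intro: order_trans mult_left_mono)
    qed (use x in auto)
    then show ?thesis using v small by simp
  qed
  have "S \<le> \<bar>d X\<bar> + S / 32"
    unfolding S_def by (rule cSUP_least) (use step in \<open>auto simp: S_def[symmetric] abs_le_iff\<close>, (smt (verit) step)+)
  then have "S / 32 \<le> \<bar>d X\<bar> / 2" using S0 by linarith
  then have le: "\<bar>d x - d X\<bar> \<le> \<bar>d X\<bar> / 2" if "X \<le> x" for x using step[OF that] by simp
  have "\<bar>(a.L - b.L) - d X\<bar> \<le> \<bar>d X\<bar> / 2"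
  proof (rule tendsto_upperbound)
    show "((\<lambda>x. \<bar>d x - d X\<bar>) \<longlongrightarrow> \<bar>(a.L - b.L) - d X\<bar>) at_top"
      unfolding d_def by (intro tendsto_intros a.tendsto_L b.tendsto_L)
    show "\<forall>\<^sub>F x in at_top. \<bar>d x - d X\<bar> \<le> \<bar>d X\<bar> / 2"
      by (rule eventually_mono[OF eventually_ge_at_top[of X]]) (rule le)
  qed simp
  then show ?thesis by (simp add: d_def)
qed


section \<open>Families of shots with a prescribed limit\<close>

lemma continuous_on_atLeast:
  fixes f :: "real \<Rightarrow> 'a::topological_space"
  assumes "\<And>B. continuous_on {a..B} f"
  shows "continuous_on {a..} f"
  unfolding continuous_on_eq_continuous_within
proof
  fix x assume x: "x \<in> {a..}"
  have "at x within {a..} = at x within {a..x + 1}"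
    by (rule at_within_nhd[of x "{..<x + 1}"]) auto
  moreover have "continuous (at x within {a..x + 1}) f"
    using assms[of "x + 1"] x by (auto simp: continuous_on_eq_continuous_within)
  ultimately show "continuous (at x within {a..}) f" by simp
qed

text \<open>For fixed \<open>X\<close> the start \<open>c\<close> comes from the intermediate value
  theorem. Its continuity in \<open>X\<close> follows from that of the limit \<open>l X c\<close>
  for fixed \<open>c\<close>: by \<open>comp\<close> two starts at the same \<open>X\<close> are no
  further apart than twice the distance of their limits.\<close>

lemma (in shooting) shooting_family:
  assumes e: "\<bar>e\<bar> \<le> \<mu> / 32"
  shows "\<exists>F G. (\<forall>X\<ge>start_pos \<alpha> \<mu>. shot \<alpha> \<mu> (F X) (G X) X \<and> inv_vel \<alpha> (F X) (G X) X = e * X \<and>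
      (inv_pos \<alpha> (F X) \<longlongrightarrow> \<mu>) at_top) \<and>
    continuous_on ({start_pos \<alpha> \<mu>..} \<times> UNIV) (\<lambda>(X, x). F X x) \<and>
    continuous_on ({start_pos \<alpha> \<mu>..} \<times> UNIV) (\<lambda>(X, x). G X x)"
proof -
  define X0 where "X0 = start_pos \<alpha> \<mu>"
  have X0: "X > 0" if "X \<ge> X0" for X using start(1)[of X] that by (simp add: X0_def)
  obtain \<Phi> where \<Phi>: "\<And>x0 p. \<Phi> x0 p (max 0 x0) = p"
    "\<And>x0 p. profile_eq \<alpha> (fst \<circ> \<Phi> x0 p) (snd \<circ> \<Phi> x0 p)"
    and \<Phi>cont: "continuous_on UNIV (\<lambda>(x0, p, x). \<Phi> x0 p x)"
    using profile_flow[OF alpha] by metis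
  \<comment> \<open>The values of \<open>f\<close> and \<open>f'\<close> at \<open>X\<close> for
    which \<open>w X = c\<close> and \<open>w' X = e * X\<close>.\<close>
  define P where "P X c = (c * X powr - \<kappa>, X powr - \<kappa> * (e * X - \<kappa> * c / X))" for X c :: real
  define f where "f X c = fst \<circ> \<Phi> X (P X c)" for X c
  define g where "g X c = snd \<circ> \<Phi> X (P X c)" for X c
  have sol: "profile_eq \<alpha> (f X c) (g X c)" for X c unfolding f_def g_def by (rule \<Phi>)
  have wX: "inv_pos \<alpha> (f X c) X = c" and vX: "inv_vel \<alpha> (f X c) (g X c) X = e * X" if "X \<ge> X0" for X c
  proof -
    have X: "X > 0" using X0 that by blast
    then have "\<Phi> X (P X c) X = P X c" using \<Phi>(1)[of X "P X c"] by simp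
    moreover have "X powr \<kappa> * X powr - \<kappa> = 1" using X by (simp flip: powr_add)
    ultimately show "inv_pos \<alpha> (f X c) X = c" "inv_vel \<alpha> (f X c) (g X c) X = e * X"
      by (simp_all add: inv_pos_def inv_vel_def f_def g_def P_def mult.left_commute[of _ "X powr - \<kappa>"]
          flip: mult.assoc) (simp_all add: algebra_simps diff_divide_distrib)
  qed
  have shot: "shot \<alpha> \<mu> (f X c) (g X c) X" if "X \<ge> X0" "\<bar>c - \<mu>\<bar> \<le> \<mu> / 4" for X c
  proof unfold_locales
    have "\<bar>e * X\<bar> \<le> \<mu> / 32 * X"
      using e X0[OF that(1)] by (simp add: abs_mult)
    then show "\<bar>inv_vel \<alpha> (f X c) (g X c) X\<bar> \<le> \<mu> / 32 * X" using vX[OF that(1)] by simp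
  qed (use sol that wX[OF that(1)] in \<open>auto simp: X0_def\<close>)
  define l where "l X c = shot.L \<alpha> \<mu> (f X c) X" for X c
  have comp: "\<bar>(l X c - l X d) - (c - d)\<bar> \<le> \<bar>c - d\<bar> / 2"
    if "X \<ge> X0" "\<bar>c - \<mu>\<bar> \<le> \<mu> / 4" "\<bar>d - \<mu>\<bar> \<le> \<mu> / 4" for X c d
    using shots_compare[OF shot[OF that(1,2)] shot[OF that(1,3)]] wX[OF that(1)] vX[OF that(1)]
    by (simp add: l_def)
  have near: "\<bar>l X c - c\<bar> \<le> 3 / 16 * \<mu>" if "X \<ge> X0" "\<bar>c - \<mu>\<bar> \<le> \<mu> / 4" for X c
    using shot.L_near[OF shot[OF that]] wX[OF that(1)] by (simp add: l_def)
  have contc: "continuous_on {3 / 4 * \<mu>..5 / 4 * \<mu>} (l X)" if X: "X \<ge> X0" for X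
  proof (rule continuous_on_sequentiallyI)
    fix u c assume u: "\<forall>n. u n \<in> {3 / 4 * \<mu>..5 / 4 * \<mu>}" and c: "c \<in> {3 / 4 * \<mu>..5 / 4 * \<mu>}"
      and lim: "u \<longlonglongrightarrow> c"
    have "(\<lambda>n. 2 * \<bar>u n - c\<bar>) \<longlonglongrightarrow> 2 * \<bar>c - c\<bar>" by (intro tendsto_intros lim)
    then have z: "(\<lambda>n. 2 * \<bar>u n - c\<bar>) \<longlonglongrightarrow> 0" by simp
    have "\<bar>l X (u n) - l X c\<bar> \<le> 2 * \<bar>u n - c\<bar>" for n
    proof -
      have "\<bar>u n - \<mu>\<bar> \<le> \<mu> / 4" "\<bar>c - \<mu>\<bar> \<le> \<mu> / 4" using u[rule_format, of n] c unfolding atLeastAtMost_iff by linarith+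
      from comp[OF X this] have "\<bar>(l X (u n) - l X c) - (u n - c)\<bar> \<le> \<bar>u n - c\<bar> / 2" .
      moreover have "\<bar>A\<bar> \<le> 2 * \<bar>d\<bar>" if "\<bar>A - d\<bar> \<le> \<bar>d\<bar> / 2" for A d :: real using that by linarith
      ultimately show ?thesis by blast
    qed
    then have "(\<lambda>n. l X (u n) - l X c) \<longlonglongrightarrow> 0" by (intro Lim_null_comparison[OF _ z]) auto
    then show "(\<lambda>n. l X (u n)) \<longlonglongrightarrow> l X c" by (simp add: LIM_zero_iff)
  qed
  have powr_cont: "continuous_on {X0..B} (\<lambda>X. X powr - \<kappa>)" for B
    by (intro continuous_intros) (use X0 in force)
  have Pcont: "continuous_on S (\<lambda>z. P (a z) (b z))" if "continuous_on S a" "continuous_on S b" "\<And>z. z \<in> S \<Longrightarrow> a z \<ge> X0"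
    for S :: "'z::topological_space set" and a b
    unfolding P_def using that X0 by (intro continuous_intros) fastforce+
  have Phi_comp: "continuous_on S (\<lambda>z. \<Phi> (a z) (P (a z) (b z)) (x z))"
    if "continuous_on S a" "continuous_on S b" "continuous_on S x" "\<And>z. z \<in> S \<Longrightarrow> a z \<ge> X0"
    for S :: "'z::topological_space set" and a b x
  proof -
    have "continuous_on S ((\<lambda>(x0, p, x). \<Phi> x0 p x) \<circ> (\<lambda>z. (a z, P (a z) (b z), x z)))"
      by (intro continuous_on_compose continuous_on_Pair Pcont that continuous_on_subset[OF \<Phi>cont]) auto
    then show ?thesis by (simp add: o_def)
  qed
  have contX: "continuous_on {X0..} (\<lambda>X. l X c)" if c: "\<bar>c - \<mu>\<bar> \<le> \<mu> / 4" for c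
  proof (rule continuous_on_atLeast)
    fix B
    \<comment> \<open>The error in \<open>L_bound\<close> is linear in \<open>X\<close>, hence
      uniform on \<open>{X0..B}\<close>; the values of \<open>w\<close> at the integers depend
      continuously on \<open>X\<close> through the flow.\<close>
    have "uniform_limit {X0..B} (\<lambda>n X. inv_pos \<alpha> (f X c) (real n)) (\<lambda>X. l X c) sequentially"
    proof (rule uniform_limitI)
      fix d :: real assume d: "d > 0"
      have "(\<lambda>n. (\<mu> / 8 * \<bar>B\<bar> + 4 * \<Lambda> * \<mu>) / real n) \<longlonglongrightarrow> 0" by real_asymp
      then have "\<forall>\<^sub>F n in sequentially. (\<mu> / 8 * \<bar>B\<bar> + 4 * \<Lambda> * \<mu>) / real n < d"
        using d order_tendstoD(2) by blast
      moreover have "\<forall>\<^sub>F n in sequentially. real n \<ge> \<bar>B\<bar> + 1"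
        by (metis eventually_sequentially le_trans of_nat_mono real_nat_ceiling_ge order_trans)
      ultimately show "\<forall>\<^sub>F n in sequentially. \<forall>X\<in>{X0..B}. dist (inv_pos \<alpha> (f X c) (real n)) (l X c) < d"
      proof eventually_elim
        case (elim n)
        show ?case
        proof
          fix X assume X: "X \<in> {X0..B}"
          have "\<bar>inv_pos \<alpha> (f X c) (real n) - l X c\<bar> \<le> (\<mu> / 8 * X + 4 * \<Lambda> * \<mu>) / real n"
            unfolding l_def by (rule shot.L_bound[OF shot]) (use X c elim in auto)
          also have "\<dots> \<le> (\<mu> / 8 * \<bar>B\<bar> + 4 * \<Lambda> * \<mu>) / real n"
            using X mu by (intro divide_right_mono add_right_mono mult_left_mono) auto
          finally show "dist (inv_pos \<alpha> (f X c) (real n)) (l X c) < d" using elim by (simp add: dist_real_def)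
        qed
      qed
    qed
    moreover have "continuous_on {X0..B} (\<lambda>X. inv_pos \<alpha> (f X c) (real n))" for n
      unfolding inv_pos_def f_def o_def by (intro continuous_intros Phi_comp) auto
    ultimately show "continuous_on {X0..B} (\<lambda>X. l X c)"
      by (intro uniform_limit_theorem[where F = sequentially]) auto
  qed
  have "\<exists>c. \<bar>c - \<mu>\<bar> \<le> \<mu> / 4 \<and> l X c = \<mu>" if X: "X \<ge> X0" for X
  proof -
    \<comment> \<open>The limits belonging to the two extreme starts are at most
      \<open>15 / 16 * \<mu>\<close> and at least \<open>17 / 16 * \<mu>\<close>.\<close>
    have "\<bar>l X (3 / 4 * \<mu>) - 3 / 4 * \<mu>\<bar> \<le> 3 / 16 * \<mu>" "\<bar>l X (5 / 4 * \<mu>) - 5 / 4 * \<mu>\<bar> \<le> 3 / 16 * \<mu>"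
      using near[OF X] mu by auto
    then have "l X (3 / 4 * \<mu>) \<le> \<mu>" "\<mu> \<le> l X (5 / 4 * \<mu>)" using mu by linarith+
    then obtain c where "3 / 4 * \<mu> \<le> c" "c \<le> 5 / 4 * \<mu>" "l X c = \<mu>"
      using IVT'[OF _ _ _ contc[OF X]] mu by auto
    moreover from this have "\<bar>c - \<mu>\<bar> \<le> \<mu> / 4" by linarith
    ultimately show ?thesis by blast
  qed
  then obtain c where c: "\<And>X. X \<ge> X0 \<Longrightarrow> \<bar>c X - \<mu>\<bar> \<le> \<mu> / 4" "\<And>X. X \<ge> X0 \<Longrightarrow> l X (c X) = \<mu>" by metis
  have ccont: "continuous_on {X0..} c"
  proof (rule continuous_on_sequentiallyI)
    fix u X assume u: "\<forall>n. u n \<in> {X0..}" and X: "X \<in> {X0..}" and lim: "u \<longlonglongrightarrow> X"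
    have "(\<lambda>n. l (u n) (c X)) \<longlonglongrightarrow> l X (c X)"
      using contX[OF c(1)[of X]] X u lim by (auto simp: continuous_on_sequentially o_def)
    then have "(\<lambda>n. 2 * \<bar>l (u n) (c X) - \<mu>\<bar>) \<longlonglongrightarrow> 2 * \<bar>l X (c X) - \<mu>\<bar>" by (intro tendsto_intros)
    then have z: "(\<lambda>n. 2 * \<bar>l (u n) (c X) - \<mu>\<bar>) \<longlonglongrightarrow> 0" using c(2) X by simp
    have "\<bar>c (u n) - c X\<bar> \<le> 2 * \<bar>l (u n) (c X) - \<mu>\<bar>" for n
    proof -
      have un: "u n \<ge> X0" and X': "X \<ge> X0" using u X by auto
      have "\<bar>(l (u n) (c (u n)) - l (u n) (c X)) - (c (u n) - c X)\<bar> \<le> \<bar>c (u n) - c X\<bar> / 2"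
        by (rule comp[OF un c(1)[OF un] c(1)[OF X']])
      then have "\<bar>(\<mu> - l (u n) (c X)) - (c (u n) - c X)\<bar> \<le> \<bar>c (u n) - c X\<bar> / 2" by (simp only: c(2)[OF un])
      moreover have "\<bar>d\<bar> \<le> 2 * \<bar>t\<bar>" if "\<bar>t - d\<bar> \<le> \<bar>d\<bar> / 2" for t d :: real
        using that by (auto simp: abs_if split: if_splits)
      ultimately have "\<bar>c (u n) - c X\<bar> \<le> 2 * \<bar>\<mu> - l (u n) (c X)\<bar>" by blast
      then show ?thesis by (simp only: abs_minus_commute[of \<mu>])
    qed
    then have "(\<lambda>n. c (u n) - c X) \<longlonglongrightarrow> 0" by (intro Lim_null_comparison[OF _ z]) auto
    then show "(\<lambda>n. c (u n)) \<longlonglongrightarrow> c X" by (simp add: LIM_zero_iff)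
  qed
  have ccont2: "continuous_on ({X0..} \<times> UNIV) (\<lambda>z::real \<times> real. c (fst z))"
    by (rule continuous_on_compose2[OF ccont]) (auto intro!: continuous_intros)
  have Phi_c: "continuous_on ({X0..} \<times> UNIV) (\<lambda>z. \<Phi> (fst z) (P (fst z) (c (fst z))) (snd z))"
    by (rule Phi_comp) (auto intro!: continuous_intros ccont2)
  show ?thesis
  proof (rule exI[of _ "\<lambda>X. f X (c X)"], rule exI[of _ "\<lambda>X. g X (c X)"], intro conjI allI impI)
    fix X assume "start_pos \<alpha> \<mu> \<le> X"
    then have X: "X \<ge> X0" by (simp add: X0_def)
    show "shot \<alpha> \<mu> (f X (c X)) (g X (c X)) X" by (rule shot[OF X c(1)[OF X]])
    show "inv_vel \<alpha> (f X (c X)) (g X (c X)) X = e * X" by (rule vX[OF X])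
    show "(inv_pos \<alpha> (f X (c X)) \<longlongrightarrow> \<mu>) at_top"
      using shot.tendsto_L[OF shot[OF X c(1)[OF X]]] c(2)[OF X] by (simp add: l_def)
  next
    show "continuous_on ({start_pos \<alpha> \<mu>..} \<times> UNIV) (\<lambda>(X, x). f X (c X) x)"
      "continuous_on ({start_pos \<alpha> \<mu>..} \<times> UNIV) (\<lambda>(X, x). g X (c X) x)"
      unfolding f_def g_def o_def case_prod_unfold X0_def[symmetric]
      using continuous_on_fst[OF Phi_c] continuous_on_snd[OF Phi_c] by simp_all
  qed
qed

section \<open>Rotation and zeros\<close>

text \<open>The negative derivative of the angle of \<open>(f, f' / \<omega>)\<close> along a profile.\<close>

definition rate :: "real \<Rightarrow> real \<Rightarrow> real \<Rightarrow> real \<Rightarrow> real \<Rightarrow> real" where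
  "rate \<alpha> \<omega> x y z = \<omega> * (z\<^sup>2 + x / 2 * y * z + y\<^sup>2 / \<alpha> + y * nonlin \<alpha> y) / (\<omega>\<^sup>2 * y\<^sup>2 + z\<^sup>2)"

lemma profile_nontrivial:
  assumes "\<alpha> > 0" "profile_eq \<alpha> f g" "f X \<noteq> 0"
  shows "f x \<noteq> 0 \<or> g x \<noteq> 0"
proof (rule ccontr)
  assume "\<not> (f x \<noteq> 0 \<or> g x \<noteq> 0)"
  moreover have "profile_eq \<alpha> (\<lambda>x. 0) (\<lambda>x. 0)" by (simp add: profile_eq_def nonlin_def)
  ultimately have "f X = 0" using profile_unique(1)[OF assms(1,2)] by blast
  then show False using assms(3) by simp
qed

lemma sum_squares_pos:
  assumes "\<omega> > 0" "y \<noteq> 0 \<or> z \<noteq> 0"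
  shows "\<omega>\<^sup>2 * y\<^sup>2 + z\<^sup>2 > (0::real)"
  using assms by (metis add_nonneg_pos add_pos_nonneg mult_pos_pos zero_le_power2 zero_less_power2 mult_nonneg_nonneg less_numeral_extra(3) power_eq_0_iff)

lemma rate_continuous:
  assumes "\<alpha> > 0" "\<omega> > 0" "continuous_on S x" "continuous_on S y" "continuous_on S z"
    and "\<And>s. s \<in> S \<Longrightarrow> y s \<noteq> 0 \<or> z s \<noteq> 0"
  shows "continuous_on S (\<lambda>s. rate \<alpha> \<omega> (x s) (y s) (z s))"
  unfolding rate_def
  by (intro continuous_intros assms continuous_on_compose2[OF continuous_on_nonlin[of \<alpha> UNIV]])
    (use assms(1) sum_squares_pos[OF assms(2) assms(6)] in force)+

text \<open>No branch of the argument is chosen. \<theta> is the integral of the angular velocity,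
  and the components \<open>A\<close> and \<open>B\<close> of the unit vector along
  \<open>(f, g / \<omega>)\<close> in the frame turned by \<theta> then have derivative 0. At
  \<open>X\<close>, where \<open>f\<close> is positive and arctan gives the angle,
  \<open>A > 0\<close> and \<open>B = 0\<close>.\<close>

lemma rotation_exists:
  assumes \<alpha>: "\<alpha> > 0" and \<omega>: "\<omega> > 0" and sol: "profile_eq \<alpha> f g" and fX: "f X > 0"
  shows "\<exists>\<theta>. \<theta> X = arctan (g X / (\<omega> * f X)) \<and>
    (\<forall>x. (\<theta> has_real_derivative - rate \<alpha> \<omega> x (f x) (g x)) (at x)) \<and>
    (\<forall>x. \<exists>r>0. f x = r * cos (\<theta> x) \<and> g x = \<omega> * (r * sin (\<theta> x)))"
proof -
  have f: "(f has_real_derivative g x) (at x)"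
    and g: "(g has_real_derivative - (x / 2) * g x - (f x / \<alpha> + nonlin \<alpha> (f x))) (at x)" for x
    using sol by (auto simp: profile_eq_def)
  have cont: "continuous_on UNIV f" "continuous_on UNIV g"
    by (auto intro!: continuous_at_imp_continuous_on DERIV_isCont[OF f] DERIV_isCont[OF g])
  have nz: "f x \<noteq> 0 \<or> g x \<noteq> 0" for x using profile_nontrivial[OF \<alpha> sol, of X x] fX by simp
  have "continuous_on UNIV (\<lambda>x. - rate \<alpha> \<omega> x (f x) (g x))"
    by (intro continuous_on_minus rate_continuous \<alpha> \<omega> cont nz continuous_on_id)
  from antiderivative_exists[OF this, of X]
  obtain H where H: "\<And>x. (H has_vector_derivative - rate \<alpha> \<omega> x (f x) (g x)) (at x)" "H X = 0"
    by blast
  define \<theta> where "\<theta> x = arctan (g X / (\<omega> * f X)) + H x" for x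
  have \<theta>': "(\<theta> has_real_derivative - rate \<alpha> \<omega> x (f x) (g x)) (at x)" for x
    unfolding \<theta>_def using H(1)[of x]
    by (auto intro!: derivative_eq_intros simp: has_real_derivative_iff_has_vector_derivative)
  define b where "b x = g x / \<omega>" for x
  define b' where "b' x = (- (x / 2) * g x - (f x / \<alpha> + nonlin \<alpha> (f x))) / \<omega>" for x
  define D where "D x = - rate \<alpha> \<omega> x (f x) (g x)" for x
  have \<theta>D: "(\<theta> has_real_derivative D x) (at x)" for x using \<theta>' by (simp add: D_def)
  define q where "q x = f x * f x + b x * b x" for x
  have q: "q x > 0" for x
    using nz[of x] \<omega> by (auto simp: q_def b_def intro: add_pos_nonneg add_nonneg_pos simp flip: power2_eq_square)
  have f': "(f has_real_derivative \<omega> * b x) (at x)" for x using f[of x] \<omega> by (simp add: b_def)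
  have b: "(b has_real_derivative b' x) (at x)" for x
    unfolding b_def[abs_def] b'_def by (intro DERIV_cdivide g)
  \<comment> \<open>The usual derivative of an angle:
    \<open>\<theta>' * (f\<^sup>2 + b\<^sup>2) = f * b' - b * f'\<close>.\<close>
  have Dq: "D x * q x = f x * b' x - b x * (\<omega> * b x)" for x
  proof -
    have "\<omega>\<^sup>2 * (f x)\<^sup>2 + (g x)\<^sup>2 = \<omega>\<^sup>2 * q x" using \<omega> by (simp add: q_def b_def field_simps power2_eq_square)
    then have "D x * q x = - (\<omega> * ((g x)\<^sup>2 + x / 2 * f x * g x + (f x)\<^sup>2 / \<alpha> + f x * nonlin \<alpha> (f x)) / \<omega>\<^sup>2)"
      using q[of x] \<omega> by (simp add: D_def rate_def)
    then show ?thesis using \<omega> by (simp add: b_def b'_def field_simps power2_eq_square)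
  qed
  define A where "A x = (f x * cos (\<theta> x) + b x * sin (\<theta> x)) / sqrt (q x)" for x
  define B where "B x = (b x * cos (\<theta> x) - f x * sin (\<theta> x)) / sqrt (q x)" for x
  define m where "m x = (f x * (\<omega> * b x) + b x * b' x)" for x
  have q': "(q has_real_derivative 2 * m x) (at x)" for x
    unfolding q_def[abs_def] m_def
    by (rule derivative_eq_intros f' b refl)+ (simp add: algebra_simps)
  have sq: "((\<lambda>x. sqrt (q x)) has_real_derivative m x / sqrt (q x)) (at x)" for x
    using q[of x] by (auto intro!: derivative_eq_intros q' simp: field_simps)
  have key: "(n * sqrt (q x) - N * (m x / sqrt (q x))) / (sqrt (q x) * sqrt (q x)) = 0"
    if "n * q x = N * m x" for n N x
  proof -
    have "n * sqrt (q x) * sqrt (q x) = N * m x" using that q[of x] by (simp add: mult.assoc)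
    then have "n * sqrt (q x) = N * (m x / sqrt (q x))" using q[of x] by (simp add: field_simps)
    then show ?thesis by simp
  qed
  have A': "(A has_real_derivative 0) (at x)" for x
  proof -
    define n where "n x = \<omega> * b x * cos (\<theta> x) - f x * sin (\<theta> x) * D x + b' x * sin (\<theta> x) + b x * cos (\<theta> x) * D x" for x
    have "((\<lambda>x. f x * cos (\<theta> x) + b x * sin (\<theta> x)) has_real_derivative n x) (at x)"
      unfolding n_def by (rule derivative_eq_intros f' b \<theta>D refl)+ (simp add: algebra_simps)
    then have d: "(A has_real_derivative (n x * sqrt (q x) - (f x * cos (\<theta> x) + b x * sin (\<theta> x)) * (m x / sqrt (q x))) / (sqrt (q x) * sqrt (q x))) (at x)"
      unfolding A_def[abs_def] using q[of x] by (intro DERIV_divide sq) auto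
    have h: "n x * q x = (f x * cos (\<theta> x) + b x * sin (\<theta> x)) * m x"
    proof -
      have "n x * q x = (\<omega> * b x * cos (\<theta> x) + b' x * sin (\<theta> x)) * q x + (b x * cos (\<theta> x) - f x * sin (\<theta> x)) * (D x * q x)"
        by (simp add: n_def algebra_simps)
      then show ?thesis unfolding Dq by (simp add: q_def m_def algebra_simps)
    qed
    show ?thesis by (rule DERIV_cong[OF d key[OF h]])
  qed
  have B': "(B has_real_derivative 0) (at x)" for x
  proof -
    define n where "n x = b' x * cos (\<theta> x) - b x * sin (\<theta> x) * D x - \<omega> * b x * sin (\<theta> x) - f x * cos (\<theta> x) * D x" for x
    have "((\<lambda>x. b x * cos (\<theta> x) - f x * sin (\<theta> x)) has_real_derivative n x) (at x)"
      unfolding n_def by (rule derivative_eq_intros f' b \<theta>D refl)+ (simp add: algebra_simps)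
    then have d: "(B has_real_derivative (n x * sqrt (q x) - (b x * cos (\<theta> x) - f x * sin (\<theta> x)) * (m x / sqrt (q x))) / (sqrt (q x) * sqrt (q x))) (at x)"
      unfolding B_def[abs_def] using q[of x] by (intro DERIV_divide sq) auto
    have h: "n x * q x = (b x * cos (\<theta> x) - f x * sin (\<theta> x)) * m x"
    proof -
      have "n x * q x = (b' x * cos (\<theta> x) - \<omega> * b x * sin (\<theta> x)) * q x - (b x * sin (\<theta> x) + f x * cos (\<theta> x)) * (D x * q x)"
        by (simp add: n_def algebra_simps)
      then show ?thesis unfolding Dq by (simp add: q_def m_def algebra_simps)
    qed
    show ?thesis by (rule DERIV_cong[OF d key[OF h]])
  qed
  have AX: "A x = A X" and BX: "B x = B X" for x
    using DERIV_isconst_all[of A] DERIV_isconst_all[of B] A' B' by blast+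
  define t where "t = g X / (\<omega> * f X)"
  have \<theta>X: "\<theta> X = arctan t" by (simp add: \<theta>_def H t_def)
  have bX: "b X = t * f X" using fX \<omega> by (simp add: b_def t_def)
  have B0: "B x = 0" for x
  proof -
    have "B X = 0" unfolding B_def \<theta>X bX cos_arctan sin_arctan by simp
    then show ?thesis using BX by metis
  qed
  have Apos: "A x > 0" for x
  proof -
    have "f X * cos (\<theta> X) + b X * sin (\<theta> X) = f X * ((1 + t\<^sup>2) / sqrt (1 + t\<^sup>2))"
      unfolding \<theta>X bX cos_arctan sin_arctan
      by (simp add: algebra_simps add_divide_distrib power2_eq_square)
    moreover have "(1 + t\<^sup>2) > 0" by (simp add: add_pos_nonneg)
    ultimately have "A X > 0" unfolding A_def using fX q[of X] by simp
    then show ?thesis using AX by metis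
  qed
  have "\<exists>r>0. f x = r * cos (\<theta> x) \<and> g x = \<omega> * (r * sin (\<theta> x))" for x
  proof (intro exI conjI)
    define r where "r = f x * cos (\<theta> x) + b x * sin (\<theta> x)"
    show "r > 0" using Apos[of x] q[of x] by (simp add: A_def r_def zero_less_divide_iff)
    have z: "b x * cos (\<theta> x) - f x * sin (\<theta> x) = 0" using B0[of x] q[of x] by (simp add: B_def)
    have "f x = f x * ((cos (\<theta> x))\<^sup>2 + (sin (\<theta> x))\<^sup>2)" by simp
    also have "\<dots> = r * cos (\<theta> x) - (b x * cos (\<theta> x) - f x * sin (\<theta> x)) * sin (\<theta> x)"
      unfolding r_def power2_eq_square by (simp only: algebra_simps)
    finally show "f x = r * cos (\<theta> x)" by (simp add: z)
    have "b x = b x * ((cos (\<theta> x))\<^sup>2 + (sin (\<theta> x))\<^sup>2)" by simp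
    also have "\<dots> = r * sin (\<theta> x) + (b x * cos (\<theta> x) - f x * sin (\<theta> x)) * cos (\<theta> x)"
      unfolding r_def power2_eq_square by (simp only: algebra_simps)
    finally have "b x = r * sin (\<theta> x)" by (simp add: z)
    then show "g x = \<omega> * (r * sin (\<theta> x))" using \<omega> by (simp add: b_def field_simps)
  qed
  then show ?thesis using \<theta>' \<theta>X unfolding t_def by blast
qed

text \<open>Just after \<open>a\<close> the function is below \<open>c\<close>. Were it not below
  \<open>c\<close> at \<open>b\<close>, it would come back to \<open>c\<close> at a first point
  \<open>z\<close>, with values at most \<open>c\<close> before it; but \<open>h' z < 0\<close>
  forces larger values just before \<open>z\<close>.\<close>

lemma downward_crossing:
  fixes h :: "real \<Rightarrow> real"
  assumes h: "\<And>x. (h has_real_derivative h' x) (at x)"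
    and neg: "\<And>x. h x = c \<Longrightarrow> h' x < 0" and a: "h a = c" and ab: "a < b"
  shows "h b < c"
proof (rule ccontr)
  assume "\<not> h b < c"
  then have hb: "h b \<ge> c" by simp
  \<comment> \<open>If \<open>h b = c\<close>, the negative derivative at \<open>b\<close> gives a
    point further left with value above \<open>c\<close>; \<open>first_hitting\<close> demands a
    strict inequality at the right end.\<close>
  have "\<exists>b'. a < b' \<and> b' \<le> b \<and> h b' > c"
  proof (cases "h b > c")
    case False
    then have "h b = c" using hb by simp
    then obtain d where d: "d > 0" "\<And>t. t > 0 \<Longrightarrow> t < d \<Longrightarrow> h b < h (b - t)"
      using DERIV_neg_dec_left[OF h neg] by blast
    define t where "t = min (d / 2) ((b - a) / 2)"
    have "t > 0" "t < d" "a < b - t" using d(1) ab by (auto simp: t_def min_def field_simps)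
    then show ?thesis using d(2) \<open>h b = c\<close> by (intro exI[of _ "b - t"]) auto
  qed (use ab in auto)
  then obtain b' where b': "a < b'" "h b' > c" by blast
  obtain d where d: "d > 0" "\<And>t. t > 0 \<Longrightarrow> t < d \<Longrightarrow> h a > h (a + t)"
    using DERIV_neg_dec_right[OF h neg[OF a]] by blast
  define s where "s = min (d / 2) ((b' - a) / 2)"
  define a' where "a' = a + s"
  have s: "s > 0" "s < d" "a + s < b'" using d(1) b'(1) by (auto simp: s_def min_def field_simps)
  then have a': "a < a'" "a' < b'" "h a' < c" using d(2)[of s] a by (auto simp: a'_def)
  have "continuous_on {a'..b'} h" by (intro continuous_at_imp_continuous_on ballI DERIV_isCont[OF h])
  then obtain z where z: "a' \<le> z" "z \<le> b'" "h z = c" "\<And>y. a' \<le> y \<Longrightarrow> y \<le> z \<Longrightarrow> h y \<le> c"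
    using first_hitting[of a' b' h c] a' b' by auto
  have "a' < z" using z a' by (cases "a' = z") auto
  obtain e where e: "e > 0" "\<And>t. t > 0 \<Longrightarrow> t < e \<Longrightarrow> h z < h (z - t)"
    using DERIV_neg_dec_left[OF h neg[OF z(3)]] by blast
  define t where "t = min (e / 2) (z - a')"
  have "t > 0" "t < e" "a' \<le> z - t" using e(1) \<open>a' < z\<close> by (auto simp: t_def min_def)
  then show False using e(2)[of t] z(3) z(4)[of "z - t"] by auto
qed

text \<open>All that the zero count uses of the angle. For a profile the derivative of the angle at
  a zero of \<open>f\<close> is \<open>- \<omega>\<close>, whatever it is elsewhere, so the values
  where the cosine vanishes are passed downwards only.\<close>

locale rotation =
  fixes \<theta> \<theta>' :: "real \<Rightarrow> real" and f :: "real \<Rightarrow> real" and X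
  assumes X: "X > 0" and der: "\<And>x. (\<theta> has_real_derivative \<theta>' x) (at x)"
    and neg: "\<And>x. cos (\<theta> x) = 0 \<Longrightarrow> \<theta>' x < 0"
    and zero: "\<And>x. f x = 0 \<longleftrightarrow> cos (\<theta> x) = 0"
    and angle_X: "- (pi / 2) < \<theta> X" "\<theta> X < pi / 2"
begin

definition level :: "int \<Rightarrow> real" where "level j = pi / 2 + of_int j * pi"

lemma cos_level: "cos t = 0 \<longleftrightarrow> (\<exists>j. t = level j)"
proof
  assume "cos t = 0"
  then obtain i where i: "odd i" "t = of_int i * (pi / 2)" using cos_zero_iff_int by blast
  then obtain j where "i = 2 * j + 1" by (metis oddE)
  then have "t = level j" using i by (simp add: level_def algebra_simps)
  then show "\<exists>j. t = level j" by blast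
next
  assume "\<exists>j. t = level j"
  then show "cos t = 0"
    by (auto simp: level_def cos_add sin_zero_iff_int2)
qed

lemma crossing: "\<theta> a = level j \<Longrightarrow> a < b \<Longrightarrow> \<theta> b < level j"
  by (rule downward_crossing[OF der]) (use neg cos_level in blast)+

lemma cont: "continuous_on S \<theta>"
  by (intro continuous_at_imp_continuous_on ballI DERIV_isCont[OF der])

lemma level_nonneg:
  assumes "\<theta> x = level j" "x < X"
  shows "j \<ge> 0"
proof (rule ccontr)
  assume "\<not> j \<ge> 0"
  then have "of_int j \<le> (-1::real)" by linarith
  then have "of_int j * pi \<le> - 1 * pi" by (intro mult_right_mono) auto
  then have "level j \<le> - (pi / 2)" by (simp add: level_def)
  then show False using crossing[OF assms] angle_X by simp
qed

lemma above_bottom: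
  assumes "x < X"
  shows "\<theta> x > - (pi / 2)"
proof (rule ccontr)
  assume "\<not> \<theta> x > - (pi / 2)"
  then obtain y where y: "x \<le> y" "y \<le> X" "\<theta> y = - (pi / 2)"
    using IVT'[of \<theta> x "- (pi / 2)" X] cont assms angle_X by force
  then have "y < X" "\<theta> y = level (- 1)" using angle_X by (auto simp: level_def order.order_iff_strict)
  then show False using level_nonneg by force
qed

text \<open>A level with \<open>j \<ge> 0\<close> lies above \<open>\<theta> X\<close>; if it is
  below \<open>\<theta> 0\<close> it is met, and by \<open>crossing\<close> only once. Levels with
  \<open>j < 0\<close> are not met before \<open>X\<close>, and one at or above
  \<open>\<theta> 0\<close> could be met inside only by an upward crossing.\<close>

lemma zeros_bij:
  "bij_betw (\<lambda>j::nat. SOME x. 0 < x \<and> x < X \<and> \<theta> x = level (int j))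
     {j. level (int j) < \<theta> 0} {x. 0 < x \<and> x < X \<and> f x = 0}"
proof -
  have ex: "\<exists>x. 0 < x \<and> x < X \<and> \<theta> x = level (int j)" if "level (int j) < \<theta> 0" for j
  proof -
    have "level (int j) \<ge> pi / 2" by (simp add: level_def)
    then have lt: "\<theta> X < level (int j)" using angle_X by simp
    note gt = that
    obtain x where x: "0 \<le> x" "x \<le> X" "\<theta> x = level (int j)"
      using IVT2'[of \<theta> X "level (int j)" 0] gt lt X cont by auto
    then show ?thesis using gt lt by (intro exI[of _ x]) (auto simp: order.order_iff_strict)
  qed
  define p where "p j = (SOME x. 0 < x \<and> x < X \<and> \<theta> x = level (int j))" for j
  have p: "0 < p j" "p j < X" "\<theta> (p j) = level (int j)" if "level (int j) < \<theta> 0" for j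
    using someI_ex[OF ex[OF that]] by (auto simp: p_def)
  have "bij_betw p {j. level (int j) < \<theta> 0} {x. 0 < x \<and> x < X \<and> f x = 0}"
  proof (rule bij_betw_imageI)
    show "inj_on p {j. level (int j) < \<theta> 0}"
    proof (rule inj_onI)
      fix i j assume "i \<in> {j. level (int j) < \<theta> 0}" "j \<in> {j. level (int j) < \<theta> 0}" "p i = p j"
      then have "level (int i) = level (int j)" using p(3)[of i] p(3)[of j] by simp
      then show "i = j" by (simp add: level_def)
    qed
    show "p ` {j. level (int j) < \<theta> 0} = {x. 0 < x \<and> x < X \<and> f x = 0}"
    proof (intro equalityI subsetI)
      fix x assume "x \<in> p ` {j. level (int j) < \<theta> 0}"
      then show "x \<in> {x. 0 < x \<and> x < X \<and> f x = 0}" using p zero cos_level by auto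
    next
      fix x assume "x \<in> {x. 0 < x \<and> x < X \<and> f x = 0}"
      then have x: "0 < x" "x < X" and "cos (\<theta> x) = 0" using zero by auto
      then obtain i where i: "\<theta> x = level i" using cos_level by blast
      then obtain j where j: "i = int j" using level_nonneg[OF i x(2)] nonneg_int_cases by metis
      \<comment> \<open>Had the angle started below the level, then, being above it just before
        \<open>x\<close>, it would have met it at some earlier \<open>z\<close>, and
        \<open>crossing\<close> would put it strictly below the level at \<open>x\<close>.\<close>
      have "level (int j) < \<theta> 0"
      proof (rule ccontr)
        assume not: "\<not> level (int j) < \<theta> 0"
        have "\<theta> 0 \<noteq> level (int j)" using crossing[of 0 "int j" x] x i j by auto
        then have "\<theta> 0 < level (int j)" using not by simp
        have "\<exists>y. 0 \<le> y \<and> y < x \<and> \<theta> y > level (int j)"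
        proof -
          obtain d where d: "d > 0" "\<And>t. t > 0 \<Longrightarrow> t < d \<Longrightarrow> \<theta> x < \<theta> (x - t)"
            using DERIV_neg_dec_left[OF der neg[OF \<open>cos (\<theta> x) = 0\<close>]] by blast
          define t where "t = min (d / 2) x"
          have "t > 0" "t < d" "t \<le> x" using d(1) x by (auto simp: t_def min_def)
          then show ?thesis using d(2)[of t] i j by (intro exI[of _ "x - t"]) auto
        qed
        then obtain y where y: "0 \<le> y" "y < x" "\<theta> y > level (int j)" by blast
        obtain z where "0 \<le> z" "z \<le> y" "\<theta> z = level (int j)"
          using IVT'[of \<theta> 0 "level (int j)" y] y \<open>\<theta> 0 < level (int j)\<close> cont by auto
        then show False using crossing[of z "int j" x] y i j by auto
      qed
      then have "p j = x"
      proof -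
        assume l: "level (int j) < \<theta> 0"
        show ?thesis
          using crossing[OF p(3)[OF l], of x] crossing[OF i, of "p j"] p(3)[OF l] i j
          by (cases "p j" x rule: linorder_cases) auto
      qed
      then show "x \<in> p ` {j. level (int j) < \<theta> 0}" using \<open>level (int j) < \<theta> 0\<close> by blast
    qed
  qed
  then show ?thesis by (simp add: p_def[abs_def])
qed

lemma finite_levels: "finite {j::nat. level (int j) < t}"
proof -
  obtain n where n: "t < real n * pi" using reals_Archimedean3[OF pi_gt_zero] by blast
  have "{j::nat. level (int j) < t} \<subseteq> {..n}"
  proof
    fix j assume "j \<in> {j::nat. level (int j) < t}"
    then have "pi / 2 + real j * pi < t" by (simp add: level_def)
    then have "real j * pi < real n * pi" using n pi_gt_zero by linarith
    then show "j \<in> {..n}" by simp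
  qed
  then show ?thesis by (rule finite_subset) simp
qed

lemma zeros_finite: "finite {x. 0 < x \<and> x < X \<and> f x = 0}"
  using bij_betw_finite[OF zeros_bij] finite_levels by blast

lemma card_zeros: "card {x. 0 < x \<and> x < X \<and> f x = 0} = card {j::nat. level (int j) < \<theta> 0}"
  using bij_betw_same_card[OF zeros_bij] by simp

lemma card_zeros_even: "\<theta> 0 = real m * pi \<Longrightarrow> card {x. 0 < x \<and> x < X \<and> f x = 0} = m"
proof -
  assume *: "\<theta> 0 = real m * pi"
  have "level (int j) < real m * pi \<longleftrightarrow> j < m" for j
  proof
    assume "level (int j) < real m * pi"
    then have "pi / 2 + real j * pi < real m * pi" by (simp add: level_def)
    then have "real j * pi < real m * pi" using pi_gt_zero by linarith
    then show "j < m" by simp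
  next
    assume "j < m"
    then have "(real j + 1) * pi \<le> real m * pi" by (intro mult_right_mono) auto
    then have "real j * pi + pi \<le> real m * pi" by (simp only: distrib_right mult_1)
    then have "pi / 2 + real j * pi < real m * pi" using pi_gt_zero by linarith
    then show "level (int j) < real m * pi" by (simp add: level_def)
  qed
  then show ?thesis unfolding card_zeros * by simp
qed

text \<open>The angle at 0 is itself the level with number \<open>m\<close>; the strict inequality
  leaves out this zero, the one at the origin.\<close>

lemma card_zeros_odd: "\<theta> 0 = pi / 2 + real m * pi \<Longrightarrow> card {x. 0 < x \<and> x < X \<and> f x = 0} = m"
  unfolding card_zeros by (simp add: level_def)

text \<open>The bound involves only the number of zeros, not \<omega>;
  \<open>zeros_prescribed\<close> fixes it before choosing \<omega>.\<close>

lemma theta_bound: "\<theta> 0 \<le> pi / 2 + real (card {x. 0 < x \<and> x < X \<and> f x = 0}) * pi"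
proof (rule ccontr)
  define n where "n = card {x. 0 < x \<and> x < X \<and> f x = 0}"
  assume "\<not> ?thesis"
  then have *: "pi / 2 + real n * pi < \<theta> 0" by (simp add: n_def)
  have "{..n} \<subseteq> {j::nat. level (int j) < \<theta> 0}"
  proof
    fix j assume "j \<in> {..n}"
    then have "real j * pi \<le> real n * pi" by (intro mult_right_mono) auto
    then have "pi / 2 + real j * pi < \<theta> 0" using * by linarith
    then show "j \<in> {j::nat. level (int j) < \<theta> 0}" by (simp add: level_def)
  qed
  from card_mono[OF finite_levels this] have "Suc n \<le> n" by (simp add: n_def card_zeros)
  then show False by simp
qed

end

text \<open>By \<open>- x * y * z \<le> z\<^sup>2 / 2 + x\<^sup>2 * y\<^sup>2 / 2\<close> the claim
  reduces to \<open>main\<close>, where \<open>K\<close> collects the coefficients of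
  \<open>y\<^sup>2\<close>. Either \<open>y\<close> is so large that the superlinear term exceeds
  \<open>K * y\<^sup>2\<close>, or \<open>\<bar>y\<bar> \<le> Y\<close> and a large energy must sit
  in \<open>z\<close>; \<open>M\<close> is chosen for the second case.\<close>

lemma rate_lower_bound:
  assumes \<alpha>: "\<alpha> > 0" and \<omega>: "\<omega> > 0" and b: "b > 0"
  shows "\<exists>M. \<forall>x y z. 0 \<le> x \<and> x \<le> b \<and> M < energy \<alpha> y z \<and> (y \<noteq> 0 \<or> z \<noteq> 0) \<longrightarrow> \<omega> / 2 \<le> rate \<alpha> \<omega> x y z"
proof -
  define K where "K = \<omega>\<^sup>2 + b\<^sup>2 / 2"
  have K: "K > 0" using \<omega> by (simp add: K_def add_pos_nonneg)
  define Y where "Y = K powr (1 / \<alpha>)"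
  have Y: "Y > 0" using K by (simp add: Y_def)
  define M where "M = K * Y\<^sup>2 + (Y\<^sup>2 / (2 * \<alpha>) + Y powr (\<alpha> + 2) / (\<alpha> + 2))"
  show ?thesis
  proof (intro exI[of _ M] allI impI, elim conjE)
    fix x y z assume x: "0 \<le> x" "x \<le> b" and E: "M < energy \<alpha> y z" and nz: "y \<noteq> 0 \<or> z \<noteq> 0"
    have q: "\<omega>\<^sup>2 * y\<^sup>2 + z\<^sup>2 > 0" by (rule sum_squares_pos[OF \<omega> nz])
    have yn: "y * nonlin \<alpha> y = y\<^sup>2 * \<bar>y\<bar> powr \<alpha>" by (simp add: nonlin_def power2_eq_square)
    have main: "K * y\<^sup>2 \<le> z\<^sup>2 / 2 + 2 * (y\<^sup>2 * \<bar>y\<bar> powr \<alpha>)"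
    proof (cases "\<bar>y\<bar> powr \<alpha> \<ge> K")
      case True
      have "y\<^sup>2 * K \<le> y\<^sup>2 * \<bar>y\<bar> powr \<alpha>" by (rule mult_left_mono[OF True]) simp
      moreover have "0 \<le> z\<^sup>2" "0 \<le> y\<^sup>2 * \<bar>y\<bar> powr \<alpha>" by simp_all
      ultimately show ?thesis using mult.commute[of K "y\<^sup>2"] by linarith
    next
      case False
      have yY: "\<bar>y\<bar> \<le> Y"
      proof (rule ccontr)
        assume "\<not> \<bar>y\<bar> \<le> Y"
        then have "Y powr \<alpha> \<le> \<bar>y\<bar> powr \<alpha>" using Y \<alpha> by (intro powr_mono2) auto
        moreover have "Y powr \<alpha> = K" using K \<alpha> by (simp add: Y_def powr_powr)
        ultimately show False using False by simp
      qed
      have y2: "y\<^sup>2 \<le> Y\<^sup>2" using yY Y by (metis abs_le_square_iff abs_of_pos)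
      have "y\<^sup>2 / (2 * \<alpha>) \<le> Y\<^sup>2 / (2 * \<alpha>)" using y2 \<alpha> by (intro divide_right_mono) auto
      moreover have "\<bar>y\<bar> powr (\<alpha> + 2) / (\<alpha> + 2) \<le> Y powr (\<alpha> + 2) / (\<alpha> + 2)"
        using yY \<alpha> by (intro divide_right_mono powr_mono2) auto
      ultimately have "K * Y\<^sup>2 \<le> z\<^sup>2 / 2" using E unfolding M_def energy_def by linarith
      moreover have "K * y\<^sup>2 \<le> K * Y\<^sup>2" using y2 K by simp
      moreover have "0 \<le> y\<^sup>2 * \<bar>y\<bar> powr \<alpha>" by simp
      ultimately show ?thesis by linarith
    qed
    have "0 \<le> (z + x * y)\<^sup>2" by simp
    then have "- (x * y * z) \<le> z\<^sup>2 / 2 + x\<^sup>2 * y\<^sup>2 / 2" by (simp add: power2_eq_square algebra_simps)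
    moreover have "x\<^sup>2 * y\<^sup>2 \<le> b\<^sup>2 * y\<^sup>2" using x by (intro mult_right_mono power_mono) auto
    moreover have "0 \<le> y\<^sup>2 / \<alpha>" using \<alpha> by simp
    moreover have "K * y\<^sup>2 = \<omega>\<^sup>2 * y\<^sup>2 + b\<^sup>2 * y\<^sup>2 / 2" by (simp add: K_def algebra_simps)
    ultimately have "\<omega>\<^sup>2 * y\<^sup>2 + z\<^sup>2 \<le> 2 * (z\<^sup>2 + x / 2 * y * z + y\<^sup>2 / \<alpha> + y * nonlin \<alpha> y)"
      using main by (simp add: yn)
    then have "\<omega> / 2 * (\<omega>\<^sup>2 * y\<^sup>2 + z\<^sup>2) \<le> \<omega> / 2 * (2 * (z\<^sup>2 + x / 2 * y * z + y\<^sup>2 / \<alpha> + y * nonlin \<alpha> y))"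
      using \<omega> by (intro mult_left_mono) auto
    then have "\<omega> / 2 * (\<omega>\<^sup>2 * y\<^sup>2 + z\<^sup>2) \<le> \<omega> * (z\<^sup>2 + x / 2 * y * z + y\<^sup>2 / \<alpha> + y * nonlin \<alpha> y)"
      by (simp only: mult.assoc[symmetric] times_divide_eq_left) simp
    then show "\<omega> / 2 \<le> rate \<alpha> \<omega> x y z"
      unfolding rate_def by (simp only: pos_le_divide_eq[OF q])
  qed
qed

text \<open>By contraposition: an energy of at most \<open>M\<close> at \<open>a\<close> bounds
  \<open>f a\<close> and \<open>g a\<close>, hence the Lyapunov function of
  \<open>inv_lyapunov\<close> at \<open>a\<close> by \<open>C\<close>, hence its value at
  \<open>X\<close>, which contains
  \<open>X\<^sup>2 * (inv_vel \<alpha> f g X)\<^sup>2 / 2\<close>.\<close>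

lemma energy_large:
  assumes \<alpha>: "\<alpha> > 0" and a: "a > 0" "2 + 8 / \<alpha> \<le> a\<^sup>2"
  shows "\<exists>C. \<forall>f g X. profile_eq \<alpha> f g \<and> a \<le> X \<and> C < X\<^sup>2 * (inv_vel \<alpha> f g X)\<^sup>2 \<longrightarrow> M < energy \<alpha> (f a) (g a)"
proof -
  define k where "k = 2 / \<alpha>"
  have k: "k > 0" using \<alpha> by (simp add: k_def)
  define P where "P = a powr k"
  have P: "P > 0" using a by (simp add: P_def)
  define U V where "U = sqrt (2 * \<alpha> * M)" and "V = sqrt (2 * M)"
  define W where "W = P * (V + k * U / a)"
  define C where "C = a\<^sup>2 * W\<^sup>2 / 2 + (k * (k + 1) * (P * U)\<^sup>2 / 2 + (P * U) powr (\<alpha> + 2) / (\<alpha> + 2))"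
  show ?thesis
  proof (intro exI[of _ "2 * C"] allI impI, elim conjE, rule ccontr)
    fix f g X assume sol: "profile_eq \<alpha> f g" and X: "a \<le> X"
      and big: "2 * C < X\<^sup>2 * (inv_vel \<alpha> f g X)\<^sup>2" and "\<not> M < energy \<alpha> (f a) (g a)"
    then have fa: "\<bar>f a\<bar> \<le> U" "\<bar>g a\<bar> \<le> V" using energy_bounds[OF \<alpha>, of "f a" "g a" M] by (auto simp: U_def V_def)
    have w: "\<bar>inv_pos \<alpha> f a\<bar> \<le> P * U"
      using fa P by (simp add: inv_pos_def abs_mult P_def k_def)
    have "\<bar>g a + k * f a / a\<bar> \<le> V + k * U / a"
    proof -
      have "\<bar>k * f a / a\<bar> = k * \<bar>f a\<bar> / a" using k a by (simp add: abs_mult)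
      also have "\<dots> \<le> k * U / a" using k a fa by (intro divide_right_mono mult_left_mono) auto
      finally show ?thesis using fa(2) by linarith
    qed
    then have v: "\<bar>inv_vel \<alpha> f g a\<bar> \<le> W"
      using P mult_left_mono[of "\<bar>g a + k * f a / a\<bar>" "V + k * U / a" P]
      by (simp add: inv_vel_def abs_mult P_def k_def W_def)
    have w2: "(inv_pos \<alpha> f a)\<^sup>2 \<le> (P * U)\<^sup>2" using power_mono[OF w, of 2] by simp
    have v2: "(inv_vel \<alpha> f g a)\<^sup>2 \<le> W\<^sup>2" using power_mono[OF v, of 2] by simp
    have "X\<^sup>2 * (inv_vel \<alpha> f g X)\<^sup>2 / 2 \<le> X\<^sup>2 * (inv_vel \<alpha> f g X)\<^sup>2 / 2 +
       (k * (k + 1) * (inv_pos \<alpha> f X)\<^sup>2 / 2 + \<bar>inv_pos \<alpha> f X\<bar> powr (\<alpha> + 2) / (\<alpha> + 2))"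
      using k \<alpha> by simp
    also have "\<dots> \<le> a\<^sup>2 * (inv_vel \<alpha> f g a)\<^sup>2 / 2 +
       (k * (k + 1) * (inv_pos \<alpha> f a)\<^sup>2 / 2 + \<bar>inv_pos \<alpha> f a\<bar> powr (\<alpha> + 2) / (\<alpha> + 2))"
      using inv_lyapunov[OF \<alpha> sol a X] by (simp add: k_def)
    also have "\<dots> \<le> C"
      unfolding C_def using w2 v2 k \<alpha> w
      by (intro add_mono divide_right_mono mult_left_mono powr_mono2) auto
    finally show False using big by simp
  qed
qed

context shooting begin

text \<open>The angle of \<open>(f, f' / \<omega>)\<close> at \<open>0\<close> is a continuous function of the shooting parameter \<open>X\<close>.
  Choosing \<open>\<omega>\<close> large makes the rotation on \<open>{0..start_pos \<alpha> \<mu>}\<close> fast once the energy is large.\<close>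

lemma zeros_prescribed:
  assumes e: "e \<noteq> 0"
    and F: "\<And>X. X \<ge> start_pos \<alpha> \<mu> \<Longrightarrow> shot \<alpha> \<mu> (F X) (G X) X"
    and vel: "\<And>X. X \<ge> start_pos \<alpha> \<mu> \<Longrightarrow> inv_vel \<alpha> (F X) (G X) X = e * X"
    and Fcont: "continuous_on ({start_pos \<alpha> \<mu>..} \<times> UNIV) (\<lambda>(X, x). F X x)"
    and Gcont: "continuous_on ({start_pos \<alpha> \<mu>..} \<times> UNIV) (\<lambda>(X, x). G X x)"
  shows "\<exists>m0. \<forall>m\<ge>m0.
    (\<exists>X\<ge>start_pos \<alpha> \<mu>. G X 0 = 0 \<and> F X 0 \<noteq> 0 \<and> finite {x. 0 < x \<and> F X x = 0} \<and> card {x. 0 < x \<and> F X x = 0} = m) \<and>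
    (\<exists>X\<ge>start_pos \<alpha> \<mu>. F X 0 = 0 \<and> finite {x. 0 < x \<and> F X x = 0} \<and> card {x. 0 < x \<and> F X x = 0} = m)"
proof -
  define X0 where "X0 = start_pos \<alpha> \<mu>"
  have X0: "X > 0" if "X \<ge> X0" for X using start(1)[of X] that by (simp add: X0_def)
  have sol: "profile_eq \<alpha> (F X) (G X)" if "X \<ge> X0" for X
    using F[of X] that by (auto simp: X0_def shot_def shot_axioms_def)
  have Fpos: "F X x > 0" if "X \<ge> X0" "X \<le> x" for X x
    using shot.w_bound(2)[OF F[of X] that(2)] that X0[OF that(1)] by (simp add: X0_def inv_pos_def zero_less_mult_iff)
  have nz: "F X x \<noteq> 0 \<or> G X x \<noteq> 0" if "X \<ge> X0" for X x
    by (rule profile_nontrivial[OF alpha sol[OF that], of X]) (use Fpos[OF that, of X] in simp)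
  have zeros_eq: "{x. 0 < x \<and> F X x = 0} = {x. 0 < x \<and> x < X \<and> F X x = 0}" if "X \<ge> X0" for X
  proof -
    have "x < X" if "F X x = 0" for x using Fpos[OF \<open>X \<ge> X0\<close>, of x] that by (cases "X \<le> x") auto
    then show ?thesis by auto
  qed
  define ang where "ang \<omega> X \<theta> \<longleftrightarrow> \<theta> X = arctan (G X X / (\<omega> * F X X)) \<and>
    (\<forall>x. (\<theta> has_real_derivative - rate \<alpha> \<omega> x (F X x) (G X x)) (at x)) \<and>
    (\<forall>x. \<exists>r>0. F X x = r * cos (\<theta> x) \<and> G X x = \<omega> * (r * sin (\<theta> x)))" for \<omega> X \<theta>
  have "\<exists>\<theta>. ang \<omega> X \<theta>" if "\<omega> > 0" "X \<ge> X0" for \<omega> X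
    unfolding ang_def by (rule rotation_exists[OF alpha that(1) sol[OF that(2)]]) (use Fpos that in simp)
  then obtain \<theta> where \<theta>: "\<And>\<omega> X. \<omega> > 0 \<Longrightarrow> X \<ge> X0 \<Longrightarrow> ang \<omega> X (\<theta> \<omega> X)" by metis
  have rot: "rotation (\<theta> \<omega> X) (\<lambda>x. - rate \<alpha> \<omega> x (F X x) (G X x)) (F X) X" if "\<omega> > 0" "X \<ge> X0" for \<omega> X
  proof
    note * = \<theta>[OF that, unfolded ang_def]
    show "X > 0" using X0 that by blast
    show "(\<theta> \<omega> X has_real_derivative - rate \<alpha> \<omega> x (F X x) (G X x)) (at x)" for x using * by blast
    show Z: "F X x = 0 \<longleftrightarrow> cos (\<theta> \<omega> X x) = 0" for x
    proof -
      obtain r where "r > 0" "F X x = r * cos (\<theta> \<omega> X x)" using * by blast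
      then show ?thesis by simp
    qed
    show "- rate \<alpha> \<omega> x (F X x) (G X x) < 0" if "cos (\<theta> \<omega> X x) = 0" for x
    proof -
      have "F X x = 0" "G X x \<noteq> 0" using Z[of x] that nz[OF \<open>X \<ge> X0\<close>, of x] by auto
      then show ?thesis using \<open>\<omega> > 0\<close> by (simp add: rate_def)
    qed
    show "- (pi / 2) < \<theta> \<omega> X X" "\<theta> \<omega> X X < pi / 2"
      using * arctan_lbound arctan_ubound by auto
  qed
  have cont: "continuous_on {X0..} (\<lambda>X. \<theta> \<omega> X 0)" if \<omega>: "\<omega> > 0" for \<omega>
  proof -
    \<comment> \<open>The substitution \<open>x = s * X\<close> turns the integral of the rate over
      \<open>{0..X}\<close> into one over a fixed interval, so that only the integrand depends on
      \<open>X\<close>.\<close>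
    have eq: "\<theta> \<omega> X 0 = arctan (G X X / (\<omega> * F X X)) + integral (cbox 0 1) (\<lambda>s. X * rate \<alpha> \<omega> (s * X) (F X (s * X)) (G X (s * X)))"
      if "X \<ge> X0" for X
    proof -
      note * = \<theta>[OF \<omega> that, unfolded ang_def]
      have "((\<lambda>s. - \<theta> \<omega> X (s * X)) has_vector_derivative X * rate \<alpha> \<omega> (s * X) (F X (s * X)) (G X (s * X))) (at s within {0..1})" for s
      proof -
        have "(\<theta> \<omega> X has_real_derivative - rate \<alpha> \<omega> (s * X) (F X (s * X)) (G X (s * X))) (at (s * X))" using * by blast
        moreover have "((\<lambda>s. s * X) has_real_derivative X) (at s)" by (auto intro!: derivative_eq_intros)
        ultimately have "((\<lambda>s. \<theta> \<omega> X (s * X)) has_real_derivative - rate \<alpha> \<omega> (s * X) (F X (s * X)) (G X (s * X)) * X) (at s)"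
          by (rule DERIV_chain2)
        from DERIV_minus[OF this] show ?thesis
          by (simp add: has_real_derivative_iff_has_vector_derivative mult.commute has_vector_derivative_at_within)
      qed
      then have "((\<lambda>s. X * rate \<alpha> \<omega> (s * X) (F X (s * X)) (G X (s * X))) has_integral (- \<theta> \<omega> X (1 * X) - - \<theta> \<omega> X (0 * X))) {0..1}"
        by (intro fundamental_theorem_of_calculus) auto
      then have "((\<lambda>s. X * rate \<alpha> \<omega> (s * X) (F X (s * X)) (G X (s * X))) has_integral (\<theta> \<omega> X 0 - \<theta> \<omega> X X)) (cbox 0 1)"
        by simp
      from integral_unique[OF this] conjunct1[OF *] show ?thesis by linarith
    qed
    have Fc: "continuous_on S (\<lambda>z. F (a z) (b z))" "continuous_on S (\<lambda>z. G (a z) (b z))"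
      if "continuous_on S a" "continuous_on S b" "\<And>z. z \<in> S \<Longrightarrow> a z \<ge> X0"
      for S :: "'z::topological_space set" and a b
    proof -
      have "continuous_on S ((\<lambda>(X, x). F X x) \<circ> (\<lambda>z. (a z, b z)))" "continuous_on S ((\<lambda>(X, x). G X x) \<circ> (\<lambda>z. (a z, b z)))"
        by (intro continuous_on_compose continuous_on_Pair that continuous_on_subset[OF Fcont] continuous_on_subset[OF Gcont];
            use that(3) in \<open>auto simp: X0_def\<close>)+
      then show "continuous_on S (\<lambda>z. F (a z) (b z))" "continuous_on S (\<lambda>z. G (a z) (b z))" by (simp_all add: o_def)
    qed
    have "continuous_on ({X0..} \<times> cbox 0 1) (\<lambda>z. fst z * rate \<alpha> \<omega> (snd z * fst z) (F (fst z) (snd z * fst z)) (G (fst z) (snd z * fst z)))"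
      by (intro continuous_intros rate_continuous Fc alpha \<omega>) (use nz in auto)
    then have "continuous_on {X0..} (\<lambda>X. integral (cbox 0 1) (\<lambda>s. X * rate \<alpha> \<omega> (s * X) (F X (s * X)) (G X (s * X))))"
      by (intro integral_continuous_on_param) (simp add: case_prod_unfold)
    moreover have "continuous_on {X0..} (\<lambda>X. arctan (G X X / (\<omega> * F X X)))"
      by (intro continuous_intros Fc) (use Fpos \<omega> in \<open>auto simp: less_imp_neq[symmetric]\<close>)
    ultimately have "continuous_on {X0..} (\<lambda>X. arctan (G X X / (\<omega> * F X X)) + integral (cbox 0 1) (\<lambda>s. X * rate \<alpha> \<omega> (s * X) (F X (s * X)) (G X (s * X))))"
      by (rule continuous_on_add[rotated])
    then show ?thesis by (rule continuous_on_cong[OF refl, THEN iffD1, rotated]) (simp add: eq)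
  qed
  have large: "\<exists>X\<ge>X0. - (pi / 2) + \<omega> / 2 * X0 \<le> \<theta> \<omega> X 0" if \<omega>: "\<omega> > 0" for \<omega>
  proof -
    have X0': "X0 > 0" "2 + 8 / \<alpha> \<le> X0\<^sup>2" "X0 \<ge> 4" using start[of X0] by (auto simp: X0_def)
    obtain M where M: "\<And>x y z. 0 \<le> x \<Longrightarrow> x \<le> X0 \<Longrightarrow> M < energy \<alpha> y z \<Longrightarrow> (y \<noteq> 0 \<or> z \<noteq> 0) \<Longrightarrow> \<omega> / 2 \<le> rate \<alpha> \<omega> x y z"
      using rate_lower_bound[OF alpha \<omega> X0'(1)] by metis
    obtain C where C: "\<And>f g X. profile_eq \<alpha> f g \<Longrightarrow> X0 \<le> X \<Longrightarrow> C < X\<^sup>2 * (inv_vel \<alpha> f g X)\<^sup>2 \<Longrightarrow> M < energy \<alpha> (f X0) (g X0)"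
      using energy_large[OF alpha X0'(1,2), of M] by metis
    \<comment> \<open>The quantity to exceed \<open>C\<close> is
      \<open>X\<^sup>2 * (e * X)\<^sup>2 = e\<^sup>2 * X ^ 4\<close>, at least
      \<open>e\<^sup>2 * X\<close> for \<open>X \<ge> 1\<close>; so
      \<open>X > \<bar>C\<bar> / e\<^sup>2\<close> suffices.\<close>
    define X where "X = X0 + \<bar>C\<bar> / e\<^sup>2 + 1"
    have e2: "e\<^sup>2 > 0" using e by simp
    have XX: "X > X0" "X \<ge> 1" "X > \<bar>C\<bar> / e\<^sup>2" using e2 X0' by (simp_all add: X_def add_pos_nonneg add_nonneg_pos)
    have X: "X \<ge> X0" using XX by simp
    have "C < X\<^sup>2 * (inv_vel \<alpha> (F X) (G X) X)\<^sup>2"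
    proof -
      have "C < X * e\<^sup>2" using XX(3) e2 by (simp add: pos_divide_less_eq)
      also have "X * e\<^sup>2 \<le> X ^ 4 * e\<^sup>2" using XX(2) e2 by (intro mult_right_mono) (simp_all add: self_le_power)
      also have "\<dots> = X\<^sup>2 * (e * X)\<^sup>2" by (simp add: power2_eq_square power4_eq_xxxx)
      finally show ?thesis using vel[of X] X by (simp add: X0_def)
    qed
    then have E0: "M < energy \<alpha> (F X X0) (G X X0)" using C[OF sol[OF X] X] by blast
    have E: "M < energy \<alpha> (F X x) (G X x)" if "0 \<le> x" "x \<le> X0" for x
      using profile_energy(1)[OF alpha sol[OF X] that] E0 by linarith
    interpret r: rotation "\<theta> \<omega> X" "\<lambda>x. - rate \<alpha> \<omega> x (F X x) (G X x)" "F X" X by (rule rot[OF \<omega> X])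
    have "\<theta> \<omega> X X0 + \<omega> / 2 * X0 \<le> \<theta> \<omega> X 0 + \<omega> / 2 * 0"
    proof (rule DERIV_nonpos_imp_nonincreasing[of 0 X0 "\<lambda>x. \<theta> \<omega> X x + \<omega> / 2 * x"])
      fix x assume x: "0 \<le> x" "x \<le> X0"
      have "((\<lambda>x. \<theta> \<omega> X x + \<omega> / 2 * x) has_real_derivative - rate \<alpha> \<omega> x (F X x) (G X x) + \<omega> / 2 * 1) (at x)"
        by (intro DERIV_add r.der DERIV_cmult DERIV_ident)
      moreover have "- rate \<alpha> \<omega> x (F X x) (G X x) + \<omega> / 2 * 1 \<le> 0" using M[OF x E[OF x] nz[OF X]] by simp
      ultimately show "\<exists>y. ((\<lambda>x. \<theta> \<omega> X x + \<omega> / 2 * x) has_real_derivative y) (at x) \<and> y \<le> 0" by blast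
    qed (use X0' in simp)
    then have "- (pi / 2) + \<omega> / 2 * X0 \<le> \<theta> \<omega> X 0" using r.above_bottom[OF XX(1)] by simp
    then show ?thesis using X by blast
  qed
  \<comment> \<open>The shot from \<open>X0\<close> is the lower end for the intermediate value
    theorem. Its zeros bound its angle by the same number for every \<omega>.\<close>
  define n0 where "n0 = card {x. 0 < x \<and> x < X0 \<and> F X0 x = 0}"
  have small: "\<theta> \<omega> X0 0 \<le> pi / 2 + real n0 * pi" if "\<omega> > 0" for \<omega>
    using rotation.theta_bound[OF rot[OF that order_refl]] by (simp add: n0_def)
  show ?thesis
  proof (intro exI[of _ "Suc n0"] allI impI)
    fix m assume m: "Suc n0 \<le> m"
    \<comment> \<open>Makes \<open>\<omega> / 2 * X0 = (m + 1) * pi\<close>, so that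
      \<open>large\<close> yields an angle of at least
      \<open>- pi / 2 + (m + 1) * pi = pi / 2 + m * pi\<close>, the larger of the two
      targets.\<close>
    define \<omega> where "\<omega> = 2 * pi * (real m + 1) / X0"
    have "X0 > 0" using X0 by blast
    then have \<omega>: "\<omega> > 0" "\<omega> / 2 * X0 = real m * pi + pi"
      by (simp add: \<omega>_def, simp add: \<omega>_def field_simps)
    obtain Y where Y: "Y \<ge> X0" "- (pi / 2) + \<omega> / 2 * X0 \<le> \<theta> \<omega> Y 0" using large[OF \<omega>(1)] by blast
    have hi: "pi / 2 + real m * pi \<le> \<theta> \<omega> Y 0" using Y(2) \<omega>(2) pi_gt_zero by linarith
    have "(real n0 + 1) * pi \<le> real m * pi" using m by (intro mult_right_mono) auto
    then have lo: "\<theta> \<omega> X0 0 \<le> real m * pi"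
      using small[OF \<omega>(1)] pi_gt_zero by (simp only: distrib_right mult_1)
    have ivt: "\<exists>X\<ge>X0. \<theta> \<omega> X 0 = t" if "real m * pi \<le> t" "t \<le> pi / 2 + real m * pi" for t
    proof -
      have "continuous_on {X0..Y} (\<lambda>X. \<theta> \<omega> X 0)" by (rule continuous_on_subset[OF cont[OF \<omega>(1)]]) auto
      then show ?thesis using IVT'[of "\<lambda>X. \<theta> \<omega> X 0" X0 t Y] lo hi that Y by force
    qed
    have "\<exists>X\<ge>X0. G X 0 = 0 \<and> F X 0 \<noteq> 0 \<and> finite {x. 0 < x \<and> F X x = 0} \<and> card {x. 0 < x \<and> F X x = 0} = m"
    proof -
      obtain X where X: "X \<ge> X0" "\<theta> \<omega> X 0 = real m * pi" using ivt[of "real m * pi"] pi_gt_zero by auto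
      interpret r: rotation "\<theta> \<omega> X" "\<lambda>x. - rate \<alpha> \<omega> x (F X x) (G X x)" "F X" X by (rule rot[OF \<omega>(1) X(1)])
      have "G X 0 = 0"
      proof -
        obtain r where "G X 0 = \<omega> * (r * sin (\<theta> \<omega> X 0))" using \<theta>[OF \<omega>(1) X(1)] unfolding ang_def by blast
        then show ?thesis using X(2) by simp
      qed
      then show ?thesis
        using X(1) nz[OF X(1), of 0] zeros_eq[OF X(1)] r.zeros_finite r.card_zeros_even[OF X(2)] by (intro exI[of _ X]) simp
    qed
    moreover have "\<exists>X\<ge>X0. F X 0 = 0 \<and> finite {x. 0 < x \<and> F X x = 0} \<and> card {x. 0 < x \<and> F X x = 0} = m"
    proof -
      obtain X where X: "X \<ge> X0" "\<theta> \<omega> X 0 = pi / 2 + real m * pi" using ivt[of "pi / 2 + real m * pi"] pi_gt_zero by auto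
      interpret r: rotation "\<theta> \<omega> X" "\<lambda>x. - rate \<alpha> \<omega> x (F X x) (G X x)" "F X" X by (rule rot[OF \<omega>(1) X(1)])
      have "F X 0 = 0"
      proof -
        have "\<theta> \<omega> X 0 = r.level (int m)" by (simp add: r.level_def X(2))
        then have "cos (\<theta> \<omega> X 0) = 0" using r.cos_level by blast
        then show ?thesis using r.zero by blast
      qed
      then show ?thesis
        using X(1) zeros_eq[OF X(1)] r.zeros_finite r.card_zeros_odd[OF X(2)] by (intro exI[of _ X]) simp
    qed
    ultimately show "(\<exists>X\<ge>start_pos \<alpha> \<mu>. G X 0 = 0 \<and> F X 0 \<noteq> 0 \<and> finite {x. 0 < x \<and> F X x = 0} \<and> card {x. 0 < x \<and> F X x = 0} = m) \<and>
      (\<exists>X\<ge>start_pos \<alpha> \<mu>. F X 0 = 0 \<and> finite {x. 0 < x \<and> F X x = 0} \<and> card {x. 0 < x \<and> F X x = 0} = m)"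
      by (simp add: X0_def)
  qed
qed

end

section \<open>Data of a profile on the half line, reflection and change of sign\<close>

definition profile_data :: "real \<Rightarrow> real \<Rightarrow> (real \<Rightarrow> real) \<Rightarrow> (real \<Rightarrow> real) \<Rightarrow> bool" where
  "profile_data \<alpha> \<mu> f g \<longleftrightarrow> profile_eq \<alpha> f g \<and> ((\<lambda>x. x powr (2 / \<alpha>) * f x) \<longlongrightarrow> \<mu>) at_top \<and>
     (\<exists>C. \<forall>x\<ge>0. \<bar>f x\<bar> \<le> C * (1 + x) powr (- 2 / \<alpha>) \<and> \<bar>x * g x\<bar> \<le> C * (1 + x) powr (- 2 / \<alpha>))"

text \<open>The equation is invariant under reflection and under change of sign, so the transformed
  pair is again a profile, and it has the same data at 0. For \<open>s = 1\<close> the conditions at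
  0 say \<open>g 0 = 0\<close>, for \<open>s = -1\<close> they say \<open>f 0 = 0\<close>.\<close>

lemma profile_symmetric:
  assumes "\<alpha> > 0" "profile_eq \<alpha> f g" "s = 1 \<or> s = -1" "f 0 = s * f 0" "g 0 = - s * g 0"
  shows "f (- x) = s * f x" "g (- x) = - s * g x"
proof -
  define f2 where "f2 x = s * f (- x)" for x
  define g2 where "g2 x = - s * g (- x)" for x
  have "(f2 has_real_derivative g2 x) (at x)" for x
  proof -
    have "(f has_real_derivative g (- x)) (at (- x))" using assms by (simp add: profile_eq_def)
    then have "((\<lambda>x. f (- x)) has_real_derivative g (- x) * - 1) (at x)"
      by (rule DERIV_chain2) (auto intro!: derivative_eq_intros)
    from DERIV_cmult[OF this, of s] show ?thesis by (simp add: f2_def[abs_def] g2_def)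
  qed
  moreover have "(g2 has_real_derivative - (x / 2) * g2 x - (f2 x / \<alpha> + nonlin \<alpha> (f2 x))) (at x)" for x
  proof -
    have "(g has_real_derivative - (- x / 2) * g (- x) - (f (- x) / \<alpha> + nonlin \<alpha> (f (- x)))) (at (- x))"
      using assms(2) unfolding profile_eq_def by blast
    then have "((\<lambda>x. g (- x)) has_real_derivative (- (- x / 2) * g (- x) - (f (- x) / \<alpha> + nonlin \<alpha> (f (- x)))) * - 1) (at x)"
      by (rule DERIV_chain2) (auto intro!: derivative_eq_intros)
    from DERIV_cmult[OF this, of "- s"]
    have d: "(g2 has_real_derivative - s * ((- (- x / 2) * g (- x) - (f (- x) / \<alpha> + nonlin \<alpha> (f (- x)))) * - 1)) (at x)"
      by (simp add: g2_def[abs_def])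
    show ?thesis
      by (rule DERIV_cong[OF d]) (use assms(3) in \<open>auto simp: f2_def g2_def nonlin_minus algebra_simps\<close>)
  qed
  ultimately have "profile_eq \<alpha> f2 g2" by (simp add: profile_eq_def)
  moreover have "f 0 = f2 0" "g 0 = g2 0" using assms(4,5) by (simp_all add: f2_def g2_def)
  ultimately have "f x = f2 x" "g x = g2 x" for x
    using profile_unique[OF assms(1,2), of f2 g2 0 x] by auto
  then show "f (- x) = s * f x" "g (- x) = - s * g x"
    using assms(3) by (metis f2_def minus_minus mult_minus1 mult_1, metis g2_def minus_minus mult_minus1 mult_1)
qed


text \<open>Beyond \<open>X\<close>, \<open>f = x powr - \<kappa> * w\<close> and
  \<open>x * g = x powr - \<kappa> * (x * v - \<kappa> * w)\<close>, where the Lyapunov function at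
  \<open>X\<close> bounds \<open>x * v\<close>. On \<open>{0..X}\<close> the energy bounds
  \<open>f\<close> and \<open>g\<close>, and the second summand of \<open>C\<close> makes up for the
  weight.\<close>

lemma (in shot) profile_data:
  assumes lim: "(w \<longlongrightarrow> l) at_top"
  shows "profile_data \<alpha> l f g"
proof -
  obtain R where R: "R > 0" "\<And>x. \<bar>f x\<bar> \<le> R" "\<And>x. \<bar>g x\<bar> \<le> R"
    using profile_bounded[OF alpha sol] by metis
  define B where "B = X\<^sup>2 * (v X)\<^sup>2 / 2 + (\<kappa> * (\<kappa> + 1) * (w X)\<^sup>2 / 2 + \<bar>w X\<bar> powr (\<alpha> + 2) / (\<alpha> + 2))"
  have v_bound: "\<bar>x * v x\<bar> \<le> sqrt (2 * B)" if "X \<le> x" for x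
  proof -
    have "x\<^sup>2 * (v x)\<^sup>2 / 2 \<le> x\<^sup>2 * (v x)\<^sup>2 / 2 + (\<kappa> * (\<kappa> + 1) * (w x)\<^sup>2 / 2 + \<bar>w x\<bar> powr (\<alpha> + 2) / (\<alpha> + 2))"
      using alpha by simp
    also have "\<dots> \<le> B"
      unfolding B_def by (rule inv_lyapunov[OF alpha sol X_ge(2) start(6)[OF X] that])
    finally have "(x * v x)\<^sup>2 \<le> 2 * B" by (simp add: power_mult_distrib)
    then show ?thesis by (metis real_sqrt_abs real_sqrt_le_iff)
  qed
  define A where "A = 2 * \<mu> + sqrt (2 * B) + \<kappa> * (2 * \<mu>)"
  have B0: "sqrt (2 * B) \<ge> 0" using v_bound[OF order_refl] abs_ge_zero[of "X * v X"] by linarith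
  have A0: "A \<ge> 0" using B0 mu alpha by (simp add: A_def)
  define C where "C = 2 powr \<kappa> * A + (R + X * R) * (1 + X) powr \<kappa>"
  have far: "x powr - \<kappa> * t \<le> C * (1 + x) powr - \<kappa>" if x: "X \<le> x" and t: "t \<le> A" for x t
  proof -
    have x1: "x \<ge> 1" using x X_ge by simp
    have "x powr - \<kappa> * t \<le> x powr - \<kappa> * A" using t by (intro mult_left_mono) auto
    also have "x powr - \<kappa> \<le> ((1 + x) / 2) powr - \<kappa>"
      using x1 alpha by (intro powr_mono2') auto
    then have "x powr - \<kappa> * A \<le> ((1 + x) / 2) powr - \<kappa> * A" using A0 by (rule mult_right_mono)
    also have "((1 + x) / 2) powr - \<kappa> = 2 powr \<kappa> * (1 + x) powr - \<kappa>"
      using x1 by (simp add: powr_divide powr_minus field_simps)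
    also have "2 powr \<kappa> * (1 + x) powr - \<kappa> * A \<le> C * (1 + x) powr - \<kappa>"
      using R X_ge by (simp add: C_def algebra_simps)
    finally show ?thesis .
  qed
  have near0: "t \<le> C * (1 + x) powr - \<kappa>" if x: "0 \<le> x" "x \<le> X" and t: "t \<le> R + X * R" for x t
  proof -
    have "(1 + X) powr - \<kappa> \<le> (1 + x) powr - \<kappa>" using x alpha by (intro powr_mono2') auto
    have "t \<le> (R + X * R) * ((1 + X) powr \<kappa> * (1 + X) powr - \<kappa>)"
      using t X_ge by (simp flip: powr_add)
    also have "\<dots> \<le> (R + X * R) * ((1 + X) powr \<kappa> * (1 + x) powr - \<kappa>)"
      using \<open>(1 + X) powr - \<kappa> \<le> (1 + x) powr - \<kappa>\<close> R X_ge by (intro mult_left_mono) auto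
    also have "\<dots> \<le> C * (1 + x) powr - \<kappa>"
      using A0 by (simp add: C_def algebra_simps)
    finally show ?thesis .
  qed
  have "\<bar>f x\<bar> \<le> C * (1 + x) powr - \<kappa> \<and> \<bar>x * g x\<bar> \<le> C * (1 + x) powr - \<kappa>" if x: "0 \<le> x" for x
  proof (cases "X \<le> x")
    case True
    have x0: "x > 0" using True X_ge by simp
    define Q where "Q = x powr \<kappa>"
    have Q: "Q > 0" "x powr - \<kappa> = 1 / Q" using x0 by (auto simp: Q_def powr_minus inverse_eq_divide)
    have "f x = x powr - \<kappa> * w x" using Q by (simp add: inv_pos_def Q_def[symmetric])
    then have f: "\<bar>f x\<bar> = x powr - \<kappa> * \<bar>w x\<bar>" by (simp add: abs_mult)
    have "x * g x = x powr - \<kappa> * (x * v x - \<kappa> * w x)"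
      using Q x0 by (simp add: inv_pos_def inv_vel_def Q_def[symmetric] field_simps)
    then have g: "\<bar>x * g x\<bar> = x powr - \<kappa> * \<bar>x * v x - \<kappa> * w x\<bar>" by (simp add: abs_mult)
    have "\<bar>w x\<bar> \<le> A" using w_bound(1)[OF True] B0 alpha mu by (simp add: A_def add_increasing2)
    moreover have "\<bar>x * v x - \<kappa> * w x\<bar> \<le> A"
    proof -
      have "\<bar>\<kappa> * w x\<bar> \<le> \<kappa> * (2 * \<mu>)" using w_bound(1)[OF True] kappa_nonneg by (simp only: abs_mult abs_of_nonneg mult_left_mono)
      then show ?thesis using v_bound[OF True] mu unfolding A_def by linarith
    qed
    ultimately show ?thesis using far[OF True] f g by simp
  next
    case False
    have "\<bar>f x\<bar> \<le> R + X * R" using R X_ge by (simp add: add_increasing2)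
    moreover have "\<bar>x * g x\<bar> \<le> R + X * R"
    proof -
      have "\<bar>x * g x\<bar> \<le> X * R" using False x R by (auto simp: abs_mult intro!: mult_mono)
      then show ?thesis using R by simp
    qed
    ultimately show ?thesis using near0[OF x, of "\<bar>f x\<bar>"] near0[OF x, of "\<bar>x * g x\<bar>"] False by simp
  qed
  moreover have "- 2 / \<alpha> = - \<kappa>" by simp
  ultimately have "\<exists>C. \<forall>x\<ge>0. \<bar>f x\<bar> \<le> C * (1 + x) powr (- 2 / \<alpha>) \<and> \<bar>x * g x\<bar> \<le> C * (1 + x) powr (- 2 / \<alpha>)"
    by metis
  then show ?thesis
    using sol lim unfolding profile_data_def inv_pos_def by blast
qed

definition zero_count_pos :: "(real \<Rightarrow> real) \<Rightarrow> nat \<Rightarrow> bool" where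
  "zero_count_pos f m \<longleftrightarrow> finite {x. 0 < x \<and> f x = 0} \<and> card {x. 0 < x \<and> f x = 0} = m"

definition even_pair :: "real \<Rightarrow> real \<Rightarrow> nat \<Rightarrow> bool" where
  "even_pair \<alpha> \<mu> m \<longleftrightarrow> (\<exists>f g f2 g2. f \<noteq> f2 \<and> profile_data \<alpha> \<mu> f g \<and> profile_data \<alpha> \<mu> f2 g2 \<and>
       g 0 = 0 \<and> g2 0 = 0 \<and> f 0 \<noteq> 0 \<and> f2 0 \<noteq> 0 \<and> zero_count_pos f m \<and> zero_count_pos f2 m)"

definition odd_pair :: "real \<Rightarrow> real \<Rightarrow> nat \<Rightarrow> bool" where
  "odd_pair \<alpha> \<mu> m \<longleftrightarrow> (\<exists>f g f2 g2. f \<noteq> f2 \<and> profile_data \<alpha> \<mu> f g \<and> profile_data \<alpha> \<mu> f2 g2 \<and>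
       f 0 = 0 \<and> f2 0 = 0 \<and> zero_count_pos f m \<and> zero_count_pos f2 m)"

lemma profiles_exist_pos:
  assumes "\<alpha> > 0" "\<mu> > 0"
  shows "\<exists>m0. \<forall>m\<ge>m0.
    even_pair \<alpha> \<mu> m \<and>
    odd_pair \<alpha> \<mu> m"
proof -
  interpret shooting \<alpha> \<mu> by unfold_locales (use assms in auto)
  define X0 where "X0 = start_pos \<alpha> \<mu>"
  have e: "\<bar>- (\<mu> / 32)\<bar> \<le> \<mu> / 32" "\<bar>\<mu> / 32\<bar> \<le> \<mu> / 32" using mu by auto
  obtain F G where FF: "(\<forall>X\<ge>X0. shot \<alpha> \<mu> (F X) (G X) X \<and> inv_vel \<alpha> (F X) (G X) X = - (\<mu> / 32) * X \<and>
      (inv_pos \<alpha> (F X) \<longlongrightarrow> \<mu>) at_top) \<and>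
    continuous_on ({X0..} \<times> UNIV) (\<lambda>(X, x). F X x) \<and> continuous_on ({X0..} \<times> UNIV) (\<lambda>(X, x). G X x)"
    using shooting_family[OF e(1), folded X0_def] by (elim exE)
  obtain F2 G2 where FF2: "(\<forall>X\<ge>X0. shot \<alpha> \<mu> (F2 X) (G2 X) X \<and> inv_vel \<alpha> (F2 X) (G2 X) X = \<mu> / 32 * X \<and>
      (inv_pos \<alpha> (F2 X) \<longlongrightarrow> \<mu>) at_top) \<and>
    continuous_on ({X0..} \<times> UNIV) (\<lambda>(X, x). F2 X x) \<and> continuous_on ({X0..} \<times> UNIV) (\<lambda>(X, x). G2 X x)"
    using shooting_family[OF e(2), folded X0_def] by (elim exE)
  have F: "shot \<alpha> \<mu> (F X) (G X) X" "inv_vel \<alpha> (F X) (G X) X = - (\<mu> / 32) * X" "(inv_pos \<alpha> (F X) \<longlongrightarrow> \<mu>) at_top"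
    and F2: "shot \<alpha> \<mu> (F2 X) (G2 X) X" "inv_vel \<alpha> (F2 X) (G2 X) X = \<mu> / 32 * X" "(inv_pos \<alpha> (F2 X) \<longlongrightarrow> \<mu>) at_top"
    if "X \<ge> X0" for X
    using conjunct1[OF FF, rule_format, OF that] conjunct1[OF FF2, rule_format, OF that] by simp_all
  have Fc: "continuous_on ({X0..} \<times> UNIV) (\<lambda>(X, x). F X x)" "continuous_on ({X0..} \<times> UNIV) (\<lambda>(X, x). G X x)"
    and F2c: "continuous_on ({X0..} \<times> UNIV) (\<lambda>(X, x). F2 X x)" "continuous_on ({X0..} \<times> UNIV) (\<lambda>(X, x). G2 X x)"
    using FF FF2 by simp_all
  have "- (\<mu> / 32) \<noteq> 0" using mu by simp
  then have "\<exists>m1. \<forall>m\<ge>m1.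
    (\<exists>X\<ge>X0. G X 0 = 0 \<and> F X 0 \<noteq> 0 \<and> zero_count_pos (F X) m) \<and> (\<exists>X\<ge>X0. F X 0 = 0 \<and> zero_count_pos (F X) m)"
    unfolding zero_count_pos_def by (rule zeros_prescribed[folded X0_def, OF _ F(1,2) Fc])
  then obtain m1 where m1: "\<forall>m\<ge>m1.
    (\<exists>X\<ge>X0. G X 0 = 0 \<and> F X 0 \<noteq> 0 \<and> zero_count_pos (F X) m) \<and> (\<exists>X\<ge>X0. F X 0 = 0 \<and> zero_count_pos (F X) m)"
    by (elim exE)
  have "\<mu> / 32 \<noteq> 0" using mu by simp
  then have "\<exists>m2. \<forall>m\<ge>m2.
    (\<exists>X\<ge>X0. G2 X 0 = 0 \<and> F2 X 0 \<noteq> 0 \<and> zero_count_pos (F2 X) m) \<and> (\<exists>X\<ge>X0. F2 X 0 = 0 \<and> zero_count_pos (F2 X) m)"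
    unfolding zero_count_pos_def by (rule zeros_prescribed[folded X0_def, OF _ F2(1,2) F2c])
  then obtain m2 where m2: "\<forall>m\<ge>m2.
    (\<exists>X\<ge>X0. G2 X 0 = 0 \<and> F2 X 0 \<noteq> 0 \<and> zero_count_pos (F2 X) m) \<and> (\<exists>X\<ge>X0. F2 X 0 = 0 \<and> zero_count_pos (F2 X) m)"
    by (elim exE)
  have pd: "profile_data \<alpha> \<mu> (F X) (G X)" "profile_data \<alpha> \<mu> (F2 X) (G2 X)" if "X \<ge> X0" for X
    by (rule shot.profile_data[OF F(1)[OF that] F(3)[OF that]], rule shot.profile_data[OF F2(1)[OF that] F2(3)[OF that]])
  have ne: "F X \<noteq> F2 Y" if "X \<ge> X0" "Y \<ge> X0" for X Y
    by (rule shots_differ[OF F(1)[OF that(1)] F2(1)[OF that(2)] F(2)[OF that(1)] F2(2)[OF that(2)]])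
  show ?thesis
  proof (intro exI[of _ "max m1 m2"] allI impI conjI)
    fix m assume m: "max m1 m2 \<le> m"
    obtain X Y where "X \<ge> X0" "G X 0 = 0" "F X 0 \<noteq> 0" "zero_count_pos (F X) m"
       "Y \<ge> X0" "G2 Y 0 = 0" "F2 Y 0 \<noteq> 0" "zero_count_pos (F2 Y) m"
      using m1 m2 m by (meson max.boundedE)
    note * = this
    show "even_pair \<alpha> \<mu> m"
      unfolding even_pair_def
      by (rule exI[of _ "F X"], rule exI[of _ "G X"], rule exI[of _ "F2 Y"], rule exI[of _ "G2 Y"]) (use * pd ne in auto)
    obtain X Y where "X \<ge> X0" "F X 0 = 0" "zero_count_pos (F X) m"
       "Y \<ge> X0" "F2 Y 0 = 0" "zero_count_pos (F2 Y) m"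
      using m1 m2 m by (meson max.boundedE)
    note * = this
    show "odd_pair \<alpha> \<mu> m"
      unfolding odd_pair_def
      by (rule exI[of _ "F X"], rule exI[of _ "G X"], rule exI[of _ "F2 Y"], rule exI[of _ "G2 Y"]) (use * pd ne in auto)
  qed
qed

lemma profile_data_minus:
  assumes "profile_data \<alpha> \<mu> f g"
  shows "profile_data \<alpha> (- \<mu>) (\<lambda>x. - f x) (\<lambda>x. - g x)"
  unfolding profile_data_def
proof (intro conjI)
  show "profile_eq \<alpha> (\<lambda>x. - f x) (\<lambda>x. - g x)"
    unfolding profile_eq_def
  proof (intro allI conjI)
    fix x
    have d: "(f has_real_derivative g x) (at x)"
      "(g has_real_derivative - (x / 2) * g x - (f x / \<alpha> + nonlin \<alpha> (f x))) (at x)"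
      using assms unfolding profile_data_def profile_eq_def by blast+
    show "((\<lambda>x. - f x) has_real_derivative - g x) (at x)" by (rule DERIV_minus[OF d(1)])
    show "((\<lambda>x. - g x) has_real_derivative - (x / 2) * - g x - (- f x / \<alpha> + nonlin \<alpha> (- f x))) (at x)"
      by (rule DERIV_cong[OF DERIV_minus[OF d(2)]]) (simp add: nonlin_minus)
  qed
  have "((\<lambda>x. - (x powr (2 / \<alpha>) * f x)) \<longlongrightarrow> - \<mu>) at_top"
    by (intro tendsto_minus) (use assms in \<open>simp add: profile_data_def\<close>)
  then show "((\<lambda>x. x powr (2 / \<alpha>) * - f x) \<longlongrightarrow> - \<mu>) at_top" by simp
  show "\<exists>C. \<forall>x\<ge>0. \<bar>- f x\<bar> \<le> C * (1 + x) powr (- 2 / \<alpha>) \<and> \<bar>x * - g x\<bar> \<le> C * (1 + x) powr (- 2 / \<alpha>)"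
    using assms by (simp add: profile_data_def)
qed

lemma profiles_exist:
  assumes "\<alpha> > 0" "\<mu> \<noteq> 0"
  shows "\<exists>m0. \<forall>m\<ge>m0.
    even_pair \<alpha> \<mu> m \<and>
    odd_pair \<alpha> \<mu> m"
proof (cases "\<mu> > 0")
  case True
  then show ?thesis using profiles_exist_pos[OF assms(1)] by simp
next
  case False
  then have "- \<mu> > 0" using assms by simp
  from profiles_exist_pos[OF assms(1) this] obtain m0
    where m0: "\<And>m. m \<ge> m0 \<Longrightarrow> even_pair \<alpha> (- \<mu>) m \<and> odd_pair \<alpha> (- \<mu>) m" by auto
  have z: "zero_count_pos (\<lambda>x. - f x) m = zero_count_pos f m" for f m by (simp add: zero_count_pos_def)
  have ne: "(\<lambda>x. - f x) \<noteq> (\<lambda>x. - f2 x)" if "f \<noteq> f2" for f f2 :: "real \<Rightarrow> real"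
    using that by (auto simp: fun_eq_iff)
  have pd: "profile_data \<alpha> \<mu> (\<lambda>x. - f x) (\<lambda>x. - g x)" if "profile_data \<alpha> (- \<mu>) f g" for f g
    using profile_data_minus[OF that] by simp
  show ?thesis
  proof (intro exI[of _ m0] allI impI conjI)
    fix m assume "m \<ge> m0"
    note m0 = m0[OF this]
    from conjunct1[OF m0, unfolded even_pair_def] obtain f g f2 g2 where *: "f \<noteq> f2" "profile_data \<alpha> (- \<mu>) f g" "profile_data \<alpha> (- \<mu>) f2 g2"
       "g 0 = 0" "g2 0 = 0" "f 0 \<noteq> 0" "f2 0 \<noteq> 0" "zero_count_pos f m" "zero_count_pos f2 m" by blast
    show "even_pair \<alpha> \<mu> m"
      unfolding even_pair_def
      by (rule exI[of _ "\<lambda>x. - f x"], rule exI[of _ "\<lambda>x. - g x"], rule exI[of _ "\<lambda>x. - f2 x"], rule exI[of _ "\<lambda>x. - g2 x"])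
        (use * pd ne z in auto)
    from conjunct2[OF m0, unfolded odd_pair_def] obtain f g f2 g2 where *: "f \<noteq> f2" "profile_data \<alpha> (- \<mu>) f g" "profile_data \<alpha> (- \<mu>) f2 g2"
       "f 0 = 0" "f2 0 = 0" "zero_count_pos f m" "zero_count_pos f2 m" by blast
    show "odd_pair \<alpha> \<mu> m"
      unfolding odd_pair_def
      by (rule exI[of _ "\<lambda>x. - f x"], rule exI[of _ "\<lambda>x. - g x"], rule exI[of _ "\<lambda>x. - f2 x"], rule exI[of _ "\<lambda>x. - g2 x"])
        (use * pd ne z in auto)
  qed
qed

lemma zeros_even:
  assumes "zero_count_pos f m" "\<And>x. f (- x) = f x" "f 0 \<noteq> 0"
  shows "has_exactly_zeros f (2 * m)"
proof -
  define Z where "Z = {x. 0 < x \<and> f x = 0}"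
  have Z: "finite Z" "card Z = m" using assms(1) by (auto simp: zero_count_pos_def Z_def)
  have "{x. f x = 0} = Z \<union> uminus ` Z"
  proof (intro equalityI subsetI)
    fix x assume "x \<in> {x. f x = 0}"
    then have "f x = 0" "x \<noteq> 0" using assms(3) by auto
    then show "x \<in> Z \<union> uminus ` Z"
      using assms(2)[of x] by (cases "x > 0") (auto simp: Z_def image_iff intro!: exI[of _ "- x"])
  qed (use assms(2) in \<open>auto simp: Z_def\<close>)
  moreover have "Z \<inter> uminus ` Z = {}" by (auto simp: Z_def)
  moreover have "card (uminus ` Z) = m" using Z by (simp add: card_image)
  ultimately show ?thesis using Z by (simp add: has_exactly_zeros_def card_Un_disjoint)
qed

lemma zeros_odd:
  assumes "zero_count_pos f m" "\<And>x. f (- x) = - f x"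
  shows "has_exactly_zeros f (2 * m + 1)"
proof -
  define Z where "Z = {x. 0 < x \<and> f x = 0}"
  have Z: "finite Z" "card Z = m" using assms(1) by (auto simp: zero_count_pos_def Z_def)
  have f0: "f 0 = 0" using assms(2)[of 0] by simp
  have "{x. f x = 0} = insert 0 (Z \<union> uminus ` Z)"
  proof (intro equalityI subsetI)
    fix x assume "x \<in> {x. f x = 0}"
    then have "f x = 0" by auto
    then show "x \<in> insert 0 (Z \<union> uminus ` Z)"
      using assms(2)[of x] by (cases x "0::real" rule: linorder_cases) (auto simp: Z_def image_iff intro!: exI[of _ "- x"])
  qed (use assms(2) f0 in \<open>auto simp: Z_def\<close>)
  moreover have "Z \<inter> uminus ` Z = {}" "0 \<notin> Z \<union> uminus ` Z" by (auto simp: Z_def)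
  moreover have "card (uminus ` Z) = m" using Z by (simp add: card_image)
  ultimately show ?thesis using Z by (simp add: has_exactly_zeros_def card_Un_disjoint)
qed

section \<open>Lebesgue spaces\<close>

lemma powr_sum_le:
  fixes a b r :: real
  assumes "r > 0"
  shows "\<bar>a + b\<bar> powr r \<le> 2 powr r * (\<bar>a\<bar> powr r + \<bar>b\<bar> powr r)"
proof -
  have "\<bar>a + b\<bar> powr r \<le> (2 * max \<bar>a\<bar> \<bar>b\<bar>) powr r"
    using assms by (intro powr_mono2) auto
  also have "\<dots> = 2 powr r * max \<bar>a\<bar> \<bar>b\<bar> powr r" by (simp add: powr_mult)
  also have "max \<bar>a\<bar> \<bar>b\<bar> powr r \<le> \<bar>a\<bar> powr r + \<bar>b\<bar> powr r" by (auto simp: max_def)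
  finally show ?thesis by simp
qed

lemma Lp_dominated:
  assumes "h \<in> borel_measurable M" "integrable M (\<lambda>x. H x powr r)" "r > 0"
    and "\<And>x. x \<in> space M \<Longrightarrow> \<bar>h x\<bar> \<le> H x"
  shows "h \<in> Lp M r"
proof -
  have [measurable]: "h \<in> borel_measurable M" by fact
  have "integrable M (\<lambda>x. \<bar>h x\<bar> powr r)"
    by (rule Bochner_Integration.integrable_bound[OF assms(2)])
      (auto intro!: AE_I2 powr_mono2 assms(4) less_imp_le[OF assms(3)])
  then show ?thesis by (simp add: Lp_def)
qed

lemma Lp_add:
  assumes "f \<in> Lp M r" "g \<in> Lp M r" "r > 0"
  shows "(\<lambda>x. f x + g x) \<in> Lp M r"
proof -
  have [measurable]: "f \<in> borel_measurable M" "g \<in> borel_measurable M" using assms by (auto simp: Lp_def)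
  have "integrable M (\<lambda>x. \<bar>f x + g x\<bar> powr r)"
  proof (rule Bochner_Integration.integrable_bound)
    show "integrable M (\<lambda>x. 2 powr r * (\<bar>f x\<bar> powr r + \<bar>g x\<bar> powr r))"
      using assms by (auto simp: Lp_def)
    show "AE x in M. norm (\<bar>f x + g x\<bar> powr r) \<le> norm (2 powr r * (\<bar>f x\<bar> powr r + \<bar>g x\<bar> powr r))"
      using powr_sum_le[OF assms(3)] by (auto simp: abs_mult add_nonneg_nonneg)
  qed measurable
  then show ?thesis by (simp add: Lp_def)
qed

lemma Lp_minus: "f \<in> Lp M r \<Longrightarrow> (\<lambda>x. - f x) \<in> Lp M r"
  by (auto simp: Lp_def)

lemma Lp_norm_tendsto_0:
  assumes "((\<lambda>t. \<integral>x. \<bar>d t x\<bar> powr r \<partial>M) \<longlongrightarrow> 0) F" "r > 0"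
  shows "((\<lambda>t. Lp_norm M r (d t)) \<longlongrightarrow> 0) F"
proof -
  have "((\<lambda>t. (\<integral>x. \<bar>d t x\<bar> powr r \<partial>M) powr (1 / r)) \<longlongrightarrow> 0 powr (1 / r)) F"
    by (intro tendsto_powr' assms tendsto_const) (use assms in \<open>auto intro!: always_eventually integral_nonneg_AE\<close>)
  then show ?thesis using assms(2) by (simp add: Lp_norm_def)
qed

lemma tendsto_Lp_dominated:
  fixes u :: "real \<Rightarrow> 'a \<Rightarrow> real"
  assumes r: "r > 0" and v: "v \<in> Lp M r"
    and meas: "\<And>t. t \<in> S - {a} \<Longrightarrow> u t \<in> borel_measurable M"
    and H: "integrable M (\<lambda>x. H x powr r)"
    and dom: "\<forall>\<^sub>F t in at a within S. \<forall>x\<in>space M. \<bar>u t x - v x\<bar> \<le> H x"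
    and lim: "AE x in M. ((\<lambda>t. u t x) \<longlongrightarrow> v x) (at a within S)"
  shows "tendsto_Lp M r u v (at a within S)"
  unfolding tendsto_Lp_def
proof (intro conjI Lp_norm_tendsto_0 r v)
  have [measurable]: "v \<in> borel_measurable M" using v by (simp add: Lp_def)
  have inS: "\<forall>\<^sub>F t in at a within S. t \<in> S - {a}" by (simp add: eventually_at_filter)
  show "\<forall>\<^sub>F t in at a within S. u t \<in> Lp M r"
    using dom inS
  proof eventually_elim
    case (elim t)
    have [measurable]: "u t \<in> borel_measurable M" using meas elim by blast
    have "(\<lambda>x. u t x - v x) \<in> Lp M r"
      by (rule Lp_dominated[OF _ H r]) (use elim in auto)
    from Lp_add[OF this v r] show ?case by simp
  qed
  show "((\<lambda>t. \<integral>x. \<bar>u t x - v x\<bar> powr r \<partial>M) \<longlongrightarrow> 0) (at a within S)"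
    unfolding tendsto_at_iff_sequentially o_def
  proof (intro allI impI)
    fix X assume X: "\<forall>i. X i \<in> S - {a}" "X \<longlonglongrightarrow> a"
    have fX: "filterlim X (at a within S) sequentially"
      using X by (auto simp: filterlim_at)
    have [measurable]: "u (X i) \<in> borel_measurable M" for i using meas X by blast
    obtain N where N: "\<And>i. i \<ge> N \<Longrightarrow> \<forall>x\<in>space M. \<bar>u (X i) x - v x\<bar> \<le> H x"
      using filterlim_iff[THEN iffD1, OF fX, rule_format, OF dom] by (auto simp: eventually_sequentially)
    have "(\<lambda>i. \<integral>x. \<bar>u (X (i + N)) x - v x\<bar> powr r \<partial>M) \<longlonglongrightarrow> (\<integral>x. 0 \<partial>M)"
    proof (rule integral_dominated_convergence[OF _ _ H])
      show "AE x in M. (\<lambda>i. \<bar>u (X (i + N)) x - v x\<bar> powr r) \<longlonglongrightarrow> 0"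
        using lim
      proof eventually_elim
        case (elim x)
        have "(\<lambda>i. u (X i) x) \<longlonglongrightarrow> v x" using filterlim_compose[OF elim fX] .
        then have "(\<lambda>i. u (X (i + N)) x) \<longlonglongrightarrow> v x" by (rule LIMSEQ_ignore_initial_segment)
        then have "(\<lambda>i. \<bar>u (X (i + N)) x - v x\<bar>) \<longlonglongrightarrow> \<bar>v x - v x\<bar>" by (intro tendsto_intros)
        then have "(\<lambda>i. \<bar>u (X (i + N)) x - v x\<bar> powr r) \<longlonglongrightarrow> \<bar>v x - v x\<bar> powr r"
          by (rule tendsto_powr') (use r in auto)
        then show ?case using r by simp
      qed
      show "AE x in M. norm (\<bar>u (X (i + N)) x - v x\<bar> powr r) \<le> H x powr r" for i
        using N[of "i + N"] r by (auto intro!: AE_I2 powr_mono2)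
    qed auto
    then have "(\<lambda>i. \<integral>x. \<bar>u (X (i + N)) x - v x\<bar> powr r \<partial>M) \<longlonglongrightarrow> 0" by simp
    then show "(\<lambda>i. \<integral>x. \<bar>u (X i) x - v x\<bar> powr r \<partial>M) \<longlonglongrightarrow> 0" by (rule LIMSEQ_offset)
  qed
qed

text \<open>The Radon-Riesz property in concrete form. Scheffe's lemma gives convergence of
  \<open>\<bar>u n\<bar> powr r\<close> in \<open>L\<^sup>1\<close>; then
  \<open>\<bar>u n - v\<bar> powr r\<close> is split into a part dominated by a multiple of
  \<open>\<bar>v\<bar> powr r\<close> and a remainder controlled by that convergence.\<close>

lemma Lp_convergence_of_norms:
  assumes r: "r > 0" and v: "v \<in> Lp M r" and u: "\<And>n. u n \<in> Lp M r"
    and lim: "\<And>x. (\<lambda>n. u n x) \<longlonglongrightarrow> v x"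
    and norms: "(\<lambda>n. \<integral>x. \<bar>u n x\<bar> powr r \<partial>M) \<longlonglongrightarrow> (\<integral>x. \<bar>v x\<bar> powr r \<partial>M)"
  shows "(\<lambda>n. \<integral>x. \<bar>u n x - v x\<bar> powr r \<partial>M) \<longlonglongrightarrow> 0"
proof -
  have [measurable]: "v \<in> borel_measurable M" "\<And>n. u n \<in> borel_measurable M" using u v by (auto simp: Lp_def)
  define a where "a x = \<bar>v x\<bar> powr r" for x
  define b where "b n x = \<bar>u n x\<bar> powr r" for n x
  have ab: "integrable M a" "integrable M (b n)" for n using u v by (auto simp: Lp_def a_def[abs_def] b_def[abs_def])
  have [measurable]: "a \<in> borel_measurable M" "b n \<in> borel_measurable M" for n using ab by auto
  have b_lim: "(\<lambda>n. b n x) \<longlonglongrightarrow> a x" for x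
    unfolding a_def b_def by (intro tendsto_powr' tendsto_rabs lim tendsto_const) (use r in auto)
  have nn: "(\<integral>\<^sup>+ x. norm (b n x) \<partial>M) = ennreal (integral\<^sup>L M (b n))" "(\<integral>\<^sup>+ x. norm (a x) \<partial>M) = ennreal (integral\<^sup>L M a)" for n
  proof -
    have nonneg: "norm (a x) = a x" "norm (b n x) = b n x" for n x by (simp_all add: a_def b_def)
    show "(\<integral>\<^sup>+ x. norm (b n x) \<partial>M) = ennreal (integral\<^sup>L M (b n))" "(\<integral>\<^sup>+ x. norm (a x) \<partial>M) = ennreal (integral\<^sup>L M a)"
      unfolding nonneg by (intro nn_integral_eq_integral ab AE_I2; simp add: a_def b_def)+
  qed
  have "(\<lambda>n. \<integral>\<^sup>+ x. norm (b n x - a x) \<partial>M) \<longlonglongrightarrow> 0"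
  proof (rule Scheffe_lemma1)
    have "(\<lambda>n. ennreal (integral\<^sup>L M (b n))) \<longlonglongrightarrow> ennreal (integral\<^sup>L M a)"
      using norms by (intro tendsto_ennrealI) (simp add: a_def[abs_def] b_def[abs_def])
    then show "limsup (\<lambda>n. \<integral>\<^sup>+ x. norm (b n x) \<partial>M) \<le> (\<integral>\<^sup>+ x. norm (a x) \<partial>M)"
      unfolding nn by (simp add: lim_imp_Limsup)
  qed (use ab b_lim in auto)
  moreover have "(\<integral>\<^sup>+ x. norm (b n x - a x) \<partial>M) = ennreal (\<integral>x. \<bar>b n x - a x\<bar> \<partial>M)" for n
    using ab by (simp add: nn_integral_eq_integral)
  ultimately have "(\<lambda>n. ennreal (\<integral>x. \<bar>b n x - a x\<bar> \<partial>M)) \<longlonglongrightarrow> ennreal 0" by simp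
  then have L1: "(\<lambda>n. \<integral>x. \<bar>b n x - a x\<bar> \<partial>M) \<longlonglongrightarrow> 0"
    by (subst (asm) tendsto_ennreal_iff) auto
  define m where "m n x = min (\<bar>u n x - v x\<bar> powr r) (2 powr r * (2 * a x))" for n x
  have [measurable]: "m n \<in> borel_measurable M" for n unfolding m_def[abs_def] by measurable
  have a_int: "integrable M (\<lambda>x. 2 powr r * (2 * a x))" using ab by simp
  have m0: "(\<lambda>n. integral\<^sup>L M (m n)) \<longlonglongrightarrow> (\<integral>x. 0 \<partial>M)"
  proof (rule integral_dominated_convergence[where w = "\<lambda>x. 2 powr r * (2 * a x)"])
    show "AE x in M. (\<lambda>n. m n x) \<longlonglongrightarrow> 0"
    proof (rule AE_I2)
      fix x
      have "(\<lambda>n. \<bar>u n x - v x\<bar>) \<longlonglongrightarrow> \<bar>v x - v x\<bar>" by (intro tendsto_intros lim)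
      then have "(\<lambda>n. \<bar>u n x - v x\<bar> powr r) \<longlonglongrightarrow> \<bar>v x - v x\<bar> powr r"
        by (rule tendsto_powr') (use r in auto)
      then have z: "(\<lambda>n. \<bar>u n x - v x\<bar> powr r) \<longlonglongrightarrow> 0" using r by simp
      show "(\<lambda>n. m n x) \<longlonglongrightarrow> 0"
        by (rule tendsto_sandwich[OF _ _ tendsto_const z]) (auto simp: m_def a_def)
    qed
    show "integrable M (\<lambda>x. 2 powr r * (2 * a x))" by (rule a_int)
    show "AE x in M. norm (m n x) \<le> 2 powr r * (2 * a x)" for n by (simp add: m_def a_def)
  qed measurable
  have m_int: "integrable M (m n)" for n
    by (rule Bochner_Integration.integrable_bound[OF a_int]) (measurable, simp add: m_def a_def)
  \<comment> \<open>Since \<open>b n x + a x \<le> 2 * a x + \<bar>b n x - a x\<bar>\<close>, what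
    exceeds the cap \<open>2 powr r * (2 * a x)\<close> in \<open>m\<close> is at most
    \<open>2 powr r * \<bar>b n x - a x\<bar>\<close>.\<close>
  have le: "\<bar>u n x - v x\<bar> powr r \<le> m n x + 2 powr r * \<bar>b n x - a x\<bar>" for n x
  proof -
    have "\<bar>u n x - v x\<bar> powr r \<le> 2 powr r * (b n x + a x)"
      using powr_sum_le[OF r, of "u n x" "- v x"] by (simp add: a_def b_def)
    also have "\<dots> \<le> 2 powr r * (2 * a x + \<bar>b n x - a x\<bar>)" by (intro mult_left_mono) auto
    finally have "\<bar>u n x - v x\<bar> powr r \<le> 2 powr r * (2 * a x) + 2 powr r * \<bar>b n x - a x\<bar>"
      by (simp only: distrib_left)
    moreover have "0 \<le> 2 powr r * \<bar>b n x - a x\<bar>" by simp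
    ultimately show ?thesis unfolding m_def by linarith
  qed
  have d_int: "integrable M (\<lambda>x. \<bar>u n x - v x\<bar> powr r)" for n
    using Lp_add[OF u Lp_minus[OF v] r] by (simp add: Lp_def)
  have "(\<lambda>n. integral\<^sup>L M (m n) + 2 powr r * (\<integral>x. \<bar>b n x - a x\<bar> \<partial>M)) \<longlonglongrightarrow> 0 + 2 powr r * 0"
    by (intro tendsto_intros L1) (use m0 in simp)
  then have z: "(\<lambda>n. integral\<^sup>L M (m n) + 2 powr r * (\<integral>x. \<bar>b n x - a x\<bar> \<partial>M)) \<longlonglongrightarrow> 0" by simp
  show ?thesis
  proof (rule tendsto_sandwich[OF _ _ tendsto_const z])
    show "\<forall>\<^sub>F n in sequentially. 0 \<le> (\<integral>x. \<bar>u n x - v x\<bar> powr r \<partial>M)" by (auto intro!: always_eventually)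
    show "\<forall>\<^sub>F n in sequentially. (\<integral>x. \<bar>u n x - v x\<bar> powr r \<partial>M) \<le>
        integral\<^sup>L M (m n) + 2 powr r * (\<integral>x. \<bar>b n x - a x\<bar> \<partial>M)"
    proof (rule always_eventually, rule allI)
      fix n
      have "(\<integral>x. \<bar>u n x - v x\<bar> powr r \<partial>M) \<le> (\<integral>x. m n x + 2 powr r * \<bar>b n x - a x\<bar> \<partial>M)"
        by (intro integral_mono d_int le Bochner_Integration.integrable_add m_int) (use ab in auto)
      also have "\<dots> = integral\<^sup>L M (m n) + 2 powr r * (\<integral>x. \<bar>b n x - a x\<bar> \<partial>M)"
        using m_int ab by (subst Bochner_Integration.integral_add) auto
      finally show "(\<integral>x. \<bar>u n x - v x\<bar> powr r \<partial>M) \<le> integral\<^sup>L M (m n) + 2 powr r * (\<integral>x. \<bar>b n x - a x\<bar> \<partial>M)" .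
    qed
  qed
qed

lemma Lp_continuous_on_cong:
  assumes "\<And>t. t \<in> I \<Longrightarrow> u t = v t"
  shows "Lp_continuous_on M r I u = Lp_continuous_on M r I v"
proof -
  have "tendsto_Lp M r u (u t) (at t within I) = tendsto_Lp M r v (v t) (at t within I)" if "t \<in> I" for t
  proof -
    have ev: "\<forall>\<^sub>F s in at t within I. s \<in> I" by (simp add: eventually_at_filter)
    have 1: "(\<forall>\<^sub>F s in at t within I. u s \<in> Lp M r) = (\<forall>\<^sub>F s in at t within I. v s \<in> Lp M r)"
      by (rule eventually_cong[OF ev]) (use assms in auto)
    have 2: "((\<lambda>s. Lp_norm M r (\<lambda>x. u s x - u t x)) \<longlongrightarrow> 0) (at t within I) =
        ((\<lambda>s. Lp_norm M r (\<lambda>x. v s x - v t x)) \<longlongrightarrow> 0) (at t within I)"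
      by (rule tendsto_cong) (use ev assms that in \<open>auto elim!: eventually_mono\<close>)
    show ?thesis unfolding tendsto_Lp_def 1 2 using assms that by simp
  qed
  then show ?thesis using assms by (auto simp: Lp_continuous_on_def)
qed

section \<open>Self-similar functions in Lebesgue spaces\<close>

text \<open>The common form of \<open>u\<close>, of its derivatives, of the nonlinear term, of the
  heat evolution of the initial value and of the Duhamel term, with different exponents \<beta>.
  Continuity in time is proved for it once.\<close>

definition scaled :: "real \<Rightarrow> (real \<Rightarrow> real) \<Rightarrow> real \<Rightarrow> real \<Rightarrow> real" where
  "scaled \<beta> \<phi> t x = t powr \<beta> * \<phi> (x / sqrt t)"

lemma integral_dilate:
  fixes \<phi> :: "real \<Rightarrow> real"
  assumes "t > 0"
  shows "integrable lborel (\<lambda>x. \<phi> (x / sqrt t)) \<longleftrightarrow> integrable lborel \<phi>"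
    and "(\<integral>x. \<phi> (x / sqrt t) \<partial>lborel) = sqrt t * (\<integral>x. \<phi> x \<partial>lborel)"
proof -
  have c: "1 / sqrt t \<noteq> 0" using assms by simp
  show "integrable lborel (\<lambda>x. \<phi> (x / sqrt t)) \<longleftrightarrow> integrable lborel \<phi>"
    using lborel_integrable_real_affine_iff[OF c, of \<phi> 0] by simp
  show "(\<integral>x. \<phi> (x / sqrt t) \<partial>lborel) = sqrt t * (\<integral>x. \<phi> x \<partial>lborel)"
    using lborel_integral_real_affine[OF c, of \<phi> 0] assms by (simp add: field_simps)
qed

lemma abs_scaled_powr:
  assumes "t > 0"
  shows "\<bar>scaled \<beta> \<phi> t x\<bar> powr r = t powr (\<beta> * r) * \<bar>\<phi> (x / sqrt t)\<bar> powr r"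
  using assms by (simp add: scaled_def abs_mult powr_mult powr_powr)

lemma scaled_Lp:
  assumes "t > 0" "\<phi> \<in> Lp lborel r"
  shows "scaled \<beta> \<phi> t \<in> Lp lborel r"
    and "(\<integral>x. \<bar>scaled \<beta> \<phi> t x\<bar> powr r \<partial>lborel) = t powr (\<beta> * r + 1 / 2) * (\<integral>x. \<bar>\<phi> x\<bar> powr r \<partial>lborel)"
proof -
  have [measurable]: "\<phi> \<in> borel_measurable borel" using assms by (simp add: Lp_def)
  have m: "scaled \<beta> \<phi> t \<in> borel_measurable lborel" unfolding scaled_def[abs_def] by measurable
  show "scaled \<beta> \<phi> t \<in> Lp lborel r"
    using assms m integral_dilate(1)[OF assms(1), of "\<lambda>x. \<bar>\<phi> x\<bar> powr r"]
    by (simp add: Lp_def abs_scaled_powr)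
  show "(\<integral>x. \<bar>scaled \<beta> \<phi> t x\<bar> powr r \<partial>lborel) = t powr (\<beta> * r + 1 / 2) * (\<integral>x. \<bar>\<phi> x\<bar> powr r \<partial>lborel)"
    using assms(1) integral_dilate(2)[OF assms(1), of "\<lambda>x. \<bar>\<phi> x\<bar> powr r"]
    by (simp add: abs_scaled_powr powr_add powr_half_sqrt)
qed

text \<open>Pointwise convergence comes from the continuity of \<phi>, and the norm is an explicit
  power of \<open>t\<close>; so \<open>Lp_convergence_of_norms\<close> applies without a dominating
  function.\<close>

lemma scaled_Lp_norm_continuous:
  assumes r: "r > 0" and \<phi>: "\<phi> \<in> Lp lborel r" "continuous_on UNIV \<phi>" and t: "t > 0"
  shows "tendsto_Lp lborel r (scaled \<beta> \<phi>) (scaled \<beta> \<phi> t) (at t within S)"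
  unfolding tendsto_Lp_def
proof (intro conjI Lp_norm_tendsto_0 r scaled_Lp(1) t \<phi>(1))
  have pos: "\<forall>\<^sub>F s in at t within S. s > 0"
    using t eventually_nhds_in_open[of "{0<..}" t] by (auto simp: eventually_at_filter elim!: eventually_mono)
  then show "\<forall>\<^sub>F s in at t within S. scaled \<beta> \<phi> s \<in> Lp lborel r"
    by (rule eventually_mono) (intro scaled_Lp(1) \<phi>(1))
  show "((\<lambda>s. \<integral>x. \<bar>scaled \<beta> \<phi> s x - scaled \<beta> \<phi> t x\<bar> powr r \<partial>lborel) \<longlongrightarrow> 0) (at t within S)"
    unfolding tendsto_at_iff_sequentially o_def
  proof (intro allI impI)
    fix X assume X: "\<forall>i. X i \<in> S - {t}" "X \<longlonglongrightarrow> t"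
    obtain N where N: "\<And>i. i \<ge> N \<Longrightarrow> X i > 0"
      using order_tendstoD(1)[OF X(2) t] by (auto simp: eventually_sequentially)
    have XN: "(\<lambda>i. X (i + N)) \<longlonglongrightarrow> t" using X(2) by (rule LIMSEQ_ignore_initial_segment)
    have "(\<lambda>i. \<integral>x. \<bar>scaled \<beta> \<phi> (X (i + N)) x - scaled \<beta> \<phi> t x\<bar> powr r \<partial>lborel) \<longlonglongrightarrow> 0"
    proof (rule Lp_convergence_of_norms[OF r])
      show "scaled \<beta> \<phi> t \<in> Lp lborel r" "scaled \<beta> \<phi> (X (n + N)) \<in> Lp lborel r" for n
        by (intro scaled_Lp(1) t \<phi>(1) N; simp)+
      show "(\<lambda>n. scaled \<beta> \<phi> (X (n + N)) x) \<longlonglongrightarrow> scaled \<beta> \<phi> t x" for x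
        unfolding scaled_def
        by (intro tendsto_intros continuous_on_tendsto_compose[OF \<phi>(2)] XN) (use t in auto)
      have "(\<lambda>n. X (n + N) powr (\<beta> * r + 1 / 2) * (\<integral>x. \<bar>\<phi> x\<bar> powr r \<partial>lborel)) \<longlonglongrightarrow> t powr (\<beta> * r + 1 / 2) * (\<integral>x. \<bar>\<phi> x\<bar> powr r \<partial>lborel)"
        by (intro tendsto_intros XN) (use t in auto)
      then show "(\<lambda>n. \<integral>x. \<bar>scaled \<beta> \<phi> (X (n + N)) x\<bar> powr r \<partial>lborel) \<longlonglongrightarrow> (\<integral>x. \<bar>scaled \<beta> \<phi> t x\<bar> powr r \<partial>lborel)"
        using scaled_Lp(2)[OF _ \<phi>(1)] N t by simp
    qed
    then show "(\<lambda>i. \<integral>x. \<bar>scaled \<beta> \<phi> (X i) x - scaled \<beta> \<phi> t x\<bar> powr r \<partial>lborel) \<longlonglongrightarrow> 0"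
      by (rule LIMSEQ_offset)
  qed
qed

lemma scaled_Lp_continuous_on:
  assumes "r > 0" "\<phi> \<in> Lp lborel r" "continuous_on UNIV \<phi>"
  shows "Lp_continuous_on lborel r {0<..} (scaled \<beta> \<phi>)"
  unfolding Lp_continuous_on_def using assms scaled_Lp(1) scaled_Lp_norm_continuous by auto

lemma integrable_japanese:
  fixes p :: real
  assumes "p > 1"
  shows "integrable lborel (\<lambda>x::real. (1 + \<bar>x\<bar>) powr (- p))"
proof -
  have "(\<integral>\<^sup>+(x::real). ennreal ((1 + \<bar>x\<bar>) powr (- p)) * indicator {0..} x \<partial>lborel) = 0 - (- ((1 + 0) powr (1 - p) / (p - 1)))"
  proof (rule nn_integral_FTC_atLeast[where F = "\<lambda>x. - ((1 + x) powr (1 - p) / (p - 1))"])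
    show "((\<lambda>x. - ((1 + x) powr (1 - p) / (p - 1))) has_real_derivative (1 + \<bar>x\<bar>) powr (- p)) (at x)" if "0 \<le> x" for x
    proof -
      have "((\<lambda>x. (1 + x) powr (1 - p)) has_real_derivative (1 - p) * (1 + x) powr (1 - p - 1) * 1) (at x)"
        using that by (intro DERIV_chain2[OF has_real_derivative_powr]) (auto intro!: derivative_eq_intros)
      note d = DERIV_minus[OF DERIV_cdivide[OF this, of "p - 1"]]
      have "(1 - p) * y / (p - 1) = - y" for y using assms by (simp add: field_simps)
      then have "- ((1 - p) * (1 + x) powr (1 - p - 1) * 1 / (p - 1)) = (1 + \<bar>x\<bar>) powr (- p)"
        using that by simp
      with d show ?thesis by (simp only:)
    qed
    have "((\<lambda>x. (1 + x) powr (1 - p)) \<longlongrightarrow> 0) at_top"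
      using assms filterlim_tendsto_add_at_top[OF tendsto_const[of "1::real"] filterlim_ident]
      by (intro tendsto_neg_powr) auto
    then have "((\<lambda>x. - ((1 + x) powr (1 - p) / (p - 1))) \<longlongrightarrow> - (0 / (p - 1))) at_top"
      by (intro tendsto_intros) (use assms in auto)
    then show "((\<lambda>x. - ((1 + x) powr (1 - p) / (p - 1))) \<longlongrightarrow> 0) at_top" by simp
  qed auto
  then have fin: "(\<integral>\<^sup>+(x::real). ennreal ((1 + \<bar>x\<bar>) powr (- p)) * indicator {0..} x \<partial>lborel) < \<infinity>" by simp
  have "(\<integral>\<^sup>+(x::real). ennreal ((1 + \<bar>x\<bar>) powr (- p)) \<partial>lborel) \<le>
     (\<integral>\<^sup>+(x::real). ennreal ((1 + \<bar>x\<bar>) powr (- p)) * indicator {0..} x + ennreal ((1 + \<bar>x\<bar>) powr (- p)) * indicator {0..} (- x) \<partial>lborel)"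
    by (intro nn_integral_mono) (auto split: split_indicator)
  also have "\<dots> = (\<integral>\<^sup>+(x::real). ennreal ((1 + \<bar>x\<bar>) powr (- p)) * indicator {0..} x \<partial>lborel) +
      (\<integral>\<^sup>+(x::real). ennreal ((1 + \<bar>x\<bar>) powr (- p)) * indicator {0..} (- x) \<partial>lborel)"
    by (intro nn_integral_add) auto
  also have "(\<integral>\<^sup>+(x::real). ennreal ((1 + \<bar>x\<bar>) powr (- p)) * indicator {0..} (- x) \<partial>lborel) =
     (\<integral>\<^sup>+(x::real). ennreal ((1 + \<bar>x\<bar>) powr (- p)) * indicator {0..} x \<partial>lborel)"
    using nn_integral_real_affine[of "\<lambda>x::real. ennreal ((1 + \<bar>x\<bar>) powr (- p)) * indicator {0..} x" "-1" 0] by simp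
  also have "(\<integral>\<^sup>+(x::real). ennreal ((1 + \<bar>x\<bar>) powr (- p)) * indicator {0..} x \<partial>lborel) +
     (\<integral>\<^sup>+(x::real). ennreal ((1 + \<bar>x\<bar>) powr (- p)) * indicator {0..} x \<partial>lborel) < \<infinity>"
    using fin by (simp add: ennreal_add_less_top)
  finally have "(\<integral>\<^sup>+(x::real). ennreal ((1 + \<bar>x\<bar>) powr (- p)) \<partial>lborel) < \<infinity>" .
  then show ?thesis by (intro integrableI_bounded) auto
qed

lemma integrable_powr_unit:
  fixes p :: real
  assumes "0 \<le> p" "p < 1"
  shows "integrable lborel (\<lambda>x. \<bar>x\<bar> powr (- p) * indicator {x. \<bar>x\<bar> \<le> 1} x)"
proof -
  have "(\<lambda>x. x powr (- p)) integrable_on {0..1}"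
    by (rule integrable_on_powr_from_0) (use assms in auto)
  then have "(\<lambda>x. x powr (- p)) absolutely_integrable_on {0..1}"
    by (rule nonnegative_absolutely_integrable_1) auto
  then have "set_integrable lebesgue {0..1} (\<lambda>x. x powr (- p))" .
  then have "set_integrable lborel {0..1} (\<lambda>x. x powr (- p))"
    unfolding set_integrable_def by (subst (asm) integrable_completion) auto
  then have 1: "integrable lborel (\<lambda>x. indicator {0..1} x *\<^sub>R x powr (- p))" by (simp add: set_integrable_def)
  have "integrable lborel (\<lambda>x. indicator {0..1} (0 + (- 1) * x) *\<^sub>R (0 + (- 1) * x) powr (- p))"
    by (rule lborel_integrable_real_affine[OF 1]) simp
  then have 2: "integrable lborel (\<lambda>x. indicator {0..1} (- x) *\<^sub>R (- x) powr (- p))" by simp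
  show ?thesis
    by (rule Bochner_Integration.integrable_bound[OF Bochner_Integration.integrable_add[OF 1 2]])
      (auto split: split_indicator intro!: AE_I2)
qed

section \<open>The self-similar solution of a profile\<close>

lemma self_similar_scaled: "self_similar \<alpha> \<phi> = scaled (- (1 / \<alpha>)) \<phi>"
  by (simp add: self_similar_def scaled_def fun_eq_iff)

text \<open>The limits at the two ends are independent parameters, so that even and odd profiles are
  treated together.\<close>

locale decaying_profile =
  fixes \<alpha> :: real and f g :: "real \<Rightarrow> real" and \<mu>\<^sub>1 \<mu>\<^sub>2 C :: real
  assumes alpha: "\<alpha> > 0" and ode: "profile_eq \<alpha> f g"
    and f_le: "\<And>x. \<bar>f x\<bar> \<le> C * (1 + \<bar>x\<bar>) powr (- (2 / \<alpha>))"
    and g_le: "\<And>x. \<bar>x * g x\<bar> \<le> C * (1 + \<bar>x\<bar>) powr (- (2 / \<alpha>))"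
    and lim_right: "((\<lambda>x. x powr (2 / \<alpha>) * f x) \<longlongrightarrow> \<mu>\<^sub>1) at_top"
    and lim_left: "((\<lambda>x. x powr (2 / \<alpha>) * f (- x)) \<longlongrightarrow> \<mu>\<^sub>2) at_top"
begin

abbreviation k :: real where "k \<equiv> 2 / \<alpha>"

text \<open>As \<open>0 powr y = 0\<close>, the value at 0 is 0; for the corresponding
  \<open>\<mu>\<^sub>1\<close> and \<open>\<mu>\<^sub>2\<close> the function equals the initial
  values of the theorem everywhere, not only almost everywhere.\<close>

definition u0 :: "real \<Rightarrow> real" where
  "u0 x = (if x > 0 then \<mu>\<^sub>1 else \<mu>\<^sub>2) * \<bar>x\<bar> powr (- k)"

definition f2 :: "real \<Rightarrow> real" where
  "f2 x = - (x / 2) * g x - (f x / \<alpha> + nonlin \<alpha> (f x))"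

text \<open>The derivative of \<open>t powr (- (1 / \<alpha>)) * f (x / sqrt t)\<close> with respect
  to \<open>t\<close> at \<open>t = 1\<close>. It contains \<open>x * g x\<close>, which is why the
  decay assumption is on this product.\<close>

definition ft :: "real \<Rightarrow> real" where
  "ft x = - f x / \<alpha> - x / 2 * g x"

abbreviation u :: "real \<Rightarrow> real \<Rightarrow> real" where "u \<equiv> scaled (- (1 / \<alpha>)) f"
abbreviation ux :: "real \<Rightarrow> real \<Rightarrow> real" where "ux \<equiv> scaled (- (1 / \<alpha>) - 1 / 2) g"
abbreviation uxx :: "real \<Rightarrow> real \<Rightarrow> real" where "uxx \<equiv> scaled (- (1 / \<alpha>) - 1) f2"
abbreviation ut :: "real \<Rightarrow> real \<Rightarrow> real" where "ut \<equiv> scaled (- (1 / \<alpha>) - 1) ft"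
abbreviation un :: "real \<Rightarrow> real \<Rightarrow> real" where "un \<equiv> scaled (- (1 / \<alpha>) - 1) (\<lambda>y. nonlin \<alpha> (f y))"

lemma k_pos: "k > 0" using alpha by simp

lemma f': "(f has_real_derivative g x) (at x)" and g': "(g has_real_derivative f2 x) (at x)"
  using ode by (simp_all add: profile_eq_def f2_def)

lemma cont_f: "continuous_on S f" and cont_g: "continuous_on S g"
  using f' g' by (auto intro!: continuous_at_imp_continuous_on DERIV_isCont)

lemma cont_nonlin: "continuous_on S (\<lambda>x. nonlin \<alpha> (f x))"
  by (rule continuous_on_compose2[OF continuous_on_nonlin[OF alpha, of UNIV] cont_f]) auto

lemma cont_f2: "continuous_on S f2"
  unfolding f2_def by (intro continuous_intros cont_f cont_g cont_nonlin) (use alpha in auto)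

lemma cont_ft: "continuous_on S ft"
  unfolding ft_def by (intro continuous_intros cont_f cont_g) (use alpha in auto)

lemma C_nonneg: "C \<ge> 0"
  using f_le[of 0] by simp

lemma f_bounded: "\<bar>f x\<bar> \<le> C"
proof -
  have "(1 + \<bar>x\<bar>) powr (- k) \<le> 1 powr (- k)" using k_pos by (intro powr_mono2') auto
  then show ?thesis using f_le[of x] C_nonneg mult_left_mono[of "(1 + \<bar>x\<bar>) powr (- k)" 1 C] by simp
qed

text \<open>\<open>k * (\<alpha> + 1) = k + 2\<close>: the gain of two powers makes the nonlinear
  term integrable for every \<alpha>, even where \<open>f\<close> decays too slowly for
  that.\<close>

lemma nonlin_decay: "\<bar>nonlin \<alpha> (f x)\<bar> \<le> C powr (\<alpha> + 1) * (1 + \<bar>x\<bar>) powr (- (k + 2))"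
proof -
  have "\<bar>f x\<bar> powr (\<alpha> + 1) \<le> (C * (1 + \<bar>x\<bar>) powr (- k)) powr (\<alpha> + 1)"
    using f_le alpha by (intro powr_mono2) auto
  also have "\<dots> = C powr (\<alpha> + 1) * (1 + \<bar>x\<bar>) powr (- k * (\<alpha> + 1))"
    using C_nonneg by (simp add: powr_mult powr_powr)
  also have "- k * (\<alpha> + 1) = - (k + 2)" using alpha by (simp add: distrib_left)
  finally show ?thesis unfolding abs_nonlin .
qed

definition decaying :: "(real \<Rightarrow> real) \<Rightarrow> bool" where
  "decaying \<phi> \<longleftrightarrow> (\<exists>A\<ge>0. \<forall>x. \<bar>\<phi> x\<bar> \<le> A * (1 + \<bar>x\<bar>) powr (- k))"

lemma decaying_add: "decaying \<phi> \<Longrightarrow> decaying \<psi> \<Longrightarrow> decaying (\<lambda>x. \<phi> x + \<psi> x)"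
proof -
  assume "decaying \<phi>" "decaying \<psi>"
  then obtain A B where "A \<ge> 0" "B \<ge> 0" and A: "\<And>x. \<bar>\<phi> x\<bar> \<le> A * (1 + \<bar>x\<bar>) powr (- k)" and B: "\<And>x. \<bar>\<psi> x\<bar> \<le> B * (1 + \<bar>x\<bar>) powr (- k)"
    by (auto simp: decaying_def)
  moreover have "\<bar>\<phi> x + \<psi> x\<bar> \<le> (A + B) * (1 + \<bar>x\<bar>) powr (- k)" for x
    using A[of x] B[of x] abs_triangle_ineq[of "\<phi> x" "\<psi> x"] by (simp only: distrib_right)
  ultimately show ?thesis unfolding decaying_def by (intro exI[of _ "A + B"]) auto
qed

lemma decaying_cmult: "decaying \<phi> \<Longrightarrow> decaying (\<lambda>x. c * \<phi> x)"
proof -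
  assume "decaying \<phi>"
  then obtain A where "A \<ge> 0" and A: "\<And>x. \<bar>\<phi> x\<bar> \<le> A * (1 + \<bar>x\<bar>) powr (- k)" by (auto simp: decaying_def)
  moreover have "\<bar>c * \<phi> x\<bar> \<le> (\<bar>c\<bar> * A) * (1 + \<bar>x\<bar>) powr (- k)" for x
    using mult_left_mono[OF A[of x], of "\<bar>c\<bar>"] by (simp add: abs_mult mult.assoc)
  ultimately show ?thesis unfolding decaying_def by (intro exI[of _ "\<bar>c\<bar> * A"]) auto
qed

lemma decaying_f: "decaying f" and decaying_xg: "decaying (\<lambda>x. x * g x)"
  using f_le g_le C_nonneg by (auto simp: decaying_def)

lemma decaying_nonlin: "decaying (\<lambda>x. nonlin \<alpha> (f x))"
  unfolding decaying_def
proof (intro exI[of _ "C powr (\<alpha> + 1)"] conjI allI)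
  fix x
  have "(1 + \<bar>x\<bar>) powr (- (k + 2)) \<le> (1 + \<bar>x\<bar>) powr (- k)" by (intro powr_mono) auto
  then show "\<bar>nonlin \<alpha> (f x)\<bar> \<le> C powr (\<alpha> + 1) * (1 + \<bar>x\<bar>) powr (- k)"
    using nonlin_decay[of x] by (meson mult_left_mono order_trans powr_ge_zero)
qed simp

lemma decaying_ft: "decaying ft"
proof -
  have "ft = (\<lambda>x. (- (1 / \<alpha>)) * f x + (- 1 / 2) * (x * g x))" by (simp add: ft_def fun_eq_iff)
  then show ?thesis by (simp only: decaying_add decaying_cmult decaying_f decaying_xg)
qed

lemma decaying_f2: "decaying f2"
proof -
  have "f2 = (\<lambda>x. ((- (1 / \<alpha>)) * f x + (- 1 / 2) * (x * g x)) + (- 1) * nonlin \<alpha> (f x))"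
    by (simp add: f2_def fun_eq_iff)
  then show ?thesis by (simp only: decaying_add decaying_cmult decaying_f decaying_xg decaying_nonlin)
qed

lemma f2_bounded: "\<exists>B\<ge>0. \<forall>x. \<bar>f2 x\<bar> \<le> B" and ft_bounded: "\<exists>B\<ge>0. \<forall>x. \<bar>ft x\<bar> \<le> B"
proof -
  have "\<exists>B\<ge>0. \<forall>x. \<bar>\<phi> x\<bar> \<le> B" if d: "decaying \<phi>" for \<phi>
  proof -
    obtain A where A: "A \<ge> 0" "\<And>x. \<bar>\<phi> x\<bar> \<le> A * (1 + \<bar>x\<bar>) powr (- k)" using d by (auto simp: decaying_def)
    have "\<bar>\<phi> x\<bar> \<le> A" for x
    proof -
      have "(1 + \<bar>x\<bar>) powr (- k) \<le> 1 powr (- k)" using k_pos by (intro powr_mono2') auto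
      then show ?thesis using A(2)[of x] mult_left_mono[of "(1 + \<bar>x\<bar>) powr (- k)" 1 A] A(1) by simp
    qed
    then show ?thesis using A(1) by blast
  qed
  then show "\<exists>B\<ge>0. \<forall>x. \<bar>f2 x\<bar> \<le> B" "\<exists>B\<ge>0. \<forall>x. \<bar>ft x\<bar> \<le> B" using decaying_f2 decaying_ft by auto
qed

lemma powr_japanese_integrable:
  assumes "\<alpha> / 2 < r" "A \<ge> 0"
  shows "integrable lborel (\<lambda>x::real. (A * (1 + \<bar>x\<bar>) powr (- k)) powr r)"
proof -
  have "k * r > 1" using assms alpha by (simp add: field_simps)
  from integrable_japanese[OF this] have "integrable lborel (\<lambda>x. A powr r * (1 + \<bar>x\<bar>) powr (- (k * r)))" by simp
  then show ?thesis using assms(2) by (simp add: powr_mult powr_powr)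
qed

lemma decaying_Lp:
  assumes "decaying \<phi>" "continuous_on UNIV \<phi>" "\<alpha> / 2 < r"
  shows "\<phi> \<in> Lp lborel r"
proof -
  obtain A where A: "A \<ge> 0" "\<And>x. \<bar>\<phi> x\<bar> \<le> A * (1 + \<bar>x\<bar>) powr (- k)" using assms(1) by (auto simp: decaying_def)
  show ?thesis
    by (rule Lp_dominated[OF _ powr_japanese_integrable[OF assms(3) A(1)] _ A(2)])
      (use assms alpha in \<open>auto intro: borel_measurable_continuous_onI\<close>)
qed

lemma DERIV_u_x:
  assumes "t > 0"
  shows "(u t has_real_derivative ux t x) (at x)" "(ux t has_real_derivative uxx t x) (at x)"
proof -
  have d: "((\<lambda>x. x / sqrt t) has_real_derivative 1 / sqrt t) (at x)" by (rule DERIV_cdivide[OF DERIV_ident])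
  have p: "t powr (\<beta> - 1 / 2) * y = t powr \<beta> * (y * (1 / sqrt t))" for \<beta> y
  proof -
    have "t powr (\<beta> - 1 / 2) = t powr \<beta> / sqrt t"
      by (simp only: powr_diff powr_half_sqrt[OF less_imp_le[OF assms]])
    then show ?thesis by (simp only: times_divide_eq_left times_divide_eq_right mult_1_right)
  qed
  show "(u t has_real_derivative ux t x) (at x)"
    unfolding scaled_def p by (rule DERIV_cmult[OF DERIV_chain2[OF f' d]])
  have e: "- (1 / \<alpha>) - 1 = (- (1 / \<alpha>) - 1 / 2) - 1 / 2" by simp
  show "(ux t has_real_derivative uxx t x) (at x)"
    unfolding scaled_def e p[of "- (1 / \<alpha>) - 1 / 2"] by (rule DERIV_cmult[OF DERIV_chain2[OF g' d]])
qed

lemma DERIV_u_t: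
  assumes "t > 0"
  shows "((\<lambda>s. u s x) has_real_derivative ut t x) (at t)"
proof -
  have s: "((\<lambda>s. x / sqrt s) has_real_derivative - (x / sqrt t) / (2 * t)) (at t)"
  proof -
    have "((\<lambda>s. x / sqrt s) has_real_derivative (0 * sqrt t - x * (inverse (sqrt t) / 2)) / (sqrt t * sqrt t)) (at t)"
      by (rule DERIV_divide[OF DERIV_const DERIV_real_sqrt[OF assms]]) (use assms in simp)
    moreover have "(0 * s - x * (inverse s / 2)) / (s * s) = - (x / s) / (2 * (s * s))" for s
      by (simp add: inverse_eq_divide)
    moreover have "sqrt t * sqrt t = t" using assms by simp
    ultimately show ?thesis by metis
  qed
  have "((\<lambda>s. s powr (- (1 / \<alpha>)) * f (x / sqrt s)) has_real_derivative
    (- (1 / \<alpha>)) * t powr (- (1 / \<alpha>) - 1) * f (x / sqrt t) +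
    g (x / sqrt t) * (- (x / sqrt t) / (2 * t)) * t powr (- (1 / \<alpha>))) (at t)"
    by (rule DERIV_mult[OF has_real_derivative_powr[OF assms] DERIV_chain2[OF f' s]])
  moreover have "t powr (- (1 / \<alpha>)) = t * t powr (- (1 / \<alpha>) - 1)"
    using assms powr_add[of t 1 "- (1 / \<alpha>) - 1"] by simp
  ultimately show ?thesis
    using assms by (simp add: scaled_def[abs_def] ft_def algebra_simps)
qed

lemma nonlin_u:
  assumes "t > 0"
  shows "nonlin \<alpha> (u t x) = un t x"
proof -
  have "(t powr (- (1 / \<alpha>))) powr \<alpha> = t powr (- 1)" using alpha by (simp add: powr_powr)
  moreover have "t powr (- (1 / \<alpha>) - 1) = t powr (- 1) * t powr (- (1 / \<alpha>))"
  proof -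
    have e: "- (1 / \<alpha>) - 1 = - 1 + - (1 / \<alpha>)" by simp
    show ?thesis unfolding e powr_add ..
  qed
  ultimately show ?thesis by (simp add: nonlin_def scaled_def abs_mult powr_mult)
qed

lemma heat_equation: "ut t x = uxx t x + un t x"
  by (simp add: scaled_def ft_def f2_def algebra_simps)

lemma scaled_continuous:
  assumes "continuous_on UNIV \<phi>"
  shows "continuous_on ({0<..} \<times> UNIV) (\<lambda>(t, x). scaled \<beta> \<phi> t x)"
  unfolding scaled_def case_prod_unfold
  by (intro continuous_intros continuous_on_compose2[OF assms]) auto

lemma classical: "classical_solution \<alpha> u"
  unfolding classical_solution_def
proof (rule exI[of _ ut], rule exI[of _ ux], rule exI[of _ uxx], intro conjI allI impI)
  show "continuous_on ({0<..} \<times> UNIV) (\<lambda>(t, x). ut t x)" "continuous_on ({0<..} \<times> UNIV) (\<lambda>(t, x). uxx t x)"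
    by (rule scaled_continuous[OF cont_ft], rule scaled_continuous[OF cont_f2])
  fix t x :: real assume t: "0 < t"
  show "((\<lambda>s. u s x) has_real_derivative ut t x) (at t)" by (rule DERIV_u_t[OF t])
  show "(u t has_real_derivative ux t x) (at x)" "(ux t has_real_derivative uxx t x) (at x)"
    by (rule DERIV_u_x[OF t])+
  show "ut t x = uxx t x + nonlin \<alpha> (u t x)" unfolding nonlin_u[OF t] by (rule heat_equation)
qed

lemma C2_profile: "C2 f"
  unfolding C2_def using f' g' cont_f2 by blast

lemma regular: "regular_self_similar_solution \<alpha> f"
  using classical C2_profile by (simp add: regular_self_similar_solution_def self_similar_scaled)

section \<open>Initial values\<close>

definition sup\<mu> :: real where "sup\<mu> = max \<bar>\<mu>\<^sub>1\<bar> \<bar>\<mu>\<^sub>2\<bar>"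

lemma u0_le: "\<bar>u0 x\<bar> \<le> sup\<mu> * \<bar>x\<bar> powr (- k)"
  unfolding u0_def abs_mult sup\<mu>_def by (intro mult_mono) auto

text \<open>The first bound is free of \<open>t\<close> because \<open>t powr (- (1 / \<alpha>)) *
  \<bar>x / sqrt t\<bar> powr (- k) = \<bar>x\<bar> powr (- k)\<close>. It yields the dominating
  functions for all limits as \<open>t\<close> tends to 0.\<close>

lemma u_le:
  assumes "t > 0"
  shows "x \<noteq> 0 \<Longrightarrow> \<bar>u t x\<bar> \<le> C * \<bar>x\<bar> powr (- k)" "\<bar>u t x\<bar> \<le> C * t powr (- (1 / \<alpha>))"
proof -
  show "\<bar>u t x\<bar> \<le> C * t powr (- (1 / \<alpha>))"
    using f_bounded[of "x / sqrt t"] by (simp add: scaled_def abs_mult mult.commute mult_right_mono)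
  show "\<bar>u t x\<bar> \<le> C * \<bar>x\<bar> powr (- k)" if "x \<noteq> 0"
  proof -
    have "(1 + \<bar>x / sqrt t\<bar>) powr (- k) \<le> \<bar>x / sqrt t\<bar> powr (- k)"
      using that assms k_pos by (intro powr_mono2') auto
    also have "\<dots> = \<bar>x\<bar> powr (- k) * t powr (1 / \<alpha>)"
      using assms by (simp add: powr_divide powr_minus powr_powr flip: powr_half_sqrt) (simp add: field_simps)
    finally have "t powr (- (1 / \<alpha>)) * (1 + \<bar>x / sqrt t\<bar>) powr (- k) \<le> t powr (- (1 / \<alpha>)) * (\<bar>x\<bar> powr (- k) * t powr (1 / \<alpha>))"
      by (rule mult_left_mono) simp
    also have "\<dots> = \<bar>x\<bar> powr (- k)" using assms by (simp add: powr_minus)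
    finally have "C * (t powr (- (1 / \<alpha>)) * (1 + \<bar>x / sqrt t\<bar>) powr (- k)) \<le> C * \<bar>x\<bar> powr (- k)"
      by (rule mult_left_mono) (rule C_nonneg)
    moreover have "\<bar>u t x\<bar> \<le> t powr (- (1 / \<alpha>)) * (C * (1 + \<bar>x / sqrt t\<bar>) powr (- k))"
      using f_le[of "x / sqrt t"] by (simp add: scaled_def abs_mult mult_left_mono)
    ultimately show ?thesis by (simp add: mult_ac)
  qed
qed

lemma integrable_powr_outer:
  fixes p \<epsilon> :: real
  assumes "p > 1" "\<epsilon> > 0"
  shows "integrable lborel (\<lambda>x. \<bar>x\<bar> powr (- p) * indicator {x. \<epsilon> < \<bar>x\<bar>} x)"
proof (rule Bochner_Integration.integrable_bound)
  show "integrable lborel (\<lambda>x::real. (\<epsilon> / (1 + \<epsilon>)) powr (- p) * (1 + \<bar>x\<bar>) powr (- p))"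
    using integrable_japanese[OF assms(1)] by simp
  have "\<bar>x\<bar> powr (- p) \<le> (\<epsilon> / (1 + \<epsilon>)) powr (- p) * (1 + \<bar>x\<bar>) powr (- p)" if "\<epsilon> < \<bar>x\<bar>" for x
  proof -
    have "\<epsilon> / (1 + \<epsilon>) * (1 + \<bar>x\<bar>) \<le> \<bar>x\<bar>" using that assms(2) by (simp add: field_simps)
    then have "\<bar>x\<bar> powr (- p) \<le> (\<epsilon> / (1 + \<epsilon>) * (1 + \<bar>x\<bar>)) powr (- p)"
      using assms by (intro powr_mono2') (auto intro!: mult_pos_pos add_pos_nonneg)
    also have "\<dots> = (\<epsilon> / (1 + \<epsilon>)) powr (- p) * (1 + \<bar>x\<bar>) powr (- p)"
      by (rule powr_mult)
    finally show ?thesis .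
  qed
  then show "AE x in lborel. norm (\<bar>x\<bar> powr (- p) * indicator {x. \<epsilon> < \<bar>x\<bar>} x) \<le>
      norm ((\<epsilon> / (1 + \<epsilon>)) powr (- p) * (1 + \<bar>x\<bar>) powr (- p))"
    by (intro AE_I2) (auto simp: abs_mult split: split_indicator)
qed measurable

lemma meas_u0 [measurable]: "u0 \<in> borel_measurable borel"
  unfolding u0_def[abs_def] by measurable

lemma meas_f [measurable]: "f \<in> borel_measurable borel"
  by (intro borel_measurable_continuous_onI cont_f)

lemma meas_scaled:
  assumes [measurable]: "\<phi> \<in> borel_measurable borel"
  shows "scaled \<beta> \<phi> t \<in> borel_measurable borel"
  unfolding scaled_def[abs_def] by measurable

lemma meas_u [measurable]: "u t \<in> borel_measurable borel"
  by (rule meas_scaled) measurable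

lemma sup\<mu>_nonneg: "sup\<mu> \<ge> 0" by (simp add: sup\<mu>_def le_max_iff_disj)

lemma u_minus_u0_le:
  assumes "t > 0" "x \<noteq> 0"
  shows "\<bar>u t x - u0 x\<bar> \<le> (C + sup\<mu>) * \<bar>x\<bar> powr (- k)"
  using u_le(1)[OF assms] u0_le[of x] abs_triangle_ineq4[of "u t x" "u0 x"] by (simp only: distrib_right)

text \<open>For \<open>x > 0\<close> and \<open>y = x / sqrt t\<close> one has
  \<open>u t x = x powr (- k) * (y powr k * f y)\<close>, and \<open>y\<close> tends to infinity as
  \<open>t\<close> tends to 0; for \<open>x < 0\<close> the limit at the other end enters.\<close>

lemma u_tendsto_u0:
  assumes "x \<noteq> 0"
  shows "((\<lambda>t. u t x) \<longlongrightarrow> u0 x) (at_right 0)"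
proof -
  have base: "t powr (- (1 / \<alpha>)) = y powr (- k) * (y / sqrt t) powr k" if "t > 0" "y > 0" for t y
  proof -
    have "sqrt t powr k = t powr (1 / \<alpha>)" using that by (simp add: powr_powr flip: powr_half_sqrt)
    moreover have "y powr (- k) * y powr k = 1" using that by (simp flip: powr_add)
    ultimately show ?thesis using that by (simp add: powr_divide powr_minus_divide)
  qed
  have lim: "filterlim (\<lambda>t. y / sqrt t) at_top (at_right 0)" if "y > 0" for y :: real
    using that by real_asymp
  show ?thesis
  proof (cases "x > 0")
    case True
    have "((\<lambda>t. x powr (- k) * ((x / sqrt t) powr k * f (x / sqrt t))) \<longlongrightarrow> x powr (- k) * \<mu>\<^sub>1) (at_right 0)"
      by (intro tendsto_mult tendsto_const filterlim_compose[OF lim_right lim[OF True]])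
    moreover have "\<forall>\<^sub>F t in at_right 0. x powr (- k) * ((x / sqrt t) powr k * f (x / sqrt t)) = u t x"
      using eventually_at_right_less[of 0] by eventually_elim (simp add: scaled_def base[OF _ True])
    ultimately show ?thesis using True by (auto simp: u0_def mult.commute dest: Lim_transform_eventually)
  next
    case False
    then have x: "- x > 0" using assms by simp
    have "((\<lambda>t. (- x) powr (- k) * ((- x / sqrt t) powr k * f (- (- x / sqrt t)))) \<longlongrightarrow> (- x) powr (- k) * \<mu>\<^sub>2) (at_right 0)"
      by (intro tendsto_mult tendsto_const filterlim_compose[OF lim_left lim[OF x]])
    moreover have "\<forall>\<^sub>F t in at_right 0. (- x) powr (- k) * ((- x / sqrt t) powr k * f (- (- x / sqrt t))) = u t x"
      using eventually_at_right_less[of 0] by eventually_elim (simp add: scaled_def base[OF _ x])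
    ultimately show ?thesis using x by (auto simp: u0_def mult.commute dest: Lim_transform_eventually)
  qed
qed

lemma eventually_pos: "\<forall>\<^sub>F t::real in at_right 0. t > 0"
  by (rule eventually_at_right_less)

text \<open>Dominated convergence: away from 0 the \<open>q\<close>-th power of
  \<open>\<bar>x\<bar> powr (- k)\<close> is integrable because \<open>k * q > 1\<close>.\<close>

lemma initial_value_A: "initial_value_A \<alpha> u u0"
  unfolding initial_value_A_def
proof (intro allI impI, elim conjE)
  fix \<epsilon> q :: real assume \<epsilon>: "\<epsilon> > 0" and q: "1 \<le> q" "\<alpha> / 2 < q"
  define M where "M = restrict_space lborel {x::real. \<epsilon> < \<bar>x\<bar>}"
  have kq: "k * q > 1" using q alpha by (simp add: field_simps)
  have int: "integrable M (\<lambda>x. (A * \<bar>x\<bar> powr (- k)) powr q)" if "A \<ge> 0" for A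
  proof -
    have "integrable lborel (\<lambda>x. A powr q * (\<bar>x\<bar> powr (- (k * q)) * indicator {x. \<epsilon> < \<bar>x\<bar>} x))"
      using integrable_powr_outer[OF kq \<epsilon>] by simp
    then have "integrable lborel (\<lambda>x. indicator {x. \<epsilon> < \<bar>x\<bar>} x *\<^sub>R (A * \<bar>x\<bar> powr (- k)) powr q)"
      using that by (simp add: powr_mult powr_powr mult_ac)
    then show ?thesis unfolding M_def by (subst integrable_restrict_space) auto
  qed
  have meas: "h \<in> borel_measurable M" if "h \<in> borel_measurable borel" for h :: "real \<Rightarrow> real"
    unfolding M_def using that by (intro measurable_restrict_space1) simp
  have sp: "space M = {x. \<epsilon> < \<bar>x\<bar>}" by (simp add: M_def space_restrict_space)
  have u0Lp: "u0 \<in> Lp M q"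
    by (rule Lp_dominated[OF meas[OF meas_u0] int[OF sup\<mu>_nonneg] _ u0_le]) (use q in auto)
  have "tendsto_Lp M q u u0 (at_right 0)"
  proof (rule tendsto_Lp_dominated[OF _ u0Lp])
    show "integrable M (\<lambda>x. ((C + sup\<mu>) * \<bar>x\<bar> powr (- k)) powr q)"
      using C_nonneg sup\<mu>_nonneg by (intro int) auto
    show "\<forall>\<^sub>F t in at_right 0. \<forall>x\<in>space M. \<bar>u t x - u0 x\<bar> \<le> (C + sup\<mu>) * \<bar>x\<bar> powr (- k)"
      using eventually_pos by eventually_elim (use \<epsilon> in \<open>auto simp: sp intro!: u_minus_u0_le\<close>)
    show "AE x in M. ((\<lambda>t. u t x) \<longlongrightarrow> u0 x) (at_right 0)"
      using \<epsilon> by (intro AE_I2 u_tendsto_u0) (auto simp: sp)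
  qed (use q meas[OF meas_u] in auto)
  then show "tendsto_Lp (restrict_space lborel {x. \<epsilon> < \<bar>x\<bar>}) q u u0 (at_right 0)" by (simp add: M_def)
qed

lemma u_Lp: "t > 0 \<Longrightarrow> \<alpha> / 2 < r \<Longrightarrow> u t \<in> Lp lborel r"
  by (intro scaled_Lp decaying_Lp decaying_f cont_f)

lemma zero_Lp: "(\<lambda>x. 0) \<in> Lp M r"
  by (simp add: Lp_def)

lemma Lp_sum_norm_le:
  assumes "a \<in> Lp M p" "b \<in> Lp M q" "h = (\<lambda>x. a x + b x)"
  shows "0 \<le> Lp_sum_norm M p q h" "Lp_sum_norm M p q h \<le> Lp_norm M p a + Lp_norm M q b"
proof -
  let ?S = "{Lp_norm M p g + Lp_norm M q h' | g h'. g \<in> Lp M p \<and> h' \<in> Lp M q \<and> h = (\<lambda>x. g x + h' x)}"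
  have mem: "Lp_norm M p a + Lp_norm M q b \<in> ?S" using assms by blast
  have nonneg: "0 \<le> s" if "s \<in> ?S" for s using that by (auto simp: Lp_norm_def)
  show "0 \<le> Lp_sum_norm M p q h" unfolding Lp_sum_norm_def using mem nonneg by (intro cInf_greatest) blast+
  show "Lp_sum_norm M p q h \<le> Lp_norm M p a + Lp_norm M q b"
    unfolding Lp_sum_norm_def by (intro cInf_lower[OF mem] bdd_belowI[where m = 0] nonneg)
qed

text \<open>Singularity and tail are separated at \<open>\<bar>x\<bar> = 1\<close>: the bound
  \<open>\<bar>x\<bar> powr (- k)\<close> is in \<open>L\<^sup>p\<close> inside, as
  \<open>k * p < 1\<close>, and in \<open>L\<^sup>q\<close> outside, as
  \<open>k * q > 1\<close>.\<close>

lemma initial_value_B: "initial_value_B \<alpha> u u0"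
  unfolding initial_value_B_def
proof (intro allI impI, elim conjE)
  fix p q :: real assume p: "1 \<le> p" "p < \<alpha> / 2" and q: "\<alpha> / 2 < q"
  define I O' where "I = (indicator {x::real. \<bar>x\<bar> \<le> 1} :: real \<Rightarrow> real)" and "O' = (indicator {x::real. 1 < \<bar>x\<bar>} :: real \<Rightarrow> real)"
  have split: "h x = h x * I x + h x * O' x" for h and x :: real
    by (auto simp: I_def O'_def split: split_indicator)
  have [measurable]: "I \<in> borel_measurable borel" "O' \<in> borel_measurable borel" by (simp_all add: I_def O'_def)
  have q1: "q > 0" "p > 0" using p q alpha by auto
  have kq: "k * q > 1" "0 \<le> k * p" "k * p < 1" using p q alpha by (simp_all add: field_simps)
  have intI: "integrable lborel (\<lambda>x. (A * \<bar>x\<bar> powr (- k) * I x) powr p)" if "A \<ge> 0" for A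
  proof -
    have "integrable lborel (\<lambda>x. A powr p * (\<bar>x\<bar> powr (- (k * p)) * I x))"
      using integrable_powr_unit[OF kq(2,3)] by (simp add: I_def)
    also have "(\<lambda>x. A powr p * (\<bar>x\<bar> powr (- (k * p)) * I x)) = (\<lambda>x. (A * \<bar>x\<bar> powr (- k) * I x) powr p)"
      using that by (auto simp: I_def powr_mult powr_powr split: split_indicator)
    finally show ?thesis .
  qed
  have intO: "integrable lborel (\<lambda>x. (A * \<bar>x\<bar> powr (- k) * O' x) powr q)" if "A \<ge> 0" for A
  proof -
    have "integrable lborel (\<lambda>x. A powr q * (\<bar>x\<bar> powr (- (k * q)) * O' x))"
      using integrable_powr_outer[OF kq(1), of 1] by (simp add: O'_def)
    also have "(\<lambda>x. A powr q * (\<bar>x\<bar> powr (- (k * q)) * O' x)) = (\<lambda>x. (A * \<bar>x\<bar> powr (- k) * O' x) powr q)"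
      using that by (auto simp: O'_def powr_mult powr_powr split: split_indicator)
    finally show ?thesis .
  qed
  have nn: "0 \<le> I x" "0 \<le> O' x" for x by (simp_all add: I_def O'_def)
  have le: "\<bar>u0 x * I x\<bar> \<le> sup\<mu> * \<bar>x\<bar> powr (- k) * I x" "\<bar>u0 x * O' x\<bar> \<le> sup\<mu> * \<bar>x\<bar> powr (- k) * O' x" for x
    using u0_le[of x] nn[of x] by (simp_all add: abs_mult mult_right_mono)
  have v: "(\<lambda>x. u0 x * I x) \<in> Lp lborel p" "(\<lambda>x. u0 x * O' x) \<in> Lp lborel q"
    by (rule Lp_dominated[OF _ intI[OF sup\<mu>_nonneg] q1(2) le(1)], simp)
      (rule Lp_dominated[OF _ intO[OF sup\<mu>_nonneg] q1(1) le(2)], simp)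
  have A0: "C + sup\<mu> \<ge> 0" using C_nonneg sup\<mu>_nonneg by simp
  have dom: "\<forall>\<^sub>F t in at_right 0. \<forall>x\<in>- {0}. \<bar>u t x - u0 x\<bar> \<le> (C + sup\<mu>) * \<bar>x\<bar> powr (- k)"
    using eventually_pos by eventually_elim (auto intro!: u_minus_u0_le)
  have AE0: "AE x::real in lborel. x \<noteq> 0" by (rule AE_lborel_singleton)
  \<comment> \<open>At \<open>x = 0\<close> the bound may fail, since its right side is 0 there.
    Changing \<open>u t\<close> at this single point makes it hold everywhere, as
    \<open>tendsto_Lp_dominated\<close> demands, and leaves the norms as they are.\<close>
  define w where "w t x = (if x = 0 then u0 x else u t x)" for t x
  have wu: "AE x in lborel. w t x = u t x" for t using AE0 by eventually_elim (simp add: w_def)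
  have [measurable]: "w t \<in> borel_measurable borel" for t unfolding w_def[abs_def] by measurable
  have wlim: "((\<lambda>t. w t x) \<longlongrightarrow> u0 x) (at_right 0)" for x
    by (cases "x = 0") (simp_all add: w_def u_tendsto_u0)
  have wdom: "\<forall>\<^sub>F t in at_right 0. \<forall>x. \<bar>w t x - u0 x\<bar> \<le> (C + sup\<mu>) * \<bar>x\<bar> powr (- k)"
    using dom by eventually_elim (auto simp: w_def)
  have cI: "tendsto_Lp lborel p (\<lambda>t x. w t x * I x) (\<lambda>x. u0 x * I x) (at_right 0)"
  proof (rule tendsto_Lp_dominated[OF q1(2) v(1) _ intI[OF A0]])
    show "\<forall>\<^sub>F t in at_right 0. \<forall>x\<in>space lborel. \<bar>w t x * I x - u0 x * I x\<bar> \<le> (C + sup\<mu>) * \<bar>x\<bar> powr (- k) * I x"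
      using wdom by eventually_elim (auto simp: abs_mult nn mult_right_mono simp flip: left_diff_distrib)
    show "AE x in lborel. ((\<lambda>t. w t x * I x) \<longlongrightarrow> u0 x * I x) (at_right 0)"
      by (intro AE_I2 tendsto_intros wlim)
  qed simp
  have cO: "tendsto_Lp lborel q (\<lambda>t x. w t x * O' x) (\<lambda>x. u0 x * O' x) (at_right 0)"
  proof (rule tendsto_Lp_dominated[OF q1(1) v(2) _ intO[OF A0]])
    show "\<forall>\<^sub>F t in at_right 0. \<forall>x\<in>space lborel. \<bar>w t x * O' x - u0 x * O' x\<bar> \<le> (C + sup\<mu>) * \<bar>x\<bar> powr (- k) * O' x"
      using wdom by eventually_elim (auto simp: abs_mult nn mult_right_mono simp flip: left_diff_distrib)
    show "AE x in lborel. ((\<lambda>t. w t x * O' x) \<longlongrightarrow> u0 x * O' x) (at_right 0)"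
      by (intro AE_I2 tendsto_intros wlim)
  qed simp
  define a where "a t x = (u t x - u0 x) * I x" for t x
  define b where "b t x = (u t x - u0 x) * O' x" for t x
  have [measurable]: "a t \<in> borel_measurable borel" "b t \<in> borel_measurable borel" for t
    unfolding a_def[abs_def] b_def[abs_def] by measurable
  have norm_a: "Lp_norm lborel p (a t) = Lp_norm lborel p (\<lambda>x. w t x * I x - u0 x * I x)" for t
    unfolding Lp_norm_def
    by (intro arg_cong2[where f = "(powr)"] refl integral_cong_AE)
      (measurable, use wu[of t] in eventually_elim, simp add: a_def left_diff_distrib)
  have norm_b: "Lp_norm lborel q (b t) = Lp_norm lborel q (\<lambda>x. w t x * O' x - u0 x * O' x)" for t
    unfolding Lp_norm_def
    by (intro arg_cong2[where f = "(powr)"] refl integral_cong_AE)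
      (measurable, use wu[of t] in eventually_elim, simp add: b_def left_diff_distrib)
  have diff_mem: "a t \<in> Lp lborel p" "b t \<in> Lp lborel q" if t: "t > 0" for t
  proof -
    have "AE x in lborel. norm (\<bar>a t x\<bar> powr p) \<le> norm (((C + sup\<mu>) * \<bar>x\<bar> powr (- k) * I x) powr p)"
      using AE0
    proof eventually_elim
      case (elim x)
      have "\<bar>a t x\<bar> \<le> (C + sup\<mu>) * \<bar>x\<bar> powr (- k) * I x"
        using u_minus_u0_le[OF t elim] nn[of x] by (simp add: a_def abs_mult mult_right_mono)
      then show ?case using q1 by (simp add: powr_mono2)
    qed
    from Bochner_Integration.integrable_bound[OF intI[OF A0] _ this] show "a t \<in> Lp lborel p" by (simp add: Lp_def)
    have "AE x in lborel. norm (\<bar>b t x\<bar> powr q) \<le> norm (((C + sup\<mu>) * \<bar>x\<bar> powr (- k) * O' x) powr q)"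
      using AE0
    proof eventually_elim
      case (elim x)
      have "\<bar>b t x\<bar> \<le> (C + sup\<mu>) * \<bar>x\<bar> powr (- k) * O' x"
        using u_minus_u0_le[OF t elim] nn[of x] by (simp add: b_def abs_mult mult_right_mono)
      then show ?case using q1 by (simp add: powr_mono2)
    qed
    from Bochner_Integration.integrable_bound[OF intO[OF A0] _ this] show "b t \<in> Lp lborel q" by (simp add: Lp_def)
  qed
  show "tendsto_Lp_sum lborel p q u u0 (at_right 0)"
    unfolding tendsto_Lp_sum_def
  proof (intro conjI)
    show "u0 \<in> Lp_sum lborel p q"
      unfolding Lp_sum_def
      by (rule CollectI, rule bexI[OF bexI[OF _ v(2)] v(1)], rule ext, rule split)
    show "\<forall>\<^sub>F t in at_right 0. u t \<in> Lp_sum lborel p q"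
      using eventually_pos
    proof eventually_elim
      case (elim t)
      show ?case unfolding Lp_sum_def
        by (rule CollectI, rule bexI[OF bexI[OF _ u_Lp[OF elim q]] zero_Lp]) simp
    qed
    have ab: "(\<lambda>x. u t x - u0 x) = (\<lambda>x. a t x + b t x)" for t
      using split[of "\<lambda>x. u t x - u0 x"] by (simp add: a_def b_def fun_eq_iff)
    have "((\<lambda>t. Lp_norm lborel p (a t) + Lp_norm lborel q (b t)) \<longlongrightarrow> 0 + 0) (at_right 0)"
      unfolding norm_a norm_b using cI cO by (intro tendsto_add) (auto simp: tendsto_Lp_def)
    then have z: "((\<lambda>t. Lp_norm lborel p (a t) + Lp_norm lborel q (b t)) \<longlongrightarrow> 0) (at_right 0)" by simp
    show "((\<lambda>t. Lp_sum_norm lborel p q (\<lambda>x. u t x - u0 x)) \<longlongrightarrow> 0) (at_right 0)"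
    proof (rule tendsto_sandwich[OF _ _ tendsto_const z])
      show "\<forall>\<^sub>F t in at_right 0. 0 \<le> Lp_sum_norm lborel p q (\<lambda>x. u t x - u0 x)"
        using eventually_pos by eventually_elim (rule Lp_sum_norm_le(1)[OF diff_mem ab])
      show "\<forall>\<^sub>F t in at_right 0. Lp_sum_norm lborel p q (\<lambda>x. u t x - u0 x) \<le> Lp_norm lborel p (a t) + Lp_norm lborel q (b t)"
        using eventually_pos by eventually_elim (rule Lp_sum_norm_le(2)[OF diff_mem ab])
    qed
  qed
qed

section \<open>Regularity in Lebesgue spaces\<close>

text \<open>By the mean value theorem the quotient is bounded by values of \<open>ut s x\<close>
  with \<open>s\<close> between \<open>t / 2\<close> and \<open>2 * t\<close>. The end
  \<open>t / 2\<close> controls the power of \<open>s\<close>, the end \<open>2 * t\<close> the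
  decay in \<open>x / sqrt s\<close>, and together they give one dominating function.\<close>

lemma difference_quotient:
  assumes t: "t > 0" and r: "\<alpha> / 2 < r"
  shows "tendsto_Lp lborel r (\<lambda>s x. (u s x - u t x) / (s - t)) (ut t) (at t within {0<..})"
proof -
  have r0: "r > 0" using r alpha by simp
  obtain A where A: "A \<ge> 0" "\<And>x. \<bar>ft x\<bar> \<le> A * (1 + \<bar>x\<bar>) powr (- k)" using decaying_ft by (auto simp: decaying_def)
  define D where "D = (t / 2) powr (- (1 / \<alpha>) - 1) * A"
  have D: "D \<ge> 0" using A by (simp add: D_def)
  have bound: "\<bar>ut s x\<bar> \<le> D * (1 + \<bar>x / sqrt (2 * t)\<bar>) powr (- k)" if s: "t / 2 \<le> s" "s \<le> 2 * t" for s x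
  proof -
    have s0: "s > 0" using s t by simp
    have "\<bar>x / sqrt (2 * t)\<bar> \<le> \<bar>x / sqrt s\<bar>"
      unfolding abs_divide using s s0 by (intro divide_left_mono mult_pos_pos) auto
    then have 1: "(1 + \<bar>x / sqrt s\<bar>) powr (- k) \<le> (1 + \<bar>x / sqrt (2 * t)\<bar>) powr (- k)"
      using k_pos abs_ge_zero[of "x / sqrt (2 * t)"] by (intro powr_mono2') linarith+
    have 2: "s powr (- (1 / \<alpha>) - 1) \<le> (t / 2) powr (- (1 / \<alpha>) - 1)"
      using s t alpha by (intro powr_mono2') (auto simp: field_simps)
    have "\<bar>ut s x\<bar> \<le> s powr (- (1 / \<alpha>) - 1) * (A * (1 + \<bar>x / sqrt s\<bar>) powr (- k))"
      using A(2)[of "x / sqrt s"] by (simp add: scaled_def abs_mult mult_left_mono)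
    also have "\<dots> \<le> (t / 2) powr (- (1 / \<alpha>) - 1) * (A * (1 + \<bar>x / sqrt (2 * t)\<bar>) powr (- k))"
      using 1 2 A(1) by (intro mult_mono mult_left_mono) auto
    finally show ?thesis by (simp add: D_def mult_ac)
  qed
  have "integrable lborel (\<lambda>x. (2 * D * (1 + \<bar>x / sqrt (2 * t)\<bar>) powr (- k)) powr r)"
    using integral_dilate(1)[of "2 * t" "\<lambda>x. (2 * D * (1 + \<bar>x\<bar>) powr (- k)) powr r"]
      powr_japanese_integrable[OF r, of "2 * D"] t D by simp
  then show ?thesis
  proof (rule tendsto_Lp_dominated[OF r0 scaled_Lp(1)[OF t decaying_Lp[OF decaying_ft cont_ft r]], rotated])
    show "(\<lambda>x. (u s x - u t x) / (s - t)) \<in> borel_measurable lborel" for s by measurable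
    have "\<forall>\<^sub>F s in at t within {0<..}. s \<in> {t / 2<..<2 * t} \<and> s \<noteq> t"
      using eventually_nhds_in_open[of "{t / 2<..<2 * t}" t] t
      by (auto simp: eventually_at_filter elim!: eventually_mono)
    then show "\<forall>\<^sub>F s in at t within {0<..}. \<forall>x\<in>space lborel.
        \<bar>(u s x - u t x) / (s - t) - ut t x\<bar> \<le> 2 * D * (1 + \<bar>x / sqrt (2 * t)\<bar>) powr (- k)"
    proof eventually_elim
      case (elim s)
      show ?case
      proof
        fix x
        define B where "B = D * (1 + \<bar>x / sqrt (2 * t)\<bar>) powr (- k)"
        have "norm (u s x - u t x) \<le> B * norm (s - t)"
        proof (rule field_differentiable_bound[where S = "{t / 2..2 * t}"])
          show "((\<lambda>s. u s x) has_real_derivative ut z x) (at z within {t / 2..2 * t})" if "z \<in> {t / 2..2 * t}" for z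
            by (rule has_field_derivative_at_within[OF DERIV_u_t]) (use that t in auto)
          show "norm (ut z x) \<le> B" if "z \<in> {t / 2..2 * t}" for z using bound[of z x] that by (simp add: B_def)
        qed (use elim t in auto)
        then have "\<bar>u s x - u t x\<bar> \<le> B * \<bar>s - t\<bar>" by (simp only: real_norm_def)
        moreover have "\<bar>s - t\<bar> > 0" using elim by simp
        ultimately have "\<bar>(u s x - u t x) / (s - t)\<bar> \<le> B" by (simp only: abs_divide pos_divide_le_eq)
        moreover have "\<bar>ut t x\<bar> \<le> B" using bound[of t x] t by (simp add: B_def)
        ultimately have "\<bar>(u s x - u t x) / (s - t) - ut t x\<bar> \<le> 2 * B" by linarith
        then show "\<bar>(u s x - u t x) / (s - t) - ut t x\<bar> \<le> 2 * D * (1 + \<bar>x / sqrt (2 * t)\<bar>) powr (- k)"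
          by (simp add: B_def mult.assoc)
      qed
    qed
    show "AE x in lborel. ((\<lambda>s. (u s x - u t x) / (s - t)) \<longlongrightarrow> ut t x) (at t within {0<..})"
    proof (rule AE_I2)
      fix x
      have "((\<lambda>s. (u s x - u t x) / (s - t)) \<longlongrightarrow> ut t x) (at t)"
        using DERIV_u_t[OF t, of x] by (simp add: has_field_derivative_iff)
      then show "((\<lambda>s. (u s x - u t x) / (s - t)) \<longlongrightarrow> ut t x) (at t within {0<..})"
        by (rule tendsto_mono[rotated]) (simp add: at_le)
    qed
  qed
qed

lemma Lr_regularity: "Lr_regularity \<alpha> u"
  unfolding Lr_regularity_def
proof (intro allI impI, elim conjE, intro conjI)
  fix r assume r: "1 \<le> r" "\<alpha> / 2 < r"
  have r0: "r > 0" using r by simp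
  show "Lp_C1_on lborel r {0<..} u"
    unfolding Lp_C1_on_def
  proof (intro conjI exI[of _ ut] ballI)
    show "u t \<in> Lp lborel r" if "t \<in> {0<..}" for t using that r u_Lp by simp
    show "Lp_continuous_on lborel r {0<..} ut"
      by (rule scaled_Lp_continuous_on[OF r0 decaying_Lp[OF decaying_ft cont_ft r(2)] cont_ft])
    show "tendsto_Lp lborel r (\<lambda>s x. (u s x - u t x) / (s - t)) (ut t) (at t within {0<..})" if "t \<in> {0<..}" for t
      using that difference_quotient r by simp
  qed
  have d1: "deriv (u t) = ux t" if "t > 0" for t
    using DERIV_u_x(1)[OF that] DERIV_imp_deriv by blast
  have d2: "deriv (ux t) = uxx t" if "t > 0" for t
    using DERIV_u_x(2)[OF that] DERIV_imp_deriv by blast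
  have "Lp_continuous_on lborel r {0<..} uxx"
    by (rule scaled_Lp_continuous_on[OF r0 decaying_Lp[OF decaying_f2 cont_f2 r(2)] cont_f2])
  then show "Lp_continuous_on lborel r {0<..} (\<lambda>t. deriv (deriv (u t)))"
    by (rule Lp_continuous_on_cong[THEN iffD1, rotated]) (simp add: d1 d2)
  have "Lp_continuous_on lborel r {0<..} un"
    by (rule scaled_Lp_continuous_on[OF r0 decaying_Lp[OF decaying_nonlin cont_nonlin r(2)] cont_nonlin])
  then show "Lp_continuous_on lborel r {0<..} (\<lambda>t x. nonlin \<alpha> (u t x))"
    by (rule Lp_continuous_on_cong[THEN iffD1, rotated]) (simp add: nonlin_u fun_eq_iff)
qed

end

section \<open>The heat semigroup\<close>

definition heat_kernel :: "real \<Rightarrow> real \<Rightarrow> real \<Rightarrow> real" where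
  "heat_kernel \<tau> x y = exp (- (x - y)\<^sup>2 / (4 * \<tau>)) / sqrt (4 * pi * \<tau>)"

lemma heat_alt: "heat \<tau> \<phi> x = (\<integral>y. heat_kernel \<tau> x y * \<phi> y \<partial>lborel)"
  by (simp add: heat_def heat_kernel_def)

lemma heat_kernel_sym: "heat_kernel \<tau> x y = heat_kernel \<tau> y x"
  by (simp add: heat_kernel_def power2_commute)

lemma heat_kernel_normal: "\<tau> > 0 \<Longrightarrow> heat_kernel \<tau> x = normal_density x (sqrt (2 * \<tau>))"
  by (simp add: heat_kernel_def normal_density_def fun_eq_iff power2_commute mult_ac)

lemma heat_kernel_nonneg: "\<tau> > 0 \<Longrightarrow> heat_kernel \<tau> x y \<ge> 0"
  by (simp add: heat_kernel_def)

lemma heat_kernel_integrable: "\<tau> > 0 \<Longrightarrow> integrable lborel (heat_kernel \<tau> x)"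
  unfolding heat_kernel_normal by (rule integrable_normal_density) simp

lemma heat_kernel_integral: "\<tau> > 0 \<Longrightarrow> (\<integral>y. heat_kernel \<tau> x y \<partial>lborel) = 1"
  unfolding heat_kernel_normal by (rule integral_normal_density) simp

lemma heat_kernel_le: "\<tau> > 0 \<Longrightarrow> heat_kernel \<tau> x y \<le> (4 * pi * \<tau>) powr (- (1 / 2))"
proof -
  assume \<tau>: "\<tau> > 0"
  then have p: "4 * pi * \<tau> > 0" by simp
  have "(4 * pi * \<tau>) powr (- (1 / 2)) = 1 / sqrt (4 * pi * \<tau>)"
    by (simp only: powr_minus_divide powr_half_sqrt[OF less_imp_le[OF p]])
  moreover have "exp (- (x - y)\<^sup>2 / (4 * \<tau>)) \<le> 1" using \<tau> by simp
  ultimately show ?thesis unfolding heat_kernel_def using p by (simp only: divide_right_mono real_sqrt_ge_zero less_imp_le)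
qed

lemma heat_kernel_measurable [measurable]:
  "heat_kernel \<tau> x \<in> borel_measurable borel" "(\<lambda>x. heat_kernel \<tau> x y) \<in> borel_measurable borel"
  unfolding heat_kernel_def[abs_def] by measurable

lemma heat_kernel_measurable_pair [measurable]:
  assumes [measurable]: "a \<in> borel_measurable M" "b \<in> borel_measurable M" "c \<in> borel_measurable M"
  shows "(\<lambda>z. heat_kernel (a z) (b z) (c z)) \<in> borel_measurable M"
  unfolding heat_kernel_def[abs_def] by measurable

text \<open>The heat kernel at time 1, centred at 0; \<open>heat_gauss\<close> rescales every other
  time to it.\<close>

definition gauss :: "real \<Rightarrow> real" where
  "gauss = normal_density 0 (sqrt 2)"

lemma gauss_eq: "gauss z = exp (- z\<^sup>2 / 4) / sqrt (4 * pi)"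
  by (simp add: gauss_def normal_density_def mult_ac)

lemma gauss_nonneg: "gauss z \<ge> 0" by (simp add: gauss_eq)

lemma gauss_integrable: "integrable lborel gauss" "integrable lborel (\<lambda>z. gauss z * \<bar>z\<bar>)"
  unfolding gauss_def using integrable_normal_moment_abs[of "sqrt 2" 0 1] by (auto intro: integrable_normal_density)

lemma gauss_integral: "(\<integral>z. gauss z \<partial>lborel) = 1"
  unfolding gauss_def by (rule integral_normal_density) simp

lemma gauss_measurable [measurable]: "gauss \<in> borel_measurable borel"
  unfolding gauss_def by measurable

lemma DERIV_gauss: "(gauss has_real_derivative - (z / 2) * gauss z) (at z)"
  unfolding gauss_eq[abs_def] by (auto intro!: derivative_eq_intros simp: field_simps)

lemma heat_gauss:
  assumes "\<tau> > 0"
  shows "heat \<tau> \<phi> x = (\<integral>z. gauss z * \<phi> (x + sqrt \<tau> * z) \<partial>lborel)"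
proof -
  have "heat \<tau> \<phi> x = \<bar>sqrt \<tau>\<bar> *\<^sub>R (\<integral>z. heat_kernel \<tau> x (x + sqrt \<tau> * z) * \<phi> (x + sqrt \<tau> * z) \<partial>lborel)"
    unfolding heat_alt using assms by (intro lborel_integral_real_affine) simp
  also have "\<dots> = (\<integral>z. sqrt \<tau> * (heat_kernel \<tau> x (x + sqrt \<tau> * z) * \<phi> (x + sqrt \<tau> * z)) \<partial>lborel)"
    using assms by simp
  also have "\<dots> = (\<integral>z. gauss z * \<phi> (x + sqrt \<tau> * z) \<partial>lborel)"
  proof (intro Bochner_Integration.integral_cong refl)
    fix z
    have "sqrt \<tau> * heat_kernel \<tau> x (x + sqrt \<tau> * z) = gauss z"
      using assms by (simp add: heat_kernel_def gauss_eq power_mult_distrib real_sqrt_mult)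
    then show "sqrt \<tau> * (heat_kernel \<tau> x (x + sqrt \<tau> * z) * \<phi> (x + sqrt \<tau> * z)) = gauss z * \<phi> (x + sqrt \<tau> * z)"
      by (simp only: mult.assoc[symmetric])
  qed
  finally show ?thesis .
qed

lemma abs_integral_le:
  fixes f g :: "'a \<Rightarrow> real"
  assumes "integrable M f" "integrable M g" "\<And>x. \<bar>f x\<bar> \<le> g x"
  shows "\<bar>\<integral>x. f x \<partial>M\<bar> \<le> (\<integral>x. g x \<partial>M)"
proof -
  have "norm (\<integral>x. f x \<partial>M) \<le> (\<integral>x. norm (f x) \<partial>M)" by (rule integral_norm_bound)
  also have "\<dots> \<le> (\<integral>x. g x \<partial>M)" using assms by (intro integral_mono) auto
  finally show ?thesis by simp
qed

lemma heat_sup_bound: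
  assumes "\<tau> > 0" "\<And>y. \<bar>\<phi> y\<bar> \<le> B"
  shows "\<bar>heat \<tau> \<phi> x\<bar> \<le> B"
proof -
  have "\<bar>heat \<tau> \<phi> x\<bar> \<le> (\<integral>y. heat_kernel \<tau> x y * B \<partial>lborel)"
  proof (cases "integrable lborel (\<lambda>y. heat_kernel \<tau> x y * \<phi> y)")
    case True
    show ?thesis
      unfolding heat_alt
    proof (rule abs_integral_le[OF True])
      show "integrable lborel (\<lambda>y. heat_kernel \<tau> x y * B)" using heat_kernel_integrable[OF assms(1)] by simp
      show "\<bar>heat_kernel \<tau> x y * \<phi> y\<bar> \<le> heat_kernel \<tau> x y * B" for y
        using assms heat_kernel_nonneg[OF assms(1), of x y] by (simp add: abs_mult mult_left_mono)
    qed
  next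
    case False
    \<comment> \<open>Without integrability the integral is 0 by convention, and the bound still
      holds.\<close>
    have "B \<ge> 0" using assms(2)[of 0] by linarith
    then show ?thesis using False heat_kernel_nonneg[OF assms(1)] by (simp add: heat_alt not_integrable_integral_eq)
  qed
  also have "\<dots> = B" using heat_kernel_integral[OF assms(1)] by simp
  finally show ?thesis .
qed

lemma heat_L1_sup_bound:
  assumes "\<tau> > 0" "integrable lborel \<phi>"
  shows "\<bar>heat \<tau> \<phi> x\<bar> \<le> (4 * pi * \<tau>) powr (- (1 / 2)) * (\<integral>y. \<bar>\<phi> y\<bar> \<partial>lborel)"
proof -
  have m [measurable]: "\<phi> \<in> borel_measurable borel" using borel_measurable_integrable[OF assms(2)] by simp
  have le: "\<bar>heat_kernel \<tau> x y * \<phi> y\<bar> \<le> (4 * pi * \<tau>) powr (- (1 / 2)) * \<bar>\<phi> y\<bar>" for y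
    using heat_kernel_le[OF assms(1), of x y] heat_kernel_nonneg[OF assms(1), of x y] by (simp add: abs_mult mult_right_mono)
  have i: "integrable lborel (\<lambda>y. (4 * pi * \<tau>) powr (- (1 / 2)) * \<bar>\<phi> y\<bar>)" using assms(2) by simp
  have "integrable lborel (\<lambda>y. heat_kernel \<tau> x y * \<phi> y)"
    by (rule Bochner_Integration.integrable_bound[OF i]) (use le in \<open>auto simp: abs_mult\<close>)
  from abs_integral_le[OF this i le]
  have "\<bar>heat \<tau> \<phi> x\<bar> \<le> (\<integral>y. (4 * pi * \<tau>) powr (- (1 / 2)) * \<bar>\<phi> y\<bar> \<partial>lborel)"
    unfolding heat_alt .
  then show ?thesis by simp
qed

text \<open>Tonelli's theorem; by symmetry the kernel has integral 1 also in its first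
  argument.\<close>

lemma heat_L1_contraction:
  assumes "\<tau> > 0" and \<phi>: "integrable lborel \<phi>"
  shows "(\<integral>\<^sup>+x. ennreal \<bar>heat \<tau> \<phi> x\<bar> \<partial>lborel) \<le> ennreal (\<integral>y. \<bar>\<phi> y\<bar> \<partial>lborel)"
proof -
  have m [measurable]: "\<phi> \<in> borel_measurable borel" using borel_measurable_integrable[OF \<phi>] by simp
  have "(\<integral>\<^sup>+x. ennreal \<bar>heat \<tau> \<phi> x\<bar> \<partial>lborel) \<le> (\<integral>\<^sup>+x. (\<integral>\<^sup>+y. ennreal (heat_kernel \<tau> x y) * ennreal \<bar>\<phi> y\<bar> \<partial>lborel) \<partial>lborel)"
  proof (rule nn_integral_mono)
    fix x
    have "ennreal \<bar>heat \<tau> \<phi> x\<bar> \<le> (\<integral>\<^sup>+y. ennreal (norm (heat_kernel \<tau> x y * \<phi> y)) \<partial>lborel)"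
    proof (cases "integrable lborel (\<lambda>y. heat_kernel \<tau> x y * \<phi> y)")
      case True
      then show ?thesis unfolding heat_alt using integral_norm_bound_ennreal[OF True] by simp
    qed (simp add: heat_alt not_integrable_integral_eq)
    also have "\<dots> = (\<integral>\<^sup>+y. ennreal (heat_kernel \<tau> x y) * ennreal \<bar>\<phi> y\<bar> \<partial>lborel)"
      using heat_kernel_nonneg[OF assms(1), of x] by (intro nn_integral_cong) (simp add: abs_mult ennreal_mult)
    finally show "ennreal \<bar>heat \<tau> \<phi> x\<bar> \<le> (\<integral>\<^sup>+y. ennreal (heat_kernel \<tau> x y) * ennreal \<bar>\<phi> y\<bar> \<partial>lborel)" .
  qed
  also have "\<dots> = (\<integral>\<^sup>+y. (\<integral>\<^sup>+x. ennreal (heat_kernel \<tau> x y) * ennreal \<bar>\<phi> y\<bar> \<partial>lborel) \<partial>lborel)"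
    by (rule lborel_pair.Fubini') measurable
  also have "\<dots> = (\<integral>\<^sup>+y. ennreal \<bar>\<phi> y\<bar> \<partial>lborel)"
  proof (intro nn_integral_cong)
    fix y
    have "(\<integral>\<^sup>+x. ennreal (heat_kernel \<tau> x y) \<partial>lborel) = (\<integral>\<^sup>+x. ennreal (heat_kernel \<tau> y x) \<partial>lborel)"
      by (subst heat_kernel_sym) simp
    also have "\<dots> = 1"
      using heat_kernel_integrable[OF assms(1)] heat_kernel_nonneg[OF assms(1)] heat_kernel_integral[OF assms(1)]
      by (subst nn_integral_eq_integral) auto
    finally show "(\<integral>\<^sup>+x. ennreal (heat_kernel \<tau> x y) * ennreal \<bar>\<phi> y\<bar> \<partial>lborel) = ennreal \<bar>\<phi> y\<bar>"
      by (simp add: nn_integral_multc)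
  qed
  also have "\<dots> = ennreal (\<integral>y. \<bar>\<phi> y\<bar> \<partial>lborel)"
    using \<phi> by (intro nn_integral_eq_integral) auto
  finally show ?thesis .
qed

lemma integral_tendsto_at:
  fixes P :: "real \<Rightarrow> real \<Rightarrow> real"
  assumes meas: "\<And>s. s \<in> S - {a} \<Longrightarrow> P s \<in> borel_measurable lborel" and L: "L \<in> borel_measurable lborel"
    and B: "integrable lborel B"
    and dom: "\<forall>\<^sub>F s in at a within S. AE z in lborel. \<bar>P s z\<bar> \<le> B z"
    and lim: "AE z in lborel. ((\<lambda>s. P s z) \<longlongrightarrow> L z) (at a within S)"
  shows "((\<lambda>s. \<integral>z. P s z \<partial>lborel) \<longlongrightarrow> (\<integral>z. L z \<partial>lborel)) (at a within S)"
  unfolding tendsto_at_iff_sequentially o_def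
proof (intro allI impI)
  fix X assume X: "\<forall>i. X i \<in> S - {a}" "X \<longlonglongrightarrow> a"
  have fX: "filterlim X (at a within S) sequentially" using X by (auto simp: filterlim_at)
  obtain N where N: "\<And>i. i \<ge> N \<Longrightarrow> AE z in lborel. \<bar>P (X i) z\<bar> \<le> B z"
    using filterlim_iff[THEN iffD1, OF fX, rule_format, OF dom] by (auto simp: eventually_sequentially)
  have "(\<lambda>i. \<integral>z. P (X (i + N)) z \<partial>lborel) \<longlonglongrightarrow> (\<integral>z. L z \<partial>lborel)"
  proof (rule integral_dominated_convergence[OF L _ B])
    show "AE z in lborel. (\<lambda>i. P (X (i + N)) z) \<longlonglongrightarrow> L z"
      using lim
    proof eventually_elim
      case (elim z)
      have "(\<lambda>i. P (X i) z) \<longlonglongrightarrow> L z" using filterlim_compose[OF elim fX] .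
      then show ?case by (rule LIMSEQ_ignore_initial_segment)
    qed
    show "AE z in lborel. norm (P (X (i + N)) z) \<le> B z" for i using N[of "i + N"] by simp
    show "P (X (i + N)) \<in> borel_measurable lborel" for i using meas X by blast
  qed
  then show "(\<lambda>i. \<integral>z. P (X i) z \<partial>lborel) \<longlonglongrightarrow> (\<integral>z. L z \<partial>lborel)" by (rule LIMSEQ_offset)
qed

lemma DERIV_integral:
  fixes P P' :: "real \<Rightarrow> real \<Rightarrow> real"
  assumes s0: "a < s0" "s0 < b"
    and P: "\<And>s z. a < s \<Longrightarrow> s < b \<Longrightarrow> ((\<lambda>s. P s z) has_real_derivative P' s z) (at s)"
    and B: "integrable lborel B" "\<And>s z. a < s \<Longrightarrow> s < b \<Longrightarrow> \<bar>P' s z\<bar> \<le> B z"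
    and int: "\<And>s. a < s \<Longrightarrow> s < b \<Longrightarrow> integrable lborel (P s)"
    and meas: "P' s0 \<in> borel_measurable lborel"
  shows "((\<lambda>s. \<integral>z. P s z \<partial>lborel) has_real_derivative (\<integral>z. P' s0 z \<partial>lborel)) (at s0)"
proof -
  have "((\<lambda>s. \<integral>z. (P s z - P s0 z) / (s - s0) \<partial>lborel) \<longlongrightarrow> (\<integral>z. P' s0 z \<partial>lborel)) (at s0 within {a<..<b})"
  proof (rule integral_tendsto_at[OF _ meas B(1)])
    show "(\<lambda>z. (P s z - P s0 z) / (s - s0)) \<in> borel_measurable lborel" if "s \<in> {a<..<b} - {s0}" for s
    proof -
      have "integrable lborel (P s)" "integrable lborel (P s0)" using that s0 int by auto
      then have [measurable]: "P s \<in> borel_measurable lborel" "P s0 \<in> borel_measurable lborel"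
        by (auto dest: borel_measurable_integrable)
      show ?thesis by measurable
    qed
    show "\<forall>\<^sub>F s in at s0 within {a<..<b}. AE z in lborel. \<bar>(P s z - P s0 z) / (s - s0)\<bar> \<le> B z"
    proof (rule eventually_mono)
      show "\<forall>\<^sub>F s in at s0 within {a<..<b}. s \<in> {a<..<b} \<and> s \<noteq> s0" by (simp add: eventually_at_filter)
    next
      fix s assume s: "s \<in> {a<..<b} \<and> s \<noteq> s0"
      show "AE z in lborel. \<bar>(P s z - P s0 z) / (s - s0)\<bar> \<le> B z"
      proof (rule AE_I2)
      fix z
      have "norm (P s z - P s0 z) \<le> B z * norm (s - s0)"
      proof (rule field_differentiable_bound[where S = "{a<..<b}"])
        show "((\<lambda>s. P s z) has_real_derivative P' y z) (at y within {a<..<b})" if "y \<in> {a<..<b}" for y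
          by (rule has_field_derivative_at_within[OF P]) (use that in auto)
        show "norm (P' y z) \<le> B z" if "y \<in> {a<..<b}" for y using B(2)[of y z] that by simp
      qed (use s s0 in auto)
      moreover have "\<bar>s - s0\<bar> > 0" using s by simp
      ultimately show "\<bar>(P s z - P s0 z) / (s - s0)\<bar> \<le> B z"
        by (simp only: abs_divide pos_divide_le_eq real_norm_def)
      qed
    qed
    show "AE z in lborel. ((\<lambda>s. (P s z - P s0 z) / (s - s0)) \<longlongrightarrow> P' s0 z) (at s0 within {a<..<b})"
      by (rule AE_I2, rule tendsto_mono[OF at_le[OF subset_UNIV]], rule P[OF s0, unfolded has_field_derivative_iff])
  qed
  moreover have "at s0 within {a<..<b} = at s0" using s0 by (intro at_within_open) auto
  ultimately have "((\<lambda>s. \<integral>z. (P s z - P s0 z) / (s - s0) \<partial>lborel) \<longlongrightarrow> (\<integral>z. P' s0 z \<partial>lborel)) (at s0)" by simp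
  moreover have "\<forall>\<^sub>F s in at s0. (\<integral>z. (P s z - P s0 z) / (s - s0) \<partial>lborel) = ((\<integral>z. P s z \<partial>lborel) - (\<integral>z. P s0 z \<partial>lborel)) / (s - s0)"
  proof -
    have "\<forall>\<^sub>F s in at s0. s \<in> {a<..<b}"
      using eventually_nhds_in_open[of "{a<..<b}" s0] s0 by (auto simp: eventually_at_filter elim!: eventually_mono)
    then show ?thesis
    proof eventually_elim
      case (elim s)
      have "integrable lborel (P s)" "integrable lborel (P s0)" using elim s0 int by auto
      then show ?case by simp
    qed
  qed
  ultimately show ?thesis unfolding has_field_derivative_iff by (rule Lim_transform_eventually)
qed

text \<open>\<open>gauss * q\<close> vanishes at both ends, so its derivative
  \<open>gauss z * q' z - z / 2 * gauss z * q z\<close> has integral 0. The factor 2 is the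
  variance.\<close>

lemma gauss_parts:
  fixes q q' :: "real \<Rightarrow> real"
  assumes q: "\<And>z. (q has_real_derivative q' z) (at z)" and cont: "continuous_on UNIV q'"
    and b: "\<And>z. \<bar>q z\<bar> \<le> M" "\<And>z. \<bar>q' z\<bar> \<le> M'"
  shows "(\<integral>z. gauss z * (z * q z) \<partial>lborel) = 2 * (\<integral>z. gauss z * q' z \<partial>lborel)"
proof -
  have qc: "continuous_on UNIV q" using q by (intro continuous_at_imp_continuous_on ballI DERIV_isCont)
  have gc: "continuous_on UNIV gauss" by (intro continuous_at_imp_continuous_on ballI DERIV_isCont[OF DERIV_gauss])
  have [measurable]: "q \<in> borel_measurable borel" "q' \<in> borel_measurable borel"
    by (intro borel_measurable_continuous_onI qc cont)+
  have i1: "integrable lborel (\<lambda>z. gauss z * (z * q z))"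
  proof (rule Bochner_Integration.integrable_bound)
    show "integrable lborel (\<lambda>z. M * (gauss z * \<bar>z\<bar>))" using gauss_integrable(2) by simp
    have "\<bar>gauss z * (z * q z)\<bar> \<le> M * (gauss z * \<bar>z\<bar>)" for z
      using mult_left_mono[OF b(1)[of z], of "gauss z * \<bar>z\<bar>"] gauss_nonneg[of z] by (simp add: abs_mult mult_ac)
    then show "AE z in lborel. norm (gauss z * (z * q z)) \<le> norm (M * (gauss z * \<bar>z\<bar>))"
      by (intro AE_I2) (metis abs_ge_self order_trans real_norm_def)
  qed measurable
  have i2: "integrable lborel (\<lambda>z. gauss z * q' z)"
  proof (rule Bochner_Integration.integrable_bound)
    show "integrable lborel (\<lambda>z. M' * gauss z)" using gauss_integrable(1) by simp
    have "\<bar>gauss z * q' z\<bar> \<le> M' * gauss z" for z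
      using mult_left_mono[OF b(2)[of z], of "gauss z"] gauss_nonneg[of z] by (simp add: abs_mult mult_ac)
    then show "AE z in lborel. norm (gauss z * q' z) \<le> norm (M' * gauss z)"
      by (intro AE_I2) (metis abs_ge_self order_trans real_norm_def)
  qed measurable
  define F' where "F' z = gauss z * q' z - (gauss z * (z * q z)) / 2" for z
  have F': "((\<lambda>z. gauss z * q z) has_vector_derivative F' z) (at z)" for z
  proof -
    have "((\<lambda>z. gauss z * q z) has_real_derivative - (z / 2) * gauss z * q z + q' z * gauss z) (at z)"
      by (rule DERIV_mult[OF DERIV_gauss q])
    then show ?thesis by (simp add: has_real_derivative_iff_has_vector_derivative F'_def algebra_simps)
  qed
  have F'_int: "integrable lborel F'" unfolding F'_def using i1 i2 by simp
  have F'_cont: "isCont F' z" for z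
  proof -
    have "isCont gauss z" "isCont q z" "isCont q' z"
      using gc qc cont by (simp_all add: continuous_on_eq_continuous_at)
    then show ?thesis unfolding F'_def by (intro continuous_intros) auto
  qed
  have g0: "(gauss \<longlongrightarrow> 0) at_top" "(gauss \<longlongrightarrow> 0) at_bot" unfolding gauss_eq[abs_def] by real_asymp+
  have lim: "((\<lambda>z. gauss z * q z) \<longlongrightarrow> 0) F" if "(gauss \<longlongrightarrow> 0) F" for F
  proof (rule Lim_null_comparison)
    show "\<forall>\<^sub>F z in F. norm (gauss z * q z) \<le> gauss z * M"
      using b(1) gauss_nonneg by (auto intro!: always_eventually simp: abs_mult mult_left_mono)
    show "((\<lambda>z. gauss z * M) \<longlongrightarrow> 0) F" using tendsto_mult_left_zero[OF that] .
  qed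
  have "(LBINT z=-\<infinity>..\<infinity>. F' z) = 0 - 0"
    by (rule interval_integral_FTC_integrable[where F = "\<lambda>z. gauss z * q z"])
      (use F' F'_cont F'_int lim g0 in \<open>auto simp: set_integrable_def ereal_tendsto_simps\<close>)
  then have "(\<integral>z. F' z \<partial>lborel) = 0"
    by (simp add: interval_lebesgue_integral_def set_lebesgue_integral_def)
  then show ?thesis unfolding F'_def using i1 i2 by simp
qed

section \<open>Duhamel's formula\<close>

lemma scaled_eq: "scaled \<beta> \<phi> t = (\<lambda>x. t powr \<beta> * \<phi> (x / sqrt t))"
  by (simp add: scaled_def fun_eq_iff)

lemma tendsto_scaled:
  assumes "continuous_on UNIV \<phi>" "(s \<longlongrightarrow> t) F" "(y \<longlongrightarrow> x) F" "t > 0"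
  shows "((\<lambda>i. scaled \<beta> \<phi> (s i) (y i)) \<longlongrightarrow> scaled \<beta> \<phi> t x) F"
  unfolding scaled_def
proof (intro tendsto_mult)
  show "((\<lambda>i. s i powr \<beta>) \<longlongrightarrow> t powr \<beta>) F" using assms by (intro tendsto_intros) auto
  have "((\<lambda>i. y i / sqrt (s i)) \<longlongrightarrow> x / sqrt t) F" using assms by (intro tendsto_intros) auto
  then show "((\<lambda>i. \<phi> (y i / sqrt (s i))) \<longlongrightarrow> \<phi> (x / sqrt t)) F"
    by (intro continuous_on_tendsto_compose[OF assms(1)]) auto
qed

lemma abs_scaled_le:
  assumes "s > 0" "\<And>y. \<bar>\<phi> y\<bar> \<le> M"
  shows "\<bar>scaled \<beta> \<phi> s x\<bar> \<le> M * s powr \<beta>"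
  using mult_left_mono[OF assms(2)[of "x / sqrt s"], of "s powr \<beta>"] by (simp add: scaled_def abs_mult mult.commute)

lemma abs_scaled_le_mono:
  assumes "0 < a" "a \<le> s" "\<beta> \<le> 0" "\<And>y. \<bar>\<phi> y\<bar> \<le> M"
  shows "\<bar>scaled \<beta> \<phi> s x\<bar> \<le> M * a powr \<beta>"
proof -
  have M: "M \<ge> 0" using assms(4)[of 0] by linarith
  have "\<bar>scaled \<beta> \<phi> s x\<bar> \<le> M * s powr \<beta>" using assms by (intro abs_scaled_le) auto
  also have "\<dots> \<le> M * a powr \<beta>" using assms M by (intro mult_left_mono powr_mono2') auto
  finally show ?thesis .
qed

text \<open>Near the singularity the kernel is replaced by its maximum, elsewhere the power by 1.
  The integral of the right side over \<open>y\<close> is independent of \<open>x\<close>, which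
  gives \<open>h1_bounded\<close>.\<close>

lemma kernel_powr_le:
  assumes "t > 0" "0 \<le> p"
  shows "heat_kernel t x y * \<bar>y\<bar> powr (- p) \<le>
    (4 * pi * t) powr (- (1 / 2)) * (\<bar>y\<bar> powr (- p) * indicator {y. \<bar>y\<bar> \<le> 1} y) + heat_kernel t x y"
proof (cases "\<bar>y\<bar> \<le> 1")
  case True
  have "heat_kernel t x y * \<bar>y\<bar> powr (- p) \<le> (4 * pi * t) powr (- (1 / 2)) * \<bar>y\<bar> powr (- p)"
    by (intro mult_right_mono heat_kernel_le assms(1)) simp
  then show ?thesis using True heat_kernel_nonneg[OF assms(1), of x y] by simp
next
  case False
  have "\<bar>y\<bar> powr (- p) \<le> 1 powr (- p)" using False assms by (intro powr_mono2') auto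
  then show ?thesis using False heat_kernel_nonneg[OF assms(1), of x y] mult_left_mono[of "\<bar>y\<bar> powr (- p)" 1 "heat_kernel t x y"]
    by simp
qed

lemma integrable_kernel_powr:
  assumes "t > 0" "0 \<le> p" "p < 1"
  shows "integrable lborel (\<lambda>y. heat_kernel t x y * \<bar>y\<bar> powr (- p))"
proof (rule Bochner_Integration.integrable_bound)
  let ?c = "(4 * pi * t) powr (- (1 / 2))"
  show "integrable lborel (\<lambda>y. ?c * (\<bar>y\<bar> powr (- p) * indicator {y. \<bar>y\<bar> \<le> 1} y) + heat_kernel t x y)"
    using integrable_powr_unit[OF assms(2,3)] heat_kernel_integrable[OF assms(1)] by simp
  show "AE y in lborel. norm (heat_kernel t x y * \<bar>y\<bar> powr (- p)) \<le>
      norm (?c * (\<bar>y\<bar> powr (- p) * indicator {y. \<bar>y\<bar> \<le> 1} y) + heat_kernel t x y)"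
    using heat_kernel_nonneg[OF assms(1)] kernel_powr_le[OF assms(1,2)] by (intro AE_I2) (simp add: abs_mult)
qed measurable

lemma set_integrable_powr_Ioo:
  fixes b :: real
  assumes "b < 1" "0 \<le> t"
  shows "set_integrable lborel {0<..<t} (\<lambda>s. s powr (- b))"
proof -
  have "(\<lambda>s. s powr (- b)) integrable_on {0..t}"
    by (rule integrable_on_powr_from_0) (use assms in auto)
  then have "(\<lambda>s. s powr (- b)) absolutely_integrable_on {0..t}"
    by (rule nonnegative_absolutely_integrable_1) auto
  then have "set_integrable lborel {0..t} (\<lambda>s. s powr (- b))"
    unfolding set_integrable_def by (subst (asm) integrable_completion) auto
  then show ?thesis by (rule set_integrable_subset) auto
qed

lemma set_integrable_powr_reflect:
  fixes b :: real
  assumes "b < 1" "0 \<le> t"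
  shows "set_integrable lborel {0<..<t} (\<lambda>s. (t - s) powr (- b))"
proof -
  have "integrable lborel (\<lambda>s. indicator {0<..<t} (t + (- 1) * s) *\<^sub>R (t + (- 1) * s) powr (- b))"
    using set_integrable_powr_Ioo[OF assms] unfolding set_integrable_def by (rule lborel_integrable_real_affine) simp
  moreover have "indicator {0<..<t} (t + (- 1) * s) = (indicator {0<..<t} s :: real)" for s
    by (auto split: split_indicator)
  ultimately show ?thesis by (simp add: set_integrable_def)
qed

context decaying_profile begin

lemma g_bounded: "\<exists>B\<ge>0. \<forall>x. \<bar>g x\<bar> \<le> B"
  using profile_bounded[OF alpha ode] by (meson less_imp_le)

lemma nonlin_bounded: "\<bar>nonlin \<alpha> (f x)\<bar> \<le> C powr (\<alpha> + 1)"
  unfolding abs_nonlin using f_bounded alpha by (intro powr_mono2) auto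

lemma nonlin_f_integrable: "integrable lborel (\<lambda>x. nonlin \<alpha> (f x))"
proof (rule Bochner_Integration.integrable_bound)
  show "integrable lborel (\<lambda>x::real. C powr (\<alpha> + 1) * (1 + \<bar>x\<bar>) powr (- (k + 2)))"
    using integrable_japanese[of "k + 2"] k_pos by simp
  show "(\<lambda>x. nonlin \<alpha> (f x)) \<in> borel_measurable lborel"
    using borel_measurable_continuous_onI[OF cont_nonlin] by simp
  show "AE x in lborel. norm (nonlin \<alpha> (f x)) \<le> norm (C powr (\<alpha> + 1) * (1 + \<bar>x\<bar>) powr (- (k + 2)))"
    using nonlin_decay by (intro AE_I2) (metis abs_ge_self order_trans real_norm_def)
qed

definition nonlin_L1 :: real where
  "nonlin_L1 = (\<integral>x. \<bar>nonlin \<alpha> (f x)\<bar> \<partial>lborel)"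

text \<open>By \<open>un_L1\<close> the exponent in the \<open>L\<^sup>1\<close> norm of the
  nonlinear term. \<open>s powr (- \<gamma>)\<close> is integrable at 0 exactly when
  \<open>\<alpha> > 2\<close>.\<close>

definition \<gamma> :: real where "\<gamma> = 1 / 2 + 1 / \<alpha>"

lemma un_integrable: "s > 0 \<Longrightarrow> integrable lborel (un s)"
  unfolding scaled_eq using integral_dilate(1)[of s "\<lambda>x. nonlin \<alpha> (f x)"] nonlin_f_integrable by simp

lemma un_L1:
  assumes "s > 0"
  shows "(\<integral>x. \<bar>un s x\<bar> \<partial>lborel) = s powr (- \<gamma>) * nonlin_L1"
proof -
  have "(\<integral>x. \<bar>un s x\<bar> \<partial>lborel) = s powr (- (1 / \<alpha>) - 1) * (sqrt s * nonlin_L1)"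
    using integral_dilate(2)[OF assms, of "\<lambda>x. \<bar>nonlin \<alpha> (f x)\<bar>"]
    by (simp add: scaled_eq abs_mult nonlin_L1_def)
  also have "\<dots> = s powr (- (1 / \<alpha>) - 1) * s powr (1 / 2) * nonlin_L1"
    using assms by (simp add: powr_half_sqrt)
  also have "s powr (- (1 / \<alpha>) - 1) * s powr (1 / 2) = s powr (- \<gamma>)"
    unfolding powr_add[symmetric] \<gamma>_def by (intro arg_cong2[where f = "(powr)"] refl) (simp add: algebra_simps)
  finally show ?thesis .
qed

lemma nonlin_L1_nonneg: "nonlin_L1 \<ge> 0" by (simp add: nonlin_L1_def)

definition source :: "real \<Rightarrow> real \<Rightarrow> real \<Rightarrow> real" where
  "source t x s = heat (t - s) (un s) x"

lemma source_eq: "s > 0 \<Longrightarrow> heat (t - s) (\<lambda>y. nonlin \<alpha> (u s y)) x = source t x s"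
  by (simp add: source_def nonlin_u)

text \<open>Bounds for complementary ranges: the first stays finite as \<open>s\<close> tends to
  \<open>t\<close>, the second has the weaker singularity \<open>s powr (- \<gamma>)\<close> at
  0.\<close>

lemma source_bounds:
  assumes "0 < s" "s < t"
  shows "\<bar>source t x s\<bar> \<le> C powr (\<alpha> + 1) * s powr (- (1 / \<alpha>) - 1)"
    and "\<bar>source t x s\<bar> \<le> (4 * pi * (t - s)) powr (- (1 / 2)) * (s powr (- \<gamma>) * nonlin_L1)"
proof -
  show "\<bar>source t x s\<bar> \<le> C powr (\<alpha> + 1) * s powr (- (1 / \<alpha>) - 1)"
    unfolding source_def using assms by (intro heat_sup_bound abs_scaled_le nonlin_bounded) auto
  show "\<bar>source t x s\<bar> \<le> (4 * pi * (t - s)) powr (- (1 / 2)) * (s powr (- \<gamma>) * nonlin_L1)"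
    unfolding source_def un_L1[OF assms(1), symmetric] using assms by (intro heat_L1_sup_bound un_integrable) auto
qed

lemma meas_scaled_affine:
  assumes "continuous_on UNIV \<phi>"
  shows "(\<lambda>z. scaled \<beta> \<phi> s (x + c * z)) \<in> borel_measurable borel"
proof -
  have [measurable]: "scaled \<beta> \<phi> s \<in> borel_measurable borel"
    by (intro meas_scaled borel_measurable_continuous_onI assms)
  show ?thesis by measurable
qed

text \<open>After the substitution \<open>y = x + sqrt (t - s) * z\<close> the Gaussian weight no longer depends on \<open>s\<close>;
  the drift term produced by the substitution is turned into \<open>uxx\<close> by partial integration.\<close>

lemma evolution_derivative:
  assumes st: "0 < s0" "s0 < t"
  shows "((\<lambda>s. heat (t - s) (u s) x) has_real_derivative source t x s0) (at s0)"
proof -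
  \<comment> \<open>On \<open>{a<..<b}\<close> the powers of \<open>s\<close> and
    \<open>1 / sqrt (t - s)\<close> are bounded, which gives a dominating function independent of
    \<open>s\<close>.\<close>
  define a b where "a = s0 / 2" and "b = (s0 + t) / 2"
  have ab: "0 < a" "a < s0" "s0 < b" "b < t" using st by (auto simp: a_def b_def)
  define y where "y s z = x + sqrt (t - s) * z" for s z
  define P where "P s z = gauss z * u s (y s z)" for s z
  define P' where "P' s z = gauss z * (ut s (y s z) + ux s (y s z) * (- z / (2 * sqrt (t - s))))" for s z
  obtain Bt where Bt: "Bt \<ge> 0" "\<And>x. \<bar>ft x\<bar> \<le> Bt" using ft_bounded by auto
  obtain Bg where Bg: "Bg \<ge> 0" "\<And>x. \<bar>g x\<bar> \<le> Bg" using g_bounded by auto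
  obtain B2 where B2: "B2 \<ge> 0" "\<And>x. \<bar>f2 x\<bar> \<le> B2" using f2_bounded by auto
  have "1 / \<alpha> > 0" using alpha by simp
  then have al: "- (1 / \<alpha>) - 1 \<le> 0" "- (1 / \<alpha>) - 1 / 2 \<le> 0" by linarith+
  have derP: "((\<lambda>s. P s z) has_real_derivative P' s z) (at s)" if s: "0 < s" "s < t" for s z
  proof -
    have "((\<lambda>s. x + sqrt (t - s) * z) has_real_derivative (inverse (sqrt (t - s)) / 2 * (0 - 1)) * z) (at s)"
      using s by (auto intro!: derivative_eq_intros)
    then have y': "((\<lambda>s. y s z) has_real_derivative - z / (2 * sqrt (t - s))) (at s)"
      unfolding y_def by (rule DERIV_cong) (simp add: field_simps)
    have r: "((\<lambda>s. s powr (- (1 / 2))) has_real_derivative - (1 / 2) * s powr (- (1 / 2) - 1)) (at s)"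
      by (rule has_real_derivative_powr[OF s(1)])
    have sq: "1 / sqrt s = s powr (- (1 / 2))" if "s > 0" for s
      by (simp only: powr_minus_divide powr_half_sqrt[OF less_imp_le[OF that]])
    define q where "q = s powr (- (1 / 2))"
    have s1: "s powr 1 = s" using s by simp
    have q1: "s powr (- (1 / 2) - 1) = q / s" unfolding powr_diff s1 q_def ..
    define Y where "Y = - z / (2 * sqrt (t - s))"
    have arg: "((\<lambda>s. y s z * s powr (- (1 / 2))) has_real_derivative Y * q + (- (1 / 2) * (q / s)) * y s z) (at s)"
      using DERIV_mult[OF y' r] unfolding q1 Y_def[symmetric] q_def[symmetric] .
    have "((\<lambda>s. s powr (- (1 / \<alpha>)) * f (y s z * s powr (- (1 / 2)))) has_real_derivative
       - (1 / \<alpha>) * s powr (- (1 / \<alpha>) - 1) * f (y s z * q) +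
       g (y s z * q) * (Y * q + (- (1 / 2) * (q / s)) * y s z) * s powr (- (1 / \<alpha>))) (at s)"
      unfolding q_def
      by (rule DERIV_mult[OF has_real_derivative_powr[OF s(1)] DERIV_chain2[OF f' arg[unfolded q_def]]])
    moreover have "- (1 / \<alpha>) * s powr (- (1 / \<alpha>) - 1) * f (y s z * q) +
       g (y s z * q) * (Y * q + (- (1 / 2) * (q / s)) * y s z) * s powr (- (1 / \<alpha>)) =
       ut s (y s z) + ux s (y s z) * Y"
    proof -
      define p where "p = s powr (- (1 / \<alpha>))"
      have p1: "s powr (- (1 / \<alpha>) - 1) = p / s" unfolding powr_diff s1 p_def ..
      have p2: "s powr (- (1 / \<alpha>) - 1 / 2) = p * q"
        unfolding p_def q_def powr_add[symmetric] by (intro arg_cong2[where f = "(powr)"] refl) simp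
      have yq: "y s z / sqrt s = y s z * q"
        unfolding q_def sq[OF s(1), symmetric] by simp
      show ?thesis
        unfolding scaled_def p1 p2 yq ft_def p_def[symmetric] using s by (simp add: field_simps)
    qed
    ultimately have d: "((\<lambda>s. s powr (- (1 / \<alpha>)) * f (y s z * s powr (- (1 / 2)))) has_real_derivative
       ut s (y s z) + ux s (y s z) * Y) (at s)" by (simp only:)
    have ev: "\<forall>\<^sub>F s in nhds s. s powr (- (1 / \<alpha>)) * f (y s z * s powr (- (1 / 2))) = u s (y s z)"
    proof -
      have "\<forall>\<^sub>F s in nhds s. s \<in> {0<..}" using s by (intro eventually_nhds_in_open) auto
      then show ?thesis
      proof eventually_elim
        case (elim r)
        then have "y r z * r powr (- (1 / 2)) = y r z / sqrt r" by (simp flip: sq)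
        then show ?case by (simp only: scaled_def)
      qed
    qed
    have "((\<lambda>s. u s (y s z)) has_real_derivative ut s (y s z) + ux s (y s z) * Y) (at s)"
      using d DERIV_cong_ev[OF refl ev refl] by blast
    from DERIV_cmult[OF this, of "gauss z"] show ?thesis by (simp add: P_def P'_def Y_def)
  qed
  have umeas: "(\<lambda>z. scaled \<beta> \<phi> s (y s z)) \<in> borel_measurable borel" if "continuous_on UNIV \<phi>" for \<beta> \<phi> s
    unfolding y_def by (rule meas_scaled_affine[OF that])
  have gint: "integrable lborel (\<lambda>z. gauss z * h z)" if "h \<in> borel_measurable borel" "\<And>z. \<bar>h z\<bar> \<le> M" for h M
  proof (rule Bochner_Integration.integrable_bound)
    show "integrable lborel (\<lambda>z. M * gauss z)" using gauss_integrable(1) by simp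
    show "(\<lambda>z. gauss z * h z) \<in> borel_measurable lborel" using that(1) by measurable
    have "\<bar>gauss z * h z\<bar> \<le> M * gauss z" for z
      using mult_left_mono[OF that(2)[of z], of "gauss z"] gauss_nonneg[of z] by (simp add: abs_mult mult_ac)
    then show "AE z in lborel. norm (gauss z * h z) \<le> norm (M * gauss z)"
      by (intro AE_I2) (metis abs_ge_self order_trans real_norm_def)
  qed
  define M1 M2 where "M1 = Bt * a powr (- (1 / \<alpha>) - 1)" and "M2 = Bg * a powr (- (1 / \<alpha>) - 1 / 2) / (2 * sqrt (t - b))"
  have deriv_int: "((\<lambda>s. \<integral>z. P s z \<partial>lborel) has_real_derivative (\<integral>z. P' s0 z \<partial>lborel)) (at s0)"
  proof (rule DERIV_integral[OF ab(2,3)])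
    show "((\<lambda>s. P s z) has_real_derivative P' s z) (at s)" if "a < s" "s < b" for s z
      by (rule derP) (use that ab in auto)
    show "integrable lborel (\<lambda>z. M1 * gauss z + M2 * (gauss z * \<bar>z\<bar>))" using gauss_integrable by simp
    show "integrable lborel (P s)" if "a < s" "s < b" for s
      unfolding P_def by (rule gint[OF umeas[OF cont_f] abs_scaled_le[OF _ f_bounded]]) (use that ab in auto)
    show "P' s0 \<in> borel_measurable lborel"
      unfolding P'_def using umeas[OF cont_ft] umeas[OF cont_g] by measurable
    show "\<bar>P' s z\<bar> \<le> M1 * gauss z + M2 * (gauss z * \<bar>z\<bar>)" if s: "a < s" "s < b" for s z
    proof -
      have 1: "\<bar>ut s (y s z)\<bar> \<le> M1" unfolding M1_def
        by (rule abs_scaled_le_mono[OF ab(1) _ al(1) Bt(2)]) (use s in simp)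
      have 2: "\<bar>ux s (y s z)\<bar> \<le> Bg * a powr (- (1 / \<alpha>) - 1 / 2)"
        by (rule abs_scaled_le_mono[OF ab(1) _ al(2) Bg(2)]) (use s in simp)
      have 3: "\<bar>- z / (2 * sqrt (t - s))\<bar> \<le> \<bar>z\<bar> / (2 * sqrt (t - b))"
        using s ab by (simp add: abs_mult frac_le)
      have "\<bar>ux s (y s z) * (- z / (2 * sqrt (t - s)))\<bar> \<le> Bg * a powr (- (1 / \<alpha>) - 1 / 2) * (\<bar>z\<bar> / (2 * sqrt (t - b)))"
        unfolding abs_mult using 2 3 Bg(1) by (intro mult_mono) auto
      also have "\<dots> = M2 * \<bar>z\<bar>" by (simp add: M2_def)
      finally have "\<bar>ut s (y s z) + ux s (y s z) * (- z / (2 * sqrt (t - s)))\<bar> \<le> M1 + M2 * \<bar>z\<bar>"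
        using 1 by linarith
      from mult_left_mono[OF this gauss_nonneg[of z]] show ?thesis
        using gauss_nonneg[of z] by (simp add: P'_def abs_mult distrib_left mult_ac)
    qed
  qed
  have tau: "t - s0 > 0" using st by simp
  \<comment> \<open>Differentiating \<open>ux s0 (y s0 z)\<close> in \<open>z\<close> gives a factor
    \<open>sqrt (t - s0)\<close>; with the variance 2 it cancels the
    \<open>1 / (2 * sqrt (t - s0))\<close> of the drift. What remains under the integral is
    \<open>ut - uxx\<close>, the nonlinear term.\<close>
  have parts: "(\<integral>z. gauss z * (z * ux s0 (y s0 z)) \<partial>lborel) = 2 * (\<integral>z. gauss z * (uxx s0 (y s0 z) * sqrt (t - s0)) \<partial>lborel)"
  proof (rule gauss_parts)
    fix z
    have "((\<lambda>z. x + sqrt (t - s0) * z) has_real_derivative sqrt (t - s0)) (at z)" by (auto intro!: derivative_eq_intros)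
    from DERIV_chain2[OF DERIV_u_x(2)[OF st(1)] this]
    show "((\<lambda>z. ux s0 (y s0 z)) has_real_derivative uxx s0 (y s0 z) * sqrt (t - s0)) (at z)" by (simp add: y_def)
    show "\<bar>ux s0 (y s0 z)\<bar> \<le> Bg * s0 powr (- (1 / \<alpha>) - 1 / 2)" by (rule abs_scaled_le[OF st(1) Bg(2)])
    show "\<bar>uxx s0 (y s0 z) * sqrt (t - s0)\<bar> \<le> B2 * s0 powr (- (1 / \<alpha>) - 1) * sqrt (t - s0)"
      unfolding abs_mult using abs_scaled_le[OF st(1) B2(2)] tau by (simp add: mult_right_mono)
  next
    show "continuous_on UNIV (\<lambda>z. uxx s0 (y s0 z) * sqrt (t - s0))"
      unfolding scaled_def y_def using st by (intro continuous_intros continuous_on_compose2[OF cont_f2]) auto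
  qed
  have i_t: "integrable lborel (\<lambda>z. gauss z * ut s0 (y s0 z))"
    by (rule gint[OF umeas[OF cont_ft] abs_scaled_le[OF st(1) Bt(2)]])
  have i_xx: "integrable lborel (\<lambda>z. gauss z * uxx s0 (y s0 z))"
    by (rule gint[OF umeas[OF cont_f2] abs_scaled_le[OF st(1) B2(2)]])
  have i_x: "integrable lborel (\<lambda>z. gauss z * (z * ux s0 (y s0 z)))"
  proof (rule Bochner_Integration.integrable_bound)
    show "integrable lborel (\<lambda>z. Bg * s0 powr (- (1 / \<alpha>) - 1 / 2) * (gauss z * \<bar>z\<bar>))" using gauss_integrable(2) by simp
    show "(\<lambda>z. gauss z * (z * ux s0 (y s0 z))) \<in> borel_measurable lborel" using umeas[OF cont_g] by measurable
    have "\<bar>gauss z * (z * ux s0 (y s0 z))\<bar> \<le> Bg * s0 powr (- (1 / \<alpha>) - 1 / 2) * (gauss z * \<bar>z\<bar>)" for z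
      using mult_left_mono[OF abs_scaled_le[OF st(1) Bg(2), where \<beta> = "- (1 / \<alpha>) - 1 / 2" and x = "y s0 z"], of "gauss z * \<bar>z\<bar>"] gauss_nonneg[of z]
      by (simp add: abs_mult mult_ac)
    then show "AE z in lborel. norm (gauss z * (z * ux s0 (y s0 z))) \<le> norm (Bg * s0 powr (- (1 / \<alpha>) - 1 / 2) * (gauss z * \<bar>z\<bar>))"
      by (intro AE_I2) (metis abs_ge_self order_trans real_norm_def)
  qed
  have "(\<integral>z. P' s0 z \<partial>lborel) = (\<integral>z. gauss z * ut s0 (y s0 z) - (1 / (2 * sqrt (t - s0))) * (gauss z * (z * ux s0 (y s0 z))) \<partial>lborel)"
    by (intro Bochner_Integration.integral_cong refl) (simp add: P'_def algebra_simps)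
  also have "\<dots> = (\<integral>z. gauss z * ut s0 (y s0 z) \<partial>lborel) - (1 / (2 * sqrt (t - s0))) * (\<integral>z. gauss z * (z * ux s0 (y s0 z)) \<partial>lborel)"
    using i_t i_x by (subst Bochner_Integration.integral_diff) auto
  also have "(1 / (2 * sqrt (t - s0))) * (\<integral>z. gauss z * (z * ux s0 (y s0 z)) \<partial>lborel) = (\<integral>z. gauss z * uxx s0 (y s0 z) \<partial>lborel)"
  proof -
    have "(\<integral>z. gauss z * (uxx s0 (y s0 z) * sqrt (t - s0)) \<partial>lborel) = sqrt (t - s0) * (\<integral>z. gauss z * uxx s0 (y s0 z) \<partial>lborel)"
      by (simp flip: mult.assoc)
    then show ?thesis unfolding parts using tau by simp
  qed
  also have "(\<integral>z. gauss z * ut s0 (y s0 z) \<partial>lborel) - (\<integral>z. gauss z * uxx s0 (y s0 z) \<partial>lborel) =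
      (\<integral>z. gauss z * ut s0 (y s0 z) - gauss z * uxx s0 (y s0 z) \<partial>lborel)"
    using i_t i_xx by (subst Bochner_Integration.integral_diff) auto
  also have "\<dots> = (\<integral>z. gauss z * un s0 (y s0 z) \<partial>lborel)"
    by (intro Bochner_Integration.integral_cong refl) (simp add: heat_equation algebra_simps)
  also have "\<dots> = source t x s0"
    unfolding source_def heat_gauss[OF tau] y_def ..
  finally have val: "(\<integral>z. P' s0 z \<partial>lborel) = source t x s0" .
  have "\<forall>\<^sub>F s in nhds s0. (\<integral>z. P s z \<partial>lborel) = heat (t - s) (u s) x"
  proof -
    have "\<forall>\<^sub>F s in nhds s0. s \<in> {..<t}" using st by (intro eventually_nhds_in_open) auto
    then show ?thesis by eventually_elim (simp add: heat_gauss P_def y_def)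
  qed
  from DERIV_cong_ev[OF refl this refl] show ?thesis using deriv_int val by simp
qed

lemma source_continuous:
  assumes s: "0 < s" "s < t"
  shows "isCont (source t x) s"
proof -
  define P where "P s z = gauss z * un s (x + sqrt (t - s) * z)" for s z
  have meas: "P s \<in> borel_measurable lborel" for s
    unfolding P_def using meas_scaled_affine[OF cont_nonlin] by measurable
  have "((\<lambda>s. \<integral>z. P s z \<partial>lborel) \<longlongrightarrow> (\<integral>z. P s z \<partial>lborel)) (at s within {s / 2<..<t})"
  proof (rule integral_tendsto_at[OF meas meas])
    show "integrable lborel (\<lambda>z. gauss z * (C powr (\<alpha> + 1) * (s / 2) powr (- (1 / \<alpha>) - 1)))" using gauss_integrable(1) by simp
    have "1 / \<alpha> > 0" using alpha by simp
    then have al: "- (1 / \<alpha>) - 1 \<le> 0" by linarith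
    show "\<forall>\<^sub>F r in at s within {s / 2<..<t}. AE z in lborel. \<bar>P r z\<bar> \<le> gauss z * (C powr (\<alpha> + 1) * (s / 2) powr (- (1 / \<alpha>) - 1))"
      unfolding eventually_at_filter
    proof (intro always_eventually allI impI AE_I2)
      fix r z assume "r \<in> {s / 2<..<t}"
      then have "\<bar>un r (x + sqrt (t - r) * z)\<bar> \<le> C powr (\<alpha> + 1) * (s / 2) powr (- (1 / \<alpha>) - 1)"
        using s by (intro abs_scaled_le_mono al nonlin_bounded) auto
      then show "\<bar>P r z\<bar> \<le> gauss z * (C powr (\<alpha> + 1) * (s / 2) powr (- (1 / \<alpha>) - 1))"
        using gauss_nonneg[of z] by (simp add: P_def abs_mult mult_left_mono)
    qed
    show "AE z in lborel. ((\<lambda>s. P s z) \<longlongrightarrow> P s z) (at s within {s / 2<..<t})"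
      unfolding P_def by (intro AE_I2 tendsto_mult tendsto_const tendsto_scaled[OF cont_nonlin] tendsto_intros s)
  qed
  moreover have "at s within {s / 2<..<t} = at s" using s by (intro at_within_open) auto
  ultimately have "((\<lambda>s. \<integral>z. P s z \<partial>lborel) \<longlongrightarrow> (\<integral>z. P s z \<partial>lborel)) (at s)" by simp
  moreover have eq: "(\<integral>z. P r z \<partial>lborel) = source t x r" if "r < t" for r
    using that unfolding source_def P_def by (subst heat_gauss) auto
  moreover have "\<forall>\<^sub>F r in at s. (\<integral>z. P r z \<partial>lborel) = source t x r"
  proof -
    have "\<forall>\<^sub>F r in at s. r \<in> {..<t}"
      using eventually_nhds_in_open[of "{..<t}" s] s by (auto simp: eventually_at_filter elim!: eventually_mono)
    then show ?thesis by eventually_elim (simp add: eq)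
  qed
  ultimately have "(source t x \<longlongrightarrow> source t x s) (at s)" using s Lim_transform_eventually by fastforce
  then show ?thesis by (simp add: isCont_def)
qed

text \<open>Right and left refer to the ends of \<open>{0<..<t}\<close>. As \<open>s\<close> tends
  to \<open>t\<close> the argument \<open>x + sqrt (t - s) * z\<close> tends to \<open>x\<close>,
  and the weight has integral 1.\<close>

lemma evolution_right_limit:
  assumes t: "t > 0"
  shows "((\<lambda>s. heat (t - s) (u s) x) \<longlongrightarrow> u t x) (at_left t)"
proof -
  define P where "P s z = gauss z * u s (x + sqrt (t - s) * z)" for s z
  have meas: "P s \<in> borel_measurable lborel" for s
    unfolding P_def using meas_scaled_affine[OF cont_f] by measurable
  have "((\<lambda>s. \<integral>z. P s z \<partial>lborel) \<longlongrightarrow> (\<integral>z. gauss z * u t x \<partial>lborel)) (at t within {..<t})"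
  proof (rule integral_tendsto_at[OF meas])
    show "(\<lambda>z. gauss z * u t x) \<in> borel_measurable lborel" by simp
    show "integrable lborel (\<lambda>z. gauss z * (C * (t / 2) powr (- (1 / \<alpha>))))" using gauss_integrable(1) by simp
    have al: "- (1 / \<alpha>) \<le> 0" using k_pos by simp
    have "\<forall>\<^sub>F s in at t within {..<t}. s \<in> {t / 2<..}"
      using eventually_nhds_in_open[of "{t / 2<..}" t] t by (auto simp: eventually_at_filter elim!: eventually_mono)
    then show "\<forall>\<^sub>F s in at t within {..<t}. AE z in lborel. \<bar>P s z\<bar> \<le> gauss z * (C * (t / 2) powr (- (1 / \<alpha>)))"
    proof eventually_elim
      case (elim s)
      show ?case
      proof (rule AE_I2)
        fix z
        have "\<bar>u s (x + sqrt (t - s) * z)\<bar> \<le> C * (t / 2) powr (- (1 / \<alpha>))"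
          using elim t by (intro abs_scaled_le_mono al f_bounded) auto
        then show "\<bar>P s z\<bar> \<le> gauss z * (C * (t / 2) powr (- (1 / \<alpha>)))"
          using gauss_nonneg[of z] by (simp add: P_def abs_mult mult_left_mono)
      qed
    qed
    have "((\<lambda>s. x + sqrt (t - s) * z) \<longlongrightarrow> x + sqrt (t - t) * z) (at t within {..<t})" for z
      by (intro tendsto_intros)
    then show "AE z in lborel. ((\<lambda>s. P s z) \<longlongrightarrow> gauss z * u t x) (at t within {..<t})"
      unfolding P_def by (intro AE_I2 tendsto_mult tendsto_const tendsto_scaled[OF cont_f] tendsto_ident_at t) simp
  qed
  moreover have "(\<integral>z. gauss z * u t x \<partial>lborel) = u t x" using gauss_integral by simp
  moreover have "\<forall>\<^sub>F s in at_left t. (\<integral>z. P s z \<partial>lborel) = heat (t - s) (u s) x"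
    by (simp add: eventually_at_filter P_def heat_gauss)
  ultimately show ?thesis using Lim_transform_eventually by fastforce
qed

end

text \<open>The condition on \<alpha> acts twice: \<open>k < 1\<close> makes \<open>u0\<close>
  locally integrable, and \<open>\<gamma> < 1\<close> makes the source integrable at
  \<open>s = 0\<close>.\<close>

locale integrable_profile = decaying_profile +
  assumes alpha2: "\<alpha> > 2"
begin

lemma k_less: "k < 1" and \<gamma>_less: "\<gamma> < 1" and k_nonneg: "k \<ge> 0"
  using alpha2 by (simp_all add: \<gamma>_def field_simps)

lemma AE_nonzero: "AE y::real in lborel. y \<noteq> 0"
  by (rule AE_lborel_singleton)

lemma evolution_left_limit:
  assumes t: "t > 0"
  shows "((\<lambda>s. heat (t - s) (u s) x) \<longlongrightarrow> heat t u0 x) (at_right 0)"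
  unfolding heat_alt
proof (rule integral_tendsto_at)
  show "(\<lambda>y. heat_kernel (t - s) x y * u s y) \<in> borel_measurable lborel" for s by measurable
  show "(\<lambda>y. heat_kernel t x y * u0 y) \<in> borel_measurable lborel" by measurable
  show "integrable lborel (\<lambda>y. sqrt 2 * C * (heat_kernel t x y * \<bar>y\<bar> powr (- k)))"
    using integrable_kernel_powr[OF t k_nonneg k_less] by simp
  have "\<forall>\<^sub>F s in at_right 0. 0 < s \<and> s < t / 2"
    using t eventually_at_right[of 0 "t/2"] by (auto intro!: exI[of _ "t / 2"])
  then show "\<forall>\<^sub>F s in at_right 0. AE y in lborel. \<bar>heat_kernel (t - s) x y * u s y\<bar> \<le> sqrt 2 * C * (heat_kernel t x y * \<bar>y\<bar> powr (- k))"
  proof eventually_elim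
    case (elim s)
    show ?case
      using AE_nonzero
    proof eventually_elim
      case (elim y)
      note s = \<open>0 < s \<and> s < t / 2\<close>
      \<comment> \<open>As \<open>t - s\<close> lies between \<open>t / 2\<close> and
        \<open>t\<close>, passing to time \<open>t\<close> costs at most \<open>sqrt 2\<close> in
        the prefactor and only increases the exponential; the majorant no longer contains
        \<open>s\<close>.\<close>
      have "heat_kernel (t - s) x y \<le> sqrt 2 * heat_kernel t x y"
      proof -
        have e: "exp (- (x - y)\<^sup>2 / (4 * (t - s))) \<le> exp (- (x - y)\<^sup>2 / (4 * t))"
          using s t by (simp add: frac_le)
        have d: "sqrt (4 * pi * t) \<le> sqrt 2 * sqrt (4 * pi * (t - s))"
          unfolding real_sqrt_mult[symmetric] using s by simp
        have p: "sqrt (4 * pi * t) > 0" "sqrt (4 * pi * (t - s)) > 0" using s t by auto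
        have "1 / sqrt (4 * pi * (t - s)) \<le> sqrt 2 / sqrt (4 * pi * t)"
          using d p by (simp add: divide_simps mult.commute)
        then have "exp (- (x - y)\<^sup>2 / (4 * (t - s))) * (1 / sqrt (4 * pi * (t - s))) \<le> exp (- (x - y)\<^sup>2 / (4 * t)) * (sqrt 2 / sqrt (4 * pi * t))"
          using e p by (intro mult_mono) auto
        then show ?thesis by (simp add: heat_kernel_def mult.commute)
      qed
      moreover have "\<bar>u s y\<bar> \<le> C * \<bar>y\<bar> powr (- k)" using u_le(1)[of s y] s elim by simp
      moreover have "heat_kernel (t - s) x y \<ge> 0" using s t by (intro heat_kernel_nonneg) auto
      ultimately have "heat_kernel (t - s) x y * \<bar>u s y\<bar> \<le> (sqrt 2 * heat_kernel t x y) * (C * \<bar>y\<bar> powr (- k))"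
        using heat_kernel_nonneg[OF t, of x y] by (intro mult_mono) auto
      then show ?case using \<open>heat_kernel (t - s) x y \<ge> 0\<close> by (simp add: abs_mult mult_ac)
    qed
  qed
  show "AE y in lborel. ((\<lambda>s. heat_kernel (t - s) x y * u s y) \<longlongrightarrow> heat_kernel t x y * u0 y) (at_right 0)"
    using AE_nonzero
  proof eventually_elim
    case (elim y)
    have "((\<lambda>s. exp (- (x - y)\<^sup>2 / (4 * (t - s))) / sqrt (4 * pi * (t - s))) \<longlongrightarrow> exp (- (x - y)\<^sup>2 / (4 * (t - 0))) / sqrt (4 * pi * (t - 0))) (at_right 0)"
      using t by (intro tendsto_intros) auto
    then have "((\<lambda>s. heat_kernel (t - s) x y) \<longlongrightarrow> heat_kernel t x y) (at_right 0)" by (simp add: heat_kernel_def)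
    then show ?case by (intro tendsto_mult u_tendsto_u0 elim)
  qed
qed

text \<open>The second of \<open>source_bounds\<close> is used up to \<open>t / 2\<close> and the
  first beyond, where \<open>s powr (- (1 / \<alpha>) - 1) = s powr (- \<gamma>) * s powr (- (1 /
  2))\<close> and the last factor is bounded.\<close>

lemma source_bound:
  assumes "t > 0"
  shows "\<exists>M\<ge>0. \<forall>x s. 0 < s \<and> s < t \<longrightarrow> \<bar>source t x s\<bar> \<le> M * s powr (- \<gamma>)"
proof -
  define M where "M = (2 * pi * t) powr (- (1 / 2)) * nonlin_L1 + C powr (\<alpha> + 1) * (t / 2) powr (- (1 / 2))"
  have M: "M \<ge> 0" using nonlin_L1_nonneg by (simp add: M_def)
  have "\<bar>source t x s\<bar> \<le> M * s powr (- \<gamma>)" if s: "0 < s" "s < t" for x s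
  proof (cases "s \<le> t / 2")
    case True
    have "(4 * pi * (t - s)) powr (- (1 / 2)) \<le> (2 * pi * t) powr (- (1 / 2))"
      using True assms by (intro powr_mono2') auto
    then have "(4 * pi * (t - s)) powr (- (1 / 2)) * (s powr (- \<gamma>) * nonlin_L1) \<le> (2 * pi * t) powr (- (1 / 2)) * (s powr (- \<gamma>) * nonlin_L1)"
      using nonlin_L1_nonneg by (intro mult_right_mono) auto
    also have "\<dots> \<le> M * s powr (- \<gamma>)" by (simp add: M_def algebra_simps)
    finally show ?thesis using source_bounds(2)[OF s, of x] by linarith
  next
    case False
    have "s powr (- (1 / \<alpha>) - 1) = s powr (- \<gamma>) * s powr (- (1 / 2))"
      unfolding powr_add[symmetric] \<gamma>_def by (intro arg_cong2[where f = "(powr)"] refl) (simp add: algebra_simps)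
    also have "s powr (- (1 / 2)) \<le> (t / 2) powr (- (1 / 2))"
      using False assms by (intro powr_mono2') auto
    finally have "C powr (\<alpha> + 1) * s powr (- (1 / \<alpha>) - 1) \<le> C powr (\<alpha> + 1) * (s powr (- \<gamma>) * (t / 2) powr (- (1 / 2)))"
      by (intro mult_left_mono) (auto simp: mult_left_mono)
    also have "\<dots> \<le> M * s powr (- \<gamma>)" using nonlin_L1_nonneg by (simp add: M_def algebra_simps)
    finally show ?thesis using source_bounds(1)[OF s, of x] by linarith
  qed
  then show ?thesis using M by blast
qed

lemma source_integrable:
  assumes "t > 0"
  shows "set_integrable lborel {0<..<t} (source t x)"
proof -
  obtain M where M: "M \<ge> 0" "\<And>s. 0 < s \<Longrightarrow> s < t \<Longrightarrow> \<bar>source t x s\<bar> \<le> M * s powr (- \<gamma>)"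
    using source_bound[OF assms] by blast
  have "set_integrable lborel {0<..<t} (\<lambda>s. M * s powr (- \<gamma>))"
    using set_integrable_powr_Ioo[OF \<gamma>_less, of t] assms by simp
  then show ?thesis
    unfolding set_integrable_def
  proof (rule Bochner_Integration.integrable_bound)
    have "continuous_on {0<..<t} (source t x)"
      by (intro continuous_at_imp_continuous_on ballI source_continuous) auto
    from borel_measurable_continuous_on_indicator[OF _ this]
    show "(\<lambda>s. indicator {0<..<t} s *\<^sub>R source t x s) \<in> borel_measurable lborel" by simp
    show "AE s in lborel. norm (indicator {0<..<t} s *\<^sub>R source t x s) \<le> norm (indicator {0<..<t} s *\<^sub>R (M * s powr (- \<gamma>)))"
      using M by (intro AE_I2) (auto split: split_indicator simp: abs_mult)
  qed
qed

lemma duhamel_source: "duhamel \<alpha> u t x = (LINT s:{0<..<t}|lborel. source t x s)"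
  unfolding duhamel_def by (intro set_lebesgue_integral_cong) (auto simp: source_eq)

lemma duhamel_formula:
  assumes t: "t > 0"
  shows "u t x = heat t u0 x + duhamel \<alpha> u t x"
proof -
  have "(LBINT s=ereal 0..ereal t. source t x s) = u t x - heat t u0 x"
  proof (rule interval_integral_FTC_integrable[where F = "\<lambda>s. heat (t - s) (u s) x"])
    show "((\<lambda>s. heat (t - s) (u s) x) has_vector_derivative source t x s) (at s)"
      if "ereal 0 < ereal s" "ereal s < ereal t" for s
      using evolution_derivative[of s t x] that by (simp add: has_real_derivative_iff_has_vector_derivative)
    show "isCont (source t x) s" if "ereal 0 < ereal s" "ereal s < ereal t" for s
      using source_continuous that by simp
    show "set_integrable lborel (einterval (ereal 0) (ereal t)) (source t x)"
      using source_integrable[OF t] by simp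
    show "(((\<lambda>s. heat (t - s) (u s) x) \<circ> real_of_ereal) \<longlongrightarrow> heat t u0 x) (at_right (ereal 0))"
      unfolding ereal_tendsto_simps by (rule evolution_left_limit[OF t])
    show "(((\<lambda>s. heat (t - s) (u s) x) \<circ> real_of_ereal) \<longlongrightarrow> u t x) (at_left (ereal t))"
      unfolding ereal_tendsto_simps by (rule evolution_right_limit[OF t])
  qed (use t in simp)
  then show ?thesis
    using t by (simp add: duhamel_source interval_lebesgue_integral_le_eq)
qed

end

section \<open>Lebesgue norms of the heat flow\<close>

lemma heat_measurable:
  assumes [measurable]: "\<phi> \<in> borel_measurable borel"
  shows "heat \<tau> \<phi> \<in> borel_measurable borel"
  unfolding heat_alt[abs_def] by measurable

lemma heat_integrable:
  assumes "\<tau> > 0" "integrable lborel \<phi>"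
  shows "integrable lborel (heat \<tau> \<phi>)" "(\<integral>x. \<bar>heat \<tau> \<phi> x\<bar> \<partial>lborel) \<le> (\<integral>x. \<bar>\<phi> x\<bar> \<partial>lborel)"
proof -
  have m: "heat \<tau> \<phi> \<in> borel_measurable lborel"
    using heat_measurable[of \<phi>] borel_measurable_integrable[OF assms(2)] by simp
  note le = heat_L1_contraction[OF assms]
  show i: "integrable lborel (heat \<tau> \<phi>)"
    by (rule integrableI_bounded[OF m]) (use le in \<open>auto intro: order_le_less_trans\<close>)
  have "ennreal (\<integral>x. \<bar>heat \<tau> \<phi> x\<bar> \<partial>lborel) = (\<integral>\<^sup>+x. ennreal \<bar>heat \<tau> \<phi> x\<bar> \<partial>lborel)"
    using i by (intro nn_integral_eq_integral[symmetric]) auto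
  also note le
  finally show "(\<integral>x. \<bar>heat \<tau> \<phi> x\<bar> \<partial>lborel) \<le> (\<integral>x. \<bar>\<phi> x\<bar> \<partial>lborel)"
    by (subst (asm) ennreal_le_iff) auto
qed

lemma bounded_integrable_Lp:
  assumes \<phi>: "integrable lborel \<phi>" "\<And>x. \<bar>\<phi> x\<bar> \<le> B" and r: "1 \<le> r"
  shows "\<phi> \<in> Lp lborel r" "(\<integral>x. \<bar>\<phi> x\<bar> powr r \<partial>lborel) \<le> B powr (r - 1) * (\<integral>x. \<bar>\<phi> x\<bar> \<partial>lborel)"
proof -
  have [measurable]: "\<phi> \<in> borel_measurable lborel" using \<phi>(1) by (rule borel_measurable_integrable)
  have le: "\<bar>\<phi> x\<bar> powr r \<le> B powr (r - 1) * \<bar>\<phi> x\<bar>" for x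
  proof -
    have e: "r = (r - 1) + 1" by simp
    have "\<bar>\<phi> x\<bar> powr r = \<bar>\<phi> x\<bar> powr (r - 1) * \<bar>\<phi> x\<bar> powr 1"
      by (subst e) (rule powr_add)
    also have "\<bar>\<phi> x\<bar> powr 1 = \<bar>\<phi> x\<bar>" by simp
    also have "\<bar>\<phi> x\<bar> powr (r - 1) * \<bar>\<phi> x\<bar> \<le> B powr (r - 1) * \<bar>\<phi> x\<bar>"
      using \<phi>(2) r by (intro mult_right_mono powr_mono2) auto
    finally show ?thesis .
  qed
  have i: "integrable lborel (\<lambda>x. B powr (r - 1) * \<bar>\<phi> x\<bar>)" using \<phi>(1) by simp
  have j: "integrable lborel (\<lambda>x. \<bar>\<phi> x\<bar> powr r)"
  proof (rule Bochner_Integration.integrable_bound[OF i])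
    show "AE x in lborel. norm (\<bar>\<phi> x\<bar> powr r) \<le> norm (B powr (r - 1) * \<bar>\<phi> x\<bar>)"
      using le by (intro AE_I2) (simp add: abs_mult)
  qed measurable
  then show "\<phi> \<in> Lp lborel r" by (simp add: Lp_def)
  have "(\<integral>x. \<bar>\<phi> x\<bar> powr r \<partial>lborel) \<le> (\<integral>x. B powr (r - 1) * \<bar>\<phi> x\<bar> \<partial>lborel)"
    by (rule integral_mono[OF j i le])
  then show "(\<integral>x. \<bar>\<phi> x\<bar> powr r \<partial>lborel) \<le> B powr (r - 1) * (\<integral>x. \<bar>\<phi> x\<bar> \<partial>lborel)" by simp
qed

lemma tendsto_Lp_cong:
  assumes "\<forall>\<^sub>F s in F. u s = u' s"
  shows "tendsto_Lp M r u v F = tendsto_Lp M r u' v F"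
proof -
  have 1: "(\<forall>\<^sub>F s in F. u s \<in> Lp M r) = (\<forall>\<^sub>F s in F. u' s \<in> Lp M r)"
    by (rule eventually_cong[OF assms]) simp
  have 2: "((\<lambda>s. Lp_norm M r (\<lambda>x. u s x - v x)) \<longlongrightarrow> 0) F = ((\<lambda>s. Lp_norm M r (\<lambda>x. u' s x - v x)) \<longlongrightarrow> 0) F"
    by (rule tendsto_cong) (use assms in eventually_elim, simp)
  show ?thesis unfolding tendsto_Lp_def 1 2 ..
qed

section \<open>The difference from the heat evolution of the initial value\<close>

context integrable_profile begin

definition h1 :: "real \<Rightarrow> real" where "h1 = heat 1 u0"

text \<open>The profile of \<open>u t - heat t u0\<close>, and by \<open>duhamel_formula\<close>
  that of the Duhamel term.\<close>

definition w :: "real \<Rightarrow> real" where "w x = f x - h1 x"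

text \<open>\<open>u0\<close> is homogeneous of degree \<open>- k\<close> and the heat flow commutes
  with parabolic scaling.\<close>

lemma heat_u0_scaled:
  assumes "t > 0"
  shows "heat t u0 x = scaled (- (1 / \<alpha>)) h1 t x"
proof -
  have hom: "u0 (sqrt t * y) = t powr (- (1 / \<alpha>)) * u0 y" for y
  proof -
    have "\<bar>sqrt t * y\<bar> powr (- k) = sqrt t powr (- k) * \<bar>y\<bar> powr (- k)"
      using assms by (simp add: abs_mult powr_mult)
    moreover have "sqrt t powr (- k) = t powr (- (1 / \<alpha>))"
      using assms by (simp add: powr_powr flip: powr_half_sqrt)
    ultimately show ?thesis using assms by (simp add: u0_def zero_less_mult_iff)
  qed
  have "x + sqrt t * z = sqrt t * (x / sqrt t + sqrt 1 * z)" for z using assms by (simp add: field_simps)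
  then have "heat t u0 x = (\<integral>z. gauss z * (t powr (- (1 / \<alpha>)) * u0 (x / sqrt t + sqrt 1 * z)) \<partial>lborel)"
    unfolding heat_gauss[OF assms] by (simp only: hom)
  also have "\<dots> = t powr (- (1 / \<alpha>)) * (\<integral>z. gauss z * u0 (x / sqrt t + sqrt 1 * z) \<partial>lborel)"
    by (subst integral_mult_right_zero[symmetric]) (intro Bochner_Integration.integral_cong refl, simp add: mult_ac)
  finally show ?thesis unfolding scaled_def h1_def heat_gauss[OF zero_less_one] .
qed

lemma kernel_u0_integrable:
  assumes "t > 0"
  shows "integrable lborel (\<lambda>y. heat_kernel t x y * u0 y)"
proof (rule Bochner_Integration.integrable_bound)
  show "integrable lborel (\<lambda>y. sup\<mu> * (heat_kernel t x y * \<bar>y\<bar> powr (- k)))"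
    using integrable_kernel_powr[OF assms k_nonneg k_less] by simp
  have "\<bar>heat_kernel t x y * u0 y\<bar> \<le> sup\<mu> * (heat_kernel t x y * \<bar>y\<bar> powr (- k))" for y
    using mult_left_mono[OF u0_le[of y] heat_kernel_nonneg[OF assms, of x y]] heat_kernel_nonneg[OF assms, of x y]
    by (simp add: abs_mult mult_ac)
  then show "AE y in lborel. norm (heat_kernel t x y * u0 y) \<le> norm (sup\<mu> * (heat_kernel t x y * \<bar>y\<bar> powr (- k)))"
    by (intro AE_I2) (metis abs_ge_self order_trans real_norm_def)
qed measurable

lemma h1_bounded: "\<exists>B\<ge>0. \<forall>x. \<bar>h1 x\<bar> \<le> B"
proof (intro exI conjI allI)
  let ?c = "(4 * pi * 1) powr (- (1 / 2))"
  define I where "I = (\<integral>y. \<bar>y\<bar> powr (- k) * indicator {y. \<bar>y\<bar> \<le> 1} y \<partial>lborel)"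
  have i: "integrable lborel (\<lambda>y. sup\<mu> * (?c * (\<bar>y\<bar> powr (- k) * indicator {y. \<bar>y\<bar> \<le> 1} y) + heat_kernel 1 x y))" for x
    using integrable_powr_unit[OF k_nonneg k_less] heat_kernel_integrable[OF zero_less_one] by simp
  have "I \<ge> 0" by (simp add: I_def)
  then show "0 \<le> sup\<mu> * (?c * I + 1)" using sup\<mu>_nonneg by simp
  fix x
  have "\<bar>h1 x\<bar> \<le> (\<integral>y. sup\<mu> * (?c * (\<bar>y\<bar> powr (- k) * indicator {y. \<bar>y\<bar> \<le> 1} y) + heat_kernel 1 x y) \<partial>lborel)"
    unfolding h1_def heat_alt
  proof (rule abs_integral_le[OF kernel_u0_integrable[OF zero_less_one] i])
    fix y
    have "\<bar>heat_kernel 1 x y * u0 y\<bar> \<le> sup\<mu> * (heat_kernel 1 x y * \<bar>y\<bar> powr (- k))"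
      using mult_left_mono[OF u0_le[of y] heat_kernel_nonneg[OF zero_less_one, of x y]] heat_kernel_nonneg[OF zero_less_one, of x y]
      by (simp add: abs_mult mult_ac)
    also have "\<dots> \<le> sup\<mu> * (?c * (\<bar>y\<bar> powr (- k) * indicator {y. \<bar>y\<bar> \<le> 1} y) + heat_kernel 1 x y)"
      by (intro mult_left_mono kernel_powr_le sup\<mu>_nonneg zero_less_one k_nonneg)
    finally show "\<bar>heat_kernel 1 x y * u0 y\<bar> \<le> sup\<mu> * (?c * (\<bar>y\<bar> powr (- k) * indicator {y. \<bar>y\<bar> \<le> 1} y) + heat_kernel 1 x y)" .
  qed
  also have "\<dots> = sup\<mu> * (?c * I + 1)"
    using integrable_powr_unit[OF k_nonneg k_less] heat_kernel_integrable[OF zero_less_one] heat_kernel_integral[OF zero_less_one]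
    by (simp add: I_def)
  finally show "\<bar>h1 x\<bar> \<le> sup\<mu> * (?c * I + 1)" .
qed

text \<open>Because of the singularity of \<open>u0\<close> the variable is kept in the kernel. For
  \<open>\<bar>s\<bar> \<le> R\<close> one has
  \<open>(s - y)\<^sup>2 \<ge> y\<^sup>2 / 2 - R\<^sup>2\<close>, and halving the quadratic term
  means doubling the time: a multiple of the kernel at time 2, centred at 0, dominates.\<close>

lemma cont_h1: "continuous_on UNIV h1"
proof -
  have "(h1 \<longlongrightarrow> h1 x) (at x)" for x
  proof -
    define R where "R = \<bar>x\<bar> + 1"
    define A where "A = sqrt 2 * exp (R\<^sup>2 / 4)"
    have A: "A \<ge> 0" by (simp add: A_def)
    have ker: "heat_kernel 1 s y \<le> A * heat_kernel 2 0 y" if "\<bar>s\<bar> \<le> R" for s y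
    proof -
      have "0 \<le> (y - 2 * s)\<^sup>2" by simp
      then have "y\<^sup>2 / 2 - s\<^sup>2 \<le> (s - y)\<^sup>2" by (simp add: power2_eq_square algebra_simps)
      moreover have "s\<^sup>2 \<le> R\<^sup>2" using power_mono[OF that, of 2] by simp
      ultimately have "exp (- (s - y)\<^sup>2 / (4 * 1)) \<le> exp (R\<^sup>2 / 4 + - (0 - y)\<^sup>2 / (4 * 2))"
        by simp
      also have "\<dots> = exp (R\<^sup>2 / 4) * exp (- (0 - y)\<^sup>2 / (4 * 2))" by (rule exp_add)
      finally have "exp (- (s - y)\<^sup>2 / (4 * 1)) / sqrt (4 * pi * 1) \<le> exp (R\<^sup>2 / 4) * exp (- (0 - y)\<^sup>2 / (4 * 2)) / sqrt (4 * pi * 1)"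
        by (rule divide_right_mono) simp
      also have "\<dots> = A * heat_kernel 2 0 y"
      proof -
        have "sqrt (4 * pi * 2) = sqrt (4 * pi * 1) * sqrt 2" by (simp only: real_sqrt_mult mult_1_right)
        then show ?thesis by (simp add: A_def heat_kernel_def)
      qed
      finally show ?thesis by (simp add: heat_kernel_def)
    qed
    have "((\<lambda>s. \<integral>y. heat_kernel 1 s y * u0 y \<partial>lborel) \<longlongrightarrow> (\<integral>y. heat_kernel 1 x y * u0 y \<partial>lborel)) (at x within UNIV)"
    proof (rule integral_tendsto_at)
      show "integrable lborel (\<lambda>y. A * sup\<mu> * (heat_kernel 2 0 y * \<bar>y\<bar> powr (- k)))"
        using integrable_kernel_powr[of 2, OF _ k_nonneg k_less] by simp
      have "\<forall>\<^sub>F s in at x within UNIV. s \<in> {x - 1<..<x + 1}"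
        using eventually_nhds_in_open[of "{x - 1<..<x + 1}" x] by (auto simp: eventually_at_filter elim!: eventually_mono)
      then show "\<forall>\<^sub>F s in at x within UNIV. AE y in lborel. \<bar>heat_kernel 1 s y * u0 y\<bar> \<le> A * sup\<mu> * (heat_kernel 2 0 y * \<bar>y\<bar> powr (- k))"
      proof eventually_elim
        case (elim s)
        then have s: "\<bar>s\<bar> \<le> R" by (auto simp: R_def)
        show ?case
        proof (rule AE_I2)
          fix y
          have "heat_kernel 1 s y * \<bar>u0 y\<bar> \<le> (A * heat_kernel 2 0 y) * (sup\<mu> * \<bar>y\<bar> powr (- k))"
            using ker[OF s, of y] u0_le[of y] A heat_kernel_nonneg[of 2 0 y] by (intro mult_mono) auto
          then show "\<bar>heat_kernel 1 s y * u0 y\<bar> \<le> A * sup\<mu> * (heat_kernel 2 0 y * \<bar>y\<bar> powr (- k))"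
            using heat_kernel_nonneg[of 1 s y] by (simp add: abs_mult mult_ac)
        qed
      qed
      show "AE y in lborel. ((\<lambda>s. heat_kernel 1 s y * u0 y) \<longlongrightarrow> heat_kernel 1 x y * u0 y) (at x within UNIV)"
        unfolding heat_kernel_def by (intro AE_I2 tendsto_intros) auto
    qed measurable
    then show ?thesis by (simp add: h1_def heat_alt[abs_def])
  qed
  then show ?thesis by (simp add: continuous_on_def)
qed

lemma cont_w: "continuous_on UNIV w"
  unfolding w_def[abs_def] by (intro continuous_intros cont_f cont_h1)

lemma w_bounded: "\<exists>B\<ge>0. \<forall>x. \<bar>w x\<bar> \<le> B"
proof -
  obtain B where B: "B \<ge> 0" "\<And>x. \<bar>h1 x\<bar> \<le> B" using h1_bounded by blast
  have "\<bar>w x\<bar> \<le> C + B" for x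
    using f_bounded[of x] B(2)[of x] unfolding w_def by linarith
  then show ?thesis using B C_nonneg by (intro exI[of _ "C + B"]) auto
qed

lemma difference_scaled:
  assumes "t > 0"
  shows "u t x - heat t u0 x = scaled (- (1 / \<alpha>)) w t x"
  unfolding heat_u0_scaled[OF assms] by (simp add: scaled_def w_def right_diff_distrib)

lemma duhamel_scaled: "t > 0 \<Longrightarrow> duhamel \<alpha> u t x = scaled (- (1 / \<alpha>)) w t x"
  using duhamel_formula[of t x] difference_scaled[of t x] by simp

lemma meas_nonlin_f [measurable]: "(\<lambda>x. nonlin \<alpha> (f x)) \<in> borel_measurable borel"
  by (intro borel_measurable_continuous_onI cont_nonlin)

lemma source_measurable:
  "(\<lambda>(s, x). source t x s) \<in> borel_measurable (lborel \<Otimes>\<^sub>M lborel)"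
  unfolding source_def heat_alt scaled_def case_prod_unfold by measurable

text \<open>As \<open>k < 1\<close>, neither \<open>f\<close> nor \<open>h1\<close> need be
  integrable. Their difference is, being the Duhamel term at time 1: Tonelli and
  \<open>heat_L1_contraction\<close> bound its \<open>L\<^sup>1\<close> norm by the integral of
  \<open>nonlin_L1 * s powr (- \<gamma>)\<close> over \<open>{0<..<1}\<close>.\<close>

lemma w_integrable: "integrable lborel w"
proof (rule integrableI_bounded)
  show "w \<in> borel_measurable lborel" using borel_measurable_continuous_onI[OF cont_w] by simp
  have [measurable]: "(\<lambda>(s, x). source 1 x s) \<in> borel_measurable (lborel \<Otimes>\<^sub>M lborel)" by (rule source_measurable)
  have w_le: "ennreal (norm (w x)) \<le> (\<integral>\<^sup>+s. ennreal \<bar>source 1 x s\<bar> * indicator {0<..<1} s \<partial>lborel)" for x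
  proof -
    have "w x = (\<integral>s. indicator {0<..<1} s *\<^sub>R source 1 x s \<partial>lborel)"
      using duhamel_scaled[of 1 x] duhamel_source[of 1 x] by (simp add: scaled_def set_lebesgue_integral_def)
    then have "ennreal (norm (w x)) \<le> (\<integral>\<^sup>+s. ennreal (norm (indicator {0<..<1} s *\<^sub>R source 1 x s)) \<partial>lborel)"
      using integral_norm_bound_ennreal[OF source_integrable[OF zero_less_one, of x, unfolded set_integrable_def]] by simp
    also have "\<dots> = (\<integral>\<^sup>+s. ennreal \<bar>source 1 x s\<bar> * indicator {0<..<1} s \<partial>lborel)"
      by (intro nn_integral_cong) (auto split: split_indicator)
    finally show ?thesis .
  qed
  have "(\<integral>\<^sup>+x. ennreal (norm (w x)) \<partial>lborel) \<le> (\<integral>\<^sup>+x. (\<integral>\<^sup>+s. ennreal \<bar>source 1 x s\<bar> * indicator {0<..<1} s \<partial>lborel) \<partial>lborel)"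
    by (intro nn_integral_mono w_le)
  also have "\<dots> = (\<integral>\<^sup>+s. (\<integral>\<^sup>+x. ennreal \<bar>source 1 x s\<bar> * indicator {0<..<1} s \<partial>lborel) \<partial>lborel)"
    by (rule lborel_pair.Fubini') measurable
  also have "\<dots> \<le> (\<integral>\<^sup>+s. ennreal (norm (indicator {0<..<1} s *\<^sub>R (nonlin_L1 * s powr (- \<gamma>)))) \<partial>lborel)"
  proof (rule nn_integral_mono)
    fix s
    show "(\<integral>\<^sup>+x. ennreal \<bar>source 1 x s\<bar> * indicator {0<..<1} s \<partial>lborel) \<le> ennreal (norm (indicator {0<..<1} s *\<^sub>R (nonlin_L1 * s powr (- \<gamma>))))"
    proof (cases "s \<in> {0<..<1}")
      case True
      then have "(\<integral>\<^sup>+x. ennreal \<bar>source 1 x s\<bar> \<partial>lborel) \<le> ennreal (s powr (- \<gamma>) * nonlin_L1)"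
        unfolding source_def un_L1[of s, symmetric, OF conjunct1[OF True[unfolded greaterThanLessThan_iff]]]
        by (intro heat_L1_contraction un_integrable) auto
      then show ?thesis using True nonlin_L1_nonneg by (simp add: mult.commute)
    qed simp
  qed
  also have "\<dots> < \<infinity>"
  proof -
    have "set_integrable lborel {0<..<1} (\<lambda>s. nonlin_L1 * s powr (- \<gamma>))"
      using set_integrable_powr_Ioo[OF \<gamma>_less, of 1] by simp
    then show ?thesis unfolding set_integrable_def integrable_iff_bounded by blast
  qed
  finally show "(\<integral>\<^sup>+x. ennreal (norm (w x)) \<partial>lborel) < \<infinity>" .
qed

lemma w_Lp: "1 \<le> r \<Longrightarrow> w \<in> Lp lborel r"
  using w_bounded bounded_integrable_Lp(1)[OF w_integrable] by blast

text \<open>Interpolating between the \<open>L\<^sup>1\<close> and the supremum bound replaces Young's inequality.\<close>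

lemma source_Lp_norm:
  assumes s: "0 < s" "s < t" and r: "1 \<le> r"
  shows "(\<lambda>x. source t x s) \<in> Lp lborel r"
    and "Lp_norm lborel r (\<lambda>x. source t x s) \<le> (4 * pi * (t - s)) powr (- ((1 - 1 / r) / 2)) * (s powr (- \<gamma>) * nonlin_L1)"
proof -
  define N where "N = s powr (- \<gamma>) * nonlin_L1"
  define Q where "Q = 4 * pi * (t - s)"
  have N: "N \<ge> 0" and Q: "Q > 0" using nonlin_L1_nonneg s by (simp_all add: N_def Q_def)
  have i: "integrable lborel (\<lambda>x. source t x s)" and L1: "(\<integral>x. \<bar>source t x s\<bar> \<partial>lborel) \<le> N"
    unfolding source_def N_def un_L1[OF s(1), symmetric] using s by (intro heat_integrable un_integrable; simp)+
  have B: "\<bar>source t x s\<bar> \<le> Q powr (- (1 / 2)) * N" for x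
    using source_bounds(2)[OF s] by (simp add: N_def Q_def)
  note Lp = bounded_integrable_Lp[OF i B r]
  show "(\<lambda>x. source t x s) \<in> Lp lborel r" by (rule Lp(1))
  have r0: "r > 0" using r by simp
  have "(\<integral>x. \<bar>source t x s\<bar> powr r \<partial>lborel) \<le> (Q powr (- (1 / 2)) * N) powr (r - 1) * N"
    using Lp(2) mult_left_mono[OF L1, of "(Q powr (- (1 / 2)) * N) powr (r - 1)"] by simp
  also have "\<dots> = Q powr (- (1 / 2) * (r - 1)) * (N powr (r - 1) * N)"
    using N Q by (simp add: powr_mult powr_powr)
  also have "N powr (r - 1) * N = N powr r"
  proof (cases "N = 0")
    case False
    then have "N powr (r - 1) * N powr 1 = N powr r" unfolding powr_add[symmetric] by simp
    then show ?thesis using False N by simp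
  qed (use r0 in simp)
  finally have "Lp_norm lborel r (\<lambda>x. source t x s) \<le> (Q powr (- (1 / 2) * (r - 1)) * N powr r) powr (1 / r)"
    unfolding Lp_norm_def using r0 by (intro powr_mono2) auto
  also have "\<dots> = Q powr (- ((1 - 1 / r) / 2)) * N"
  proof -
    have "(Q powr (- (1 / 2) * (r - 1)) * N powr r) powr (1 / r) = (Q powr (- (1 / 2) * (r - 1))) powr (1 / r) * (N powr r) powr (1 / r)"
      by (rule powr_mult)
    also have "(N powr r) powr (1 / r) = N" using r0 N by (simp add: powr_powr)
    also have "(Q powr (- (1 / 2) * (r - 1))) powr (1 / r) = Q powr (- ((1 - 1 / r) / 2))"
      unfolding powr_powr by (intro arg_cong2[where f = "(powr)"] refl) (use r0 in \<open>simp add: field_simps\<close>)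
    finally show ?thesis .
  qed
  finally show "Lp_norm lborel r (\<lambda>x. source t x s) \<le> (4 * pi * (t - s)) powr (- ((1 - 1 / r) / 2)) * (s powr (- \<gamma>) * nonlin_L1)"
    by (simp add: N_def Q_def)
qed

lemma source_Lp_abs_integrable:
  assumes t: "t > 0" and r: "1 \<le> r"
  shows "Lp_abs_integrable_on lborel r {0<..<t} (\<lambda>s. heat (t - s) (\<lambda>y. nonlin \<alpha> (u s y)))"
  unfolding Lp_abs_integrable_on_def
proof (intro conjI ballI)
  define v where "v s = heat (t - s) (\<lambda>y. nonlin \<alpha> (u s y))" for s
  have v: "v s = (\<lambda>x. source t x s)" if "s > 0" for s
    using source_eq[OF that] by (simp add: v_def fun_eq_iff)
  let ?R = "restrict_space lborel {0<..<t} \<Otimes>\<^sub>M lborel"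
  have "(\<lambda>z. (fst z, snd z)) \<in> measurable ?R (lborel \<Otimes>\<^sub>M lborel)"
  proof (rule measurable_Pair)
    have "(\<lambda>x. x) \<in> measurable (restrict_space lborel {0<..<t}) (lborel :: real measure)"
      by (intro measurable_restrict_space1) simp
    from measurable_compose[OF measurable_fst this] show "fst \<in> measurable ?R lborel" by simp
  qed (rule measurable_snd)
  from measurable_compose[OF this source_measurable[of t]]
  have "(\<lambda>z. source t (snd z) (fst z)) \<in> borel_measurable ?R" by simp
  moreover have "(\<lambda>(s, x). v s x) z = source t (snd z) (fst z)" if "z \<in> space ?R" for z
    using that v by (auto simp: space_pair_measure space_restrict_space)
  ultimately have "(\<lambda>(s, x). v s x) \<in> borel_measurable ?R"
    by (subst measurable_cong[where g = "\<lambda>z. source t (snd z) (fst z)"])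
  then show "(\<lambda>(s, x). heat (t - s) (\<lambda>y. nonlin \<alpha> (u s y)) x) \<in> borel_measurable ?R" by (simp add: v_def)
  show "heat (t - s) (\<lambda>y. nonlin \<alpha> (u s y)) \<in> Lp lborel r" if "s \<in> {0<..<t}" for s
    using source_Lp_norm(1)[of s t r] v[of s] that r by (simp add: v_def)
  \<comment> \<open>The exponents \<open>a\<close> at \<open>s = t\<close> and \<gamma> at
    \<open>s = 0\<close> are both below 1; splitting at \<open>t / 2\<close> leaves one singularity
    on each side.\<close>
  define a where "a = (1 - 1 / r) / 2"
  have a: "0 \<le> a" "a < 1" using r by (simp_all add: a_def field_simps)
  define n where "n s = Lp_norm lborel r (\<lambda>x. source t x s)" for s
  have \<gamma>0: "\<gamma> \<ge> 0" using alpha by (simp add: \<gamma>_def)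
  define b1 b2 where "b1 = (2 * pi * t) powr (- a) * nonlin_L1" and "b2 = (4 * pi) powr (- a) * ((t / 2) powr (- \<gamma>) * nonlin_L1)"
  have b: "b1 \<ge> 0" "b2 \<ge> 0" using nonlin_L1_nonneg by (simp_all add: b1_def b2_def)
  have n_le: "n s \<le> b1 * s powr (- \<gamma>) + b2 * (t - s) powr (- a)" if s: "0 < s" "s < t" for s
  proof (cases "s \<le> t / 2")
    case True
    have "(4 * pi * (t - s)) powr (- a) \<le> (2 * pi * t) powr (- a)"
      using True t a by (intro powr_mono2') auto
    then have "(4 * pi * (t - s)) powr (- a) * (s powr (- \<gamma>) * nonlin_L1) \<le> (2 * pi * t) powr (- a) * (s powr (- \<gamma>) * nonlin_L1)"
      using nonlin_L1_nonneg by (intro mult_right_mono) auto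
    also have "\<dots> \<le> b1 * s powr (- \<gamma>) + b2 * (t - s) powr (- a)"
      using b by (simp add: b1_def mult_ac)
    finally show ?thesis using source_Lp_norm(2)[OF s r] by (simp add: n_def a_def)
  next
    case False
    have "s powr (- \<gamma>) \<le> (t / 2) powr (- \<gamma>)" using False t \<gamma>0 by (intro powr_mono2') auto
    then have "(4 * pi * (t - s)) powr (- a) * (s powr (- \<gamma>) * nonlin_L1) \<le> (4 * pi * (t - s)) powr (- a) * ((t / 2) powr (- \<gamma>) * nonlin_L1)"
      using nonlin_L1_nonneg by (intro mult_left_mono mult_right_mono) auto
    also have "\<dots> = (4 * pi) powr (- a) * (t - s) powr (- a) * ((t / 2) powr (- \<gamma>) * nonlin_L1)"
      by (simp only: powr_mult)
    also have "\<dots> \<le> b1 * s powr (- \<gamma>) + b2 * (t - s) powr (- a)"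
      using b by (simp add: b2_def mult_ac)
    finally show ?thesis using source_Lp_norm(2)[OF s r] by (simp add: n_def a_def)
  qed
  have n0: "0 \<le> n s" for s by (simp add: n_def Lp_norm_def)
  have [measurable]: "(\<lambda>(s, x). source t x s) \<in> borel_measurable (lborel \<Otimes>\<^sub>M lborel)" by (rule source_measurable)
  have n_meas: "n \<in> borel_measurable lborel"
    unfolding n_def[abs_def] Lp_norm_def by measurable
  have "set_integrable lborel {0<..<t} n"
    unfolding set_integrable_def
  proof (rule Bochner_Integration.integrable_bound)
    have "set_integrable lborel {0<..<t} (\<lambda>s. b1 * s powr (- \<gamma>) + b2 * (t - s) powr (- a))"
      using set_integrable_powr_Ioo[OF \<gamma>_less, of t] set_integrable_powr_reflect[OF a(2), of t] t
      by (intro set_integral_add) auto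
    then show "integrable lborel (\<lambda>s. indicator {0<..<t} s *\<^sub>R (b1 * s powr (- \<gamma>) + b2 * (t - s) powr (- a)))"
      by (simp add: set_integrable_def)
    show "(\<lambda>s. indicator {0<..<t} s *\<^sub>R n s) \<in> borel_measurable lborel" using n_meas by measurable
    show "AE s in lborel. norm (indicator {0<..<t} s *\<^sub>R n s) \<le> norm (indicator {0<..<t} s *\<^sub>R (b1 * s powr (- \<gamma>) + b2 * (t - s) powr (- a)))"
      using n_le n0 by (intro AE_I2) (auto split: split_indicator intro: order_trans[OF n_le abs_ge_self])
  qed
  then show "set_integrable lborel {0<..<t} (\<lambda>s. Lp_norm lborel r (heat (t - s) (\<lambda>y. nonlin \<alpha> (u s y))))"
    by (rule set_integrable_cong[THEN iffD1, rotated -1]) (use v in \<open>auto simp: n_def v_def\<close>)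
qed

lemma integral_equation: "integral_equation \<alpha> u u0"
  unfolding integral_equation_def
proof (intro conjI allI impI)
  show "AE x in lborel. u t x = heat t u0 x + duhamel \<alpha> u t x" if "t > 0" for t
    using duhamel_formula[OF that] by simp
  fix r assume r: "\<alpha> / 2 < r"
  then have r1: "1 \<le> r" "r > 0" using alpha2 by simp_all
  show "Lp_abs_integrable_on lborel r {0<..<t} (\<lambda>s. heat (t - s) (\<lambda>y. nonlin \<alpha> (u s y)))" if "t > 0" for t
    by (rule source_Lp_abs_integrable[OF that r1(1)])
  have fLp: "f \<in> Lp lborel r" by (rule decaying_Lp[OF decaying_f cont_f r])
  show "Lp_continuous_on lborel r {0<..} u"
    by (rule scaled_Lp_continuous_on[OF r1(2) fLp cont_f])
  \<comment> \<open>Membership of \<open>h1\<close> in \<open>L\<^sup>r\<close> is read off from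
    \<open>f\<close> and \<open>w\<close> instead of from estimates of the heat evolution.\<close>
  have "h1 = (\<lambda>x. f x + - w x)" by (simp add: w_def fun_eq_iff)
  then have "h1 \<in> Lp lborel r" using Lp_add[OF fLp Lp_minus[OF w_Lp[OF r1(1)]] r1(2)] by simp
  from scaled_Lp_continuous_on[OF r1(2) this cont_h1, of "- (1 / \<alpha>)"]
  show "Lp_continuous_on lborel r {0<..} (\<lambda>t. heat t u0)"
    by (rule Lp_continuous_on_cong[THEN iffD1, rotated]) (simp add: heat_u0_scaled fun_eq_iff)
  from scaled_Lp_continuous_on[OF r1(2) w_Lp[OF r1(1)] cont_w, of "- (1 / \<alpha>)"]
  show "Lp_continuous_on lborel r {0<..} (duhamel \<alpha> u)"
    by (rule Lp_continuous_on_cong[THEN iffD1, rotated]) (simp add: duhamel_scaled fun_eq_iff)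
qed

text \<open>At positive times this is continuity of dilations. At time 0 the \<open>r\<close>-th
  power of the norm is a constant times \<open>s powr (1 / 2 - r / \<alpha>)\<close>, which tends to
  0 because \<open>r < \<alpha> / 2\<close>.\<close>

lemma difference_continuity: "difference_continuity \<alpha> u u0"
  unfolding difference_continuity_def
proof (intro allI impI, elim conjE)
  fix r assume r: "1 \<le> r" "r < \<alpha> / 2"
  have r0: "r > 0" using r by simp
  define d where "d t x = (if t = 0 then 0 else u t x - heat t u0 x)" for t x
  have d0: "d 0 = (\<lambda>x. 0)" by (simp add: d_def fun_eq_iff)
  have d: "d t = scaled (- (1 / \<alpha>)) w t" if "t > 0" for t
    using that by (simp add: d_def difference_scaled fun_eq_iff)
  have "Lp_continuous_on lborel r {0..} d"
    unfolding Lp_continuous_on_def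
  proof (intro conjI ballI)
    show dLp: "d t \<in> Lp lborel r" if "t \<in> {0..}" for t
      using that by (cases "t = 0") (simp_all add: d0 zero_Lp d scaled_Lp(1) w_Lp r(1))
    fix t :: real assume t: "t \<in> {0..}"
    show "tendsto_Lp lborel r d (d t) (at t within {0..})"
    proof (cases "t = 0")
      case False
      then have t0: "t > 0" using t by simp
      have "\<forall>\<^sub>F s in at t within {0..}. s \<in> {0<..}"
        using eventually_nhds_in_open[of "{0<..}" t] t0 by (auto simp: eventually_at_filter elim!: eventually_mono)
      then have "\<forall>\<^sub>F s in at t within {0..}. scaled (- (1 / \<alpha>)) w s = d s"
        by eventually_elim (simp add: d)
      from tendsto_Lp_cong[OF this] scaled_Lp_norm_continuous[OF r0 w_Lp[OF r(1)] cont_w t0]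
      show ?thesis unfolding d[OF t0] by blast
    next
      case True
      have pos: "\<forall>\<^sub>F s in at 0 within {0::real..}. 0 < s" by (auto simp: eventually_at_filter)
      define e where "e = - (1 / \<alpha>) * r + 1 / 2"
      have e: "e > 0" using r alpha by (simp add: e_def field_simps)
      have "((\<lambda>s::real. s powr e) \<longlongrightarrow> 0 powr e) (at 0 within {0..})"
        by (rule tendsto_powr'[OF tendsto_ident_at tendsto_const]) (use e in \<open>auto simp: eventually_at_filter\<close>)
      then have "((\<lambda>s. s powr e * (\<integral>x. \<bar>w x\<bar> powr r \<partial>lborel)) \<longlongrightarrow> 0) (at 0 within {0..})"
        using e by (intro tendsto_mult_left_zero) simp
      moreover have "\<forall>\<^sub>F s in at 0 within {0..}. s powr e * (\<integral>x. \<bar>w x\<bar> powr r \<partial>lborel) = (\<integral>x. \<bar>d s x - d 0 x\<bar> powr r \<partial>lborel)"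
        using pos by eventually_elim (simp add: d d0 scaled_Lp(2)[OF _ w_Lp[OF r(1)]] e_def)
      ultimately have "((\<lambda>s. \<integral>x. \<bar>d s x - d 0 x\<bar> powr r \<partial>lborel) \<longlongrightarrow> 0) (at 0 within {0..})"
        by (rule Lim_transform_eventually)
      moreover have "\<forall>\<^sub>F s in at 0 within {0..}. d s \<in> Lp lborel r"
        using pos by eventually_elim (intro dLp, simp)
      ultimately show ?thesis
        unfolding True tendsto_Lp_def using dLp[of 0] r0 by (auto intro: Lp_norm_tendsto_0)
    qed
  qed
  then show "Lp_continuous_on lborel r {0..} (\<lambda>t x. if t = 0 then 0 else u t x - heat t u0 x)"
    by (simp add: d_def[abs_def])
qed

end

section \<open>Assembling the even and the odd solutions\<close>

lemma (in decaying_profile) solution_profile: "solution_profile \<alpha> u0 f"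
proof -
  have "initial_value_B \<alpha> u u0 \<and> integral_equation \<alpha> u u0 \<and> difference_continuity \<alpha> u u0" if "\<alpha> > 2"
  proof -
    interpret integrable_profile \<alpha> f g \<mu>\<^sub>1 \<mu>\<^sub>2 C by unfold_locales (rule that)
    show ?thesis using initial_value_B integral_equation difference_continuity by blast
  qed
  then show ?thesis
    unfolding solution_profile_def self_similar_scaled
    using regular initial_value_A Lr_regularity by blast
qed

lemma decaying_profile_of_data:
  assumes "\<alpha> > 0" "profile_data \<alpha> \<mu> f g" "s = 1 \<or> s = -1"
    and sym: "\<And>x. f (- x) = s * f x" "\<And>x. g (- x) = - s * g x"
  shows "\<exists>C. decaying_profile \<alpha> f g \<mu> (s * \<mu>) C"
proof -
  have e: "- 2 / \<alpha> = - (2 / \<alpha>)" by simp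
  obtain C where C: "\<And>x. 0 \<le> x \<Longrightarrow> \<bar>f x\<bar> \<le> C * (1 + x) powr (- (2 / \<alpha>))" "\<And>x. 0 \<le> x \<Longrightarrow> \<bar>x * g x\<bar> \<le> C * (1 + x) powr (- (2 / \<alpha>))"
    using assms(2) unfolding profile_data_def e by blast
  have abs: "\<bar>f x\<bar> = \<bar>f \<bar>x\<bar>\<bar>" "\<bar>x * g x\<bar> = \<bar>\<bar>x\<bar> * g \<bar>x\<bar>\<bar>" for x
    using sym[of x] assms(3) by (cases "x \<ge> 0"; auto simp: abs_mult)+
  have "decaying_profile \<alpha> f g \<mu> (s * \<mu>) C"
  proof
    show "\<bar>f x\<bar> \<le> C * (1 + \<bar>x\<bar>) powr - (2 / \<alpha>)" for x using C(1)[of "\<bar>x\<bar>"] abs(1)[of x] by simp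
    show "\<bar>x * g x\<bar> \<le> C * (1 + \<bar>x\<bar>) powr - (2 / \<alpha>)" for x using C(2)[of "\<bar>x\<bar>"] abs(2)[of x] by simp
    show lim: "((\<lambda>x. x powr (2 / \<alpha>) * f x) \<longlongrightarrow> \<mu>) at_top" using assms(2) by (simp add: profile_data_def)
    from tendsto_mult_left[OF this, of s] show "((\<lambda>x. x powr (2 / \<alpha>) * f (- x)) \<longlongrightarrow> s * \<mu>) at_top"
      by (simp add: sym mult.left_commute)
  qed (use assms in \<open>auto simp: profile_data_def\<close>)
  then show ?thesis by blast
qed

lemma even_solution:
  assumes "\<alpha> > 0" "profile_data \<alpha> \<mu> f g" "g 0 = 0" "f 0 \<noteq> 0" "zero_count_pos f m"
  shows "solution_profile \<alpha> (\<lambda>x. \<mu> * \<bar>x\<bar> powr (- 2 / \<alpha>)) f \<and> (\<forall>x. f (- x) = f x) \<and> has_exactly_zeros f (2 * m)"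
proof -
  have ode: "profile_eq \<alpha> f g" using assms(2) by (simp add: profile_data_def)
  have sym: "f (- x) = 1 * f x" "g (- x) = - 1 * g x" for x
    using profile_symmetric[OF assms(1) ode, of 1 x] assms(3) by auto
  obtain C where C: "decaying_profile \<alpha> f g \<mu> (1 * \<mu>) C"
    using decaying_profile_of_data[OF assms(1,2) _ sym] by auto
  interpret decaying_profile \<alpha> f g \<mu> "1 * \<mu>" C by (rule C)
  have "u0 = (\<lambda>x. \<mu> * \<bar>x\<bar> powr (- 2 / \<alpha>))" unfolding u0_def[abs_def] by (simp add: fun_eq_iff)
  from solution_profile[unfolded this] sym(1) zeros_even[OF assms(5) _ assms(4)] show ?thesis by simp
qed

lemma odd_solution:
  assumes "\<alpha> > 0" "profile_data \<alpha> \<mu> f g" "f 0 = 0" "zero_count_pos f m"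
  shows "solution_profile \<alpha> (\<lambda>x. \<mu> * \<bar>x\<bar> powr (- 2 / \<alpha> - 1) * x) f \<and> (\<forall>x. f (- x) = - f x) \<and> has_exactly_zeros f (2 * m + 1)"
proof -
  have ode: "profile_eq \<alpha> f g" using assms(2) by (simp add: profile_data_def)
  have sym: "f (- x) = - 1 * f x" "g (- x) = - (- 1) * g x" for x
    using profile_symmetric[OF assms(1) ode, of "-1" x] assms(3) by auto
  obtain C where C: "decaying_profile \<alpha> f g \<mu> (- 1 * \<mu>) C"
    using decaying_profile_of_data[OF assms(1,2) _ sym] by auto
  interpret decaying_profile \<alpha> f g \<mu> "- 1 * \<mu>" C by (rule C)
  have "u0 x = \<mu> * \<bar>x\<bar> powr (- 2 / \<alpha> - 1) * x" for x
  proof (cases "x = 0")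
    case False
    have "\<bar>x\<bar> powr (- 2 / \<alpha> - 1) = \<bar>x\<bar> powr (- 2 / \<alpha>) / \<bar>x\<bar>"
      using False by (simp add: powr_diff)
    then show ?thesis using False unfolding u0_def by (cases "x > 0") simp_all
  next
    case True
    then show ?thesis unfolding u0_def by simp
  qed
  then have "u0 = (\<lambda>x. \<mu> * \<bar>x\<bar> powr (- 2 / \<alpha> - 1) * x)" by (rule ext)
  from solution_profile[unfolded this] sym(1) zeros_odd[OF assms(4)] show ?thesis by simp
qed

theorem theorem1p4:
  fixes \<alpha> \<mu> :: real
  assumes "\<alpha> > 0" and "\<mu> \<noteq> 0"
  shows
    "(\<exists>m0::nat. \<forall>m\<ge>m0. \<exists>f g :: real \<Rightarrow> real. f \<noteq> g \<and>
        (\<forall>h\<in>{f, g}.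
           solution_profile \<alpha> (\<lambda>x. \<mu> * \<bar>x\<bar> powr (- 2 / \<alpha>)) h \<and>
           (\<forall>x. h (- x) = h x) \<and>
           has_exactly_zeros h (2 * m)))
     \<and>
     (\<exists>m0::nat. \<forall>m\<ge>m0. \<exists>f g :: real \<Rightarrow> real. f \<noteq> g \<and>
        (\<forall>h\<in>{f, g}.
           solution_profile \<alpha> (\<lambda>x. \<mu> * \<bar>x\<bar> powr (- 2 / \<alpha> - 1) * x) h \<and>
           (\<forall>x. h (- x) = - h x) \<and>
           has_exactly_zeros h (2 * m + 1)))"
proof -
  obtain m0 where m0: "\<And>m. m \<ge> m0 \<Longrightarrow> even_pair \<alpha> \<mu> m \<and> odd_pair \<alpha> \<mu> m"
    using profiles_exist[OF assms] by auto
  have "\<exists>f g :: real \<Rightarrow> real. f \<noteq> g \<and> (\<forall>h\<in>{f, g}.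
      solution_profile \<alpha> (\<lambda>x. \<mu> * \<bar>x\<bar> powr (- 2 / \<alpha>)) h \<and> (\<forall>x. h (- x) = h x) \<and> has_exactly_zeros h (2 * m))"
    if m: "m \<ge> m0" for m
  proof -
    obtain f g f2 g2 where "f \<noteq> f2" "profile_data \<alpha> \<mu> f g" "profile_data \<alpha> \<mu> f2 g2"
      "g 0 = 0" "g2 0 = 0" "f 0 \<noteq> 0" "f2 0 \<noteq> 0" "zero_count_pos f m" "zero_count_pos f2 m"
      using m0[OF m] unfolding even_pair_def by (elim exE conjE)
    then show ?thesis
      using even_solution[OF assms(1), of \<mu> f g m] even_solution[OF assms(1), of \<mu> f2 g2 m]
      by (intro exI[of _ f] exI[of _ f2]) simp
  qed
  moreover have "\<exists>f g :: real \<Rightarrow> real. f \<noteq> g \<and> (\<forall>h\<in>{f, g}.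
      solution_profile \<alpha> (\<lambda>x. \<mu> * \<bar>x\<bar> powr (- 2 / \<alpha> - 1) * x) h \<and> (\<forall>x. h (- x) = - h x) \<and> has_exactly_zeros h (2 * m + 1))"
    if m: "m \<ge> m0" for m
  proof -
    obtain f g f2 g2 where "f \<noteq> f2" "profile_data \<alpha> \<mu> f g" "profile_data \<alpha> \<mu> f2 g2"
      "f 0 = 0" "f2 0 = 0" "zero_count_pos f m" "zero_count_pos f2 m"
      using m0[OF m] unfolding odd_pair_def by (elim exE conjE)
    then show ?thesis
      using odd_solution[OF assms(1), of \<mu> f g m] odd_solution[OF assms(1), of \<mu> f2 g2 m]
      by (intro exI[of _ f] exI[of _ f2]) simp
  qed
  ultimately show ?thesis by blast
qed

end
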